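(* Let $A$ be a finite abelian group and let $(C,\phi)$ be an $A$-equivariant formal group over an affine scheme $S$. Then the rings $k_B$ ($B\leq A$), with the restriction maps $\operatorname{res}^B_{B'}\colon k_B\to k_{B'}$ and transfer maps $\operatorname{tr}^B_{B'}\colon k_{B'}\to k_B$ (for $B'\leq B\leq A$) described in the context and with all conjugation maps equal to the identity, form a Mackey functor for $A$. That is: (a) $\operatorname{res}^B_B=1$ and $\operatorname{res}^B_{B''}=\operatorname{res}^{B'}_{B''}\operatorname{res}^B_{B'}$ whenever $B''\leq B'\leq B\leq A$; (b) $\operatorname{tr}^B_B=1$ and $\operatorname{tr}^B_{B''}=\operatorname{tr}^B_{B'}\operatorname{tr}^{B'}_{B''}$ whenever $B''\leq B'\leq B\leq A$; (c) if $B',B''\leq B\leq A$ then for all $r\in k_{B''}$, $\operatorname{res}^B_{B'}\operatorname{tr}^B_{B''}(r)=|B/(B'+B'')|\,\operatorname{tr}^{B'}_{B'\cap B''}\operatorname{res}^{B''}_{B'\cap B''}(r)$.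
   Context: All rings are commutative with unit. $S=\operatorname{spec}(k)$, $\mathcal{O}_S=k$. A formal ring is a complete Hausdorff linearly topologised ring $R$; $\operatorname{spf}(R)=\operatorname{colim}_J\operatorname{spec}(R/J)$ ($J$ open), $\mathcal{O}_{\operatorname{spf}(R)}=R$. A closed subscheme $\operatorname{spf}(R/J)$ of $\operatorname{spf}(R)$ is a regular hypersurface if $J$ is generated by a single regular element. A formal multicurve over $S$ is a formal scheme $C=\operatorname{spf}(R)$ over $S$ such that (i) there is a regular $y\in R$ such that for all $m\geq 0$ the ideal $Ry^m$ is open, $R/y^m$ is finitely generated free over $k$, and $R=\varprojlim_m R/y^m$; (ii) the diagonal in $C\times_SC$ is a regular hypersurface. A formal multicurve group is a formal multicurve with a commutative group structure over $S$; it has a coordinate, i.e. a regular element $x\in\mathcal{O}_C$ whose vanishing locus is the zero section. A divisor on $C$ is a closed subscheme $\operatorname{spec}(\mathcal{O}_C/J)$ with $J$ open and generated by one regular element and $\mathcal{O}_C/J$ finitely generated projective over $k$; sums of divisors correspond to products of ideals; a section $u$ gives a divisor $[u]$. $A^*=\operatorname{Hom}(A,\mathbb{Q}/\mathbb{Z})$. An $A$-equivariant formal group over $S$ is a formal multicurve group $C$ with a homomorphism $\phi\colon A^*\times S\to C$ such that $\mathcal{O}_C=\varprojlim_m\mathcal{O}_C/J^m$ as topological rings, $J$ being the ideal of the divisor $\sum_{\alpha\in A^*}[\phi(\alpha)]$. Transfer elements. For $n\geq 1$, $v_n\in\mathcal{O}_C$ is the unique function with $x(na)=x(a)v_n(a)$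 for all points $a$ of $C$. For a finite abelian group $U$ with a homomorphism $\phi\colon U\times S\to C$, let $I(U,\phi)\leq\mathcal{O}_S$ be the ideal generated by the elements $x(\phi(u))$, $u\in U$. Choose nonzero $\alpha_1,\ldots,\alpha_m\in U$ of orders $n_1,\ldots,n_m$ such that $\bigoplus_i\mathbb{Z}/n_i\to U$ is an isomorphism, and put $t(U,\phi)=\prod_iv_{n_i}(\phi(\alpha_i))\in\mathcal{O}_S$; this is independent of the choices of the $\alpha_i$ and of $x$, and $t(U,\phi)I(U,\phi)=0$. The Mackey structure. For $B\leq A$ let $\operatorname{ann}(B)=\{\alpha\in A^*:\alpha|_B=0\}$, so $A^*/\operatorname{ann}(B)=B^*$, and put $k_B=k/I(\operatorname{ann}(B),\phi)$, $S[B]=\operatorname{spec}(k_B)$, $C[B]=C\times_SS[B]$. Over $S[B]$, $\phi$ factors through a homomorphism $\phi_B\colon B^*\times S[B]\to C[B]$. For $B'\leq B$: $\operatorname{res}^B_{B'}\colon k_B\to k_{B'}$ is the quotient map, with kernel $I(\operatorname{ann}(B')/\operatorname{ann}(B),\phi_B)$ (where $\operatorname{ann}(B')/\operatorname{ann}(B)\leq B^*$); and $\operatorname{tr}^B_{B'}\colon k_{B'}\to k_B$ is the map induced by multiplication by the element $t(\operatorname{ann}(B')/\operatorname{ann}(B),\phi_B)\in k_B$, which annihilates that kernel. $B'+B''$ denotes the subgroup generated by $B'$ and $B''$ (the group $A$ is written additively). *)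

theory Defs
  imports
    "HOL-Analysis.Analysis"
    "HOL-Algebra.Module"
    "HOL-Algebra.QuotRing"
    "HOL-Algebra.Ideal_Product"
    "HOL-Algebra.Multiplicative_Group"
    "HOL-Algebra.Elementary_Groups"
    "HOL-Algebra.Product_Groups"
    "HOL-Algebra.Free_Abelian_Groups"
begin

section \<open>Linearly topologised algebras\<close>

record ('k, 'r) top_algebra = "('k, 'r) module" +
  opens :: "'r topology"

definition open_ideals :: "('k, 'r) top_algebra \<Rightarrow> 'r set set" where
  "open_ideals P = {J. ideal J P \<and> openin (opens P) J}"

text \<open>The base ring carries the discrete topology, so continuity of the structure map and of
  scalar multiplication is automatic.\<close>

definition lin_top_algebra :: "('k, 'x) ring_scheme \<Rightarrow> ('k, 'r) top_algebra \<Rightarrow> bool" where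
  "lin_top_algebra k P \<longleftrightarrow>
     Module.algebra k P \<and>
     topspace (opens P) = carrier P \<and>
     continuous_map (prod_topology (opens P) (opens P)) (opens P) (\<lambda>(a, b). a \<oplus>\<^bsub>P\<^esub> b) \<and>
     continuous_map (opens P) (opens P) (\<lambda>a. \<ominus>\<^bsub>P\<^esub> a) \<and>
     continuous_map (prod_topology (opens P) (opens P)) (opens P) (\<lambda>(a, b). a \<otimes>\<^bsub>P\<^esub> b) \<and>
     (\<forall>U. openin (opens P) U \<and> \<zero>\<^bsub>P\<^esub> \<in> U \<longrightarrow> (\<exists>J\<in>open_ideals P. J \<subseteq> U))"

text \<open>The ring \<open>k\<close>, and the quotient of an algebra by an ideal, as discrete \<open>k\<close>-algebras.\<close>

definition base_algebra :: "('k, 'x) ring_scheme \<Rightarrow> ('k, 'k) top_algebra" where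
  "base_algebra k =
     \<lparr>carrier = carrier k, monoid.mult = monoid.mult k, monoid.one = monoid.one k,
      ring.zero = ring.zero k, ring.add = ring.add k,
      smult = monoid.mult k, opens = discrete_topology (carrier k)\<rparr>"

definition quot_algebra :: "('k, 'r) top_algebra \<Rightarrow> 'r set \<Rightarrow> ('k, 'r set) top_algebra" where
  "quot_algebra P J =
     \<lparr>carrier = carrier (P Quot J), monoid.mult = monoid.mult (P Quot J),
      monoid.one = monoid.one (P Quot J),
      ring.zero = ring.zero (P Quot J), ring.add = ring.add (P Quot J),
      smult = (\<lambda>c X. \<Union>p\<in>X. J +>\<^bsub>P\<^esub> (c \<odot>\<^bsub>P\<^esub> p)),
      opens = discrete_topology (carrier (P Quot J))\<rparr>"

text \<open>The inverse limit of the discrete rings \<open>P/J\<close> over a set \<open>\<J>\<close> of ideals: the coset \<open>c J\<close>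
  is sent to \<open>c J'\<close> by the projection \<open>P/J \<rightarrow> P/J'\<close> exactly if \<open>c J \<subseteq> c J'\<close>.\<close>

definition lim_families :: "('k, 'r) top_algebra \<Rightarrow> 'r set set \<Rightarrow> ('r set \<Rightarrow> 'r set) set" where
  "lim_families P \<J> =
     {c \<in> \<Pi>\<^sub>E J\<in>\<J>. carrier (P Quot J). \<forall>J\<in>\<J>. \<forall>J'\<in>\<J>. J \<subseteq> J' \<longrightarrow> c J \<subseteq> c J'}"

definition lim_algebra ::
  "('k, 'r) top_algebra \<Rightarrow> 'r set set \<Rightarrow> ('k, 'r set \<Rightarrow> 'r set) top_algebra" where
  "lim_algebra P \<J> =
     \<lparr>carrier = lim_families P \<J>,
      monoid.mult = (\<lambda>c d. \<lambda>J\<in>\<J>. c J \<otimes>\<^bsub>quot_algebra P J\<^esub> d J),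
      monoid.one = (\<lambda>J\<in>\<J>. \<one>\<^bsub>quot_algebra P J\<^esub>),
      ring.zero = (\<lambda>J\<in>\<J>. \<zero>\<^bsub>quot_algebra P J\<^esub>),
      ring.add = (\<lambda>c d. \<lambda>J\<in>\<J>. c J \<oplus>\<^bsub>quot_algebra P J\<^esub> d J),
      smult = (\<lambda>a c. \<lambda>J\<in>\<J>. a \<odot>\<^bsub>quot_algebra P J\<^esub> c J),
      opens = subtopology (product_topology (\<lambda>J. opens (quot_algebra P J)) \<J>) (lim_families P \<J>)\<rparr>"

definition to_lim :: "('k, 'r) top_algebra \<Rightarrow> 'r set set \<Rightarrow> 'r \<Rightarrow> ('r set \<Rightarrow> 'r set)" where
  "to_lim P \<J> = (\<lambda>r. \<lambda>J\<in>\<J>. J +>\<^bsub>P\<^esub> r)"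

text \<open>\<open>P = lim P/J\<close> as topological rings (\<open>to_lim\<close> is a ring homomorphism in any case).\<close>

definition is_lim_of_quotients :: "('k, 'r) top_algebra \<Rightarrow> 'r set set \<Rightarrow> bool" where
  "is_lim_of_quotients P \<J> \<longleftrightarrow>
     homeomorphic_map (opens P) (opens (lim_algebra P \<J>)) (to_lim P \<J>)"

abbreviation completion :: "('k, 'r) top_algebra \<Rightarrow> ('k, 'r set \<Rightarrow> 'r set) top_algebra" where
  "completion P \<equiv> lim_algebra P (open_ideals P)"

text \<open>Formal \<open>k\<close>-algebras: complete, Hausdorff and linearly topologised.\<close>

definition formal_algebra :: "('k, 'x) ring_scheme \<Rightarrow> ('k, 'r) top_algebra \<Rightarrow> bool" where
  "formal_algebra k P \<longleftrightarrow> lin_top_algebra k P \<and> is_lim_of_quotients P (open_ideals P)"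

text \<open>A morphism \<open>spf T \<rightarrow> spf P\<close> over \<open>spec k\<close> is an element of \<open>cont_alg_homs k P T\<close>. Maps are
  taken to be extensional, so that equality of morphisms is equality of functions.\<close>

definition cont_alg_homs ::
  "('k, 'x) ring_scheme \<Rightarrow> ('k, 'p) top_algebra \<Rightarrow> ('k, 't) top_algebra \<Rightarrow> ('p \<Rightarrow> 't) set" where
  "cont_alg_homs k P T =
     {h \<in> ring_hom P T \<inter> extensional (carrier P).
        (\<forall>c\<in>carrier k. \<forall>p\<in>carrier P. h (c \<odot>\<^bsub>P\<^esub> p) = c \<odot>\<^bsub>T\<^esub> h p) \<and>
        continuous_map (opens P) (opens T) h}"

section \<open>Completed tensor products\<close>

text \<open>The monoid ring \<open>\<int>[P \<times> Q]\<close> of the multiplicative monoid \<open>P \<times> Q\<close>. Its additive group is the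
  free abelian group on \<open>carrier P \<times> carrier Q\<close>.\<close>

definition pair_monoid_ring ::
  "('k, 'p) top_algebra \<Rightarrow> ('k, 'q) top_algebra \<Rightarrow> (('p \<times> 'q) \<Rightarrow>\<^sub>0 int) ring" where
  "pair_monoid_ring P Q =
     \<lparr>carrier = carrier (free_Abelian_group (carrier P \<times> carrier Q)),
      monoid.mult = (\<lambda>u v. frag_extend (\<lambda>(p, q).
        frag_extend (\<lambda>(p', q'). frag_of (p \<otimes>\<^bsub>P\<^esub> p', q \<otimes>\<^bsub>Q\<^esub> q')) v) u),
      monoid.one = frag_of (\<one>\<^bsub>P\<^esub>, \<one>\<^bsub>Q\<^esub>), ring.zero = 0, ring.add = (+)\<rparr>"

definition tensor_relations ::
  "('k, 'x) ring_scheme \<Rightarrow> ('k, 'p) top_algebra \<Rightarrow> ('k, 'q) top_algebra \<Rightarrow>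
   (('p \<times> 'q) \<Rightarrow>\<^sub>0 int) set" where
  "tensor_relations k P Q =
     {frag_of (p \<oplus>\<^bsub>P\<^esub> p', q) - frag_of (p, q) - frag_of (p', q) | p p' q.
        p \<in> carrier P \<and> p' \<in> carrier P \<and> q \<in> carrier Q} \<union>
     {frag_of (p, q \<oplus>\<^bsub>Q\<^esub> q') - frag_of (p, q) - frag_of (p, q') | p q q'.
        p \<in> carrier P \<and> q \<in> carrier Q \<and> q' \<in> carrier Q} \<union>
     {frag_of (c \<odot>\<^bsub>P\<^esub> p, q) - frag_of (p, c \<odot>\<^bsub>Q\<^esub> q) | c p q.
        c \<in> carrier k \<and> p \<in> carrier P \<and> q \<in> carrier Q}"

text \<open>The additive subgroup spanned by these relations is closed under multiplication by pairs, so
  it is the ideal they generate, and the quotient ring below has \<open>P \<otimes>\<^sub>k Q\<close> as additive group.\<close>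

definition tensor_ideal ::
  "('k, 'x) ring_scheme \<Rightarrow> ('k, 'p) top_algebra \<Rightarrow> ('k, 'q) top_algebra \<Rightarrow>
   (('p \<times> 'q) \<Rightarrow>\<^sub>0 int) set" where
  "tensor_ideal k P Q = Idl\<^bsub>pair_monoid_ring P Q\<^esub> (tensor_relations k P Q)"

abbreviation tensor_ring ::
  "('k, 'x) ring_scheme \<Rightarrow> ('k, 'p) top_algebra \<Rightarrow> ('k, 'q) top_algebra \<Rightarrow>
   (('p \<times> 'q) \<Rightarrow>\<^sub>0 int) set ring" where
  "tensor_ring k P Q \<equiv> pair_monoid_ring P Q Quot tensor_ideal k P Q"

definition pure_tensor ::
  "('k, 'x) ring_scheme \<Rightarrow> ('k, 'p) top_algebra \<Rightarrow> ('k, 'q) top_algebra \<Rightarrow> 'p \<Rightarrow> 'q \<Rightarrow>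
   (('p \<times> 'q) \<Rightarrow>\<^sub>0 int) set" where
  "pure_tensor k P Q p q = tensor_ideal k P Q +>\<^bsub>pair_monoid_ring P Q\<^esub> frag_of (p, q)"

text \<open>The ideals \<open>I \<otimes> Q + P \<otimes> J\<close>, for \<open>I\<close> and \<open>J\<close> open, are a base of neighbourhoods of \<open>0\<close>.\<close>

definition tensor_base ::
  "('k, 'x) ring_scheme \<Rightarrow> ('k, 'p) top_algebra \<Rightarrow> ('k, 'q) top_algebra \<Rightarrow>
   (('p \<times> 'q) \<Rightarrow>\<^sub>0 int) set set set" where
  "tensor_base k P Q =
     {Idl\<^bsub>tensor_ring k P Q\<^esub> ((\<lambda>p. pure_tensor k P Q p \<one>\<^bsub>Q\<^esub>) ` I \<union> (\<lambda>q. pure_tensor k P Q \<one>\<^bsub>P\<^esub> q) ` J)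
      | I J. I \<in> open_ideals P \<and> J \<in> open_ideals Q}"

definition tensor_algebra ::
  "('k, 'x) ring_scheme \<Rightarrow> ('k, 'p) top_algebra \<Rightarrow> ('k, 'q) top_algebra \<Rightarrow>
   ('k, (('p \<times> 'q) \<Rightarrow>\<^sub>0 int) set) top_algebra" where
  "tensor_algebra k P Q =
     \<lparr>carrier = carrier (tensor_ring k P Q), monoid.mult = monoid.mult (tensor_ring k P Q),
      monoid.one = monoid.one (tensor_ring k P Q), ring.zero = ring.zero (tensor_ring k P Q),
      ring.add = ring.add (tensor_ring k P Q),
      smult = (\<lambda>c z. pure_tensor k P Q (c \<odot>\<^bsub>P\<^esub> \<one>\<^bsub>P\<^esub>) \<one>\<^bsub>Q\<^esub> \<otimes>\<^bsub>tensor_ring k P Q\<^esub> z),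
      opens = topology (\<lambda>U. U \<subseteq> carrier (tensor_ring k P Q) \<and>
        (\<forall>u\<in>U. \<exists>K\<in>tensor_base k P Q. K +>\<^bsub>tensor_ring k P Q\<^esub> u \<subseteq> U))\<rparr>"

type_synonym ('p, 'q) ctensor =
  "(('p \<times> 'q) \<Rightarrow>\<^sub>0 int) set set \<Rightarrow> (('p \<times> 'q) \<Rightarrow>\<^sub>0 int) set set"

text \<open>The ring of functions on \<open>spf P \<times>\<^sub>S spf Q\<close>, with its two coprojections.\<close>

definition ctensor ::
  "('k, 'x) ring_scheme \<Rightarrow> ('k, 'p) top_algebra \<Rightarrow> ('k, 'q) top_algebra \<Rightarrow>
   ('k, ('p, 'q) ctensor) top_algebra" where
  "ctensor k P Q = completion (tensor_algebra k P Q)"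

definition in1 ::
  "('k, 'x) ring_scheme \<Rightarrow> ('k, 'p) top_algebra \<Rightarrow> ('k, 'q) top_algebra \<Rightarrow> 'p \<Rightarrow> ('p, 'q) ctensor" where
  "in1 k P Q = (\<lambda>p\<in>carrier P.
     to_lim (tensor_algebra k P Q) (open_ideals (tensor_algebra k P Q)) (pure_tensor k P Q p \<one>\<^bsub>Q\<^esub>))"

definition in2 ::
  "('k, 'x) ring_scheme \<Rightarrow> ('k, 'p) top_algebra \<Rightarrow> ('k, 'q) top_algebra \<Rightarrow> 'q \<Rightarrow> ('p, 'q) ctensor" where
  "in2 k P Q = (\<lambda>q\<in>carrier Q.
     to_lim (tensor_algebra k P Q) (open_ideals (tensor_algebra k P Q)) (pure_tensor k P Q \<one>\<^bsub>P\<^esub> q))"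

text \<open>The map out of the completed tensor product with components \<open>a\<close> and \<open>b\<close>, that is, the
  morphism \<open>(a, b) : spf T \<rightarrow> spf P \<times>\<^sub>S spf Q\<close>. It exists and is unique for every formal \<open>T\<close>.\<close>

definition copair ::
  "('k, 'x) ring_scheme \<Rightarrow> ('k, 'p) top_algebra \<Rightarrow> ('k, 'q) top_algebra \<Rightarrow> ('k, 't) top_algebra \<Rightarrow>
   ('p \<Rightarrow> 't) \<Rightarrow> ('q \<Rightarrow> 't) \<Rightarrow> (('p, 'q) ctensor \<Rightarrow> 't)" where
  "copair k P Q T a b = (THE h. h \<in> cont_alg_homs k (ctensor k P Q) T \<and>
     (\<forall>p\<in>carrier P. h (in1 k P Q p) = a p) \<and> (\<forall>q\<in>carrier Q. h (in2 k P Q q) = b q))"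

section \<open>Formal multicurves and formal multicurve groups\<close>

definition regular_element :: "('k, 'r) top_algebra \<Rightarrow> 'r \<Rightarrow> bool" where
  "regular_element P y \<longleftrightarrow>
     y \<in> carrier P \<and> (\<forall>r\<in>carrier P. y \<otimes>\<^bsub>P\<^esub> r = \<zero>\<^bsub>P\<^esub> \<longrightarrow> r = \<zero>\<^bsub>P\<^esub>)"

definition fg_free :: "('k, 'x) ring_scheme \<Rightarrow> ('k, 'r) top_algebra \<Rightarrow> bool" where
  "fg_free k M \<longleftrightarrow>
     (\<exists>(n::nat) e. e \<in> {..<n} \<rightarrow> carrier M \<and>
        (\<forall>v\<in>carrier M. \<exists>!c. c \<in> {..<n} \<rightarrow>\<^sub>E carrier k \<and>
           v = finsum M (\<lambda>i. c i \<odot>\<^bsub>M\<^esub> e i) {..<n}))"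

text \<open>The diagonal is the closed subscheme of \<open>C \<times>\<^sub>S C\<close> defined by the kernel of the (completed)
  multiplication map, that is, of the copairing of two identity maps.\<close>

definition diagonal_ideal ::
  "('k, 'x) ring_scheme \<Rightarrow> ('k, 'r) top_algebra \<Rightarrow> ('r, 'r) ctensor set" where
  "diagonal_ideal k R =
     a_kernel (ctensor k R R) R (copair k R R R (\<lambda>r\<in>carrier R. r) (\<lambda>r\<in>carrier R. r))"

text \<open>\<open>formal_multicurve k R\<close>: \<open>spf R\<close> is a formal multicurve over \<open>S = spec k\<close>.\<close>

definition formal_multicurve :: "('k, 'x) ring_scheme \<Rightarrow> ('k, 'r) top_algebra \<Rightarrow> bool" where
  "formal_multicurve k R \<longleftrightarrow>
     formal_algebra k R \<and>
     (\<exists>y. regular_element R y \<and>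
        (\<forall>m::nat. openin (opens R) (PIdl\<^bsub>R\<^esub> (y [^]\<^bsub>R\<^esub> m)) \<and>
                  fg_free k (quot_algebra R (PIdl\<^bsub>R\<^esub> (y [^]\<^bsub>R\<^esub> m)))) \<and>
        is_lim_of_quotients R {PIdl\<^bsub>R\<^esub> (y [^]\<^bsub>R\<^esub> m) | m::nat. True}) \<and>
     (\<exists>d. regular_element (ctensor k R R) d \<and> diagonal_ideal k R = PIdl\<^bsub>ctensor k R R\<^esub> d)"

text \<open>The \<open>T\<close>-valued points \<open>C(T)\<close> of \<open>C = spf R\<close> over \<open>S\<close>, for a formal \<open>k\<close>-algebra \<open>T\<close>, with the
  addition given by \<open>\<mu> : R \<rightarrow> R \<otimes> R\<close> (completed), i.e. by a morphism \<open>C \<times>\<^sub>S C \<rightarrow> C\<close>, and the zero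
  given by \<open>\<epsilon> : R \<rightarrow> k\<close>, i.e. by a section of \<open>C\<close>.\<close>

definition points ::
  "('k, 'x) ring_scheme \<Rightarrow> ('k, 'r) top_algebra \<Rightarrow> ('r \<Rightarrow> ('r, 'r) ctensor) \<Rightarrow> ('r \<Rightarrow> 'k) \<Rightarrow>
   ('k, 't) top_algebra \<Rightarrow> ('r \<Rightarrow> 't) monoid" where
  "points k R \<mu> \<epsilon> T =
     \<lparr>carrier = cont_alg_homs k R T,
      monoid.mult = (\<lambda>a b. \<lambda>r\<in>carrier R. copair k R R T a b (\<mu> r)),
      monoid.one = (\<lambda>r\<in>carrier R. \<epsilon> r \<odot>\<^bsub>T\<^esub> \<one>\<^bsub>T\<^esub>)\<rparr>"

text \<open>The group axioms are stated for universal points: associativity for the three projections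
  \<open>C \<times>\<^sub>S C \<times>\<^sub>S C \<rightarrow> C\<close>, commutativity for the two projections \<open>C \<times>\<^sub>S C \<rightarrow> C\<close>, and the laws for zero and
  negatives for the identity of \<open>C\<close>. The map \<open>\<nu>\<close> gives the negation \<open>C \<rightarrow> C\<close>.\<close>

definition comm_group_structure ::
  "('k, 'x) ring_scheme \<Rightarrow> ('k, 'r) top_algebra \<Rightarrow> ('r \<Rightarrow> ('r, 'r) ctensor) \<Rightarrow> ('r \<Rightarrow> 'k) \<Rightarrow> bool" where
  "comm_group_structure k R \<mu> \<epsilon> \<longleftrightarrow>
     \<mu> \<in> cont_alg_homs k R (ctensor k R R) \<and>
     \<epsilon> \<in> cont_alg_homs k R (base_algebra k) \<and>
     (let R2 = ctensor k R R; R3 = ctensor k R2 R;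
          p1 = (\<lambda>r\<in>carrier R. in1 k R2 R (in1 k R R r));
          p2 = (\<lambda>r\<in>carrier R. in1 k R2 R (in2 k R R r));
          p3 = in2 k R2 R
      in (p1 \<otimes>\<^bsub>points k R \<mu> \<epsilon> R3\<^esub> p2) \<otimes>\<^bsub>points k R \<mu> \<epsilon> R3\<^esub> p3
           = p1 \<otimes>\<^bsub>points k R \<mu> \<epsilon> R3\<^esub> (p2 \<otimes>\<^bsub>points k R \<mu> \<epsilon> R3\<^esub> p3)) \<and>
     (let R2 = ctensor k R R; p1 = in1 k R R; p2 = in2 k R R
      in p1 \<otimes>\<^bsub>points k R \<mu> \<epsilon> R2\<^esub> p2 = p2 \<otimes>\<^bsub>points k R \<mu> \<epsilon> R2\<^esub> p1) \<and>
     (let G = points k R \<mu> \<epsilon> R; i = (\<lambda>r\<in>carrier R. r)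
      in \<one>\<^bsub>G\<^esub> \<otimes>\<^bsub>G\<^esub> i = i \<and> (\<exists>\<nu>\<in>carrier G. \<nu> \<otimes>\<^bsub>G\<^esub> i = \<one>\<^bsub>G\<^esub>))"

definition formal_multicurve_group ::
  "('k, 'x) ring_scheme \<Rightarrow> ('k, 'r) top_algebra \<Rightarrow> ('r \<Rightarrow> ('r, 'r) ctensor) \<Rightarrow> ('r \<Rightarrow> 'k) \<Rightarrow> bool" where
  "formal_multicurve_group k R \<mu> \<epsilon> \<longleftrightarrow> formal_multicurve k R \<and> comm_group_structure k R \<mu> \<epsilon>"

definition coordinate ::
  "('k, 'x) ring_scheme \<Rightarrow> ('k, 'r) top_algebra \<Rightarrow> ('r \<Rightarrow> 'k) \<Rightarrow> 'r \<Rightarrow> bool" where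
  "coordinate k R \<epsilon> x \<longleftrightarrow>
     regular_element R x \<and> PIdl\<^bsub>R\<^esub> x = a_kernel R (base_algebra k) \<epsilon>"

section \<open>Equivariant formal groups\<close>

definition rat_mod_int :: "rat set monoid" where
  "rat_mod_int = \<lparr>carrier = UNIV, monoid.mult = (+), monoid.one = (0::rat)\<rparr> Mod \<int>"

definition dual_group :: "('g, 'm) monoid_scheme \<Rightarrow> ('g \<Rightarrow> rat set) monoid" where
  "dual_group A =
     \<lparr>carrier = hom A rat_mod_int \<inter> extensional (carrier A),
      monoid.mult = (\<lambda>\<alpha> \<beta>. \<lambda>a\<in>carrier A. \<alpha> a \<otimes>\<^bsub>rat_mod_int\<^esub> \<beta> a),
      monoid.one = (\<lambda>a\<in>carrier A. \<one>\<^bsub>rat_mod_int\<^esub>)\<rparr>"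

definition ann :: "('g, 'm) monoid_scheme \<Rightarrow> 'g set \<Rightarrow> ('g \<Rightarrow> rat set) set" where
  "ann A B = {\<alpha> \<in> carrier (dual_group A). \<forall>b\<in>B. \<alpha> b = \<one>\<^bsub>rat_mod_int\<^esub>}"

text \<open>Since \<open>A\<^sup>* \<times> S\<close> is a finite disjoint union of copies of \<open>S\<close>, a homomorphism \<open>A\<^sup>* \<times> S \<rightarrow> C\<close> over
  \<open>S\<close> is a group homomorphism from \<open>A\<^sup>*\<close> to the group \<open>C(k)\<close> of sections. The divisor of a section
  \<open>u : R \<rightarrow> k\<close> has ideal \<open>ker u\<close>, and sums of divisors correspond to products in the monoid
  \<open>ideals_set R\<close> of ideals.\<close>

definition equivariant_ideal ::
  "('k, 'x) ring_scheme \<Rightarrow> ('k, 'r) top_algebra \<Rightarrow> ('g, 'm) monoid_scheme \<Rightarrow>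
   (('g \<Rightarrow> rat set) \<Rightarrow> 'r \<Rightarrow> 'k) \<Rightarrow> 'r set" where
  "equivariant_ideal k R A \<phi> =
     finprod (ideals_set R) (\<lambda>\<alpha>. a_kernel R (base_algebra k) (\<phi> \<alpha>)) (carrier (dual_group A))"

definition equivariant_formal_group ::
  "('k, 'x) ring_scheme \<Rightarrow> ('k, 'r) top_algebra \<Rightarrow> ('r \<Rightarrow> ('r, 'r) ctensor) \<Rightarrow> ('r \<Rightarrow> 'k) \<Rightarrow>
   ('g, 'm) monoid_scheme \<Rightarrow> (('g \<Rightarrow> rat set) \<Rightarrow> 'r \<Rightarrow> 'k) \<Rightarrow> bool" where
  "equivariant_formal_group k R \<mu> \<epsilon> A \<phi> \<longleftrightarrow>
     formal_multicurve_group k R \<mu> \<epsilon> \<and>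
     \<phi> \<in> hom (dual_group A) (points k R \<mu> \<epsilon> (base_algebra k)) \<and>
     is_lim_of_quotients R
       {equivariant_ideal k R A \<phi> [^]\<^bsub>ideals_set R\<^esub> m | m::nat. True}"

section \<open>Transfer elements\<close>

text \<open>For a point \<open>a : R \<rightarrow> T\<close>, the value \<open>x(a)\<close> of a function \<open>x \<in> R\<close> is \<open>a x\<close>. The identity of \<open>R\<close> is
  the universal point of \<open>C\<close>, so the equation \<open>x(na) = x(a) v\<^sub>n(a)\<close> for all points \<open>a\<close> is the equation
  for this point. The same element, mapped to \<open>R \<otimes> k\<^sub>B\<close>, serves as \<open>v\<^sub>n\<close> over \<open>S[B]\<close>.\<close>

definition v_fun ::
  "('k, 'x) ring_scheme \<Rightarrow> ('k, 'r) top_algebra \<Rightarrow> ('r \<Rightarrow> ('r, 'r) ctensor) \<Rightarrow> ('r \<Rightarrow> 'k) \<Rightarrow>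
   'r \<Rightarrow> nat \<Rightarrow> 'r" where
  "v_fun k R \<mu> \<epsilon> x n = (THE w. w \<in> carrier R \<and>
     ((\<lambda>r\<in>carrier R. r) [^]\<^bsub>points k R \<mu> \<epsilon> R\<^esub> n) x = x \<otimes>\<^bsub>R\<^esub> w)"

definition coord_ideal :: "('k, 't) top_algebra \<Rightarrow> 'r \<Rightarrow> 'u set \<Rightarrow> ('u \<Rightarrow> 'r \<Rightarrow> 't) \<Rightarrow> 't set" where
  "coord_ideal T x U \<psi> = Idl\<^bsub>T\<^esub> ((\<lambda>u. \<psi> u x) ` U)"

definition cyclic_decomposition :: "('u, 'm) monoid_scheme \<Rightarrow> 'u list \<Rightarrow> bool" where
  "cyclic_decomposition U \<alpha>s \<longleftrightarrow>
     set \<alpha>s \<subseteq> carrier U - {\<one>\<^bsub>U\<^esub>} \<and>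
     (\<lambda>e. finprod U (\<lambda>i. (\<alpha>s ! i) [^]\<^bsub>U\<^esub> (e i :: int)) {..<length \<alpha>s})
       \<in> iso (sum_group {..<length \<alpha>s} (\<lambda>i. integer_mod_group (group.ord U (\<alpha>s ! i)))) U"

definition transfer_element ::
  "('k, 'x) ring_scheme \<Rightarrow> ('k, 'r) top_algebra \<Rightarrow> ('r \<Rightarrow> ('r, 'r) ctensor) \<Rightarrow> ('r \<Rightarrow> 'k) \<Rightarrow> 'r \<Rightarrow>
   ('k, 't) top_algebra \<Rightarrow> ('u, 'm) monoid_scheme \<Rightarrow> ('u \<Rightarrow> 'r \<Rightarrow> 't) \<Rightarrow> 't" where
  "transfer_element k R \<mu> \<epsilon> x T U \<psi> =
     (let \<alpha>s = (SOME \<alpha>s. cyclic_decomposition U \<alpha>s)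
      in finprod T (\<lambda>i. \<psi> (\<alpha>s ! i) (v_fun k R \<mu> \<epsilon> x (group.ord U (\<alpha>s ! i)))) {..<length \<alpha>s})"

section \<open>The Mackey structure\<close>

definition kB_ideal ::
  "('k, 'x) ring_scheme \<Rightarrow> 'r \<Rightarrow> ('g, 'm) monoid_scheme \<Rightarrow>
   (('g \<Rightarrow> rat set) \<Rightarrow> 'r \<Rightarrow> 'k) \<Rightarrow> 'g set \<Rightarrow> 'k set" where
  "kB_ideal k x A \<phi> B = coord_ideal (base_algebra k) x (ann A B) \<phi>"

definition kB ::
  "('k, 'x) ring_scheme \<Rightarrow> 'r \<Rightarrow> ('g, 'm) monoid_scheme \<Rightarrow>
   (('g \<Rightarrow> rat set) \<Rightarrow> 'r \<Rightarrow> 'k) \<Rightarrow> 'g set \<Rightarrow> ('k, 'k set) top_algebra" where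
  "kB k x A \<phi> B = quot_algebra (base_algebra k) (kB_ideal k x A \<phi> B)"

text \<open>The character group \<open>B\<^sup>*\<close> is taken to be \<open>A\<^sup>*/ann(B)\<close>. A section of \<open>C[B] = C \<times>\<^sub>S S[B]\<close> over
  \<open>S[B]\<close> is the same as a point of \<open>C\<close> with values in \<open>k\<^sub>B\<close>, so \<open>\<phi>\<^sub>B\<close> sends the coset of \<open>\<alpha>\<close> to the
  composite of \<open>\<phi> \<alpha>\<close> with the projection \<open>k \<rightarrow> k\<^sub>B\<close>.\<close>

definition phiB ::
  "('k, 'x) ring_scheme \<Rightarrow> ('k, 'r) top_algebra \<Rightarrow> 'r \<Rightarrow> ('g, 'm) monoid_scheme \<Rightarrow>
   (('g \<Rightarrow> rat set) \<Rightarrow> 'r \<Rightarrow> 'k) \<Rightarrow> 'g set \<Rightarrow> ('g \<Rightarrow> rat set) set \<Rightarrow> 'r \<Rightarrow> 'k set" where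
  "phiB k R x A \<phi> B X = the_elem
     ((\<lambda>\<alpha>. \<lambda>r\<in>carrier R. kB_ideal k x A \<phi> B +>\<^bsub>base_algebra k\<^esub> \<phi> \<alpha> r) ` X)"

definition ann_quot :: "('g, 'm) monoid_scheme \<Rightarrow> 'g set \<Rightarrow> 'g set \<Rightarrow> ('g \<Rightarrow> rat set) set monoid" where
  "ann_quot A B B' = (dual_group A)\<lparr>carrier := ann A B'\<rparr> Mod ann A B"

definition resB ::
  "('k, 'x) ring_scheme \<Rightarrow> 'r \<Rightarrow> ('g, 'm) monoid_scheme \<Rightarrow>
   (('g \<Rightarrow> rat set) \<Rightarrow> 'r \<Rightarrow> 'k) \<Rightarrow> 'g set \<Rightarrow> 'g set \<Rightarrow> 'k set \<Rightarrow> 'k set" where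
  "resB k x A \<phi> B B' = (\<lambda>X\<in>carrier (kB k x A \<phi> B).
     \<Union>r\<in>X. kB_ideal k x A \<phi> B' +>\<^bsub>base_algebra k\<^esub> r)"

text \<open>The value of the map \<open>k\<^sub>B\<^sub>' \<rightarrow> k\<^sub>B\<close> induced by multiplication by the transfer element: the common
  value of \<open>t X\<close> for all \<open>X \<in> k\<^sub>B\<close> restricting to \<open>Y\<close>.\<close>

definition trB ::
  "('k, 'x) ring_scheme \<Rightarrow> ('k, 'r) top_algebra \<Rightarrow> ('r \<Rightarrow> ('r, 'r) ctensor) \<Rightarrow> ('r \<Rightarrow> 'k) \<Rightarrow> 'r \<Rightarrow>
   ('g, 'm) monoid_scheme \<Rightarrow> (('g \<Rightarrow> rat set) \<Rightarrow> 'r \<Rightarrow> 'k) \<Rightarrow> 'g set \<Rightarrow> 'g set \<Rightarrow> 'k set \<Rightarrow> 'k set" where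
  "trB k R \<mu> \<epsilon> x A \<phi> B B' = (\<lambda>Y\<in>carrier (kB k x A \<phi> B').
     let t = transfer_element k R \<mu> \<epsilon> x (kB k x A \<phi> B) (ann_quot A B B') (phiB k R x A \<phi> B)
     in the_elem {t \<otimes>\<^bsub>kB k x A \<phi> B\<^esub> X | X. X \<in> carrier (kB k x A \<phi> B) \<and> resB k x A \<phi> B B' X = Y})"

end

theory Submission
  imports Defs
begin

text \<open>Let \<open>V \<subseteq> N\<close> be subgroups of \<open>A\<^sup>*\<close> and \<open>T\<close> a quotient of \<open>k\<close> in which \<open>x(\<phi>(\<alpha>)) = 0\<close> for \<open>\<alpha> \<in> V\<close>. To a
  chain of subgroups from \<open>V\<close> to \<open>N\<close> with cyclic quotients, generated by \<open>\<alpha>\<^sub>i\<close> of order \<open>n\<^sub>i\<close>,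
  attach the product of the elements \<open>v\<^bsub>n\<^sub>i\<^esub>(\<phi>(\<alpha>\<^sub>i))\<close> of \<open>T\<close>. It depends only on \<open>V\<close> and \<open>N\<close>, as in the
  theorem of Jordan and Hoelder, and it annihilates \<open>x(\<phi>(\<alpha>))\<close> for \<open>\<alpha> \<in> N\<close>, because
  \<open>f(a + b) - f(a)\<close> is divisible by \<open>x(b)\<close> for every function \<open>f\<close>. The transfer element is the product
  for a chain obtained from a cyclic decomposition of \<open>N/V\<close>, so any other chain may be used to
  compute it: concatenation of chains makes the transfers transitive. For the double coset formula
  take a chain from \<open>ann(B)\<close> to \<open>ann(B'')\<close> through \<open>ann(B') \<inter> ann(B'') = ann(B' + B'')\<close>. Its upper part gives,
  by adding \<open>ann(B')\<close>, a chain from \<open>ann(B')\<close> to \<open>ann(B' \<inter> B'')\<close>; in its lower part all \<open>\<phi>(\<alpha>\<^sub>i)\<close> vanish over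
  \<open>k\<^bsub>B'\<^esub>\<close>, and \<open>v\<^sub>n(0) = n\<close>, so it contributes the factor \<open>|ann(B' + B'')/ann(B)| = |B/(B' + B'')|\<close>.\<close>

section \<open>Linear topologies\<close>

text \<open>Cyclic decompositions do not compose: one of W/V and one of N/W give none of N/V in
  general (two copies of Z/2 inside Z/4), while the transfer element is defined by a decomposition
  of N/V. Chains drop the splitting, so they can be concatenated, refined and pushed forward. The
  price is that v_n takes different values at different generators of the same step. They agree only
  after multiplication by the value of the chain below the step, which kills x on the lower group;
  so annihilation accompanies every comparison, and chains are compared from their top step. The
  values live on a group given only by its universal points, with functions on C x C in a completed
  tensor product. Every divisibility is therefore verified on a pure tensor and extended by density,
  which requires the ideal in question to be open. Over the discrete ring k every ideal is open. But
  v_n(0) = n comes from x(na) = n x(a) modulo x(a)^2 on C itself, and there the openness of the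
  ideal of x^2 has to be derived from the topology of C.\<close>

lemma ideal_subset_carrier: "ideal I R \<Longrightarrow> I \<subseteq> carrier R"
  by (rule additive_subgroup.a_subset[OF ideal.axioms(1)])

lemma (in ring) coset_eq_iff:
  assumes "ideal I R" "a \<in> carrier R" "b \<in> carrier R"
  shows "I +> a = I +> b \<longleftrightarrow> a \<ominus> b \<in> I"
  using quotient_eq_iff_same_a_r_cos[OF assms] by simp

lemma (in ring) mem_coset_iff:
  assumes "ideal I R" "b \<in> carrier R"
  shows "a \<in> I +> b \<longleftrightarrow> a \<in> carrier R \<and> a \<ominus> b \<in> I"
proof -
  interpret I: ideal I R by fact
  show ?thesis
  proof
    assume a: "a \<in> I +> b"
    then have "a \<in> carrier R" using I.a_elemrcos_carrier assms by blast
    moreover from this have "I +> b = I +> a" using I.a_repr_independence' a assms by blast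
    ultimately show "a \<in> carrier R \<and> a \<ominus> b \<in> I" using coset_eq_iff assms by metis
  next
    assume "a \<in> carrier R \<and> a \<ominus> b \<in> I"
    then have "I +> a = I +> b" "a \<in> I +> a" using coset_eq_iff assms I.a_rcos_self by blast+
    then show "a \<in> I +> b" by simp
  qed
qed

text \<open>Several records below copy the operations of a ring into a larger record; this carries
  the ring axioms across.\<close>

lemma cring_cong:
  assumes "cring R" "carrier S = carrier R" "monoid.mult S = monoid.mult R" "\<one>\<^bsub>S\<^esub> = \<one>\<^bsub>R\<^esub>"
    "ring.add S = ring.add R" "\<zero>\<^bsub>S\<^esub> = \<zero>\<^bsub>R\<^esub>"
  shows "cring S"
proof -
  interpret R: cring R by fact
  show ?thesis
  proof (rule cringI)
    show "abelian_group S"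
      by (rule abelian_groupI) (auto simp: assms R.a_ac intro!: bexI[where P = "\<lambda>y. y \<oplus>\<^bsub>R\<^esub> _ = _", OF R.l_neg])
    show "comm_monoid S"
      by (rule comm_monoidI) (auto simp: assms R.m_ac)
  qed (simp add: assms R.l_distr)
qed

lemma a_r_coset_cong: "ring.add S = ring.add R \<Longrightarrow> a_r_coset S = a_r_coset R"
  by (simp add: a_r_coset_def r_coset_def fun_eq_iff)

text \<open>A filter base of ideals whose cosets are a base of the topology. One notion serves both
  for all open ideals of a given algebra and for the explicit families by which completions and
  tensor products are topologised.\<close>

definition lin_basis :: "('k, 'r) top_algebra \<Rightarrow> 'r set set \<Rightarrow> bool" where
  "lin_basis P \<B> \<longleftrightarrow> \<B> \<noteq> {} \<and> (\<forall>K\<in>\<B>. ideal K P) \<and> (\<forall>K\<in>\<B>. \<forall>K'\<in>\<B>. \<exists>K''\<in>\<B>. K'' \<subseteq> K \<inter> K') \<and>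
    (\<forall>U. openin (opens P) U \<longleftrightarrow> U \<subseteq> carrier P \<and> (\<forall>u\<in>U. \<exists>K\<in>\<B>. K +>\<^bsub>P\<^esub> u \<subseteq> U))"

lemma lin_basisD:
  assumes "lin_basis P \<B>"
  shows "\<B> \<noteq> {}" "\<And>K. K \<in> \<B> \<Longrightarrow> ideal K P"
    "\<And>K K'. K \<in> \<B> \<Longrightarrow> K' \<in> \<B> \<Longrightarrow> \<exists>K''\<in>\<B>. K'' \<subseteq> K \<inter> K'"
    "\<And>U. openin (opens P) U \<longleftrightarrow> U \<subseteq> carrier P \<and> (\<forall>u\<in>U. \<exists>K\<in>\<B>. K +>\<^bsub>P\<^esub> u \<subseteq> U)"
  using assms by (simp_all add: lin_basis_def)

text \<open>\<open>J\<close> is a union of cosets of \<open>K\<close>.\<close>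

lemma lin_basis_ideal_open:
  assumes P: "cring P" "lin_basis P \<B>" and J: "ideal J P" and K: "K \<in> \<B>" "K \<subseteq> J"
  shows "J \<in> open_ideals P"
proof -
  interpret cring P by fact
  interpret J: ideal J P by fact
  have "K +>\<^bsub>P\<^esub> u \<subseteq> J" if "u \<in> J" for u
    using that K(2) by (auto simp: a_r_coset_def r_coset_def)
  then show ?thesis unfolding open_ideals_def using J K(1) J.a_subset lin_basisD(4)[OF P(2)] by auto
qed

lemma lin_basis_nhds:
  assumes P: "cring P" "lin_basis P \<B>" and J: "J \<in> open_ideals P"
  shows "\<exists>K\<in>\<B>. K \<subseteq> J"
proof -
  interpret cring P by fact
  have J: "openin (opens P) J" "ideal J P" using J unfolding open_ideals_def by auto
  interpret J: ideal J P by fact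
  have "\<zero>\<^bsub>P\<^esub> \<in> J" by simp
  then obtain K where K: "K \<in> \<B>" "K +>\<^bsub>P\<^esub> \<zero>\<^bsub>P\<^esub> \<subseteq> J" using J(1) unfolding lin_basisD(4)[OF P(2)] by blast
  have "K \<subseteq> carrier P" using ideal_subset_carrier[OF lin_basisD(2)[OF P(2) K(1)]] .
  then show ?thesis using K by auto
qed

lemma lin_basis_coset_open:
  assumes P: "cring P" "lin_basis P \<B>" and K: "K \<in> \<B>" and a: "a \<in> carrier P"
  shows "openin (opens P) (K +>\<^bsub>P\<^esub> a)"
proof -
  interpret cring P by fact
  interpret K: ideal K P using lin_basisD(2)[OF P(2) K] .
  have "K +>\<^bsub>P\<^esub> u \<subseteq> K +>\<^bsub>P\<^esub> a" if "u \<in> K +>\<^bsub>P\<^esub> a" for u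
    using K.a_repr_independence'[OF that a] by simp
  moreover have "K +>\<^bsub>P\<^esub> a \<subseteq> carrier P" using a_r_coset_subset_G[OF K.a_subset a] .
  ultimately show ?thesis unfolding lin_basisD(4)[OF P(2)] using K by auto
qed

text \<open>Each operation descends to the quotient by every ideal, so it sends cosets into cosets;
  for a topology with a base of cosets this is continuity.\<close>

lemma lin_basis_lin_top:
  assumes alg: "Module.algebra k P" and B: "lin_basis P \<B>"
  shows "lin_top_algebra k P" "\<B> \<subseteq> open_ideals P"
proof -
  interpret M: cring P using \<open>Module.algebra k P\<close> by (rule algebra.M_cring)
  interpret A: Module.algebra k P by fact
  have P: "cring P" by (rule A.M_cring)
  show sub: "\<B> \<subseteq> open_ideals P"
    using lin_basis_ideal_open[OF P B] lin_basisD(2)[OF B] by blast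
  have opn: "openin (opens P) U \<longleftrightarrow> U \<subseteq> carrier P \<and> (\<forall>u\<in>U. \<exists>K\<in>\<B>. K +>\<^bsub>P\<^esub> u \<subseteq> U)" for U
    using lin_basisD(4)[OF B] .
  obtain K0 where K0: "K0 \<in> \<B>" using lin_basisD(1)[OF B] by blast
  have "openin (opens P) (carrier P)"
    unfolding opn
  proof (intro conjI ballI order_refl bexI[OF _ K0])
    interpret K0: ideal K0 P using lin_basisD(2)[OF B K0] .
    fix u assume "u \<in> carrier P"
    then show "K0 +>\<^bsub>P\<^esub> u \<subseteq> carrier P" using M.a_r_coset_subset_G[OF K0.a_subset] by blast
  qed
  then have top: "topspace (opens P) = carrier P"
    using opn by (metis openin_subset openin_topspace subset_antisym)
  have nb: "a \<in> K +>\<^bsub>P\<^esub> a" "openin (opens P) (K +>\<^bsub>P\<^esub> a)" if "K \<in> \<B>" "a \<in> carrier P" for K a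
  proof -
    interpret K: ideal K P using lin_basisD(2)[OF B that(1)] .
    show "a \<in> K +>\<^bsub>P\<^esub> a" using K.a_rcos_self that by blast
    show "openin (opens P) (K +>\<^bsub>P\<^esub> a)" using lin_basis_coset_open[OF P B that] .
  qed
  \<comment> \<open>\<open>bin\<close> treats addition and multiplication at once: an operation
    compatible with congruence modulo every ideal is jointly continuous.\<close>
  have bin: "continuous_map (prod_topology (opens P) (opens P)) (opens P) (\<lambda>(a, b). f a b)"
    if f: "\<And>a b. a \<in> carrier P \<Longrightarrow> b \<in> carrier P \<Longrightarrow> f a b \<in> carrier P"
      "\<And>K a b a' b'. ideal K P \<Longrightarrow> a \<in> carrier P \<Longrightarrow> b \<in> carrier P \<Longrightarrow> a' \<in> carrier P \<Longrightarrow> b' \<in> carrier P \<Longrightarrow>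
        K +>\<^bsub>P\<^esub> a = K +>\<^bsub>P\<^esub> a' \<Longrightarrow> K +>\<^bsub>P\<^esub> b = K +>\<^bsub>P\<^esub> b' \<Longrightarrow> K +>\<^bsub>P\<^esub> f a b = K +>\<^bsub>P\<^esub> f a' b'" for f
    unfolding continuous_map_def
  proof (intro conjI allI impI)
    show "(\<lambda>(a, b). f a b) \<in> topspace (prod_topology (opens P) (opens P)) \<rightarrow> topspace (opens P)"
      using f(1) by (auto simp: top)
    fix U assume U: "openin (opens P) U"
    show "openin (prod_topology (opens P) (opens P))
      {x \<in> topspace (prod_topology (opens P) (opens P)). (case x of (a, b) \<Rightarrow> f a b) \<in> U}"
      unfolding openin_prod_topology_alt
    proof (intro allI impI, unfold topspace_prod_topology top)
      fix a b assume "(a, b) \<in> {x \<in> carrier P \<times> carrier P. (case x of (a, b) \<Rightarrow> f a b) \<in> U}"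
      then have ab: "a \<in> carrier P" "b \<in> carrier P" "f a b \<in> U" by auto
      from ab(3) obtain K where K: "K \<in> \<B>" "K +>\<^bsub>P\<^esub> f a b \<subseteq> U" using U unfolding opn by blast
      interpret K: ideal K P using lin_basisD(2)[OF B K(1)] .
      have "(K +>\<^bsub>P\<^esub> a) \<times> (K +>\<^bsub>P\<^esub> b) \<subseteq> {x \<in> carrier P \<times> carrier P. (case x of (a, b) \<Rightarrow> f a b) \<in> U}"
      proof
        fix z assume "z \<in> (K +>\<^bsub>P\<^esub> a) \<times> (K +>\<^bsub>P\<^esub> b)"
        then obtain a' b' where z: "z = (a', b')" and ab': "a' \<in> K +>\<^bsub>P\<^esub> a" "b' \<in> K +>\<^bsub>P\<^esub> b" by blast
        have c: "a' \<in> carrier P" "b' \<in> carrier P" using ab' ab K.a_elemrcos_carrier by blast+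
        have "K +>\<^bsub>P\<^esub> f a' b' = K +>\<^bsub>P\<^esub> f a b"
          using f(2)[OF K.is_ideal c ab(1,2)] ab' ab K.a_repr_independence' by metis
        then have "f a' b' \<in> U" using K(2) K.a_rcos_self[OF f(1)[OF c]] by blast
        then show "z \<in> {x \<in> carrier P \<times> carrier P. (case x of (a, b) \<Rightarrow> f a b) \<in> U}" using c z by simp
      qed
      then show "\<exists>Ua V. openin (opens P) Ua \<and> openin (opens P) V \<and> a \<in> Ua \<and> b \<in> V \<and>
          Ua \<times> V \<subseteq> {x \<in> carrier P \<times> carrier P. (case x of (a, b) \<Rightarrow> f a b) \<in> U}"
        using nb[OF K(1) ab(1)] nb[OF K(1) ab(2)] by blast
    qed
  qed
  have hom: "K +>\<^bsub>P\<^esub> (a \<oplus>\<^bsub>P\<^esub> b) = K +>\<^bsub>P\<^esub> (a' \<oplus>\<^bsub>P\<^esub> b')" "K +>\<^bsub>P\<^esub> (a \<otimes>\<^bsub>P\<^esub> b) = K +>\<^bsub>P\<^esub> (a' \<otimes>\<^bsub>P\<^esub> b')"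
    if "ideal K P" "a \<in> carrier P" "b \<in> carrier P" "a' \<in> carrier P" "b' \<in> carrier P"
      "K +>\<^bsub>P\<^esub> a = K +>\<^bsub>P\<^esub> a'" "K +>\<^bsub>P\<^esub> b = K +>\<^bsub>P\<^esub> b'" for K a b a' b'
    using that ring_hom_add[OF ideal.rcos_ring_hom[OF that(1)]] ring_hom_mult[OF ideal.rcos_ring_hom[OF that(1)]]
    by metis+
  have "continuous_map (opens P) (opens P) (\<lambda>a. \<ominus>\<^bsub>P\<^esub> a)"
    unfolding continuous_map_def
  proof (intro conjI allI impI)
    show "(\<lambda>a. \<ominus>\<^bsub>P\<^esub> a) \<in> topspace (opens P) \<rightarrow> topspace (opens P)" by (simp add: top)
    fix U assume U: "openin (opens P) U"
    show "openin (opens P) {x \<in> topspace (opens P). \<ominus>\<^bsub>P\<^esub> x \<in> U}"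
      unfolding opn
    proof (clarsimp simp: top)
      fix u assume u: "u \<in> carrier P" "\<ominus>\<^bsub>P\<^esub> u \<in> U"
      then obtain K where K: "K \<in> \<B>" "K +>\<^bsub>P\<^esub> (\<ominus>\<^bsub>P\<^esub> u) \<subseteq> U" using U unfolding opn by blast
      note Ki = lin_basisD(2)[OF B K(1)]
      have "w \<in> carrier P \<and> \<ominus>\<^bsub>P\<^esub> w \<in> U" if w: "w \<in> K +>\<^bsub>P\<^esub> u" for w
      proof -
        have wc: "w \<in> carrier P" "w \<ominus>\<^bsub>P\<^esub> u \<in> K" using w M.mem_coset_iff[OF Ki u(1)] by auto
        have "\<ominus>\<^bsub>P\<^esub> (w \<ominus>\<^bsub>P\<^esub> u) \<in> K" using wc(2) Ki by (meson additive_subgroup.a_inv_closed ideal.axioms(1))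
        moreover have "\<ominus>\<^bsub>P\<^esub> (w \<ominus>\<^bsub>P\<^esub> u) = (\<ominus>\<^bsub>P\<^esub> w) \<ominus>\<^bsub>P\<^esub> (\<ominus>\<^bsub>P\<^esub> u)"
          using wc u by (simp add: a_minus_def M.minus_add)
        ultimately have "\<ominus>\<^bsub>P\<^esub> w \<in> K +>\<^bsub>P\<^esub> (\<ominus>\<^bsub>P\<^esub> u)" using M.mem_coset_iff[OF Ki, of "\<ominus>\<^bsub>P\<^esub> u"] wc u by simp
        then show ?thesis using K wc by blast
      qed
      then show "\<exists>K\<in>\<B>. K +>\<^bsub>P\<^esub> u \<subseteq> {x \<in> carrier P. \<ominus>\<^bsub>P\<^esub> x \<in> U}" using K(1) by blast
    qed
  qed
  moreover have "\<exists>J\<in>open_ideals P. J \<subseteq> U" if U: "openin (opens P) U" "\<zero>\<^bsub>P\<^esub> \<in> U" for U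
  proof -
    obtain K where K: "K \<in> \<B>" "K +>\<^bsub>P\<^esub> \<zero>\<^bsub>P\<^esub> \<subseteq> U" using U unfolding opn by blast
    have "K \<subseteq> carrier P" using ideal_subset_carrier[OF lin_basisD(2)[OF B K(1)]] .
    then have "K \<subseteq> U" using K(2) by simp
    with K(1) sub show ?thesis by (meson subsetD)
  qed
  moreover have "continuous_map (prod_topology (opens P) (opens P)) (opens P) (\<lambda>(a, b). a \<oplus>\<^bsub>P\<^esub> b)"
    by (rule bin, simp, (rule hom(1); assumption))
  moreover have "continuous_map (prod_topology (opens P) (opens P)) (opens P) (\<lambda>(a, b). a \<otimes>\<^bsub>P\<^esub> b)"
    by (rule bin, simp, (rule hom(2); assumption))
  ultimately show "lin_top_algebra k P"
    unfolding lin_top_algebra_def using alg top by simp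
qed

text \<open>Translation is continuous, so the neighbourhoods of a point are the translates of those
  of zero, and each of these contains an open ideal.\<close>

lemma lin_top_basis:
  assumes P: "lin_top_algebra k P"
  shows "lin_basis P (open_ideals P)"
proof -
  have "Module.algebra k P" using P unfolding lin_top_algebra_def by blast
  then interpret M: cring P by (rule algebra.M_cring)
  have top: "topspace (opens P) = carrier P"
    and add: "continuous_map (prod_topology (opens P) (opens P)) (opens P) (\<lambda>(a, b). a \<oplus>\<^bsub>P\<^esub> b)"
    and nbhd: "\<And>U. openin (opens P) U \<Longrightarrow> \<zero>\<^bsub>P\<^esub> \<in> U \<Longrightarrow> \<exists>J\<in>open_ideals P. J \<subseteq> U"
    using P unfolding lin_top_algebra_def by blast+
  have trans: "openin (opens P) {a \<in> carrier P. a \<oplus>\<^bsub>P\<^esub> c \<in> U}" if c: "c \<in> carrier P" and U: "openin (opens P) U" for c U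
  proof -
    have "continuous_map (opens P) (prod_topology (opens P) (opens P)) (\<lambda>a. (a, c))"
      using c by (intro continuous_map_pairedI continuous_map_id[unfolded id_def]) (simp add: top)
    from continuous_map_compose[OF this add] have "continuous_map (opens P) (opens P) (\<lambda>a. a \<oplus>\<^bsub>P\<^esub> c)"
      by (simp add: comp_def)
    from openin_continuous_map_preimage[OF this U] show ?thesis by (simp add: top)
  qed
  have opn: "openin (opens P) U \<longleftrightarrow> U \<subseteq> carrier P \<and> (\<forall>u\<in>U. \<exists>K\<in>open_ideals P. K +>\<^bsub>P\<^esub> u \<subseteq> U)" for U
  proof (intro iffI conjI ballI)
    assume U: "openin (opens P) U"
    then show "U \<subseteq> carrier P" using openin_subset top by blast
    fix u assume u: "u \<in> U"
    then have uc: "u \<in> carrier P" using \<open>U \<subseteq> carrier P\<close> by blast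
    have "\<zero>\<^bsub>P\<^esub> \<in> {a \<in> carrier P. a \<oplus>\<^bsub>P\<^esub> u \<in> U}" using u uc by simp
    then obtain J where J: "J \<in> open_ideals P" "J \<subseteq> {a \<in> carrier P. a \<oplus>\<^bsub>P\<^esub> u \<in> U}"
      using nbhd[OF trans[OF uc U]] by blast
    then have "J +>\<^bsub>P\<^esub> u \<subseteq> U" by (auto simp: a_r_coset_def r_coset_def)
    with J show "\<exists>K\<in>open_ideals P. K +>\<^bsub>P\<^esub> u \<subseteq> U" by blast
  next
    assume U: "U \<subseteq> carrier P \<and> (\<forall>u\<in>U. \<exists>K\<in>open_ideals P. K +>\<^bsub>P\<^esub> u \<subseteq> U)"
    show "openin (opens P) U"
    proof (subst openin_subopen, intro ballI)
      fix u assume u: "u \<in> U"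
      then obtain K where K: "K \<in> open_ideals P" "K +>\<^bsub>P\<^esub> u \<subseteq> U" using U by blast
      have uc: "u \<in> carrier P" using u U by blast
      have Ki: "ideal K P" "openin (opens P) K" using K unfolding open_ideals_def by auto
      have "K +>\<^bsub>P\<^esub> u = {a \<in> carrier P. a \<oplus>\<^bsub>P\<^esub> (\<ominus>\<^bsub>P\<^esub> u) \<in> K}"
        using M.mem_coset_iff[OF Ki(1) uc] by (auto simp: a_minus_def)
      then have "openin (opens P) (K +>\<^bsub>P\<^esub> u)" using trans[OF _ Ki(2), of "\<ominus>\<^bsub>P\<^esub> u"] uc by simp
      moreover have "u \<in> K +>\<^bsub>P\<^esub> u"
      proof -
        interpret K: ideal K P by fact
        show ?thesis using K.a_rcos_self[OF uc] .
      qed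
      ultimately show "\<exists>T. openin (opens P) T \<and> u \<in> T \<and> T \<subseteq> U" using K(2) by blast
    qed
  qed
  have c: "carrier P \<in> open_ideals P"
    using M.oneideal top openin_topspace unfolding open_ideals_def by (metis mem_Collect_eq)
  have int: "K \<inter> K' \<in> open_ideals P" if "K \<in> open_ideals P" "K' \<in> open_ideals P" for K K'
    using that M.i_intersect unfolding open_ideals_def by auto
  show ?thesis unfolding lin_basis_def
  proof (intro conjI ballI allI)
    show "open_ideals P \<noteq> {}" using c by auto
    show "ideal K P" if "K \<in> open_ideals P" for K using that by (simp add: open_ideals_def)
    show "\<exists>K''\<in>open_ideals P. K'' \<subseteq> K \<inter> K'" if "K \<in> open_ideals P" "K' \<in> open_ideals P" for K K'
      using int[OF that] by blast
  qed (rule opn)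
qed

lemma lin_topD:
  assumes P: "lin_top_algebra k P"
  shows "Module.algebra k P" "cring P" "topspace (opens P) = carrier P" "carrier P \<in> open_ideals P"
    "\<And>K K'. K \<in> open_ideals P \<Longrightarrow> K' \<in> open_ideals P \<Longrightarrow> K \<inter> K' \<in> open_ideals P"
    "\<And>K. K \<in> open_ideals P \<Longrightarrow> ideal K P"
    "\<And>J K. K \<in> open_ideals P \<Longrightarrow> ideal J P \<Longrightarrow> K \<subseteq> J \<Longrightarrow> J \<in> open_ideals P"
proof -
  show alg: "Module.algebra k P" "topspace (opens P) = carrier P"
    using P unfolding lin_top_algebra_def by blast+
  interpret M: cring P using \<open>Module.algebra k P\<close> by (rule algebra.M_cring)
  interpret A: Module.algebra k P by fact
  show c: "cring P" by (rule A.M_cring)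
  show "carrier P \<in> open_ideals P"
    using M.oneideal alg(2) openin_topspace unfolding open_ideals_def by (metis mem_Collect_eq)
  show "\<And>K K'. K \<in> open_ideals P \<Longrightarrow> K' \<in> open_ideals P \<Longrightarrow> K \<inter> K' \<in> open_ideals P"
    using M.i_intersect unfolding open_ideals_def by auto
  show "\<And>K. K \<in> open_ideals P \<Longrightarrow> ideal K P" by (simp add: open_ideals_def)
  show "\<And>J K. K \<in> open_ideals P \<Longrightarrow> ideal J P \<Longrightarrow> K \<subseteq> J \<Longrightarrow> J \<in> open_ideals P"
    using lin_basis_ideal_open[OF c lin_top_basis[OF P]] by blast
qed

text \<open>A homomorphism is additive, so continuity at zero suffices, and there both topologies
  are given by ideals.\<close>

lemma ring_hom_continuous_iff:
  assumes P: "cring P" "lin_basis P \<B>" and T: "cring T" "lin_basis T \<C>" and h: "h \<in> ring_hom P T"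
    and top: "topspace (opens P) = carrier P" "topspace (opens T) = carrier T"
  shows "continuous_map (opens P) (opens T) h \<longleftrightarrow> (\<forall>J\<in>\<C>. \<exists>K\<in>\<B>. h ` K \<subseteq> J)"
proof
  interpret P: cring P by fact
  interpret T: cring T by fact
  interpret h: ring_hom_cring P T h using P(1) T(1) h by (simp add: ring_hom_cring_def ring_hom_cring_axioms_def)
  {
    assume c: "continuous_map (opens P) (opens T) h"
    show "\<forall>J\<in>\<C>. \<exists>K\<in>\<B>. h ` K \<subseteq> J"
    proof
      fix J assume J: "J \<in> \<C>"
      have Ji: "ideal J T" using lin_basisD(2)[OF T(2) J] .
      have Jo: "openin (opens T) J"
        using lin_basis_ideal_open[OF T Ji J order_refl] unfolding open_ideals_def by blast
      have "{x \<in> carrier P. h x \<in> J} \<in> open_ideals P"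
        using openin_continuous_map_preimage[OF c Jo] h.ring.ideal_vimage[OF Ji] top
        unfolding open_ideals_def by simp
      then show "\<exists>K\<in>\<B>. h ` K \<subseteq> J" using lin_basis_nhds[OF P] by blast
    qed
  }
  assume c: "\<forall>J\<in>\<C>. \<exists>K\<in>\<B>. h ` K \<subseteq> J"
  show "continuous_map (opens P) (opens T) h"
    unfolding continuous_map_def
  proof (intro conjI allI impI)
    show "h \<in> topspace (opens P) \<rightarrow> topspace (opens T)" using top h.hom_closed by simp
    fix U assume U: "openin (opens T) U"
    show "openin (opens P) {x \<in> topspace (opens P). h x \<in> U}"
      unfolding lin_basisD(4)[OF P(2)]
    proof (clarsimp simp: top)
      fix u assume u: "u \<in> carrier P" "h u \<in> U"
      then obtain J where J: "J \<in> \<C>" "J +>\<^bsub>T\<^esub> h u \<subseteq> U" using U unfolding lin_basisD(4)[OF T(2)] by blast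
      obtain K where K: "K \<in> \<B>" "h ` K \<subseteq> J" using c J by blast
      have Kc: "K \<subseteq> carrier P" using ideal_subset_carrier[OF lin_basisD(2)[OF P(2) K(1)]] .
      have "w \<in> carrier P \<and> h w \<in> U" if w: "w \<in> K +>\<^bsub>P\<^esub> u" for w
      proof -
        obtain j where j: "j \<in> K" "w = j \<oplus>\<^bsub>P\<^esub> u" using w by (auto simp: a_r_coset_def r_coset_def)
        then have "h w = h j \<oplus>\<^bsub>T\<^esub> h u" using Kc u by auto
        then have "h w \<in> J +>\<^bsub>T\<^esub> h u" using j K by (auto simp: a_r_coset_def r_coset_def)
        then show ?thesis using J j Kc u by auto
      qed
      then show "\<exists>K\<in>\<B>. K +>\<^bsub>P\<^esub> u \<subseteq> {x \<in> carrier P. h x \<in> U}" using K by blast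
    qed
  qed
qed

text \<open>Injectivity and surjectivity of the map to the limit over all open ideals, spelled out:
  an element in every open ideal is zero, and every compatible family of cosets has a common
  element. Maps into \<open>T\<close> are compared by the first property and constructed by the
  second.\<close>

definition complete_algebra :: "('k, 'x) ring_scheme \<Rightarrow> ('k, 'r) top_algebra \<Rightarrow> bool" where
  "complete_algebra k T \<longleftrightarrow> lin_top_algebra k T \<and>
     (\<forall>r\<in>carrier T. (\<forall>J\<in>open_ideals T. r \<in> J) \<longrightarrow> r = \<zero>\<^bsub>T\<^esub>) \<and>
     (\<forall>c\<in>lim_families T (open_ideals T). \<exists>t\<in>carrier T. \<forall>J\<in>open_ideals T. c J = J +>\<^bsub>T\<^esub> t)"

lemma carrier_quot: "carrier (P Quot J) = (\<lambda>p. J +>\<^bsub>P\<^esub> p) ` carrier P"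
  by (auto simp: FactRing_def A_RCOSETS_def')

lemma topspace_lim: "topspace (opens (lim_algebra P \<J>)) = lim_families P \<J>"
  by (auto simp: lim_algebra_def quot_algebra_def lim_families_def)

lemma formal_imp_complete:
  assumes "formal_algebra k P"
  shows "complete_algebra k P"
proof -
  have P: "lin_top_algebra k P" using assms unfolding formal_algebra_def by blast
  note D = lin_topD[OF P]
  interpret cring P by (rule D)
  have "homeomorphic_map (opens P) (opens (completion P)) (to_lim P (open_ideals P))"
    using assms unfolding formal_algebra_def is_lim_of_quotients_def by blast
  then have inj: "inj_on (to_lim P (open_ideals P)) (carrier P)"
    and surj: "to_lim P (open_ideals P) ` carrier P = lim_families P (open_ideals P)"
    using homeomorphic_imp_injective_map homeomorphic_imp_surjective_map D(3) topspace_lim by (metis, metis)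
  have "r = \<zero>\<^bsub>P\<^esub>" if r: "r \<in> carrier P" "\<forall>J\<in>open_ideals P. r \<in> J" for r
  proof -
    have "J +>\<^bsub>P\<^esub> r = J +>\<^bsub>P\<^esub> \<zero>\<^bsub>P\<^esub>" if "J \<in> open_ideals P" for J
      using coset_eq_iff[OF D(6)[OF that], of r "\<zero>\<^bsub>P\<^esub>"] r that by (simp add: a_minus_def)
    then have "to_lim P (open_ideals P) r = to_lim P (open_ideals P) \<zero>\<^bsub>P\<^esub>" unfolding to_lim_def by (rule restrict_ext)
    then show ?thesis using inj r by (auto dest: inj_onD)
  qed
  moreover have "\<exists>t\<in>carrier P. \<forall>J\<in>open_ideals P. c J = J +>\<^bsub>P\<^esub> t" if "c \<in> lim_families P (open_ideals P)" for c
  proof -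
    obtain t where "t \<in> carrier P" "c = to_lim P (open_ideals P) t" using surj \<open>c \<in> _\<close> by blast
    then show ?thesis by (auto simp: to_lim_def)
  qed
  ultimately show ?thesis unfolding complete_algebra_def using P by blast
qed

section \<open>The base ring as a discrete algebra\<close>

lemma base_algebra_sel [simp]:
  "carrier (base_algebra k) = carrier k" "monoid.mult (base_algebra k) = monoid.mult k"
  "\<one>\<^bsub>base_algebra k\<^esub> = \<one>\<^bsub>k\<^esub>" "\<zero>\<^bsub>base_algebra k\<^esub> = \<zero>\<^bsub>k\<^esub>" "ring.add (base_algebra k) = ring.add k"
  "smult (base_algebra k) = monoid.mult k" "opens (base_algebra k) = discrete_topology (carrier k)"
  by (simp_all add: base_algebra_def)

lemma base_algebra_cring: "cring k \<Longrightarrow> cring (base_algebra k)"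
  by (rule cring_cong) auto

text \<open>The zero ideal is open in a discrete ring, so a compatible family is determined by its
  component there. That every ideal is open later lets congruences modulo an arbitrary ideal of
  \<open>k\<close> be tested by density.\<close>

lemma base_algebra_complete:
  assumes "cring k" shows "complete_algebra k (base_algebra k)"
    "open_ideals (base_algebra k) = {J. ideal J (base_algebra k)}"
proof -
  interpret cring k by fact
  interpret B: cring "base_algebra k" using base_algebra_cring assms .
  have alg: "Module.algebra k (base_algebra k)"
    by (rule algebraI) (use assms B.is_cring in \<open>auto simp: l_distr r_distr m_assoc\<close>)
  show O: "open_ideals (base_algebra k) = {J. ideal J (base_algebra k)}"
    unfolding open_ideals_def using ideal_subset_carrier by fastforce
  have "lin_basis (base_algebra k) {{\<zero>\<^bsub>k\<^esub>}}"
    unfolding lin_basis_def using B.zeroideal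
    by (auto simp: a_r_coset_def r_coset_def subset_iff)
  then have lt: "lin_top_algebra k (base_algebra k)" using lin_basis_lin_top(1)[OF alg] by blast
  moreover have z: "{\<zero>\<^bsub>k\<^esub>} \<in> open_ideals (base_algebra k)" unfolding O using B.zeroideal by simp
  moreover have "\<exists>t\<in>carrier k. \<forall>J\<in>open_ideals (base_algebra k). c J = J +>\<^bsub>base_algebra k\<^esub> t"
    if c: "c \<in> lim_families (base_algebra k) (open_ideals (base_algebra k))" for c
  proof -
    have q: "c J \<in> carrier (base_algebra k Quot J)" if "J \<in> open_ideals (base_algebra k)" for J
      using c that by (auto simp: lim_families_def)
    then obtain t where t: "t \<in> carrier k" "c {\<zero>\<^bsub>k\<^esub>} = {\<zero>\<^bsub>k\<^esub>} +>\<^bsub>base_algebra k\<^esub> t"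
      using z unfolding carrier_quot by (metis (no_types, lifting) base_algebra_sel(1) imageE)
    then have t0: "t \<in> c {\<zero>\<^bsub>k\<^esub>}" by (auto simp: a_r_coset_def r_coset_def)
    have "c J = J +>\<^bsub>base_algebra k\<^esub> t" if J: "J \<in> open_ideals (base_algebra k)" for J
    proof -
      have Ji: "ideal J (base_algebra k)" using J O by simp
      interpret J: ideal J "base_algebra k" by fact
      have "{\<zero>\<^bsub>k\<^esub>} \<subseteq> J" using J.zero_closed by simp
      then have "c {\<zero>\<^bsub>k\<^esub>} \<subseteq> c J" using c z J by (auto simp: lim_families_def)
      then have "t \<in> c J" using t0 by blast
      moreover obtain s where s: "s \<in> carrier (base_algebra k)" "c J = J +>\<^bsub>base_algebra k\<^esub> s"
        using q[OF J] unfolding carrier_quot by auto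
      ultimately show ?thesis using J.a_repr_independence'[of t s] by simp
    qed
    then show ?thesis using t by blast
  qed
  ultimately show "complete_algebra k (base_algebra k)" unfolding complete_algebra_def by auto
qed

section \<open>Completions\<close>

lemma quot_algebra_sel [simp]:
  "carrier (quot_algebra P J) = carrier (P Quot J)" "monoid.mult (quot_algebra P J) = monoid.mult (P Quot J)"
  "\<one>\<^bsub>quot_algebra P J\<^esub> = \<one>\<^bsub>P Quot J\<^esub>" "\<zero>\<^bsub>quot_algebra P J\<^esub> = \<zero>\<^bsub>P Quot J\<^esub>"
  "ring.add (quot_algebra P J) = ring.add (P Quot J)"
  "opens (quot_algebra P J) = discrete_topology (carrier (P Quot J))"
  by (simp_all add: quot_algebra_def)

lemma quot_simps:
  assumes "ideal J P"
  shows "\<zero>\<^bsub>P Quot J\<^esub> = J" "\<one>\<^bsub>P Quot J\<^esub> = J +>\<^bsub>P\<^esub> \<one>\<^bsub>P\<^esub>"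
    "a \<in> carrier P \<Longrightarrow> b \<in> carrier P \<Longrightarrow> (J +>\<^bsub>P\<^esub> a) \<otimes>\<^bsub>P Quot J\<^esub> (J +>\<^bsub>P\<^esub> b) = J +>\<^bsub>P\<^esub> (a \<otimes>\<^bsub>P\<^esub> b)"
    "a \<in> carrier P \<Longrightarrow> b \<in> carrier P \<Longrightarrow> (J +>\<^bsub>P\<^esub> a) \<oplus>\<^bsub>P Quot J\<^esub> (J +>\<^bsub>P\<^esub> b) = J +>\<^bsub>P\<^esub> (a \<oplus>\<^bsub>P\<^esub> b)"
    "J +>\<^bsub>P\<^esub> \<zero>\<^bsub>P\<^esub> = J"
proof -
  interpret J: ideal J P by fact
  show "\<zero>\<^bsub>P Quot J\<^esub> = J" "\<one>\<^bsub>P Quot J\<^esub> = J +>\<^bsub>P\<^esub> \<one>\<^bsub>P\<^esub>" by (simp_all add: FactRing_def)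
  note h = J.rcos_ring_hom
  show "a \<in> carrier P \<Longrightarrow> b \<in> carrier P \<Longrightarrow> (J +>\<^bsub>P\<^esub> a) \<otimes>\<^bsub>P Quot J\<^esub> (J +>\<^bsub>P\<^esub> b) = J +>\<^bsub>P\<^esub> (a \<otimes>\<^bsub>P\<^esub> b)"
    using ring_hom_mult[OF h] by simp
  show "a \<in> carrier P \<Longrightarrow> b \<in> carrier P \<Longrightarrow> (J +>\<^bsub>P\<^esub> a) \<oplus>\<^bsub>P Quot J\<^esub> (J +>\<^bsub>P\<^esub> b) = J +>\<^bsub>P\<^esub> (a \<oplus>\<^bsub>P\<^esub> b)"
    using ring_hom_add[OF h] by simp
  show "J +>\<^bsub>P\<^esub> \<zero>\<^bsub>P\<^esub> = J" using J.a_subset by simp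
qed

lemma quot_algebra_cring:
  assumes "cring P" "ideal J P" shows "cring (quot_algebra P J)"
  by (rule cring_cong[OF ideal.quotient_is_cring[OF assms(2,1)]]) simp_all

text \<open>The scalar multiple of a coset is a union over its members. All terms of the union
  coincide, because c j = (c 1) j stays in the ideal when j lies in it.\<close>

lemma quot_algebra_smult:
  assumes "Module.algebra k P" "ideal J P" "c \<in> carrier k" "p \<in> carrier P"
  shows "c \<odot>\<^bsub>quot_algebra P J\<^esub> (J +>\<^bsub>P\<^esub> p) = J +>\<^bsub>P\<^esub> (c \<odot>\<^bsub>P\<^esub> p)"
proof -
  interpret M: cring P using assms(1) by (rule algebra.M_cring)
  interpret A: Module.algebra k P by fact
  interpret J: ideal J P by fact
  have "J +>\<^bsub>P\<^esub> (c \<odot>\<^bsub>P\<^esub> q) = J +>\<^bsub>P\<^esub> (c \<odot>\<^bsub>P\<^esub> p)" if q: "q \<in> J +>\<^bsub>P\<^esub> p" for q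
  proof -
    obtain j where j: "j \<in> J" "q = j \<oplus>\<^bsub>P\<^esub> p" using q by (auto simp: a_r_coset_def r_coset_def)
    have jc: "j \<in> carrier P" using j J.Icarr by blast
    have "c \<odot>\<^bsub>P\<^esub> j = (c \<odot>\<^bsub>P\<^esub> \<one>\<^bsub>P\<^esub>) \<otimes>\<^bsub>P\<^esub> j" using A.smult_assoc2[OF assms(3) M.one_closed jc] jc by simp
    then have "c \<odot>\<^bsub>P\<^esub> j \<in> J" using J.I_l_closed[OF j(1)] assms(3) by simp
    moreover have "c \<odot>\<^bsub>P\<^esub> q = c \<odot>\<^bsub>P\<^esub> j \<oplus>\<^bsub>P\<^esub> c \<odot>\<^bsub>P\<^esub> p" using j jc assms A.smult_r_distr by simp
    ultimately have "c \<odot>\<^bsub>P\<^esub> q \<in> J +>\<^bsub>P\<^esub> (c \<odot>\<^bsub>P\<^esub> p)" by (auto simp: a_r_coset_def r_coset_def)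
    then show ?thesis using J.a_repr_independence'[of "c \<odot>\<^bsub>P\<^esub> q" "c \<odot>\<^bsub>P\<^esub> p"] assms A.smult_closed by simp
  qed
  moreover have "p \<in> J +>\<^bsub>P\<^esub> p" using J.a_rcos_self assms by blast
  ultimately have "(\<Union>q\<in>J +>\<^bsub>P\<^esub> p. J +>\<^bsub>P\<^esub> (c \<odot>\<^bsub>P\<^esub> q)) = J +>\<^bsub>P\<^esub> (c \<odot>\<^bsub>P\<^esub> p)" by blast
  then show ?thesis unfolding quot_algebra_def by simp
qed

lemma quot_algebra_algebra:
  assumes alg: "Module.algebra k P" and J: "ideal J P"
  shows "Module.algebra k (quot_algebra P J)"
proof -
  interpret M: cring P using assms(1) by (rule algebra.M_cring)
  interpret A: Module.algebra k P by fact
  note s = quot_simps[OF J] quot_algebra_smult[OF assms]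
  show ?thesis
    by (rule algebraI)
      (auto simp: carrier_quot s A.R_cring quot_algebra_cring[OF M.is_cring J] A.smult_l_distr A.smult_r_distr
        A.smult_assoc1 A.smult_assoc2)
qed

text \<open>One element represents the family at \<open>J\<close> and therefore at every larger
  ideal, so locally a family can be handled as if it came from \<open>P\<close>.\<close>

lemma lim_familiesD:
  assumes P: "cring P" "\<And>J. J \<in> \<J> \<Longrightarrow> ideal J P" and c: "c \<in> lim_families P \<J>" and J: "J \<in> \<J>"
  shows "\<exists>p\<in>carrier P. \<forall>J'\<in>\<J>. J \<subseteq> J' \<longrightarrow> c J' = J' +>\<^bsub>P\<^esub> p"
proof -
  interpret cring P by fact
  have q: "c J \<in> (\<lambda>p. J +>\<^bsub>P\<^esub> p) ` carrier P" if "J \<in> \<J>" for J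
    using c that unfolding lim_families_def carrier_quot[symmetric] by auto
  obtain p where p: "p \<in> carrier P" "c J = J +>\<^bsub>P\<^esub> p" using q[OF J] by blast
  have "c J' = J' +>\<^bsub>P\<^esub> p" if J': "J' \<in> \<J>" "J \<subseteq> J'" for J'
  proof -
    interpret J: ideal J P using P(2)[OF J] .
    interpret J': ideal J' P using P(2)[OF J'(1)] .
    have "c J \<subseteq> c J'" using c J J' unfolding lim_families_def by blast
    then have "p \<in> c J'" using p J.a_rcos_self by blast
    moreover obtain q where q: "q \<in> carrier P" "c J' = J' +>\<^bsub>P\<^esub> q" using q[OF J'(1)] by blast
    ultimately show ?thesis using J'.a_repr_independence' by metis
  qed
  with p show ?thesis by blast
qed

lemma lim_familiesI:
  assumes "c \<in> extensional \<J>"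
    and "\<And>J. J \<in> \<J> \<Longrightarrow> \<exists>p\<in>carrier P. \<forall>J'\<in>\<J>. J \<subseteq> J' \<longrightarrow> c J' = J' +>\<^bsub>P\<^esub> p"
  shows "c \<in> lim_families P \<J>"
proof -
  have "c J \<in> carrier (P Quot J)" if "J \<in> \<J>" for J using assms(2)[OF that] that unfolding carrier_quot by blast
  moreover have "c J \<subseteq> c J'" if J: "J \<in> \<J>" "J' \<in> \<J>" "J \<subseteq> J'" for J J'
  proof -
    obtain p where "c J' = J' +>\<^bsub>P\<^esub> p" "c J = J +>\<^bsub>P\<^esub> p" using assms(2)[OF J(1)] J by blast
    then show ?thesis using J(3) by (auto simp: a_r_coset_def r_coset_def)
  qed
  ultimately show ?thesis using assms(1) unfolding lim_families_def by (auto simp: PiE_iff)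
qed

lemma lim_families_eqI:
  assumes "c \<in> lim_families P \<J>" "d \<in> lim_families P \<J>" "\<And>J. J \<in> \<J> \<Longrightarrow> c J = d J"
  shows "c = d"
  by (rule extensionalityI[of c \<J>]) (use assms in \<open>simp_all add: lim_families_def PiE_iff\<close>)

lemma lim_algebra_sel [simp]:
  "carrier (lim_algebra P \<J>) = lim_families P \<J>"
  "J \<in> \<J> \<Longrightarrow> (c \<otimes>\<^bsub>lim_algebra P \<J>\<^esub> d) J = c J \<otimes>\<^bsub>P Quot J\<^esub> d J"
  "J \<in> \<J> \<Longrightarrow> (c \<oplus>\<^bsub>lim_algebra P \<J>\<^esub> d) J = c J \<oplus>\<^bsub>P Quot J\<^esub> d J"
  "J \<in> \<J> \<Longrightarrow> (a \<odot>\<^bsub>lim_algebra P \<J>\<^esub> c) J = a \<odot>\<^bsub>quot_algebra P J\<^esub> c J"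
  "J \<in> \<J> \<Longrightarrow> \<one>\<^bsub>lim_algebra P \<J>\<^esub> J = \<one>\<^bsub>P Quot J\<^esub>"
  "J \<in> \<J> \<Longrightarrow> \<zero>\<^bsub>lim_algebra P \<J>\<^esub> J = \<zero>\<^bsub>P Quot J\<^esub>"
  by (simp_all add: lim_algebra_def)

lemma lim_algebra_ext:
  "c \<otimes>\<^bsub>lim_algebra P \<J>\<^esub> d \<in> extensional \<J>" "c \<oplus>\<^bsub>lim_algebra P \<J>\<^esub> d \<in> extensional \<J>"
  "a \<odot>\<^bsub>lim_algebra P \<J>\<^esub> c \<in> extensional \<J>" "\<one>\<^bsub>lim_algebra P \<J>\<^esub> \<in> extensional \<J>"
  "\<zero>\<^bsub>lim_algebra P \<J>\<^esub> \<in> extensional \<J>"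
  by (simp_all add: lim_algebra_def)

section \<open>The completion as a topological algebra\<close>

context
  fixes k :: "('k, 'x) ring_scheme" and P :: "('k, 'r) top_algebra"
  assumes P: "lin_top_algebra k P"
begin

interpretation cring P using lin_topD(2)[OF P] .
interpretation A: Module.algebra k P using lin_topD(1)[OF P] .

private abbreviation "\<J> \<equiv> open_ideals P"
private abbreviation "C \<equiv> lim_algebra P \<J>"

lemma open_ideal: "J \<in> \<J> \<Longrightarrow> ideal J P"
  using lin_topD(6)[OF P] .

lemmas lim_rep = lim_familiesD[OF is_cring open_ideal]

lemma lim_closed:
  shows "c \<in> lim_families P \<J> \<Longrightarrow> d \<in> lim_families P \<J> \<Longrightarrow> c \<otimes>\<^bsub>C\<^esub> d \<in> lim_families P \<J>"
    "c \<in> lim_families P \<J> \<Longrightarrow> d \<in> lim_families P \<J> \<Longrightarrow> c \<oplus>\<^bsub>C\<^esub> d \<in> lim_families P \<J>"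
    "c \<in> lim_families P \<J> \<Longrightarrow> a \<in> carrier k \<Longrightarrow> a \<odot>\<^bsub>C\<^esub> c \<in> lim_families P \<J>"
    "\<one>\<^bsub>C\<^esub> \<in> lim_families P \<J>" "\<zero>\<^bsub>C\<^esub> \<in> lim_families P \<J>"
proof -
  note s = quot_simps[OF open_ideal] quot_algebra_smult[OF A.algebra_axioms open_ideal]
  {
    fix c d assume c: "c \<in> lim_families P \<J>" and d: "d \<in> lim_families P \<J>"
    show "c \<otimes>\<^bsub>C\<^esub> d \<in> lim_families P \<J>"
    proof (rule lim_familiesI[OF lim_algebra_ext(1)])
      fix J assume J: "J \<in> \<J>"
      obtain p q where "p \<in> carrier P" "\<forall>J'\<in>\<J>. J \<subseteq> J' \<longrightarrow> c J' = J' +>\<^bsub>P\<^esub> p"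
        "q \<in> carrier P" "\<forall>J'\<in>\<J>. J \<subseteq> J' \<longrightarrow> d J' = J' +>\<^bsub>P\<^esub> q" using lim_rep[OF _ c J] lim_rep[OF _ d J] by blast
      then show "\<exists>p\<in>carrier P. \<forall>J'\<in>\<J>. J \<subseteq> J' \<longrightarrow> (c \<otimes>\<^bsub>C\<^esub> d) J' = J' +>\<^bsub>P\<^esub> p"
        by (intro bexI[of _ "p \<otimes>\<^bsub>P\<^esub> q"]) (auto simp: s)
    qed
    show "c \<oplus>\<^bsub>C\<^esub> d \<in> lim_families P \<J>"
    proof (rule lim_familiesI[OF lim_algebra_ext(2)])
      fix J assume J: "J \<in> \<J>"
      obtain p q where "p \<in> carrier P" "\<forall>J'\<in>\<J>. J \<subseteq> J' \<longrightarrow> c J' = J' +>\<^bsub>P\<^esub> p"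
        "q \<in> carrier P" "\<forall>J'\<in>\<J>. J \<subseteq> J' \<longrightarrow> d J' = J' +>\<^bsub>P\<^esub> q" using lim_rep[OF _ c J] lim_rep[OF _ d J] by blast
      then show "\<exists>p\<in>carrier P. \<forall>J'\<in>\<J>. J \<subseteq> J' \<longrightarrow> (c \<oplus>\<^bsub>C\<^esub> d) J' = J' +>\<^bsub>P\<^esub> p"
        by (intro bexI[of _ "p \<oplus>\<^bsub>P\<^esub> q"]) (auto simp: s)
    qed
    assume a: "a \<in> carrier k"
    show "a \<odot>\<^bsub>C\<^esub> c \<in> lim_families P \<J>"
    proof (rule lim_familiesI[OF lim_algebra_ext(3)])
      fix J assume J: "J \<in> \<J>"
      obtain p where "p \<in> carrier P" "\<forall>J'\<in>\<J>. J \<subseteq> J' \<longrightarrow> c J' = J' +>\<^bsub>P\<^esub> p" using lim_rep[OF _ c J] by blast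
      then show "\<exists>p\<in>carrier P. \<forall>J'\<in>\<J>. J \<subseteq> J' \<longrightarrow> (a \<odot>\<^bsub>C\<^esub> c) J' = J' +>\<^bsub>P\<^esub> p"
        using a by (intro bexI[of _ "a \<odot>\<^bsub>P\<^esub> p"]) (auto simp: s)
    qed
  }
  show "\<one>\<^bsub>C\<^esub> \<in> lim_families P \<J>"
    by (rule lim_familiesI[OF lim_algebra_ext(4)], rule bexI[of _ "\<one>\<^bsub>P\<^esub>"]) (auto simp: s)
  show "\<zero>\<^bsub>C\<^esub> \<in> lim_families P \<J>"
    by (rule lim_familiesI[OF lim_algebra_ext(5)], rule bexI[of _ "\<zero>\<^bsub>P\<^esub>"]) (auto simp: s)
qed

lemma lim_component:
  assumes "c \<in> lim_families P \<J>" "J \<in> \<J>"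
  shows "c J \<in> carrier (quot_algebra P J)"
  using assms unfolding lim_families_def by auto

text \<open>All axioms hold componentwise in the quotients \<open>P/J\<close>.\<close>

lemma completion_algebra: "Module.algebra k C"
proof -
  interpret K: cring k using A.R_cring .
  have alg: "Module.algebra k (quot_algebra P J)" if "J \<in> \<J>" for J
    using quot_algebra_algebra[OF A.algebra_axioms open_ideal[OF that]] .
  have cr: "cring (P Quot J)" if "J \<in> \<J>" for J
    using ideal.quotient_is_cring[OF open_ideal[OF that] is_cring] .
  note eqI = lim_families_eqI[where P = P and \<J> = \<J>]
  note Q = cring.cring_simprules(1,5,7,8,10-14,23-25)[OF cr] lim_component[unfolded quot_algebra_sel(1)]
  have md: "module k (quot_algebra P J)" if "J \<in> \<J>" for J using algebra.axioms(1)[OF alg[OF that]] .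
  note M = module.smult_l_distr[OF md] module.smult_r_distr[OF md] module.smult_assoc1[OF md] module.smult_one[OF md]
    algebra.smult_assoc2[OF alg]
  note M = M[unfolded quot_algebra_sel]
  \<comment> \<open>The negative of \<open>c\<close> is exhibited as (-1) c, whose membership in the
    limit is already known from closure under scalar multiples.\<close>
  have neg: "(\<ominus>\<^bsub>k\<^esub> \<one>\<^bsub>k\<^esub>) \<odot>\<^bsub>C\<^esub> c \<oplus>\<^bsub>C\<^esub> c = \<zero>\<^bsub>C\<^esub>" if c: "c \<in> carrier C" for c
  proof (rule eqI)
    fix J assume J: "J \<in> \<J>"
    interpret QA: Module.algebra k "quot_algebra P J" using alg[OF J] .
    have "c J \<in> carrier (quot_algebra P J)" using lim_component c J by simp
    then show "((\<ominus>\<^bsub>k\<^esub> \<one>\<^bsub>k\<^esub>) \<odot>\<^bsub>C\<^esub> c \<oplus>\<^bsub>C\<^esub> c) J = \<zero>\<^bsub>C\<^esub> J"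
      using QA.smult_l_minus[of "\<one>\<^bsub>k\<^esub>" "c J"] QA.l_neg[of "c J"] J by simp
  qed (use c lim_closed in auto)
  have ab: "abelian_group C"
    by (rule abelian_groupI) (auto simp: lim_closed Q intro!: eqI bexI[where P = "\<lambda>d. d \<oplus>\<^bsub>C\<^esub> _ = _", OF neg])
  have mon: "comm_monoid C"
    by (rule comm_monoidI) (auto simp: lim_closed Q intro!: eqI)
  have "cring C"
    by (rule cringI[OF ab mon]) (auto simp: lim_closed Q intro!: eqI)
  then show ?thesis
    by (intro algebraI A.R_cring) (auto simp: lim_closed Q M intro!: eqI)
qed

text \<open>The kernel of the projection to \<open>P/J\<close>. As a coset, the zero of
  \<open>P/J\<close> is \<open>J\<close> itself, whence the equation \<open>c J = J\<close>.\<close>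

definition lim_kernel :: "'r set \<Rightarrow> ('r set \<Rightarrow> 'r set) set" where
  "lim_kernel J = {c \<in> lim_families P \<J>. c J = J}"

lemma lim_minus:
  assumes "c \<in> lim_families P \<J>" "J \<in> \<J>"
  shows "(\<ominus>\<^bsub>C\<^esub> c) J = \<ominus>\<^bsub>quot_algebra P J\<^esub> c J"
proof -
  interpret C: cring C using completion_algebra by (rule algebra.M_cring)
  interpret Q: cring "quot_algebra P J" using quot_algebra_cring[OF is_cring open_ideal[OF assms(2)]] .
  have cm: "\<ominus>\<^bsub>C\<^esub> c \<in> lim_families P \<J>" using C.a_inv_closed[of c] assms by simp
  have "(\<ominus>\<^bsub>C\<^esub> c \<oplus>\<^bsub>C\<^esub> c) J = \<zero>\<^bsub>C\<^esub> J" using C.l_neg[of c] assms by simp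
  then have "(\<ominus>\<^bsub>C\<^esub> c) J \<oplus>\<^bsub>quot_algebra P J\<^esub> c J = \<zero>\<^bsub>quot_algebra P J\<^esub>" using assms by simp
  then show ?thesis
    using Q.minus_equality lim_component[OF assms] lim_component[OF cm assms(2)] by metis
qed

lemma lim_kernel_ideal:
  assumes J: "J \<in> \<J>" shows "ideal (lim_kernel J) C"
proof -
  interpret C: cring C using completion_algebra by (rule algebra.M_cring)
  interpret Q: cring "quot_algebra P J" using quot_algebra_cring[OF is_cring open_ideal[OF J]] .
  have z: "\<zero>\<^bsub>quot_algebra P J\<^esub> = J" using quot_simps(1)[OF open_ideal[OF J]] by simp
  have "(\<lambda>c. c J) \<in> ring_hom C (quot_algebra P J)"
    using lim_component J by (intro ring_hom_memI) auto
  then interpret h: ring_hom_ring C "quot_algebra P J" "\<lambda>c. c J"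
    using C.ring_axioms Q.ring_axioms by (simp add: ring_hom_ring_def ring_hom_ring_axioms_def)
  have "lim_kernel J = a_kernel C (quot_algebra P J) (\<lambda>c. c J)"
    unfolding a_kernel_def' lim_kernel_def by (simp only: z lim_algebra_sel(1))
  then show ?thesis using h.kernel_is_ideal by simp
qed

lemma lim_kernel_coset:
  assumes J: "J \<in> \<J>" and c: "c \<in> lim_families P \<J>"
  shows "lim_kernel J +>\<^bsub>C\<^esub> c = {d \<in> lim_families P \<J>. d J = c J}"
proof -
  interpret C: cring C using completion_algebra by (rule algebra.M_cring)
  interpret Q: cring "quot_algebra P J" using quot_algebra_cring[OF is_cring open_ideal[OF J]] .
  have z: "\<zero>\<^bsub>quot_algebra P J\<^esub> = J" using quot_simps(1)[OF open_ideal[OF J]] by simp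
  have "d \<ominus>\<^bsub>C\<^esub> c \<in> lim_kernel J \<longleftrightarrow> d J = c J" if d: "d \<in> lim_families P \<J>" for d
  proof -
    have "(d \<ominus>\<^bsub>C\<^esub> c) J = d J \<ominus>\<^bsub>quot_algebra P J\<^esub> c J"
      using lim_minus[OF c J] J by (simp add: a_minus_def)
    moreover have "d \<ominus>\<^bsub>C\<^esub> c \<in> lim_families P \<J>" using C.minus_closed[of d c] c d by simp
    ultimately show ?thesis unfolding lim_kernel_def
      using Q.r_right_minus_eq[OF lim_component[OF d J] lim_component[OF c J]] z by simp
  qed
  then show ?thesis using C.mem_coset_iff[OF lim_kernel_ideal[OF J]] c by auto
qed

text \<open>A basic open set of a product restricts only finitely many components; one open ideal
  below all of their indices controls it.\<close>

lemma finite_Inter_open_ideals: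
  "finite F \<Longrightarrow> F \<subseteq> \<J> \<Longrightarrow> \<exists>J\<in>\<J>. \<forall>J'\<in>F. J \<subseteq> J'"
proof (induction rule: finite_induct)
  case empty
  then show ?case using lin_topD(4)[OF P] by blast
next
  case (insert J0 F)
  then obtain J where "J \<in> \<J>" "\<forall>J'\<in>F. J \<subseteq> J'" by blast
  moreover from this have "J0 \<inter> J \<in> \<J>" using lin_topD(5)[OF P] insert by blast
  ultimately show ?case by (intro bexI[of _ "J0 \<inter> J"]) auto
qed

text \<open>Representatives of the two families at \<open>J\<close> differ by an element of
  \<open>J\<close>, hence of \<open>J'\<close>.\<close>

lemma lim_mono:
  assumes c: "c \<in> lim_families P \<J>" "d \<in> lim_families P \<J>" and J: "J \<in> \<J>" "J' \<in> \<J>" "J \<subseteq> J'" and eq: "c J = d J"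
  shows "c J' = d J'"
proof -
  obtain p where p: "p \<in> carrier P" "\<forall>J'\<in>\<J>. J \<subseteq> J' \<longrightarrow> c J' = J' +>\<^bsub>P\<^esub> p" using lim_rep[OF _ c(1) J(1)] by blast
  obtain q where q: "q \<in> carrier P" "\<forall>J'\<in>\<J>. J \<subseteq> J' \<longrightarrow> d J' = J' +>\<^bsub>P\<^esub> q" using lim_rep[OF _ c(2) J(1)] by blast
  have "J +>\<^bsub>P\<^esub> p = J +>\<^bsub>P\<^esub> q" using p q eq J by simp
  then have "p \<ominus>\<^bsub>P\<^esub> q \<in> J'" using coset_eq_iff[OF open_ideal[OF J(1)] p(1) q(1)] J by blast
  then have "J' +>\<^bsub>P\<^esub> p = J' +>\<^bsub>P\<^esub> q" using coset_eq_iff[OF open_ideal[OF J(2)] p(1) q(1)] by blast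
  then show ?thesis using p q J by simp
qed

text \<open>The component of a family at a small ideal determines its components at all larger ones.
  Hence a box, which restricts finitely many components, contains around each of its families all
  those that agree with it at one sufficiently small \<open>J\<close>: on the limit the product
  topology is a linear one.\<close>

lemma completion_basis: "lin_basis C (lim_kernel ` \<J>)"
  unfolding lin_basis_def
proof (intro conjI ballI allI)
  show "lim_kernel ` \<J> \<noteq> {}" using lin_topD(4)[OF P] by blast
  show "ideal K C" if "K \<in> lim_kernel ` \<J>" for K using that lim_kernel_ideal by blast
  show "\<exists>K''\<in>lim_kernel ` \<J>. K'' \<subseteq> K \<inter> K'" if K: "K \<in> lim_kernel ` \<J>" "K' \<in> lim_kernel ` \<J>" for K K'
  proof -
    obtain J J' where J: "J \<in> \<J>" "J' \<in> \<J>" "K = lim_kernel J" "K' = lim_kernel J'" using K by blast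
    have JJ: "J \<inter> J' \<in> \<J>" using lin_topD(5)[OF P J(1,2)] .
    have z: "\<zero>\<^bsub>C\<^esub> \<in> lim_families P \<J>" "\<And>J. J \<in> \<J> \<Longrightarrow> \<zero>\<^bsub>C\<^esub> J = J"
      using lim_closed(5) quot_simps(1)[OF open_ideal] by auto
    have "lim_kernel (J \<inter> J') \<subseteq> K \<inter> K'"
    proof
      fix c assume "c \<in> lim_kernel (J \<inter> J')"
      then have c: "c \<in> lim_families P \<J>" "c (J \<inter> J') = J \<inter> J'" unfolding lim_kernel_def by auto
      have "c J = J" "c J' = J'"
        using lim_mono[OF c(1) z(1) JJ J(1)] lim_mono[OF c(1) z(1) JJ J(2)] c z(2) J JJ by auto
      then show "c \<in> K \<inter> K'" using c J by (simp add: lim_kernel_def)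
    qed
    then show ?thesis using JJ by blast
  qed
  fix U
  define X where "X = product_topology (\<lambda>J. opens (quot_algebra P J)) \<J>"
  have opC: "opens C = subtopology X (lim_families P \<J>)" by (simp add: lim_algebra_def X_def)
  have tX: "topspace X = (\<Pi>\<^sub>E J\<in>\<J>. carrier (P Quot J))" by (simp add: X_def)
  show "openin (opens C) U \<longleftrightarrow> U \<subseteq> carrier C \<and> (\<forall>u\<in>U. \<exists>K\<in>lim_kernel ` \<J>. K +>\<^bsub>C\<^esub> u \<subseteq> U)"
  proof (intro iffI conjI ballI)
    assume "openin (opens C) U"
    then obtain W where W: "openin X W" "U = W \<inter> lim_families P \<J>" unfolding opC openin_subtopology by blast
    then show "U \<subseteq> carrier C" by simp
    fix u assume u: "u \<in> U"
    then have "u \<in> W" using W by simp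
    from bspec[OF iffD1[OF openin_product_topology_alt W(1)[unfolded X_def]] this]
    obtain V where V: "finite {i \<in> \<J>. V i \<noteq> topspace (opens (quot_algebra P i))}" "u \<in> PiE \<J> V" "PiE \<J> V \<subseteq> W"
      by (elim exE conjE)
    \<comment> \<open>\<open>J\<close> lies below every index at which the box is not the whole
      factor.\<close>
    obtain J where J: "J \<in> \<J>" "\<forall>J'\<in>{i \<in> \<J>. V i \<noteq> topspace (opens (quot_algebra P i))}. J \<subseteq> J'"
      using finite_Inter_open_ideals[OF V(1)] by blast
    have ul: "u \<in> lim_families P \<J>" using u W by blast
    have "d \<in> U" if d: "d \<in> lim_families P \<J>" "d J = u J" for d
    proof -
      have "d i \<in> V i" if i: "i \<in> \<J>" for i
      proof (cases "V i = topspace (opens (quot_algebra P i))")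
        case True
        then show ?thesis using lim_component[OF d(1) i] by simp
      next
        case False
        then have "d i = u i" using lim_mono[OF d(1) ul J(1) i _ d(2)] J i by blast
        then show ?thesis using V(2) i by auto
      qed
      then have "d \<in> PiE \<J> V" using d(1) by (auto simp: lim_families_def PiE_iff)
      then show ?thesis using V W d by blast
    qed
    then have "lim_kernel J +>\<^bsub>C\<^esub> u \<subseteq> U" unfolding lim_kernel_coset[OF J(1) ul] by blast
    then show "\<exists>K\<in>lim_kernel ` \<J>. K +>\<^bsub>C\<^esub> u \<subseteq> U" using J by blast
  next
    assume U: "U \<subseteq> carrier C \<and> (\<forall>u\<in>U. \<exists>K\<in>lim_kernel ` \<J>. K +>\<^bsub>C\<^esub> u \<subseteq> U)"
    show "openin (opens C) U"
    proof (subst openin_subopen, intro ballI)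
      fix u assume u: "u \<in> U"
      then obtain J where J: "J \<in> \<J>" "lim_kernel J +>\<^bsub>C\<^esub> u \<subseteq> U" using U by blast
      have ul: "u \<in> lim_families P \<J>" using u U by auto
      have "openin X {f \<in> topspace X. f J \<in> {u J}}"
      proof (rule openin_continuous_map_preimage)
        show "continuous_map X (opens (quot_algebra P J)) (\<lambda>f. f J)"
          unfolding X_def by (rule continuous_map_product_projection[OF J(1)])
        show "openin (opens (quot_algebra P J)) {u J}" using lim_component[OF ul J(1)] by simp
      qed
      then have "openin (opens C) ({f \<in> topspace X. f J \<in> {u J}} \<inter> lim_families P \<J>)"
        unfolding opC by (auto simp: openin_subtopology)
      moreover have "{f \<in> topspace X. f J \<in> {u J}} \<inter> lim_families P \<J> = lim_kernel J +>\<^bsub>C\<^esub> u"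
        unfolding lim_kernel_coset[OF J(1) ul] tX by (auto simp: lim_families_def)
      moreover have "u \<in> lim_kernel J +>\<^bsub>C\<^esub> u" unfolding lim_kernel_coset[OF J(1) ul] using ul by simp
      ultimately show "\<exists>T. openin (opens C) T \<and> u \<in> T \<and> T \<subseteq> U" using J(2) by metis
    qed
  qed
qed

lemma completion_lin_top: "lin_top_algebra k C"
  using lin_basis_lin_top(1)[OF completion_algebra completion_basis] .

lemma lim_kernel_open: "J \<in> \<J> \<Longrightarrow> lim_kernel J \<in> open_ideals C"
  using lin_basis_lin_top(2)[OF completion_algebra completion_basis] by blast

lemma lim_kernel_nhds: "K \<in> open_ideals C \<Longrightarrow> \<exists>J\<in>\<J>. lim_kernel J \<subseteq> K"
  using lin_basis_nhds[OF algebra.M_cring[OF completion_algebra] completion_basis] by blast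

lemma to_lim_closed: "p \<in> carrier P \<Longrightarrow> to_lim P \<J> p \<in> lim_families P \<J>"
  by (rule lim_familiesI) (auto simp: to_lim_def)

lemma to_lim_component [simp]: "J \<in> \<J> \<Longrightarrow> to_lim P \<J> p J = J +>\<^bsub>P\<^esub> p"
  by (simp add: to_lim_def)

lemma to_lim_hom: "to_lim P \<J> \<in> ring_hom P C"
proof (rule ring_hom_memI)
  note s = quot_simps[OF open_ideal]
  show "to_lim P \<J> p \<in> carrier C" if "p \<in> carrier P" for p using to_lim_closed that by simp
  fix p q assume pq: "p \<in> carrier P" "q \<in> carrier P"
  show "to_lim P \<J> (p \<otimes>\<^bsub>P\<^esub> q) = to_lim P \<J> p \<otimes>\<^bsub>C\<^esub> to_lim P \<J> q"
    by (rule lim_families_eqI[where P = P]) (use pq to_lim_closed lim_closed s in auto)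
  show "to_lim P \<J> (p \<oplus>\<^bsub>P\<^esub> q) = to_lim P \<J> p \<oplus>\<^bsub>C\<^esub> to_lim P \<J> q"
    by (rule lim_families_eqI[where P = P]) (use pq to_lim_closed lim_closed s in auto)
next
  show "to_lim P \<J> \<one>\<^bsub>P\<^esub> = \<one>\<^bsub>C\<^esub>"
    by (rule lim_families_eqI[where P = P]) (use to_lim_closed lim_closed quot_simps[OF open_ideal] in auto)
qed

lemma to_lim_smult:
  assumes "a \<in> carrier k" "p \<in> carrier P"
  shows "to_lim P \<J> (a \<odot>\<^bsub>P\<^esub> p) = a \<odot>\<^bsub>C\<^esub> to_lim P \<J> p"
  by (rule lim_families_eqI[where P = P])
    (use assms to_lim_closed lim_closed(3) quot_algebra_smult[OF A.algebra_axioms open_ideal] in auto)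

lemma lim_kernel_to_lim:
  assumes "p \<in> carrier P" "J \<in> \<J>"
  shows "to_lim P \<J> p \<in> lim_kernel J \<longleftrightarrow> p \<in> J"
proof -
  have "J +>\<^bsub>P\<^esub> p = J \<longleftrightarrow> p \<in> J"
    using coset_eq_iff[OF open_ideal[OF assms(2)] assms(1) zero_closed] quot_simps(5)[OF open_ideal[OF assms(2)]] assms(1)
    by (simp add: a_minus_def)
  then show ?thesis using assms to_lim_closed by (simp add: lim_kernel_def)
qed

text \<open>An open ideal contains the kernel of the projection to some \<open>P/J\<close>, and the
  component at \<open>J\<close> of any family comes from \<open>P\<close>.\<close>

lemma to_lim_dense:
  assumes c: "c \<in> carrier C" and K: "K \<in> open_ideals C"
  shows "\<exists>p\<in>carrier P. c \<ominus>\<^bsub>C\<^esub> to_lim P \<J> p \<in> K"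
proof -
  interpret C: cring C using completion_algebra by (rule algebra.M_cring)
  have c: "c \<in> lim_families P \<J>" using c by simp
  obtain J where J: "J \<in> \<J>" "lim_kernel J \<subseteq> K" using lim_kernel_nhds[OF K] by blast
  obtain p where p: "p \<in> carrier P" "c J = J +>\<^bsub>P\<^esub> p" using lim_rep[OF _ c J(1)] J(1) by blast
  have "c \<in> lim_kernel J +>\<^bsub>C\<^esub> to_lim P \<J> p"
    unfolding lim_kernel_coset[OF J(1) to_lim_closed[OF p(1)]] using c p J by simp
  then have "c \<ominus>\<^bsub>C\<^esub> to_lim P \<J> p \<in> lim_kernel J"
    using C.mem_coset_iff[OF lim_kernel_ideal[OF J(1)]] to_lim_closed[OF p(1)] by simp
  then show ?thesis using p J by blast
qed

text \<open>The kernels of the projections to the \<open>P/J\<close> are cofinal among the open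
  ideals of the completion. A compatible family of cosets therefore has well-defined components in
  the \<open>P/J\<close>, and these components form the required element.\<close>

lemma completion_complete: "complete_algebra k C"
  unfolding complete_algebra_def
proof (intro conjI ballI impI completion_lin_top)
  interpret C: cring C using completion_algebra by (rule algebra.M_cring)
  {
    fix c assume c: "c \<in> carrier C" "\<forall>K\<in>open_ideals C. c \<in> K"
    show "c = \<zero>\<^bsub>C\<^esub>"
    proof (rule lim_families_eqI[where P = P, OF _ lim_closed(5)])
      fix J assume J: "J \<in> \<J>"
      then have "c \<in> lim_kernel J" using c lim_kernel_open by blast
      then show "c J = \<zero>\<^bsub>C\<^esub> J" using J quot_simps(1)[OF open_ideal[OF J]] by (simp add: lim_kernel_def)
    qed (use c in simp)
  }
  fix f assume f: "f \<in> lim_families C (open_ideals C)"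
  note repC = lim_familiesD[OF C.is_cring lin_topD(6)[OF completion_lin_top] f]
  \<comment> \<open>All members of the coset \<open>f (lim_kernel J)\<close> have the same component
    at \<open>J\<close>; the description picks that value.\<close>
  define t where "t = (\<lambda>J\<in>\<J>. THE X. \<exists>c\<in>f (lim_kernel J). X = c J)"
  have t: "t J = c J" if J: "J \<in> \<J>" and c: "c \<in> carrier C" "f (lim_kernel J) = lim_kernel J +>\<^bsub>C\<^esub> c" for J c
  proof -
    have cl: "c \<in> lim_families P \<J>" using c by simp
    have "(THE X. \<exists>c\<in>f (lim_kernel J). X = c J) = c J"
      unfolding c(2) lim_kernel_coset[OF J cl] by (rule the_equality) (use cl in auto)
    then show ?thesis using J by (simp add: t_def)
  qed
  have "t \<in> lim_families P \<J>"
  proof (rule lim_familiesI)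
    fix J assume J: "J \<in> \<J>"
    obtain c where c: "c \<in> carrier C" "\<forall>K\<in>open_ideals C. lim_kernel J \<subseteq> K \<longrightarrow> f K = K +>\<^bsub>C\<^esub> c"
      using repC[OF _ lim_kernel_open[OF J]] by blast
    have cl: "c \<in> lim_families P \<J>" using c by simp
    obtain p where p: "p \<in> carrier P" "\<forall>J'\<in>\<J>. J \<subseteq> J' \<longrightarrow> c J' = J' +>\<^bsub>P\<^esub> p" using lim_rep[OF _ cl J] by blast
    have "t J' = c J'" if J': "J' \<in> \<J>" "J \<subseteq> J'" for J'
    proof (rule t[OF J'(1) c(1)])
      have "lim_kernel J \<subseteq> lim_kernel J'"
        using lim_mono[OF _ lim_closed(5) J J'] J J' quot_simps(1)[OF open_ideal]
        by (auto simp: lim_kernel_def)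
      then show "f (lim_kernel J') = lim_kernel J' +>\<^bsub>C\<^esub> c" using c lim_kernel_open[OF J'(1)] by blast
    qed
    then show "\<exists>p\<in>carrier P. \<forall>J'\<in>\<J>. J \<subseteq> J' \<longrightarrow> t J' = J' +>\<^bsub>P\<^esub> p" using p by auto
  qed (simp add: t_def)
  moreover have "f K = K +>\<^bsub>C\<^esub> t" if K: "K \<in> open_ideals C" for K
  proof -
    have Ki: "ideal K C" using lin_topD(6)[OF completion_lin_top K] .
    obtain J where J: "J \<in> \<J>" "lim_kernel J \<subseteq> K" using lim_kernel_nhds[OF K] by blast
    obtain c where c: "c \<in> carrier C" "\<forall>K\<in>open_ideals C. lim_kernel J \<subseteq> K \<longrightarrow> f K = K +>\<^bsub>C\<^esub> c"
      using repC[OF _ lim_kernel_open[OF J(1)]] by blast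
    have cl: "c \<in> lim_families P \<J>" using c by simp
    have "t J = c J" using t[OF J(1) c(1)] c(2) lim_kernel_open[OF J(1)] by blast
    then have "t \<in> lim_kernel J +>\<^bsub>C\<^esub> c"
      unfolding lim_kernel_coset[OF J(1) cl] using \<open>t \<in> lim_families P \<J>\<close> by simp
    then have "t \<ominus>\<^bsub>C\<^esub> c \<in> K" using C.mem_coset_iff[OF lim_kernel_ideal[OF J(1)] c(1)] J(2) by blast
    then have "K +>\<^bsub>C\<^esub> t = K +>\<^bsub>C\<^esub> c" using C.coset_eq_iff[OF Ki _ c(1), of t] \<open>t \<in> lim_families P \<J>\<close> by simp
    then show ?thesis using c K J by simp
  qed
  ultimately show "\<exists>t\<in>carrier C. \<forall>K\<in>open_ideals C. f K = K +>\<^bsub>C\<^esub> t" by auto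
qed

end

section \<open>Continuous homomorphisms and the universal property of the completion\<close>

lemma cont_alg_homsD:
  assumes h: "h \<in> cont_alg_homs k P T"
  shows "h \<in> ring_hom P T" "h \<in> extensional (carrier P)"
    "\<And>c p. c \<in> carrier k \<Longrightarrow> p \<in> carrier P \<Longrightarrow> h (c \<odot>\<^bsub>P\<^esub> p) = c \<odot>\<^bsub>T\<^esub> h p"
    "continuous_map (opens P) (opens T) h" "\<And>p. p \<in> carrier P \<Longrightarrow> h p \<in> carrier T"
  using h unfolding cont_alg_homs_def by (auto simp: ring_hom_def)

lemma cont_alg_homs_iff:
  assumes P: "lin_top_algebra k P" and T: "lin_top_algebra k T"
  shows "h \<in> cont_alg_homs k P T \<longleftrightarrow> h \<in> ring_hom P T \<and> h \<in> extensional (carrier P) \<and>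
    (\<forall>c\<in>carrier k. \<forall>p\<in>carrier P. h (c \<odot>\<^bsub>P\<^esub> p) = c \<odot>\<^bsub>T\<^esub> h p) \<and>
    (\<forall>J\<in>open_ideals T. \<exists>K\<in>open_ideals P. h ` K \<subseteq> J)"
  using ring_hom_continuous_iff[OF lin_topD(2)[OF P] lin_top_basis[OF P] lin_topD(2)[OF T] lin_top_basis[OF T] _
    lin_topD(3)[OF P] lin_topD(3)[OF T], of h]
  unfolding cont_alg_homs_def by auto

lemma cont_alg_homs_vimage:
  assumes P: "lin_top_algebra k P" and T: "lin_top_algebra k T" and h: "h \<in> cont_alg_homs k P T"
    and J: "J \<in> open_ideals T"
  shows "{p \<in> carrier P. h p \<in> J} \<in> open_ideals P"
proof -
  interpret P: cring P using lin_topD(2)[OF P] .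
  interpret T: cring T using lin_topD(2)[OF T] .
  interpret h: ring_hom_ring P T h
    using P.ring_axioms T.ring_axioms cont_alg_homsD(1)[OF h] by (simp add: ring_hom_ring_def ring_hom_ring_axioms_def)
  have "openin (opens P) {p \<in> topspace (opens P). h p \<in> J}"
    using openin_continuous_map_preimage[OF cont_alg_homsD(4)[OF h]] J unfolding open_ideals_def by blast
  then show ?thesis
    using h.ideal_vimage[of J] J lin_topD(3)[OF P] unfolding open_ideals_def by simp
qed

lemma cont_alg_homs_compose:
  assumes "lin_top_algebra k P" "lin_top_algebra k Q" "lin_top_algebra k T"
    and f: "f \<in> cont_alg_homs k P Q" and g: "g \<in> cont_alg_homs k Q T"
  shows "(\<lambda>p\<in>carrier P. g (f p)) \<in> cont_alg_homs k P T"
proof -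
  interpret P: cring P using lin_topD(2)[OF assms(1)] .
  interpret A: Module.algebra k P using lin_topD(1)[OF assms(1)] .
  note F = cont_alg_homsD[OF f] and G = cont_alg_homsD[OF g]
  show ?thesis unfolding cont_alg_homs_iff[OF assms(1,3)]
  proof (intro conjI ballI)
    have "g \<circ> f \<in> ring_hom P T" using ring_hom_trans[OF F(1) G(1)] .
    then show "(\<lambda>p\<in>carrier P. g (f p)) \<in> ring_hom P T" by (auto simp: ring_hom_def)
    fix J assume J: "J \<in> open_ideals T"
    let ?K = "{p \<in> carrier P. f p \<in> {q \<in> carrier Q. g q \<in> J}}"
    have "?K \<in> open_ideals P"
      using cont_alg_homs_vimage[OF assms(1,2) f cont_alg_homs_vimage[OF assms(2,3) g J]] .
    then show "\<exists>K\<in>open_ideals P. (\<lambda>p\<in>carrier P. g (f p)) ` K \<subseteq> J" by (rule bexI[rotated]) auto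
  qed (use F G in auto)
qed

lemma complete_hausdorff:
  assumes T: "complete_algebra k T" and "s \<in> carrier T" "t \<in> carrier T"
    and "\<And>J. J \<in> open_ideals T \<Longrightarrow> s \<ominus>\<^bsub>T\<^esub> t \<in> J"
  shows "s = t"
proof -
  have lt: "lin_top_algebra k T" using T unfolding complete_algebra_def by blast
  interpret T: cring T using lin_topD(2)[OF lt] .
  have "s \<ominus>\<^bsub>T\<^esub> t = \<zero>\<^bsub>T\<^esub>" using T assms(2-4) T.minus_closed[OF assms(2,3)] unfolding complete_algebra_def by blast
  then show ?thesis using T.r_right_minus_eq assms(2,3) by blast
qed

text \<open>The preimages of \<open>J\<close> under the finitely many maps intersect in an open
  ideal, and the image of \<open>P\<close> is dense. The same \<open>p\<close> works for all maps in
  \<open>H\<close>, so an identity that involves several maps can be checked on one element of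
  \<open>P\<close>.\<close>

lemma completion_approx:
  assumes P: "lin_top_algebra k P" and T: "lin_top_algebra k T"
    and H: "finite H" "H \<subseteq> cont_alg_homs k (completion P) T"
    and J: "J \<in> open_ideals T" and c: "c \<in> carrier (completion P)"
  shows "\<exists>p\<in>carrier P. \<forall>h\<in>H. h c \<ominus>\<^bsub>T\<^esub> h (to_lim P (open_ideals P) p) \<in> J"
proof -
  have C: "lin_top_algebra k (completion P)" using completion_lin_top[OF P] .
  interpret C: cring "completion P" using lin_topD(2)[OF C] .
  interpret T: cring T using lin_topD(2)[OF T] .
  let ?V = "\<lambda>h. {c \<in> carrier (completion P). h c \<in> J}"
  have "?V ` H \<subseteq> open_ideals (completion P)"
    by (rule image_subsetI, rule cont_alg_homs_vimage[OF C T _ J]) (use H in blast)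
  from finite_Inter_open_ideals[OF C finite_imageI[OF H(1)] this]
  obtain K where K: "K \<in> open_ideals (completion P)" "\<forall>V\<in>?V ` H. K \<subseteq> V" by (elim bexE)
  obtain p where p: "p \<in> carrier P" "c \<ominus>\<^bsub>completion P\<^esub> to_lim P (open_ideals P) p \<in> K"
    using to_lim_dense[OF P c K(1)] by blast
  have tl: "to_lim P (open_ideals P) p \<in> carrier (completion P)" using to_lim_closed[OF P p(1)] by simp
  have "h c \<ominus>\<^bsub>T\<^esub> h (to_lim P (open_ideals P) p) \<in> J" if h: "h \<in> H" for h
  proof -
    have hh: "h \<in> ring_hom (completion P) T" using H h cont_alg_homsD(1) by blast
    interpret h: ring_hom_cring "completion P" T h
      using hh C.is_cring T.is_cring by (simp add: ring_hom_cring_def ring_hom_cring_axioms_def)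
    have "h (c \<ominus>\<^bsub>completion P\<^esub> to_lim P (open_ideals P) p) \<in> J"
      using subsetD[OF bspec[OF K(2) imageI[OF h]] p(2)] by simp
    then show ?thesis using c tl by (simp add: a_minus_def del: lim_algebra_sel(1))
  qed
  with p show ?thesis by blast
qed

text \<open>Density of the image of \<open>P\<close>, together with the Hausdorff property of
  \<open>T\<close>.\<close>

lemma completion_hom_unique:
  assumes P: "lin_top_algebra k P" and T: "complete_algebra k T"
    and h: "h \<in> cont_alg_homs k (completion P) T" "h' \<in> cont_alg_homs k (completion P) T"
    and eq: "\<And>p. p \<in> carrier P \<Longrightarrow> h (to_lim P (open_ideals P) p) = h' (to_lim P (open_ideals P) p)"
  shows "h = h'"
proof (rule extensionalityI[OF cont_alg_homsD(2)[OF h(1)] cont_alg_homsD(2)[OF h(2)]])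
  have lt: "lin_top_algebra k T" using T unfolding complete_algebra_def by blast
  interpret T: cring T using lin_topD(2)[OF lt] .
  fix c assume c: "c \<in> carrier (completion P)"
  note hc = cont_alg_homsD(5)[OF h(1) c] cont_alg_homsD(5)[OF h(2) c]
  show "h c = h' c"
  proof (rule complete_hausdorff[OF T hc])
    fix J assume J: "J \<in> open_ideals T"
    interpret J: ideal J T using lin_topD(6)[OF lt J] .
    obtain p where p: "p \<in> carrier P" "\<forall>g\<in>{h, h'}. g c \<ominus>\<^bsub>T\<^esub> g (to_lim P (open_ideals P) p) \<in> J"
      using completion_approx[OF P lt _ _ J c, of "{h, h'}"] h by auto
    let ?t = "h (to_lim P (open_ideals P) p)"
    have t: "?t \<in> carrier T" using cont_alg_homsD(5)[OF h(1)] to_lim_closed[OF P p(1)] by simp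
    have "(h c \<ominus>\<^bsub>T\<^esub> ?t) \<ominus>\<^bsub>T\<^esub> (h' c \<ominus>\<^bsub>T\<^esub> ?t) \<in> J"
      using p eq[OF p(1)] J.a_closed J.a_inv_closed by (simp add: a_minus_def)
    moreover have "(h c \<ominus>\<^bsub>T\<^esub> ?t) \<ominus>\<^bsub>T\<^esub> (h' c \<ominus>\<^bsub>T\<^esub> ?t) = h c \<ominus>\<^bsub>T\<^esub> h' c" using hc t by algebra
    ultimately show "h c \<ominus>\<^bsub>T\<^esub> h' c \<in> J" by simp
  qed
qed

text \<open>\<open>h c\<close> is the limit in \<open>T\<close> of the values \<open>g p\<close>,
  where \<open>p\<close> represents \<open>c\<close> modulo the preimage of \<open>J\<close> and
  \<open>J\<close> runs over the open ideals of \<open>T\<close>. Completeness of \<open>T\<close>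
  provides the limit.\<close>

lemma completion_extend:
  assumes P: "lin_top_algebra k P" and T: "complete_algebra k T"
    and g: "g \<in> ring_hom P T" "\<And>c p. c \<in> carrier k \<Longrightarrow> p \<in> carrier P \<Longrightarrow> g (c \<odot>\<^bsub>P\<^esub> p) = c \<odot>\<^bsub>T\<^esub> g p"
      "\<And>J. J \<in> open_ideals T \<Longrightarrow> {p \<in> carrier P. g p \<in> J} \<in> open_ideals P"
  shows "\<exists>h\<in>cont_alg_homs k (completion P) T. \<forall>p\<in>carrier P. h (to_lim P (open_ideals P) p) = g p"
proof -
  have lt: "lin_top_algebra k T" using T unfolding complete_algebra_def by blast
  interpret T: cring T using lin_topD(2)[OF lt] .
  interpret TA: Module.algebra k T using lin_topD(1)[OF lt] .
  interpret P: cring P using lin_topD(2)[OF P] .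
  have C: "lin_top_algebra k (completion P)" using completion_lin_top[OF P] .
  interpret C: cring "completion P" using lin_topD(2)[OF C] .
  interpret CA: Module.algebra k "completion P" using lin_topD(1)[OF C] .
  interpret PA: Module.algebra k P using lin_topD(1)[OF P] .
  interpret g: ring_hom_cring P T g
    using g(1) P.is_cring T.is_cring by (simp add: ring_hom_cring_def ring_hom_cring_axioms_def)
  define V where "V = (\<lambda>J. {p \<in> carrier P. g p \<in> J})"
  have V: "V J \<in> open_ideals P" if "J \<in> open_ideals T" for J using g(3)[OF that] by (simp add: V_def)
  have Ti: "ideal J T" if "J \<in> open_ideals T" for J using lin_topD(6)[OF lt that] .
  have Pi: "ideal J P" if "J \<in> open_ideals P" for J using lin_topD(6)[OF P that] .
  have wd: "J +>\<^bsub>T\<^esub> g p = J +>\<^bsub>T\<^esub> g q"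
    if J: "J \<in> open_ideals T" and p: "p \<in> carrier P" "q \<in> carrier P" "V J +>\<^bsub>P\<^esub> p = V J +>\<^bsub>P\<^esub> q" for J p q
  proof -
    have "g (p \<ominus>\<^bsub>P\<^esub> q) \<in> J" using P.coset_eq_iff[OF Pi[OF V[OF J]] p(1,2)] p(3) by (simp add: V_def)
    then show ?thesis using T.coset_eq_iff[OF Ti[OF J]] p by (simp add: a_minus_def)
  qed
  \<comment> \<open>\<open>hp c t\<close> says that \<open>t\<close> is a value of the extension at
    \<open>c\<close>: modulo each \<open>J\<close> it is the common class of \<open>g p\<close> for
    all representatives \<open>p\<close>.\<close>
  define hp where "hp = (\<lambda>c t. t \<in> carrier T \<and> (\<forall>J\<in>open_ideals T. \<forall>p\<in>carrier P.
    c (V J) = V J +>\<^bsub>P\<^esub> p \<longrightarrow> J +>\<^bsub>T\<^esub> g p = J +>\<^bsub>T\<^esub> t))"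
  have rep: "\<exists>p\<in>carrier P. c (V J) = V J +>\<^bsub>P\<^esub> p" if c: "c \<in> lim_families P (open_ideals P)" and J: "J \<in> open_ideals T" for c J
    using lim_rep[OF P _ c V[OF J]] V[OF J] by blast
  have ex: "\<exists>t. hp c t" if c: "c \<in> lim_families P (open_ideals P)" for c
  proof -
    define d where "d = (\<lambda>J\<in>open_ideals T. J +>\<^bsub>T\<^esub> g (SOME p. p \<in> carrier P \<and> c (V J) = V J +>\<^bsub>P\<^esub> p))"
    have d: "d J = J +>\<^bsub>T\<^esub> g p" if J: "J \<in> open_ideals T" and p: "p \<in> carrier P" "c (V J) = V J +>\<^bsub>P\<^esub> p" for J p
    proof -
      define q where "q = (SOME p. p \<in> carrier P \<and> c (V J) = V J +>\<^bsub>P\<^esub> p)"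
      have q: "q \<in> carrier P \<and> c (V J) = V J +>\<^bsub>P\<^esub> q" unfolding q_def by (rule someI_ex) (use p in blast)
      have "J +>\<^bsub>T\<^esub> g q = J +>\<^bsub>T\<^esub> g p" by (rule wd[OF J _ p(1)]) (use p q in auto)
      then show ?thesis using J by (simp add: d_def q_def)
    qed
    have "d \<in> lim_families T (open_ideals T)"
    proof (rule lim_familiesI)
      fix J assume J: "J \<in> open_ideals T"
      obtain p where p: "p \<in> carrier P" "\<forall>J'\<in>open_ideals P. V J \<subseteq> J' \<longrightarrow> c J' = J' +>\<^bsub>P\<^esub> p"
        using lim_rep[OF P _ c V[OF J]] by blast
      have "d J' = J' +>\<^bsub>T\<^esub> g p" if J': "J' \<in> open_ideals T" "J \<subseteq> J'" for J'
      proof -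
        have "V J \<subseteq> V J'" using J' unfolding V_def by blast
        then show ?thesis using d[OF J'(1) p(1)] p(2) V[OF J'(1)] by simp
      qed
      then show "\<exists>p\<in>carrier T. \<forall>J'\<in>open_ideals T. J \<subseteq> J' \<longrightarrow> d J' = J' +>\<^bsub>T\<^esub> p"
        using p(1) by (intro bexI[of _ "g p"]) auto
    qed (simp add: d_def)
    then obtain t where t: "t \<in> carrier T" "\<forall>J\<in>open_ideals T. d J = J +>\<^bsub>T\<^esub> t"
      using T unfolding complete_algebra_def by blast
    then have "hp c t" unfolding hp_def using d by simp
    then show ?thesis by (rule exI)
  qed
  \<comment> \<open>To identify a value of the extension it is enough to have one suitable
    representative for each \<open>J\<close>. Every algebraic law for \<open>h\<close> is checked in
    this way.\<close>
  have uniq: "s = t" if s: "hp c s" and t: "t \<in> carrier T" and c: "c \<in> lim_families P (open_ideals P)"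
    and eq: "\<And>J. J \<in> open_ideals T \<Longrightarrow> \<exists>p\<in>carrier P. c (V J) = V J +>\<^bsub>P\<^esub> p \<and> J +>\<^bsub>T\<^esub> g p = J +>\<^bsub>T\<^esub> t" for c s t
  proof (rule complete_hausdorff[OF T])
    show sc: "s \<in> carrier T" using s unfolding hp_def by blast
    fix J assume J: "J \<in> open_ideals T"
    obtain p where "p \<in> carrier P" "c (V J) = V J +>\<^bsub>P\<^esub> p" "J +>\<^bsub>T\<^esub> g p = J +>\<^bsub>T\<^esub> t" using eq[OF J] by blast
    then have "J +>\<^bsub>T\<^esub> s = J +>\<^bsub>T\<^esub> t" using s J unfolding hp_def by simp
    then show "s \<ominus>\<^bsub>T\<^esub> t \<in> J" using T.coset_eq_iff[OF Ti[OF J] sc t] by simp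
  qed (rule t)
  define h where "h = (\<lambda>c\<in>lim_families P (open_ideals P). SOME t. hp c t)"
  have h: "hp c (h c)" if "c \<in> lim_families P (open_ideals P)" for c
    using someI_ex[OF ex[OF that]] that by (simp add: h_def)
  have hc: "h c \<in> carrier T" if "c \<in> lim_families P (open_ideals P)" for c using h[OF that] unfolding hp_def by blast
  have hJ: "J +>\<^bsub>T\<^esub> g p = J +>\<^bsub>T\<^esub> h c"
    if "c \<in> lim_families P (open_ideals P)" "J \<in> open_ideals T" "p \<in> carrier P" "c (V J) = V J +>\<^bsub>P\<^esub> p" for c J p
    using h[OF that(1)] that(2-) unfolding hp_def by simp
  note cl = lim_closed[OF P]
  have "h \<in> ring_hom (completion P) T"
  proof (rule ring_hom_memI)
    show "h c \<in> carrier T" if "c \<in> carrier (completion P)" for c using hc that by simp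
    fix c d assume "c \<in> carrier (completion P)" "d \<in> carrier (completion P)"
    then have cd: "c \<in> lim_families P (open_ideals P)" "d \<in> lim_families P (open_ideals P)" by auto
    show "h (c \<otimes>\<^bsub>completion P\<^esub> d) = h c \<otimes>\<^bsub>T\<^esub> h d"
    proof (rule uniq[OF h[OF cl(1)[OF cd]] _ cl(1)[OF cd]])
      fix J assume J: "J \<in> open_ideals T"
      obtain p where p: "p \<in> carrier P" "c (V J) = V J +>\<^bsub>P\<^esub> p" using rep[OF cd(1) J] by blast
      obtain q where q: "q \<in> carrier P" "d (V J) = V J +>\<^bsub>P\<^esub> q" using rep[OF cd(2) J] by blast
      have "J +>\<^bsub>T\<^esub> g (p \<otimes>\<^bsub>P\<^esub> q) = J +>\<^bsub>T\<^esub> (h c \<otimes>\<^bsub>T\<^esub> h d)"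
        using hJ[OF cd(1) J p] hJ[OF cd(2) J q] p q hc cd quot_simps(3)[OF Ti[OF J], symmetric] by simp
      moreover have "(c \<otimes>\<^bsub>completion P\<^esub> d) (V J) = V J +>\<^bsub>P\<^esub> (p \<otimes>\<^bsub>P\<^esub> q)"
        using p q V[OF J] quot_simps(3)[OF Pi[OF V[OF J]]] by simp
      ultimately show "\<exists>p\<in>carrier P. (c \<otimes>\<^bsub>completion P\<^esub> d) (V J) = V J +>\<^bsub>P\<^esub> p \<and>
          J +>\<^bsub>T\<^esub> g p = J +>\<^bsub>T\<^esub> (h c \<otimes>\<^bsub>T\<^esub> h d)" using p q by blast
    qed (use hc cd in simp)
    show "h (c \<oplus>\<^bsub>completion P\<^esub> d) = h c \<oplus>\<^bsub>T\<^esub> h d"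
    proof (rule uniq[OF h[OF cl(2)[OF cd]] _ cl(2)[OF cd]])
      fix J assume J: "J \<in> open_ideals T"
      obtain p where p: "p \<in> carrier P" "c (V J) = V J +>\<^bsub>P\<^esub> p" using rep[OF cd(1) J] by blast
      obtain q where q: "q \<in> carrier P" "d (V J) = V J +>\<^bsub>P\<^esub> q" using rep[OF cd(2) J] by blast
      have "J +>\<^bsub>T\<^esub> g (p \<oplus>\<^bsub>P\<^esub> q) = J +>\<^bsub>T\<^esub> (h c \<oplus>\<^bsub>T\<^esub> h d)"
        using hJ[OF cd(1) J p] hJ[OF cd(2) J q] p q hc cd quot_simps(4)[OF Ti[OF J], symmetric] by simp
      moreover have "(c \<oplus>\<^bsub>completion P\<^esub> d) (V J) = V J +>\<^bsub>P\<^esub> (p \<oplus>\<^bsub>P\<^esub> q)"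
        using p q V[OF J] quot_simps(4)[OF Pi[OF V[OF J]]] by simp
      ultimately show "\<exists>p\<in>carrier P. (c \<oplus>\<^bsub>completion P\<^esub> d) (V J) = V J +>\<^bsub>P\<^esub> p \<and>
          J +>\<^bsub>T\<^esub> g p = J +>\<^bsub>T\<^esub> (h c \<oplus>\<^bsub>T\<^esub> h d)" using p q by blast
    qed (use hc cd in simp)
  next
    show "h \<one>\<^bsub>completion P\<^esub> = \<one>\<^bsub>T\<^esub>"
    proof (rule uniq[OF h[OF cl(4)] T.one_closed cl(4)])
      fix J assume J: "J \<in> open_ideals T"
      show "\<exists>p\<in>carrier P. \<one>\<^bsub>completion P\<^esub> (V J) = V J +>\<^bsub>P\<^esub> p \<and> J +>\<^bsub>T\<^esub> g p = J +>\<^bsub>T\<^esub> \<one>\<^bsub>T\<^esub>"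
        using V[OF J] quot_simps(2)[OF Pi[OF V[OF J]]] by (intro bexI[of _ "\<one>\<^bsub>P\<^esub>"]) auto
    qed
  qed
  moreover have "h (a \<odot>\<^bsub>completion P\<^esub> c) = a \<odot>\<^bsub>T\<^esub> h c" if a: "a \<in> carrier k" and "c \<in> carrier (completion P)" for a c
  proof -
    have c: "c \<in> lim_families P (open_ideals P)" using that by simp
    show ?thesis
    proof (rule uniq[OF h[OF cl(3)[OF c a]] _ cl(3)[OF c a]])
      fix J assume J: "J \<in> open_ideals T"
      obtain p where p: "p \<in> carrier P" "c (V J) = V J +>\<^bsub>P\<^esub> p" using rep[OF c J] by blast
      have "J +>\<^bsub>T\<^esub> g (a \<odot>\<^bsub>P\<^esub> p) = J +>\<^bsub>T\<^esub> (a \<odot>\<^bsub>T\<^esub> h c)"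
        using hJ[OF c J p] p hc[OF c] a g(2) quot_algebra_smult[OF TA.algebra_axioms Ti[OF J], symmetric] by simp
      moreover have "(a \<odot>\<^bsub>completion P\<^esub> c) (V J) = V J +>\<^bsub>P\<^esub> (a \<odot>\<^bsub>P\<^esub> p)"
        using p V[OF J] quot_algebra_smult[OF PA.algebra_axioms Pi[OF V[OF J]]] a by simp
      ultimately show "\<exists>p\<in>carrier P. (a \<odot>\<^bsub>completion P\<^esub> c) (V J) = V J +>\<^bsub>P\<^esub> p \<and>
          J +>\<^bsub>T\<^esub> g p = J +>\<^bsub>T\<^esub> (a \<odot>\<^bsub>T\<^esub> h c)" using p a PA.smult_closed by blast
    qed (use hc[OF c] a in simp)
  qed
  \<comment> \<open>The kernel of the projection to the quotient of \<open>P\<close> by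
    \<open>V J\<close> is open and is sent into \<open>J\<close>.\<close>
  moreover have "\<exists>K\<in>open_ideals (completion P). h ` K \<subseteq> J" if J: "J \<in> open_ideals T" for J
  proof (intro bexI[OF _ lim_kernel_open[OF P V[OF J]]] image_subsetI)
    fix c assume "c \<in> lim_kernel P (V J)"
    then have c: "c \<in> lim_families P (open_ideals P)" "c (V J) = V J" by (auto simp: lim_kernel_def[OF P])
    have "c (V J) = V J +>\<^bsub>P\<^esub> \<zero>\<^bsub>P\<^esub>" using c quot_simps(5)[OF Pi[OF V[OF J]]] by simp
    then have "J +>\<^bsub>T\<^esub> g \<zero>\<^bsub>P\<^esub> = J +>\<^bsub>T\<^esub> h c" by (rule hJ[OF c(1) J P.zero_closed])
    then have "J +>\<^bsub>T\<^esub> h c = J +>\<^bsub>T\<^esub> \<zero>\<^bsub>T\<^esub>" by simp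
    then show "h c \<in> J" using T.coset_eq_iff[OF Ti[OF J] hc[OF c(1)] T.zero_closed] hc[OF c(1)] by (simp add: a_minus_def)
  qed
  ultimately have "h \<in> cont_alg_homs k (completion P) T"
    unfolding cont_alg_homs_iff[OF C lt] by (simp add: h_def)
  moreover have "h (to_lim P (open_ideals P) p) = g p" if p: "p \<in> carrier P" for p
  proof (rule uniq[OF h[OF to_lim_closed[OF P p]] _ to_lim_closed[OF P p]])
    fix J assume J: "J \<in> open_ideals T"
    show "\<exists>q\<in>carrier P. to_lim P (open_ideals P) p (V J) = V J +>\<^bsub>P\<^esub> q \<and> J +>\<^bsub>T\<^esub> g q = J +>\<^bsub>T\<^esub> g p"
      using V[OF J] p by (intro bexI[of _ p]) (auto simp: to_lim_component[OF P])
  qed (use p in simp)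
  ultimately show ?thesis by blast
qed

section \<open>Completed tensor products\<close>

text \<open>In a commutative ring negatives are multiples by -1, so being an ideal is a condition on
  the carrier, zero and the two operations only.\<close>

lemma (in cring) ideal_iff:
  "ideal K R \<longleftrightarrow> K \<subseteq> carrier R \<and> \<zero> \<in> K \<and> (\<forall>a\<in>K. \<forall>b\<in>K. a \<oplus> b \<in> K) \<and> (\<forall>a\<in>K. \<forall>r\<in>carrier R. r \<otimes> a \<in> K)"
proof (intro iffI)
  assume "ideal K R"
  then interpret K: ideal K R .
  show "K \<subseteq> carrier R \<and> \<zero> \<in> K \<and> (\<forall>a\<in>K. \<forall>b\<in>K. a \<oplus> b \<in> K) \<and> (\<forall>a\<in>K. \<forall>r\<in>carrier R. r \<otimes> a \<in> K)"
    using K.a_subset K.I_l_closed by auto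
next
  assume K: "K \<subseteq> carrier R \<and> \<zero> \<in> K \<and> (\<forall>a\<in>K. \<forall>b\<in>K. a \<oplus> b \<in> K) \<and> (\<forall>a\<in>K. \<forall>r\<in>carrier R. r \<otimes> a \<in> K)"
  have neg: "\<ominus> a \<in> K" if "a \<in> K" for a
  proof -
    have "\<ominus> a = \<ominus> \<one> \<otimes> a" using that K by (simp add: l_minus subset_iff)
    then show ?thesis using that K by simp
  qed
  show "ideal K R"
  proof (rule idealI[OF ring_axioms])
    show "subgroup K (add_monoid R)"
      by (rule add.subgroupI) (use K neg in \<open>auto simp: a_inv_def\<close>)
  qed (use K m_comm in \<open>auto simp: subset_iff\<close>)
qed

lemma ideal_cong:
  assumes "cring A" "cring B" "carrier A = carrier B" "ring.add A = ring.add B" "monoid.mult A = monoid.mult B"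
    "\<zero>\<^bsub>A\<^esub> = \<zero>\<^bsub>B\<^esub>"
  shows "ideal K A \<longleftrightarrow> ideal K B"
  using assms by (simp add: cring.ideal_iff)

section \<open>The monoid ring of pairs\<close>

definition pair_mult ::
  "('k, 'p) top_algebra \<Rightarrow> ('k, 'q) top_algebra \<Rightarrow> (('p \<times> 'q) \<Rightarrow>\<^sub>0 int) \<Rightarrow> (('p \<times> 'q) \<Rightarrow>\<^sub>0 int) \<Rightarrow>
   (('p \<times> 'q) \<Rightarrow>\<^sub>0 int)" where
  "pair_mult P Q u v = frag_extend (\<lambda>(p, q).
     frag_extend (\<lambda>(p', q'). frag_of (p \<otimes>\<^bsub>P\<^esub> p', q \<otimes>\<^bsub>Q\<^esub> q')) v) u"

lemma pair_monoid_ring_sel [simp]: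
  "carrier (pair_monoid_ring P Q) = {u. Poly_Mapping.keys u \<subseteq> carrier P \<times> carrier Q}"
  "u \<otimes>\<^bsub>pair_monoid_ring P Q\<^esub> v = pair_mult P Q u v"
  "\<one>\<^bsub>pair_monoid_ring P Q\<^esub> = frag_of (\<one>\<^bsub>P\<^esub>, \<one>\<^bsub>Q\<^esub>)"
  "\<zero>\<^bsub>pair_monoid_ring P Q\<^esub> = 0" "u \<oplus>\<^bsub>pair_monoid_ring P Q\<^esub> v = u + v"
  by (auto simp: pair_monoid_ring_def pair_mult_def)

lemma pair_mult_of:
  "pair_mult P Q (frag_of (p, q)) (frag_of (p', q')) = frag_of (p \<otimes>\<^bsub>P\<^esub> p', q \<otimes>\<^bsub>Q\<^esub> q')"
  by (simp add: pair_mult_def)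

lemma pair_mult_zero [simp]: "pair_mult P Q 0 v = 0" "pair_mult P Q u 0 = 0"
proof -
  show "pair_mult P Q 0 v = 0" by (simp add: pair_mult_def)
  show "pair_mult P Q u 0 = 0" unfolding pair_mult_def by (rule frag_extend_eq_0) auto
qed

lemma pair_mult_diff_left: "pair_mult P Q (u - u') v = pair_mult P Q u v - pair_mult P Q u' v"
  by (simp add: pair_mult_def frag_extend_diff)

lemma frag_extend_diff_fun: "frag_extend (\<lambda>x. f x - g x) u = frag_extend f u - frag_extend g u"
proof (rule frag_induction[of u UNIV])
  fix a b
  assume "frag_extend (\<lambda>x. f x - g x) a = frag_extend f a - frag_extend g a"
    "frag_extend (\<lambda>x. f x - g x) b = frag_extend f b - frag_extend g b"
  then show "frag_extend (\<lambda>x. f x - g x) (a - b) = frag_extend f (a - b) - frag_extend g (a - b)"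
    unfolding frag_extend_diff by simp
qed simp_all

lemma pair_mult_diff_right: "pair_mult P Q u (v - v') = pair_mult P Q u v - pair_mult P Q u v'"
proof -
  have "pair_mult P Q u (v - v') = frag_extend (\<lambda>x.
      (case x of (p, q) \<Rightarrow> frag_extend (\<lambda>(p', q'). frag_of (p \<otimes>\<^bsub>P\<^esub> p', q \<otimes>\<^bsub>Q\<^esub> q')) v) -
      (case x of (p, q) \<Rightarrow> frag_extend (\<lambda>(p', q'). frag_of (p \<otimes>\<^bsub>P\<^esub> p', q \<otimes>\<^bsub>Q\<^esub> q')) v')) u"
    unfolding pair_mult_def by (rule frag_extend_eq) (auto simp: frag_extend_diff)
  then show ?thesis unfolding frag_extend_diff_fun pair_mult_def by simp
qed

lemma keys_diff_subset:
  "Poly_Mapping.keys u \<subseteq> S \<Longrightarrow> Poly_Mapping.keys v \<subseteq> S \<Longrightarrow> Poly_Mapping.keys (u - v :: 'a \<Rightarrow>\<^sub>0 int) \<subseteq> S"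
  using keys_diff[of u v] by blast

lemmas free_induct = free_Abelian_group_induct [consumes 1, case_names zero diff one]

lemma keys_pair_mult:
  assumes "cring P" "cring Q" and u: "Poly_Mapping.keys u \<subseteq> carrier P \<times> carrier Q"
    and v: "Poly_Mapping.keys v \<subseteq> carrier P \<times> carrier Q"
  shows "Poly_Mapping.keys (pair_mult P Q u v) \<subseteq> carrier P \<times> carrier Q"
proof -
  interpret P: cring P by fact
  interpret Q: cring Q by fact
  show ?thesis using u
  proof (induction u rule: free_induct)
    case (one a)
    obtain p q where a: "a = (p, q)" by force
    show ?case using v
      by (induction v rule: free_induct)
        (use one a in \<open>auto simp: pair_mult_diff_right pair_mult_of keys_diff_subset\<close>)
  qed (auto simp: pair_mult_diff_left keys_diff_subset)
qed

text \<open>Both sides of each law are additive in every argument, so it is enough to treat pairs,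
  where the laws hold in \<open>P\<close> and in \<open>Q\<close>. Additivity is used in the form of
  differences because the induction for free abelian groups is.\<close>

lemma pair_monoid_ring_cring:
  assumes "cring P" "cring Q"
  shows "cring (pair_monoid_ring P Q)"
proof -
  interpret P: cring P by fact
  interpret Q: cring Q by fact
  let ?S = "carrier P \<times> carrier Q"
  have comm: "pair_mult P Q u v = pair_mult P Q v u"
    if u: "Poly_Mapping.keys u \<subseteq> ?S" and v: "Poly_Mapping.keys v \<subseteq> ?S" for u v
    using u
  proof (induction u rule: free_induct)
    case (one a)
    obtain p q where a: "a = (p, q)" by force
    show ?case using v
    proof (induction v rule: free_induct)
      case (one b)
      then show ?case using \<open>a \<in> ?S\<close> a by (cases b) (simp add: pair_mult_of P.m_comm Q.m_comm)
    qed (simp_all add: pair_mult_diff_left pair_mult_diff_right)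
  qed (simp_all add: pair_mult_diff_left pair_mult_diff_right)
  have assoc: "pair_mult P Q (pair_mult P Q u v) w = pair_mult P Q u (pair_mult P Q v w)"
    if u: "Poly_Mapping.keys u \<subseteq> ?S" and v: "Poly_Mapping.keys v \<subseteq> ?S" and w: "Poly_Mapping.keys w \<subseteq> ?S" for u v w
    using u
  proof (induction u rule: free_induct)
    case (one a)
    then obtain p q where a: "a = (p, q)" "p \<in> carrier P" "q \<in> carrier Q" by force
    show ?case using v
    proof (induction v rule: free_induct)
      case (one b)
      then obtain p' q' where b: "b = (p', q')" "p' \<in> carrier P" "q' \<in> carrier Q" by force
      show ?case using w
      proof (induction w rule: free_induct)
        case (one c)
        then show ?case using a b by (cases c) (simp add: pair_mult_of P.m_assoc Q.m_assoc)
      qed (simp_all add: pair_mult_diff_right)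
    qed (simp_all add: pair_mult_diff_left pair_mult_diff_right)
  qed (simp_all add: pair_mult_diff_left)
  have one: "pair_mult P Q (frag_of (\<one>\<^bsub>P\<^esub>, \<one>\<^bsub>Q\<^esub>)) u = u" if "Poly_Mapping.keys u \<subseteq> ?S" for u
    using that
  proof (induction u rule: free_induct)
    case (one c)
    then show ?case by (cases c) (simp add: pair_mult_of)
  qed (simp_all add: pair_mult_diff_right)
  have distr: "pair_mult P Q (u + v) w = pair_mult P Q u w + pair_mult P Q v w" for u v w
    using pair_mult_diff_left[of P Q u "0 - v" w] pair_mult_diff_left[of P Q 0 v w] by simp
  show ?thesis
  proof (rule cringI)
    show "abelian_group (pair_monoid_ring P Q)"
    proof (rule abelian_groupI)
      fix u v assume uv: "u \<in> carrier (pair_monoid_ring P Q)" "v \<in> carrier (pair_monoid_ring P Q)"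
      then show "u \<oplus>\<^bsub>pair_monoid_ring P Q\<^esub> v \<in> carrier (pair_monoid_ring P Q)"
        using keys_add[of u v] by auto
    next
      fix u assume "u \<in> carrier (pair_monoid_ring P Q)"
      then show "\<exists>v\<in>carrier (pair_monoid_ring P Q). v \<oplus>\<^bsub>pair_monoid_ring P Q\<^esub> u = \<zero>\<^bsub>pair_monoid_ring P Q\<^esub>"
        by (intro bexI[of _ "- u"]) auto
    qed (simp_all add: ac_simps)
    show "comm_monoid (pair_monoid_ring P Q)"
      by (rule comm_monoidI) (use keys_pair_mult[OF assms] comm assoc one in simp_all)
  qed (simp add: distr)
qed

lemma pair_monoid_ring_minus:
  assumes "cring P" "cring Q" "u \<in> carrier (pair_monoid_ring P Q)" "v \<in> carrier (pair_monoid_ring P Q)"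
  shows "u \<ominus>\<^bsub>pair_monoid_ring P Q\<^esub> v = u - v"
proof -
  interpret Z: cring "pair_monoid_ring P Q" using pair_monoid_ring_cring[OF assms(1,2)] .
  have "\<ominus>\<^bsub>pair_monoid_ring P Q\<^esub> v = - v"
    by (rule Z.minus_equality) (use assms in simp_all)
  then show ?thesis by (simp add: a_minus_def)
qed

section \<open>The algebraic tensor product and its topology\<close>

context
  fixes k :: "('k, 'x) ring_scheme" and P :: "('k, 'p) top_algebra" and Q :: "('k, 'q) top_algebra"
  assumes P: "lin_top_algebra k P" and Q: "lin_top_algebra k Q"
begin

interpretation P: cring P using lin_topD(2)[OF P] .
interpretation Q: cring Q using lin_topD(2)[OF Q] .
interpretation PA: Module.algebra k P using lin_topD(1)[OF P] .
interpretation QA: Module.algebra k Q using lin_topD(1)[OF Q] .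

private abbreviation "Z \<equiv> pair_monoid_ring P Q"
private abbreviation "TR \<equiv> tensor_ring k P Q"
private abbreviation "TA \<equiv> tensor_algebra k P Q"
private abbreviation "pt \<equiv> pure_tensor k P Q"

interpretation Z: cring Z using pair_monoid_ring_cring[OF P.is_cring Q.is_cring] .

lemma tensor_relations_subset: "tensor_relations k P Q \<subseteq> carrier Z"
proof
  fix z assume "z \<in> tensor_relations k P Q"
  then show "z \<in> carrier Z"
    unfolding tensor_relations_def by (elim UnE CollectE exE conjE) (simp_all add: keys_diff_subset)
qed

lemma tensor_ideal_ideal: "ideal (tensor_ideal k P Q) Z"
  unfolding tensor_ideal_def by (rule Z.genideal_ideal[OF tensor_relations_subset])

interpretation I: ideal "tensor_ideal k P Q" Z using tensor_ideal_ideal .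

lemma tensor_ring_cring: "cring TR"
  using I.quotient_is_cring[OF Z.is_cring] .

interpretation TR: cring TR using tensor_ring_cring .

lemma frag_of_carrier: "p \<in> carrier P \<Longrightarrow> q \<in> carrier Q \<Longrightarrow> frag_of (p, q) \<in> carrier Z"
  by simp

lemma pure_tensor_closed: "p \<in> carrier P \<Longrightarrow> q \<in> carrier Q \<Longrightarrow> pt p q \<in> carrier TR"
  unfolding pure_tensor_def using frag_of_carrier carrier_quot by blast

lemma pure_tensor_mult:
  assumes "p \<in> carrier P" "q \<in> carrier Q" "p' \<in> carrier P" "q' \<in> carrier Q"
  shows "pt p q \<otimes>\<^bsub>TR\<^esub> pt p' q' = pt (p \<otimes>\<^bsub>P\<^esub> p') (q \<otimes>\<^bsub>Q\<^esub> q')"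
  unfolding pure_tensor_def
  using quot_simps(3)[OF I.is_ideal frag_of_carrier[OF assms(1,2)] frag_of_carrier[OF assms(3,4)]]
  by (simp add: pair_mult_of)

lemma pure_tensor_one: "\<one>\<^bsub>TR\<^esub> = pt \<one>\<^bsub>P\<^esub> \<one>\<^bsub>Q\<^esub>"
  unfolding pure_tensor_def using quot_simps(2)[OF I.is_ideal] by simp

lemma tensor_relation_mem: "z \<in> tensor_relations k P Q \<Longrightarrow> z \<in> tensor_ideal k P Q"
  unfolding tensor_ideal_def using Z.genideal_self[OF tensor_relations_subset] by blast

lemma pure_tensor_add:
  shows "p \<in> carrier P \<Longrightarrow> p' \<in> carrier P \<Longrightarrow> q \<in> carrier Q \<Longrightarrow> pt (p \<oplus>\<^bsub>P\<^esub> p') q = pt p q \<oplus>\<^bsub>TR\<^esub> pt p' q"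
    "p \<in> carrier P \<Longrightarrow> q \<in> carrier Q \<Longrightarrow> q' \<in> carrier Q \<Longrightarrow> pt p (q \<oplus>\<^bsub>Q\<^esub> q') = pt p q \<oplus>\<^bsub>TR\<^esub> pt p q'"
proof -
  have *: "tensor_ideal k P Q +>\<^bsub>Z\<^esub> u = tensor_ideal k P Q +>\<^bsub>Z\<^esub> (v \<oplus>\<^bsub>Z\<^esub> w)"
    if "u \<in> carrier Z" "v \<in> carrier Z" "w \<in> carrier Z" "u - v - w \<in> tensor_relations k P Q" for u v w
  proof -
    have "u \<ominus>\<^bsub>Z\<^esub> (v \<oplus>\<^bsub>Z\<^esub> w) = u - v - w"
      using pair_monoid_ring_minus[OF P.is_cring Q.is_cring that(1) Z.a_closed[OF that(2,3)]] by simp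
    then show ?thesis using Z.coset_eq_iff[OF I.is_ideal that(1) Z.a_closed[OF that(2,3)]] tensor_relation_mem[OF that(4)]
      by simp
  qed
  {
    assume a: "p \<in> carrier P" "p' \<in> carrier P" "q \<in> carrier Q"
    then have "frag_of (p \<oplus>\<^bsub>P\<^esub> p', q) - frag_of (p, q) - frag_of (p', q) \<in> tensor_relations k P Q"
      unfolding tensor_relations_def by blast
    from *[OF _ _ _ this] a show "pt (p \<oplus>\<^bsub>P\<^esub> p') q = pt p q \<oplus>\<^bsub>TR\<^esub> pt p' q"
      unfolding pure_tensor_def by (subst quot_simps(4)[OF I.is_ideal]) simp_all
  }
  {
    assume a: "p \<in> carrier P" "q \<in> carrier Q" "q' \<in> carrier Q"
    then have "frag_of (p, q \<oplus>\<^bsub>Q\<^esub> q') - frag_of (p, q) - frag_of (p, q') \<in> tensor_relations k P Q"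
      unfolding tensor_relations_def by blast
    from *[OF _ _ _ this] a show "pt p (q \<oplus>\<^bsub>Q\<^esub> q') = pt p q \<oplus>\<^bsub>TR\<^esub> pt p q'"
      unfolding pure_tensor_def by (subst quot_simps(4)[OF I.is_ideal]) simp_all
  }
qed

lemma pure_tensor_smult:
  assumes "c \<in> carrier k" "p \<in> carrier P" "q \<in> carrier Q"
  shows "pt (c \<odot>\<^bsub>P\<^esub> p) q = pt p (c \<odot>\<^bsub>Q\<^esub> q)"
proof -
  have "frag_of (c \<odot>\<^bsub>P\<^esub> p, q) - frag_of (p, c \<odot>\<^bsub>Q\<^esub> q) \<in> tensor_relations k P Q"
    unfolding tensor_relations_def using assms by blast
  then have "frag_of (c \<odot>\<^bsub>P\<^esub> p, q) \<ominus>\<^bsub>Z\<^esub> frag_of (p, c \<odot>\<^bsub>Q\<^esub> q) \<in> tensor_ideal k P Q"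
    using tensor_relation_mem assms by (subst pair_monoid_ring_minus[OF P.is_cring Q.is_cring]) auto
  then show ?thesis unfolding pure_tensor_def
    using Z.coset_eq_iff[OF I.is_ideal frag_of_carrier frag_of_carrier] assms by simp
qed

text \<open>Pure tensors generate the additive group. A single clause for differences replaces sums
  and negatives, as in the induction for free abelian groups from which it descends.\<close>

lemma tensor_induct [consumes 1, case_names zero pure diff]:
  assumes z: "z \<in> carrier TR" and "R \<zero>\<^bsub>TR\<^esub>"
    and pure: "\<And>p q. p \<in> carrier P \<Longrightarrow> q \<in> carrier Q \<Longrightarrow> R (pt p q)"
    and minus: "\<And>a b. a \<in> carrier TR \<Longrightarrow> b \<in> carrier TR \<Longrightarrow> R a \<Longrightarrow> R b \<Longrightarrow> R (a \<ominus>\<^bsub>TR\<^esub> b)"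
  shows "R z"
proof -
  let ?\<pi> = "\<lambda>u. tensor_ideal k P Q +>\<^bsub>Z\<^esub> u"
  interpret \<pi>: ring_hom_cring Z TR ?\<pi> using I.rcos_ring_hom_cring[OF Z.is_cring] .
  obtain u where u: "u \<in> carrier Z" "z = ?\<pi> u" using z unfolding carrier_quot by blast
  from u(1) have "Poly_Mapping.keys u \<subseteq> carrier P \<times> carrier Q" by simp
  then have "R (?\<pi> u)"
  proof (induction u rule: free_induct)
    case zero
    then show ?case using \<pi>.hom_zero assms(2) by simp
  next
    case (diff x y)
    then have c: "x \<in> carrier Z" "y \<in> carrier Z" by auto
    have "?\<pi> (x - y) = ?\<pi> x \<ominus>\<^bsub>TR\<^esub> ?\<pi> y"
      using c pair_monoid_ring_minus[OF P.is_cring Q.is_cring c, symmetric]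
      by (simp only: a_minus_def \<pi>.hom_add \<pi>.hom_a_inv Z.a_inv_closed)
    then show ?case using minus[OF \<pi>.hom_closed[OF c(1)] \<pi>.hom_closed[OF c(2)]] diff by simp
  next
    case (one a)
    then show ?case using pure unfolding pure_tensor_def by (cases a) simp
  qed
  then show ?thesis using u by simp
qed

lemma tensor_algebra_sel:
  "carrier TA = carrier TR" "monoid.mult TA = monoid.mult TR" "\<one>\<^bsub>TA\<^esub> = \<one>\<^bsub>TR\<^esub>" "\<zero>\<^bsub>TA\<^esub> = \<zero>\<^bsub>TR\<^esub>"
  "ring.add TA = ring.add TR" "c \<odot>\<^bsub>TA\<^esub> z = pt (c \<odot>\<^bsub>P\<^esub> \<one>\<^bsub>P\<^esub>) \<one>\<^bsub>Q\<^esub> \<otimes>\<^bsub>TR\<^esub> z"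
  by (simp_all add: tensor_algebra_def)

lemma tensor_algebra_algebra: "Module.algebra k TA"
proof -
  have cr: "cring TA" by (rule cring_cong[OF tensor_ring_cring]) (simp_all add: tensor_algebra_sel)
  have f: "pt (c \<odot>\<^bsub>P\<^esub> \<one>\<^bsub>P\<^esub>) \<one>\<^bsub>Q\<^esub> \<in> carrier TR" if "c \<in> carrier k" for c
    using pure_tensor_closed that by simp
  have plus: "pt ((a \<oplus>\<^bsub>k\<^esub> b) \<odot>\<^bsub>P\<^esub> \<one>\<^bsub>P\<^esub>) \<one>\<^bsub>Q\<^esub> = pt (a \<odot>\<^bsub>P\<^esub> \<one>\<^bsub>P\<^esub>) \<one>\<^bsub>Q\<^esub> \<oplus>\<^bsub>TR\<^esub> pt (b \<odot>\<^bsub>P\<^esub> \<one>\<^bsub>P\<^esub>) \<one>\<^bsub>Q\<^esub>"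
    if "a \<in> carrier k" "b \<in> carrier k" for a b
    using that PA.smult_l_distr pure_tensor_add(1) by simp
  have times: "pt ((a \<otimes>\<^bsub>k\<^esub> b) \<odot>\<^bsub>P\<^esub> \<one>\<^bsub>P\<^esub>) \<one>\<^bsub>Q\<^esub> = pt (a \<odot>\<^bsub>P\<^esub> \<one>\<^bsub>P\<^esub>) \<one>\<^bsub>Q\<^esub> \<otimes>\<^bsub>TR\<^esub> pt (b \<odot>\<^bsub>P\<^esub> \<one>\<^bsub>P\<^esub>) \<one>\<^bsub>Q\<^esub>"
    if ab: "a \<in> carrier k" "b \<in> carrier k" for a b
  proof -
    have "(a \<odot>\<^bsub>P\<^esub> \<one>\<^bsub>P\<^esub>) \<otimes>\<^bsub>P\<^esub> (b \<odot>\<^bsub>P\<^esub> \<one>\<^bsub>P\<^esub>) = (a \<otimes>\<^bsub>k\<^esub> b) \<odot>\<^bsub>P\<^esub> \<one>\<^bsub>P\<^esub>"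
      using ab PA.smult_assoc2[of a "\<one>\<^bsub>P\<^esub>" "b \<odot>\<^bsub>P\<^esub> \<one>\<^bsub>P\<^esub>"] PA.smult_assoc1[of a b "\<one>\<^bsub>P\<^esub>"] by simp
    then show ?thesis using pure_tensor_mult ab by simp
  qed
  have ms: "c \<odot>\<^bsub>TA\<^esub> x \<in> carrier TA" "(c \<oplus>\<^bsub>k\<^esub> d) \<odot>\<^bsub>TA\<^esub> x = c \<odot>\<^bsub>TA\<^esub> x \<oplus>\<^bsub>TA\<^esub> d \<odot>\<^bsub>TA\<^esub> x"
    "c \<odot>\<^bsub>TA\<^esub> (x \<oplus>\<^bsub>TA\<^esub> y) = c \<odot>\<^bsub>TA\<^esub> x \<oplus>\<^bsub>TA\<^esub> c \<odot>\<^bsub>TA\<^esub> y"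
    "(c \<otimes>\<^bsub>k\<^esub> d) \<odot>\<^bsub>TA\<^esub> x = c \<odot>\<^bsub>TA\<^esub> (d \<odot>\<^bsub>TA\<^esub> x)" "\<one>\<^bsub>k\<^esub> \<odot>\<^bsub>TA\<^esub> x = x"
    "(c \<odot>\<^bsub>TA\<^esub> x) \<otimes>\<^bsub>TA\<^esub> y = c \<odot>\<^bsub>TA\<^esub> (x \<otimes>\<^bsub>TA\<^esub> y)"
    if c: "c \<in> carrier k" "d \<in> carrier k" and x: "x \<in> carrier TA" "y \<in> carrier TA" for c d x y
    using c x f plus times TR.l_distr TR.r_distr TR.m_assoc pure_tensor_one[symmetric]
    by (simp_all add: tensor_algebra_sel)
  have k1: "\<one>\<^bsub>k\<^esub> \<in> carrier k" using PA.R_cring by (simp add: cring.cring_simprules(6))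
  show ?thesis
    by (rule algebraI) (rule PA.R_cring cr | (rule ms; assumption) | (rule ms(5)[OF k1 k1]; assumption))+
qed

lemma tensor_base_generators:
  assumes "I \<in> open_ideals P" "J \<in> open_ideals Q"
  shows "(\<lambda>p. pt p \<one>\<^bsub>Q\<^esub>) ` I \<union> (\<lambda>q. pt \<one>\<^bsub>P\<^esub> q) ` J \<subseteq> carrier TR"
proof -
  have "I \<subseteq> carrier P" "J \<subseteq> carrier Q"
    using ideal_subset_carrier[OF lin_topD(6)[OF P assms(1)]] ideal_subset_carrier[OF lin_topD(6)[OF Q assms(2)]] .
  then have "p \<in> I \<Longrightarrow> pt p \<one>\<^bsub>Q\<^esub> \<in> carrier TR" "q \<in> J \<Longrightarrow> pt \<one>\<^bsub>P\<^esub> q \<in> carrier TR" for p q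
    using pure_tensor_closed by auto
  then show ?thesis by (intro Un_least image_subsetI)
qed

text \<open>\<open>topology\<close> is meaningful only after the predicate is shown to define a
  topology. Closure under intersection holds because the base is directed: intersect the ideals of
  \<open>P\<close> and those of \<open>Q\<close> separately.\<close>

lemma tensor_algebra_basis: "lin_basis TA (tensor_base k P Q)"
proof -
  interpret TA: cring TA using algebra.M_cring[OF tensor_algebra_algebra] .
  have ic: "ideal K TA \<longleftrightarrow> ideal K TR" for K
    by (rule ideal_cong[OF TA.is_cring TR.is_cring]) (simp_all add: tensor_algebra_sel)
  define gens where "gens = (\<lambda>I J. (\<lambda>p. pt p \<one>\<^bsub>Q\<^esub>) ` I \<union> (\<lambda>q. pt \<one>\<^bsub>P\<^esub> q) ` J)"
  have base: "tensor_base k P Q = {Idl\<^bsub>TR\<^esub> (gens I J) | I J. I \<in> open_ideals P \<and> J \<in> open_ideals Q}"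
    unfolding tensor_base_def gens_def by simp
  have ne: "tensor_base k P Q \<noteq> {}" using lin_topD(4)[OF P] lin_topD(4)[OF Q] unfolding base by blast
  have idl: "ideal K TR" if "K \<in> tensor_base k P Q" for K
    using that TR.genideal_ideal[OF tensor_base_generators] unfolding base gens_def by blast
  have dir: "\<exists>K''\<in>tensor_base k P Q. K'' \<subseteq> K \<inter> K'" if K: "K \<in> tensor_base k P Q" "K' \<in> tensor_base k P Q" for K K'
  proof -
    obtain I J where K1: "K = Idl\<^bsub>TR\<^esub> (gens I J)" "I \<in> open_ideals P" "J \<in> open_ideals Q" using K unfolding base by blast
    obtain I' J' where K2: "K' = Idl\<^bsub>TR\<^esub> (gens I' J')" "I' \<in> open_ideals P" "J' \<in> open_ideals Q" using K unfolding base by blast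
    have "Idl\<^bsub>TR\<^esub> (gens (I \<inter> I') (J \<inter> J')) \<subseteq> Idl\<^bsub>TR\<^esub> (gens I J)"
      using tensor_base_generators[OF K1(2,3)] unfolding gens_def by (intro TR.subset_Idl_subset) auto
    moreover have "Idl\<^bsub>TR\<^esub> (gens (I \<inter> I') (J \<inter> J')) \<subseteq> Idl\<^bsub>TR\<^esub> (gens I' J')"
      using tensor_base_generators[OF K2(2,3)] unfolding gens_def by (intro TR.subset_Idl_subset) auto
    moreover have "Idl\<^bsub>TR\<^esub> (gens (I \<inter> I') (J \<inter> J')) \<in> tensor_base k P Q"
      unfolding base using lin_topD(5)[OF P K1(2) K2(2)] lin_topD(5)[OF Q K1(3) K2(3)] by blast
    ultimately show ?thesis using K1 K2 by blast
  qed
  define opn where "opn = (\<lambda>U. U \<subseteq> carrier TR \<and> (\<forall>u\<in>U. \<exists>K\<in>tensor_base k P Q. K +>\<^bsub>TR\<^esub> u \<subseteq> U))"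
  have "istopology opn"
    unfolding istopology_def
  proof (intro conjI allI impI)
    fix S U assume SU: "opn S" "opn U"
    show "opn (S \<inter> U)"
      unfolding opn_def
    proof (intro conjI ballI)
      fix u assume u: "u \<in> S \<inter> U"
      then obtain K K' where K: "K \<in> tensor_base k P Q" "K +>\<^bsub>TR\<^esub> u \<subseteq> S" "K' \<in> tensor_base k P Q" "K' +>\<^bsub>TR\<^esub> u \<subseteq> U"
        using SU unfolding opn_def by blast
      obtain K'' where K'': "K'' \<in> tensor_base k P Q" "K'' \<subseteq> K \<inter> K'" using dir[OF K(1,3)] by blast
      have "K'' +>\<^bsub>TR\<^esub> u \<subseteq> K +>\<^bsub>TR\<^esub> u" "K'' +>\<^bsub>TR\<^esub> u \<subseteq> K' +>\<^bsub>TR\<^esub> u"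
        using K''(2) unfolding a_r_coset_def r_coset_def by auto
      then show "\<exists>K\<in>tensor_base k P Q. K +>\<^bsub>TR\<^esub> u \<subseteq> S \<inter> U" using K K''(1) by blast
    qed (use SU in \<open>auto simp: opn_def\<close>)
  next
    fix \<K> assume K: "\<forall>S\<in>\<K>. opn S"
    show "opn (\<Union>\<K>)"
      unfolding opn_def
    proof (intro conjI ballI)
      show "\<Union>\<K> \<subseteq> carrier TR" using K unfolding opn_def by blast
      fix u assume "u \<in> \<Union>\<K>"
      then obtain S where S: "S \<in> \<K>" "u \<in> S" by blast
      then obtain K0 where "K0 \<in> tensor_base k P Q" "K0 +>\<^bsub>TR\<^esub> u \<subseteq> S" using K unfolding opn_def by blast
      then show "\<exists>K\<in>tensor_base k P Q. K +>\<^bsub>TR\<^esub> u \<subseteq> \<Union>\<K>" using S by blast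
    qed
  qed
  moreover have "opens TA = topology opn" by (simp add: tensor_algebra_def opn_def)
  ultimately have op: "openin (opens TA) U \<longleftrightarrow> opn U" for U by (simp add: topology_inverse')
  have rc: "a_r_coset TA = a_r_coset TR" by (rule a_r_coset_cong) (simp add: tensor_algebra_sel)
  show ?thesis
    unfolding lin_basis_def
  proof (intro conjI ballI allI)
    show "openin (opens TA) U \<longleftrightarrow> U \<subseteq> carrier TA \<and> (\<forall>u\<in>U. \<exists>K\<in>tensor_base k P Q. K +>\<^bsub>TA\<^esub> u \<subseteq> U)" for U
      unfolding op opn_def rc by (simp add: tensor_algebra_sel)
  qed (use ne idl ic dir in auto)
qed

lemma tensor_lin_top: "lin_top_algebra k TA"
  using lin_basis_lin_top(1)[OF tensor_algebra_algebra tensor_algebra_basis] .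

text \<open>The member of the base generated by the images of \<open>I\<close> and \<open>J\<close>
  lies in \<open>K\<close>.\<close>

lemma tensor_open_idealI:
  assumes K: "ideal K TA" and I: "I \<in> open_ideals P" "\<And>p. p \<in> I \<Longrightarrow> pt p \<one>\<^bsub>Q\<^esub> \<in> K"
    and J: "J \<in> open_ideals Q" "\<And>q. q \<in> J \<Longrightarrow> pt \<one>\<^bsub>P\<^esub> q \<in> K"
  shows "K \<in> open_ideals TA"
proof -
  interpret TA: cring TA using algebra.M_cring[OF tensor_algebra_algebra] .
  have "ideal K TR \<longleftrightarrow> ideal K TA"
    by (rule ideal_cong[OF TR.is_cring TA.is_cring]) (simp_all add: tensor_algebra_sel)
  then have KTR: "ideal K TR" using K by simp
  have "Idl\<^bsub>TR\<^esub> ((\<lambda>p. pt p \<one>\<^bsub>Q\<^esub>) ` I \<union> (\<lambda>q. pt \<one>\<^bsub>P\<^esub> q) ` J) \<subseteq> K"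
    by (rule TR.genideal_minimal[OF KTR]) (use I J in auto)
  moreover have "Idl\<^bsub>TR\<^esub> ((\<lambda>p. pt p \<one>\<^bsub>Q\<^esub>) ` I \<union> (\<lambda>q. pt \<one>\<^bsub>P\<^esub> q) ` J) \<in> tensor_base k P Q"
    unfolding tensor_base_def using I J by blast
  ultimately show ?thesis using lin_basis_ideal_open[OF TA.is_cring tensor_algebra_basis K] by blast
qed

text \<open>The map (p, q) to \<open>a p\<close> times \<open>b q\<close> extends to the free
  abelian group. It is multiplicative because \<open>T\<close> is commutative, and it kills the
  tensor relations because \<open>a\<close> and \<open>b\<close> are additive and linear over
  \<open>k\<close>.\<close>

lemma tensor_hom_exists:
  assumes T: "Module.algebra k T" and a: "a \<in> ring_hom P T" and b: "b \<in> ring_hom Q T"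
    and al: "\<And>c p. c \<in> carrier k \<Longrightarrow> p \<in> carrier P \<Longrightarrow> a (c \<odot>\<^bsub>P\<^esub> p) = c \<odot>\<^bsub>T\<^esub> a p"
    and bl: "\<And>c p. c \<in> carrier k \<Longrightarrow> p \<in> carrier Q \<Longrightarrow> b (c \<odot>\<^bsub>Q\<^esub> p) = c \<odot>\<^bsub>T\<^esub> b p"
  shows "\<exists>g\<in>ring_hom TA T. (\<forall>p\<in>carrier P. \<forall>q\<in>carrier Q. g (pt p q) = a p \<otimes>\<^bsub>T\<^esub> b q) \<and>
    (\<forall>c\<in>carrier k. \<forall>z\<in>carrier TA. g (c \<odot>\<^bsub>TA\<^esub> z) = c \<odot>\<^bsub>T\<^esub> g z)"
proof -
  interpret T: cring T using T by (rule algebra.M_cring)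
  interpret TT: Module.algebra k T by fact
  interpret a: ring_hom_cring P T a
    using a P.is_cring T.is_cring by (simp add: ring_hom_cring_def ring_hom_cring_axioms_def)
  interpret b: ring_hom_cring Q T b
    using b Q.is_cring T.is_cring by (simp add: ring_hom_cring_def ring_hom_cring_axioms_def)
  let ?S = "carrier P \<times> carrier Q"
  have "(\<lambda>(p, q). a p \<otimes>\<^bsub>T\<^esub> b q) ` ?S \<subseteq> carrier (add_monoid T)" by auto
  from comm_group.free_Abelian_group_universal[OF T.a_comm_group this]
  obtain h where h: "h \<in> hom (free_Abelian_group ?S) (add_monoid T)"
    "\<And>x. x \<in> ?S \<Longrightarrow> h (frag_of x) = (\<lambda>(p, q). a p \<otimes>\<^bsub>T\<^esub> b q) x" by blast
  have hof: "h (frag_of (p, q)) = a p \<otimes>\<^bsub>T\<^esub> b q" if "p \<in> carrier P" "q \<in> carrier Q" for p q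
    using h(2)[of "(p, q)"] that by simp
  have hc: "h u \<in> carrier T" if "u \<in> carrier Z" for u using h(1) that unfolding hom_def by auto
  have hadd: "h (u + v) = h u \<oplus>\<^bsub>T\<^esub> h v" if "u \<in> carrier Z" "v \<in> carrier Z" for u v
    using h(1) that unfolding hom_def by simp
  have h0: "h 0 = \<zero>\<^bsub>T\<^esub>" using hadd[of 0 0] hc[of 0] by simp
  have hdiff: "h (u - v) = h u \<ominus>\<^bsub>T\<^esub> h v" if uv: "u \<in> carrier Z" "v \<in> carrier Z" for u v
  proof -
    have c: "u - v \<in> carrier Z" using uv keys_diff_subset by simp
    have "h u = h (u - v) \<oplus>\<^bsub>T\<^esub> h v" using hadd[OF c uv(2)] by simp
    then show ?thesis using hc[OF c] hc[OF uv(2)] by (simp add: a_minus_def T.a_assoc T.r_neg)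
  qed
  \<comment> \<open>Both sides are additive in \<open>u\<close> and in \<open>v\<close>, so two
    nested inductions reduce the claim to pairs.\<close>
  have hmult: "h (pair_mult P Q u v) = h u \<otimes>\<^bsub>T\<^esub> h v" if u: "Poly_Mapping.keys u \<subseteq> ?S" and v: "Poly_Mapping.keys v \<subseteq> ?S" for u v
    using u
  proof (induction u rule: free_induct)
    case zero
    then show ?case using h0 hc[of v] v by simp
  next
    case (diff x y)
    then show ?case
      using hdiff[of "pair_mult P Q x v" "pair_mult P Q y v"] hdiff[of x y] keys_pair_mult[OF P.is_cring Q.is_cring _ v] hc v
      by (simp add: pair_mult_diff_left a_minus_def T.l_distr T.l_minus)
  next
    case (one s)
    then obtain p q where s: "s = (p, q)" "p \<in> carrier P" "q \<in> carrier Q" by force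
    have sk: "Poly_Mapping.keys (frag_of s) \<subseteq> ?S" using one by simp
    show ?case using v
    proof (induction v rule: free_induct)
      case zero
      then show ?case using h0 hc[of "frag_of s"] sk by simp
    next
      case (diff x y)
      then show ?case
        using hdiff[of "pair_mult P Q (frag_of s) x" "pair_mult P Q (frag_of s) y"] hdiff[of x y]
          keys_pair_mult[OF P.is_cring Q.is_cring sk] hc sk
        by (simp add: pair_mult_diff_right a_minus_def T.r_distr T.r_minus)
    next
      case (one t)
      then obtain p' q' where "t = (p', q')" "p' \<in> carrier P" "q' \<in> carrier Q" by force
      then show ?case using s by (simp add: pair_mult_of hof T.m_ac)
    qed
  qed
  have "h \<in> ring_hom Z T"
    using hc hmult hadd hof[of "\<one>\<^bsub>P\<^esub>" "\<one>\<^bsub>Q\<^esub>"] by (intro ring_hom_memI) auto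
  then interpret h: ring_hom_cring Z T h
    using Z.is_cring T.is_cring by (simp add: ring_hom_cring_def ring_hom_cring_axioms_def)
  have "tensor_relations k P Q \<subseteq> a_kernel Z T h"
  proof
    fix z assume z: "z \<in> tensor_relations k P Q"
    then consider p p' q where "z = frag_of (p \<oplus>\<^bsub>P\<^esub> p', q) - frag_of (p, q) - frag_of (p', q)"
        "p \<in> carrier P" "p' \<in> carrier P" "q \<in> carrier Q"
      | p q q' where "z = frag_of (p, q \<oplus>\<^bsub>Q\<^esub> q') - frag_of (p, q) - frag_of (p, q')"
        "p \<in> carrier P" "q \<in> carrier Q" "q' \<in> carrier Q"
      | c p q where "z = frag_of (c \<odot>\<^bsub>P\<^esub> p, q) - frag_of (p, c \<odot>\<^bsub>Q\<^esub> q)" "c \<in> carrier k" "p \<in> carrier P" "q \<in> carrier Q"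
      unfolding tensor_relations_def by blast
    then have "h z = \<zero>\<^bsub>T\<^esub>"
    proof cases
      case 1
      have c: "a p \<otimes>\<^bsub>T\<^esub> b q \<in> carrier T" "a p' \<otimes>\<^bsub>T\<^esub> b q \<in> carrier T" using 1 by auto
      have "h z = (a p \<otimes>\<^bsub>T\<^esub> b q \<oplus>\<^bsub>T\<^esub> a p' \<otimes>\<^bsub>T\<^esub> b q) \<ominus>\<^bsub>T\<^esub> (a p \<otimes>\<^bsub>T\<^esub> b q) \<ominus>\<^bsub>T\<^esub> (a p' \<otimes>\<^bsub>T\<^esub> b q)"
        using 1 by (simp add: hdiff keys_diff_subset hof T.l_distr)
      also have "\<dots> = \<zero>\<^bsub>T\<^esub>" using c by algebra
      finally show ?thesis .
    next
      case 2
      have c: "a p \<otimes>\<^bsub>T\<^esub> b q \<in> carrier T" "a p \<otimes>\<^bsub>T\<^esub> b q' \<in> carrier T" using 2 by auto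
      have "h z = (a p \<otimes>\<^bsub>T\<^esub> b q \<oplus>\<^bsub>T\<^esub> a p \<otimes>\<^bsub>T\<^esub> b q') \<ominus>\<^bsub>T\<^esub> (a p \<otimes>\<^bsub>T\<^esub> b q) \<ominus>\<^bsub>T\<^esub> (a p \<otimes>\<^bsub>T\<^esub> b q')"
        using 2 by (simp add: hdiff keys_diff_subset hof T.r_distr)
      also have "\<dots> = \<zero>\<^bsub>T\<^esub>" using c by algebra
      finally show ?thesis .
    next
      case 3
      have "(c \<odot>\<^bsub>T\<^esub> a p) \<otimes>\<^bsub>T\<^esub> b q = c \<odot>\<^bsub>T\<^esub> (a p \<otimes>\<^bsub>T\<^esub> b q)" using 3 TT.smult_assoc2 by simp
      moreover have "a p \<otimes>\<^bsub>T\<^esub> (c \<odot>\<^bsub>T\<^esub> b q) = c \<odot>\<^bsub>T\<^esub> (a p \<otimes>\<^bsub>T\<^esub> b q)"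
        using 3 TT.smult_assoc2[of c "b q" "a p"] T.m_comm[of "a p"] by simp
      ultimately show ?thesis using 3 by (simp add: hdiff hof al bl T.r_neg a_minus_def)
    qed
    then show "z \<in> a_kernel Z T h" using z tensor_relations_subset unfolding a_kernel_def' by blast
  qed
  then have ker: "tensor_ideal k P Q \<subseteq> a_kernel Z T h"
    unfolding tensor_ideal_def by (rule Z.genideal_minimal[OF h.ring.kernel_is_ideal])
  let ?\<pi> = "\<lambda>u. tensor_ideal k P Q +>\<^bsub>Z\<^esub> u"
  \<comment> \<open>\<open>g\<close> is defined on cosets through a chosen representative; since the
    tensor ideal lies in the kernel of \<open>h\<close>, the choice is immaterial.\<close>
  define g where "g = (\<lambda>X. h (SOME u. u \<in> carrier Z \<and> X = ?\<pi> u))"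
  have g: "g (?\<pi> u) = h u" if u: "u \<in> carrier Z" for u
  proof -
    define v where "v = (SOME v. v \<in> carrier Z \<and> ?\<pi> u = ?\<pi> v)"
    have v: "v \<in> carrier Z \<and> ?\<pi> u = ?\<pi> v" unfolding v_def by (rule someI_ex) (use u in blast)
    then have "u \<ominus>\<^bsub>Z\<^esub> v \<in> a_kernel Z T h" using Z.coset_eq_iff[OF I.is_ideal u, of v] ker by blast
    then have "h (u - v) = \<zero>\<^bsub>T\<^esub>"
      using pair_monoid_ring_minus[OF P.is_cring Q.is_cring u] v unfolding a_kernel_def' by simp
    then have "h u = h v" using hdiff[OF u, of v] v hc u T.r_right_minus_eq by metis
    then show ?thesis by (simp add: g_def v_def)
  qed
  have gpt: "g (pt p q) = a p \<otimes>\<^bsub>T\<^esub> b q" if "p \<in> carrier P" "q \<in> carrier Q" for p q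
    unfolding pure_tensor_def using g[OF frag_of_carrier[OF that]] hof[OF that] by simp
  have gh: "g \<in> ring_hom TA T"
  proof (rule ring_hom_memI; unfold tensor_algebra_sel)
    fix x assume "x \<in> carrier TR"
    then obtain u where u: "u \<in> carrier Z" "x = ?\<pi> u" unfolding carrier_quot by blast
    then show "g x \<in> carrier T" using g hc by simp
    fix y assume "y \<in> carrier TR"
    then obtain v where v: "v \<in> carrier Z" "y = ?\<pi> v" unfolding carrier_quot by blast
    show "g (x \<otimes>\<^bsub>TR\<^esub> y) = g x \<otimes>\<^bsub>T\<^esub> g y"
      using u v g[OF u(1)] g[OF v(1)] g[OF Z.m_closed[OF u(1) v(1)]] quot_simps(3)[OF I.is_ideal u(1) v(1)]
        h.hom_mult[OF u(1) v(1)] by (simp only:)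
    show "g (x \<oplus>\<^bsub>TR\<^esub> y) = g x \<oplus>\<^bsub>T\<^esub> g y"
      using u v g[OF u(1)] g[OF v(1)] g[OF Z.a_closed[OF u(1) v(1)]] quot_simps(4)[OF I.is_ideal u(1) v(1)]
        h.hom_add[OF u(1) v(1)] by (simp only:)
  next
    show "g \<one>\<^bsub>TR\<^esub> = \<one>\<^bsub>T\<^esub>" unfolding pure_tensor_one using gpt by simp
  qed
  moreover have "g (c \<odot>\<^bsub>TA\<^esub> z) = c \<odot>\<^bsub>T\<^esub> g z" if c: "c \<in> carrier k" and z: "z \<in> carrier TA" for c z
  proof -
    have gz: "g z \<in> carrier T" using gh z by (simp add: ring_hom_def Pi_iff)
    have "pt (c \<odot>\<^bsub>P\<^esub> \<one>\<^bsub>P\<^esub>) \<one>\<^bsub>Q\<^esub> \<in> carrier TA" using pure_tensor_closed c by (simp add: tensor_algebra_sel)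
    then have "g (c \<odot>\<^bsub>TA\<^esub> z) = g (pt (c \<odot>\<^bsub>P\<^esub> \<one>\<^bsub>P\<^esub>) \<one>\<^bsub>Q\<^esub>) \<otimes>\<^bsub>T\<^esub> g z"
      using ring_hom_mult[OF gh _ z] by (simp add: tensor_algebra_sel)
    also have "\<dots> = c \<odot>\<^bsub>T\<^esub> g z" using c gz gpt al TT.smult_assoc2[of c "\<one>\<^bsub>T\<^esub>" "g z"] by simp
    finally show ?thesis .
  qed
  ultimately show ?thesis using gpt by blast
qed

end

lemma complete_lin_top: "complete_algebra k T \<Longrightarrow> lin_top_algebra k T"
  by (simp add: complete_algebra_def)

section \<open>The completed tensor product as a coproduct\<close>

context
  fixes k :: "('k, 'x) ring_scheme" and P :: "('k, 'p) top_algebra" and Q :: "('k, 'q) top_algebra"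
  assumes P: "lin_top_algebra k P" and Q: "lin_top_algebra k Q"
begin

interpretation P: cring P using lin_topD(2)[OF P] .
interpretation Q: cring Q using lin_topD(2)[OF Q] .
interpretation PA: Module.algebra k P using lin_topD(1)[OF P] .
interpretation QA: Module.algebra k Q using lin_topD(1)[OF Q] .

private abbreviation "TPQ \<equiv> tensor_algebra k P Q"
private abbreviation "ptn \<equiv> pure_tensor k P Q"
private abbreviation "\<iota> \<equiv> to_lim TPQ (open_ideals TPQ)"

lemmas TA_lin_top = tensor_lin_top[OF P Q]
lemmas TA_sel = tensor_algebra_sel[OF P Q]

interpretation TPQ: cring TPQ using lin_topD(2)[OF TA_lin_top] .

lemma ctensor_complete: "complete_algebra k (ctensor k P Q)"
  unfolding ctensor_def by (rule completion_complete[OF TA_lin_top])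

interpretation CT: cring "ctensor k P Q"
  using lin_topD(2)[OF complete_lin_top[OF ctensor_complete]] .

lemma pt_closed: "p \<in> carrier P \<Longrightarrow> q \<in> carrier Q \<Longrightarrow> ptn p q \<in> carrier TPQ"
  using pure_tensor_closed[OF P Q] by (simp add: TA_sel)

lemma to_ctensor_hom: "\<iota> \<in> ring_hom TPQ (ctensor k P Q)"
  using to_lim_hom[OF TA_lin_top] by (simp add: ctensor_def)

lemma to_ctensor_pure:
  assumes "p \<in> carrier P" "q \<in> carrier Q"
  shows "\<iota> (ptn p q) = in1 k P Q p \<otimes>\<^bsub>ctensor k P Q\<^esub> in2 k P Q q"
proof -
  have "ptn p q = ptn p \<one>\<^bsub>Q\<^esub> \<otimes>\<^bsub>TPQ\<^esub> ptn \<one>\<^bsub>P\<^esub> q"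
    using pure_tensor_mult[OF P Q, of p "\<one>\<^bsub>Q\<^esub>" "\<one>\<^bsub>P\<^esub>" q] assms by (simp add: TA_sel)
  then show ?thesis
    using ring_hom_mult[OF to_ctensor_hom pt_closed[OF assms(1) Q.one_closed] pt_closed[OF P.one_closed assms(2)]] assms
    by (simp add: in1_def in2_def)
qed

lemma to_ctensor_linear:
  assumes "c \<in> carrier k" "z \<in> carrier TPQ"
  shows "\<iota> (c \<odot>\<^bsub>TPQ\<^esub> z) = c \<odot>\<^bsub>ctensor k P Q\<^esub> \<iota> z"
  using to_lim_smult[OF TA_lin_top assms] by (simp add: ctensor_def)

text \<open>Continuity holds because a basic open ideal of the tensor product is generated by the
  images of an open ideal of each factor.\<close>

lemma coprojections:
  "in1 k P Q \<in> cont_alg_homs k P (ctensor k P Q)" "in2 k P Q \<in> cont_alg_homs k Q (ctensor k P Q)"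
proof -
  have C: "lin_top_algebra k (ctensor k P Q)" using complete_lin_top[OF ctensor_complete] .
  \<comment> \<open>One member of the base below \<open>K\<close> yields the open ideals needed for
    both coprojections.\<close>
  have pow: "\<exists>I\<in>open_ideals P. \<exists>J\<in>open_ideals Q. (\<forall>p\<in>I. \<iota> (ptn p \<one>\<^bsub>Q\<^esub>) \<in> K) \<and> (\<forall>q\<in>J. \<iota> (ptn \<one>\<^bsub>P\<^esub> q) \<in> K)"
    if K: "K \<in> open_ideals (ctensor k P Q)" for K
  proof -
    obtain L where L: "L \<in> open_ideals TPQ" "lim_kernel TPQ L \<subseteq> K"
      using lim_kernel_nhds[OF TA_lin_top] K unfolding ctensor_def by blast
    obtain B where B: "B \<in> tensor_base k P Q" "B \<subseteq> L"
      using lin_basis_nhds[OF TPQ.is_cring tensor_algebra_basis[OF P Q] L(1)] by blast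
    obtain I J where IJ: "I \<in> open_ideals P" "J \<in> open_ideals Q"
      "B = Idl\<^bsub>tensor_ring k P Q\<^esub> ((\<lambda>p. ptn p \<one>\<^bsub>Q\<^esub>) ` I \<union> (\<lambda>q. ptn \<one>\<^bsub>P\<^esub> q) ` J)"
      using B(1) unfolding tensor_base_def by blast
    have gens: "(\<lambda>p. ptn p \<one>\<^bsub>Q\<^esub>) ` I \<union> (\<lambda>q. ptn \<one>\<^bsub>P\<^esub> q) ` J \<subseteq> B"
      unfolding IJ(3) using ring.genideal_self[OF cring.axioms(1)[OF tensor_ring_cring[OF P Q]] tensor_base_generators[OF P Q IJ(1,2)]] .
    have "\<iota> z \<in> K" if z: "z \<in> B" for z
    proof -
      have "z \<in> carrier TPQ" "z \<in> L" using z B(2) ideal_subset_carrier[OF lin_topD(6)[OF TA_lin_top L(1)]] by blast+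
      then show ?thesis using lim_kernel_to_lim[OF TA_lin_top _ L(1)] L(2) by blast
    qed
    then show ?thesis using gens IJ(1,2) by blast
  qed
  have lin1: "ptn (c \<odot>\<^bsub>P\<^esub> p) \<one>\<^bsub>Q\<^esub> = c \<odot>\<^bsub>TPQ\<^esub> ptn p \<one>\<^bsub>Q\<^esub>" if "c \<in> carrier k" "p \<in> carrier P" for c p
    using pure_tensor_mult[OF P Q, of "c \<odot>\<^bsub>P\<^esub> \<one>\<^bsub>P\<^esub>" "\<one>\<^bsub>Q\<^esub>" p "\<one>\<^bsub>Q\<^esub>"] that PA.smult_assoc2[of c "\<one>\<^bsub>P\<^esub>" p]
    by (simp add: TA_sel)
  have lin2: "ptn \<one>\<^bsub>P\<^esub> (c \<odot>\<^bsub>Q\<^esub> q) = c \<odot>\<^bsub>TPQ\<^esub> ptn \<one>\<^bsub>P\<^esub> q" if "c \<in> carrier k" "q \<in> carrier Q" for c q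
    using pure_tensor_mult[OF P Q, of "c \<odot>\<^bsub>P\<^esub> \<one>\<^bsub>P\<^esub>" "\<one>\<^bsub>Q\<^esub>" "\<one>\<^bsub>P\<^esub>" q] that pure_tensor_smult[OF P Q, of c "\<one>\<^bsub>P\<^esub>" q]
    by (simp add: TA_sel)
  have 1: "(\<lambda>p. \<iota> (ptn p \<one>\<^bsub>Q\<^esub>)) \<in> ring_hom P (ctensor k P Q)"
  proof -
    have "(\<lambda>p. ptn p \<one>\<^bsub>Q\<^esub>) \<in> ring_hom P TPQ"
    proof (rule ring_hom_memI)
      fix p p' assume p: "p \<in> carrier P" "p' \<in> carrier P"
      show "ptn (p \<otimes>\<^bsub>P\<^esub> p') \<one>\<^bsub>Q\<^esub> = ptn p \<one>\<^bsub>Q\<^esub> \<otimes>\<^bsub>TPQ\<^esub> ptn p' \<one>\<^bsub>Q\<^esub>"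
        using pure_tensor_mult[OF P Q p(1) Q.one_closed p(2) Q.one_closed] by (simp add: TA_sel)
      show "ptn (p \<oplus>\<^bsub>P\<^esub> p') \<one>\<^bsub>Q\<^esub> = ptn p \<one>\<^bsub>Q\<^esub> \<oplus>\<^bsub>TPQ\<^esub> ptn p' \<one>\<^bsub>Q\<^esub>"
        using pure_tensor_add(1)[OF P Q p Q.one_closed] by (simp add: TA_sel)
    qed (simp_all add: pure_tensor_closed[OF P Q] TA_sel pure_tensor_one[OF P Q])
    then show ?thesis using ring_hom_trans[OF _ to_ctensor_hom] by (simp add: comp_def)
  qed
  have 2: "(\<lambda>q. \<iota> (ptn \<one>\<^bsub>P\<^esub> q)) \<in> ring_hom Q (ctensor k P Q)"
  proof -
    have "(\<lambda>q. ptn \<one>\<^bsub>P\<^esub> q) \<in> ring_hom Q TPQ"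
    proof (rule ring_hom_memI)
      fix p p' assume p: "p \<in> carrier Q" "p' \<in> carrier Q"
      show "ptn \<one>\<^bsub>P\<^esub> (p \<otimes>\<^bsub>Q\<^esub> p') = ptn \<one>\<^bsub>P\<^esub> p \<otimes>\<^bsub>TPQ\<^esub> ptn \<one>\<^bsub>P\<^esub> p'"
        using pure_tensor_mult[OF P Q P.one_closed p(1) P.one_closed p(2)] by (simp add: TA_sel)
      show "ptn \<one>\<^bsub>P\<^esub> (p \<oplus>\<^bsub>Q\<^esub> p') = ptn \<one>\<^bsub>P\<^esub> p \<oplus>\<^bsub>TPQ\<^esub> ptn \<one>\<^bsub>P\<^esub> p'"
        using pure_tensor_add(2)[OF P Q P.one_closed p] by (simp add: TA_sel)
    qed (simp_all add: pure_tensor_closed[OF P Q] TA_sel pure_tensor_one[OF P Q])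
    then show ?thesis using ring_hom_trans[OF _ to_ctensor_hom] by (simp add: comp_def)
  qed
  show "in1 k P Q \<in> cont_alg_homs k P (ctensor k P Q)"
    unfolding cont_alg_homs_iff[OF P C]
  proof (intro conjI ballI)
    show "in1 k P Q \<in> ring_hom P (ctensor k P Q)" using 1 by (auto simp: ring_hom_def in1_def)
    show "\<exists>I\<in>open_ideals P. in1 k P Q ` I \<subseteq> K" if K: "K \<in> open_ideals (ctensor k P Q)" for K
    proof -
      obtain I where I: "I \<in> open_ideals P" "\<forall>p\<in>I. \<iota> (ptn p \<one>\<^bsub>Q\<^esub>) \<in> K" using pow[OF K] by blast
      then have "in1 k P Q ` I \<subseteq> K"
        using ideal_subset_carrier[OF lin_topD(6)[OF P I(1)]] by (auto simp: in1_def subset_iff)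
      then show ?thesis using I by blast
    qed
  qed (auto simp: in1_def lin1 to_ctensor_linear pt_closed)
  show "in2 k P Q \<in> cont_alg_homs k Q (ctensor k P Q)"
    unfolding cont_alg_homs_iff[OF Q C]
  proof (intro conjI ballI)
    show "in2 k P Q \<in> ring_hom Q (ctensor k P Q)" using 2 by (auto simp: ring_hom_def in2_def)
    show "\<exists>I\<in>open_ideals Q. in2 k P Q ` I \<subseteq> K" if K: "K \<in> open_ideals (ctensor k P Q)" for K
    proof -
      obtain I where I: "I \<in> open_ideals Q" "\<forall>q\<in>I. \<iota> (ptn \<one>\<^bsub>P\<^esub> q) \<in> K" using pow[OF K] by blast
      then have "in2 k P Q ` I \<subseteq> K"
        using ideal_subset_carrier[OF lin_topD(6)[OF Q I(1)]] by (auto simp: in2_def subset_iff)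
      then show ?thesis using I by blast
    qed
  qed (auto simp: in2_def lin2 to_ctensor_linear pt_closed)
qed

text \<open>A pure tensor is the product of the images of its two factors, pure tensors generate the
  algebraic tensor product, and this is dense in its completion.\<close>

lemma ctensor_hom_unique:
  assumes T: "complete_algebra k T"
    and h: "h \<in> cont_alg_homs k (ctensor k P Q) T" "h' \<in> cont_alg_homs k (ctensor k P Q) T"
    and eq: "\<And>p. p \<in> carrier P \<Longrightarrow> h (in1 k P Q p) = h' (in1 k P Q p)"
      "\<And>q. q \<in> carrier Q \<Longrightarrow> h (in2 k P Q q) = h' (in2 k P Q q)"
  shows "h = h'"
proof (rule completion_hom_unique[OF TA_lin_top T])
  show "h \<in> cont_alg_homs k (completion TPQ) T" "h' \<in> cont_alg_homs k (completion TPQ) T"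
    using h by (simp_all add: ctensor_def)
  interpret T: cring T using lin_topD(2)[OF complete_lin_top[OF T]] .
  interpret h: ring_hom_cring "ctensor k P Q" T h
    using cont_alg_homsD(1)[OF h(1)] CT.is_cring T.is_cring by (simp add: ring_hom_cring_def ring_hom_cring_axioms_def)
  interpret h': ring_hom_cring "ctensor k P Q" T h'
    using cont_alg_homsD(1)[OF h(2)] CT.is_cring T.is_cring by (simp add: ring_hom_cring_def ring_hom_cring_axioms_def)
  interpret \<iota>: ring_hom_cring TPQ "ctensor k P Q" \<iota>
    using to_ctensor_hom CT.is_cring TPQ.is_cring by (simp add: ring_hom_cring_def ring_hom_cring_axioms_def)
  fix z assume "z \<in> carrier TPQ"
  then have "z \<in> carrier (tensor_ring k P Q)" by (simp add: TA_sel)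
  then show "h (\<iota> z) = h' (\<iota> z)"
  proof (induction z rule: tensor_induct[OF P Q, consumes 1, case_names zero pure diff])
    case zero
    then show ?case using \<iota>.hom_zero by (simp add: TA_sel)
  next
    case (pure p q)
    then show ?case
      using to_ctensor_pure[OF pure] eq(1)[OF pure(1)] eq(2)[OF pure(2)] cont_alg_homsD(5)[OF coprojections(1) pure(1)]
        cont_alg_homsD(5)[OF coprojections(2) pure(2)] by simp
  next
    case (diff a b)
    have ab: "a \<in> carrier TPQ" "b \<in> carrier TPQ" using diff by (simp_all add: TA_sel)
    interpret TR: cring "tensor_ring k P Q" using tensor_ring_cring[OF P Q] .
    have "\<ominus>\<^bsub>TPQ\<^esub> b = \<ominus>\<^bsub>tensor_ring k P Q\<^esub> b"
      by (rule TPQ.minus_equality) (use diff TR.l_neg in \<open>simp_all add: TA_sel\<close>)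
    then have "\<iota> (a \<ominus>\<^bsub>tensor_ring k P Q\<^esub> b) = \<iota> a \<ominus>\<^bsub>ctensor k P Q\<^esub> \<iota> b"
      using ab \<iota>.hom_add[OF ab(1) TPQ.a_inv_closed[OF ab(2)]] \<iota>.hom_a_inv[OF ab(2)] by (simp add: a_minus_def TA_sel)
    then show ?case using \<iota>.hom_closed[OF ab(1)] \<iota>.hom_closed[OF ab(2)] diff by (simp add: a_minus_def)
  qed
qed

text \<open>The map on the algebraic tensor product extends to the completion once it is continuous.
  The preimage of \<open>J\<close> contains the generators that come from the preimages of
  \<open>J\<close> under \<open>a\<close> and under \<open>b\<close>, hence is open.\<close>

lemma copair_exists:
  assumes T: "complete_algebra k T" and a: "a \<in> cont_alg_homs k P T" and b: "b \<in> cont_alg_homs k Q T"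
  shows "\<exists>h. h \<in> cont_alg_homs k (ctensor k P Q) T \<and>
    (\<forall>p\<in>carrier P. h (in1 k P Q p) = a p) \<and> (\<forall>q\<in>carrier Q. h (in2 k P Q q) = b q)"
proof -
  have lt: "lin_top_algebra k T" using complete_lin_top[OF T] .
  interpret T: cring T using lin_topD(2)[OF lt] .
  note A = cont_alg_homsD[OF a] and B = cont_alg_homsD[OF b]
  obtain g where g: "g \<in> ring_hom TPQ T" "\<forall>p\<in>carrier P. \<forall>q\<in>carrier Q. g (ptn p q) = a p \<otimes>\<^bsub>T\<^esub> b q"
    "\<forall>c\<in>carrier k. \<forall>z\<in>carrier TPQ. g (c \<odot>\<^bsub>TPQ\<^esub> z) = c \<odot>\<^bsub>T\<^esub> g z"
    using tensor_hom_exists[OF P Q lin_topD(1)[OF lt] A(1) B(1) A(3) B(3)] by blast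
  interpret g: ring_hom_ring TPQ T g
    using g(1) TPQ.ring_axioms T.ring_axioms by (simp add: ring_hom_ring_def ring_hom_ring_axioms_def)
  have a1: "a \<one>\<^bsub>P\<^esub> = \<one>\<^bsub>T\<^esub>" "b \<one>\<^bsub>Q\<^esub> = \<one>\<^bsub>T\<^esub>" using ring_hom_one A(1) B(1) by auto
  have "{z \<in> carrier TPQ. g z \<in> J} \<in> open_ideals TPQ" if J: "J \<in> open_ideals T" for J
    by (rule tensor_open_idealI[OF P Q g.ideal_vimage[OF lin_topD(6)[OF lt J]]
          cont_alg_homs_vimage[OF P lt a J] _ cont_alg_homs_vimage[OF Q lt b J]])
      (use g(2) a1 A(5) B(5) pt_closed in auto)
  then obtain h where h: "h \<in> cont_alg_homs k (completion TPQ) T" "\<forall>z\<in>carrier TPQ. h (\<iota> z) = g z"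
    using completion_extend[OF TA_lin_top T g(1)] g(3) by blast
  have "h (in1 k P Q p) = a p" if "p \<in> carrier P" for p
    using h(2) pt_closed[OF that Q.one_closed] g(2) that a1 A(5) by (simp add: in1_def)
  moreover have "h (in2 k P Q q) = b q" if "q \<in> carrier Q" for q
    using h(2) pt_closed[OF P.one_closed that] g(2) that a1 B(5) by (simp add: in2_def)
  ultimately show ?thesis using h(1) by (auto simp: ctensor_def)
qed

text \<open>Existence and uniqueness turn the description in \<open>copair\<close> into usable
  equations. The last one, on pure tensors, is where later congruences are computed.\<close>

lemma copair_props:
  assumes T: "complete_algebra k T" and a: "a \<in> cont_alg_homs k P T" and b: "b \<in> cont_alg_homs k Q T"
  shows "copair k P Q T a b \<in> cont_alg_homs k (ctensor k P Q) T"
    "\<And>p. p \<in> carrier P \<Longrightarrow> copair k P Q T a b (in1 k P Q p) = a p"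
    "\<And>q. q \<in> carrier Q \<Longrightarrow> copair k P Q T a b (in2 k P Q q) = b q"
    "\<And>p q. p \<in> carrier P \<Longrightarrow> q \<in> carrier Q \<Longrightarrow> copair k P Q T a b (\<iota> (ptn p q)) = a p \<otimes>\<^bsub>T\<^esub> b q"
proof -
  let ?S = "\<lambda>h. h \<in> cont_alg_homs k (ctensor k P Q) T \<and>
    (\<forall>p\<in>carrier P. h (in1 k P Q p) = a p) \<and> (\<forall>q\<in>carrier Q. h (in2 k P Q q) = b q)"
  obtain h where h: "?S h" using copair_exists[OF assms] by blast
  have "h' = h" if "?S h'" for h'
    by (rule ctensor_hom_unique[OF T]) (use h that in auto)
  then have S: "?S (copair k P Q T a b)" unfolding copair_def by (rule theI[of ?S, OF h])
  then show "copair k P Q T a b \<in> cont_alg_homs k (ctensor k P Q) T"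
    "\<And>p. p \<in> carrier P \<Longrightarrow> copair k P Q T a b (in1 k P Q p) = a p"
    "\<And>q. q \<in> carrier Q \<Longrightarrow> copair k P Q T a b (in2 k P Q q) = b q" by auto
  fix p q assume pq: "p \<in> carrier P" "q \<in> carrier Q"
  note c = cont_alg_homsD(5)[OF coprojections(1) pq(1)] cont_alg_homsD(5)[OF coprojections(2) pq(2)]
  show "copair k P Q T a b (\<iota> (ptn p q)) = a p \<otimes>\<^bsub>T\<^esub> b q"
    unfolding to_ctensor_pure[OF pq] using ring_hom_mult[OF cont_alg_homsD(1)[OF conjunct1[OF S]] c] S pq by simp
qed

lemma copair_unique:
  assumes T: "complete_algebra k T" and h: "h \<in> cont_alg_homs k (ctensor k P Q) T"
    and eq: "\<And>p. p \<in> carrier P \<Longrightarrow> h (in1 k P Q p) = a p" "\<And>q. q \<in> carrier Q \<Longrightarrow> h (in2 k P Q q) = b q"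
  shows "copair k P Q T a b = h"
  unfolding copair_def
proof (rule the_equality)
  fix h' assume "h' \<in> cont_alg_homs k (ctensor k P Q) T \<and>
    (\<forall>p\<in>carrier P. h' (in1 k P Q p) = a p) \<and> (\<forall>q\<in>carrier Q. h' (in2 k P Q q) = b q)"
  then show "h' = h" by (intro ctensor_hom_unique[OF T]) (use h eq in auto)
qed (use h eq in auto)

end

section \<open>The group of points\<close>

locale formal_group =
  fixes k :: "('k, 'x) ring_scheme" and R :: "('k, 'r) top_algebra"
    and \<mu> :: "'r \<Rightarrow> ('r, 'r) ctensor" and \<epsilon> :: "'r \<Rightarrow> 'k"
  assumes k: "cring k" and R: "complete_algebra k R" and grp: "comm_group_structure k R \<mu> \<epsilon>"
begin

abbreviation "R2 \<equiv> ctensor k R R"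
abbreviation "R3 \<equiv> ctensor k R2 R"
abbreviation "pts \<equiv> points k R \<mu> \<epsilon>"
abbreviation "idR \<equiv> (\<lambda>r\<in>carrier R. r)"
abbreviation "kk \<equiv> base_algebra k"

lemma R_lin_top: "lin_top_algebra k R" using complete_lin_top[OF R] .

sublocale R: cring R using lin_topD(2)[OF R_lin_top] .
sublocale RA: Module.algebra k R using lin_topD(1)[OF R_lin_top] .
sublocale kk: cring kk using base_algebra_cring[OF k] .

lemma R2: "complete_algebra k R2" using ctensor_complete[OF R_lin_top R_lin_top] .
lemma R2_lin_top: "lin_top_algebra k R2" using complete_lin_top[OF R2] .
lemma R3: "complete_algebra k R3" using ctensor_complete[OF R2_lin_top R_lin_top] .
lemma kk: "complete_algebra k kk" using base_algebra_complete(1)[OF k] .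
lemma kk_lin_top: "lin_top_algebra k kk" using complete_lin_top[OF kk] .

lemma mu_hom: "\<mu> \<in> cont_alg_homs k R R2" and eps_hom: "\<epsilon> \<in> cont_alg_homs k R kk"
  using grp unfolding comm_group_structure_def by blast+

text \<open>Functoriality of the points: a morphism from \<open>T\<close> to \<open>S\<close> over
  \<open>k\<close> turns a point with values in \<open>T\<close> into one with values in
  \<open>S\<close>.\<close>

definition push :: "('t \<Rightarrow> 's) \<Rightarrow> ('r \<Rightarrow> 't) \<Rightarrow> ('r \<Rightarrow> 's)" where
  "push f a = (\<lambda>r\<in>carrier R. f (a r))"

lemma pts_sel [simp]: "carrier (pts T) = cont_alg_homs k R T"
  "a \<otimes>\<^bsub>pts T\<^esub> b = (\<lambda>r\<in>carrier R. copair k R R T a b (\<mu> r))"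
  "\<one>\<^bsub>pts T\<^esub> = (\<lambda>r\<in>carrier R. \<epsilon> r \<odot>\<^bsub>T\<^esub> \<one>\<^bsub>T\<^esub>)"
  by (simp_all add: points_def)

lemma push_closed:
  assumes "lin_top_algebra k T" "lin_top_algebra k T'" "f \<in> cont_alg_homs k T T'" "a \<in> cont_alg_homs k R T"
  shows "push f a \<in> cont_alg_homs k R T'"
  unfolding push_def using cont_alg_homs_compose[OF R_lin_top assms(1,2,4,3)] .

lemma id_hom: "lin_top_algebra k T \<Longrightarrow> (\<lambda>t\<in>carrier T. t) \<in> cont_alg_homs k T T"
  by (subst cont_alg_homs_iff)
    (auto simp: ring_hom_def dest: lin_topD(1,2) intro!: algebra.axioms module.smult_closed cring.cring_simprules
      dest: ideal_subset_carrier[OF lin_topD(6)])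

lemma push_id: "a \<in> cont_alg_homs k R T \<Longrightarrow> push a idR = a"
  using cont_alg_homsD(2) by (fastforce simp: push_def extensional_def)

lemma mult_closed:
  assumes "complete_algebra k T" "a \<in> cont_alg_homs k R T" "b \<in> cont_alg_homs k R T"
  shows "a \<otimes>\<^bsub>pts T\<^esub> b \<in> cont_alg_homs k R T"
  using cont_alg_homs_compose[OF R_lin_top R2_lin_top complete_lin_top[OF assms(1)] mu_hom
    copair_props(1)[OF R_lin_top R_lin_top assms]] by simp

text \<open>The pair of the pushed points and the composite of \<open>f\<close> with the pair have
  the same components, so they coincide by uniqueness. Composing with \<open>\<mu>\<close> gives
  naturality of the addition.\<close>

lemma push_mult:
  assumes T: "complete_algebra k T" and T': "complete_algebra k T'" and f: "f \<in> cont_alg_homs k T T'"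
    and a: "a \<in> cont_alg_homs k R T" and b: "b \<in> cont_alg_homs k R T"
  shows "push f (a \<otimes>\<^bsub>pts T\<^esub> b) = push f a \<otimes>\<^bsub>pts T'\<^esub> push f b"
proof -
  note lt = complete_lin_top[OF T] complete_lin_top[OF T']
  note c = copair_props[OF R_lin_top R_lin_top T a b]
  have "copair k R R T' (push f a) (push f b) = (\<lambda>z\<in>carrier R2. f (copair k R R T a b z))"
    by (rule copair_unique[OF R_lin_top R_lin_top T' cont_alg_homs_compose[OF R2_lin_top lt c(1) f]])
      (use c cont_alg_homsD(5)[OF coprojections(1)[OF R_lin_top R_lin_top]]
         cont_alg_homsD(5)[OF coprojections(2)[OF R_lin_top R_lin_top]] in \<open>simp_all add: push_def\<close>)
  then show ?thesis using cont_alg_homsD(5)[OF mu_hom] by (auto simp: push_def)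
qed

text \<open>The zero point is the composite of \<open>\<epsilon>\<close> with the structure map of
  \<open>T\<close>, which is continuous because \<open>k\<close> is discrete.\<close>

lemma one_closed':
  assumes T: "complete_algebra k T" shows "\<one>\<^bsub>pts T\<^esub> \<in> cont_alg_homs k R T"
proof -
  have lt: "lin_top_algebra k T" using complete_lin_top[OF T] .
  interpret T: cring T using lin_topD(2)[OF lt] .
  interpret TPQ: Module.algebra k T using lin_topD(1)[OF lt] .
  have "(\<lambda>c\<in>carrier kk. c \<odot>\<^bsub>T\<^esub> \<one>\<^bsub>T\<^esub>) \<in> cont_alg_homs k kk T"
    unfolding cont_alg_homs_iff[OF kk_lin_top lt]
  proof (intro conjI ballI)
    have "(a \<otimes>\<^bsub>k\<^esub> b) \<odot>\<^bsub>T\<^esub> \<one>\<^bsub>T\<^esub> = (a \<odot>\<^bsub>T\<^esub> \<one>\<^bsub>T\<^esub>) \<otimes>\<^bsub>T\<^esub> (b \<odot>\<^bsub>T\<^esub> \<one>\<^bsub>T\<^esub>)" if "a \<in> carrier k" "b \<in> carrier k" for a b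
      using that TPQ.smult_assoc2[of a "\<one>\<^bsub>T\<^esub>" "b \<odot>\<^bsub>T\<^esub> \<one>\<^bsub>T\<^esub>"] TPQ.smult_assoc1[of a b "\<one>\<^bsub>T\<^esub>"] by simp
    then show "(\<lambda>c\<in>carrier kk. c \<odot>\<^bsub>T\<^esub> \<one>\<^bsub>T\<^esub>) \<in> ring_hom kk T"
      using kk.m_closed kk.a_closed kk.one_closed by (intro ring_hom_memI) (auto simp: TPQ.smult_l_distr)
    have "{\<zero>\<^bsub>k\<^esub>} \<in> open_ideals kk" using base_algebra_complete(2)[OF k] kk.zeroideal by simp
    moreover have "\<zero>\<^bsub>k\<^esub> \<odot>\<^bsub>T\<^esub> \<one>\<^bsub>T\<^esub> = \<zero>\<^bsub>T\<^esub>" by simp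
    moreover have "\<zero>\<^bsub>k\<^esub> \<in> carrier k" using kk.zero_closed by simp
    moreover fix J assume "J \<in> open_ideals T"
    then have "\<zero>\<^bsub>T\<^esub> \<in> J" using lin_topD(6)[OF lt] additive_subgroup.zero_closed ideal.axioms(1) by blast
    ultimately show "\<exists>K\<in>open_ideals kk. (\<lambda>c\<in>carrier kk. c \<odot>\<^bsub>T\<^esub> \<one>\<^bsub>T\<^esub>) ` K \<subseteq> J"
      by (intro bexI[of _ "{\<zero>\<^bsub>k\<^esub>}"]) auto
  qed (use kk.m_closed TPQ.smult_assoc1 in auto)
  from push_closed[OF kk_lin_top lt this eps_hom] show ?thesis
    using cont_alg_homsD(5)[OF eps_hom] by (simp add: push_def cong: restrict_cong)
qed

lemma push_one:
  assumes T: "complete_algebra k T" and T': "complete_algebra k T'" and f: "f \<in> cont_alg_homs k T T'"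
  shows "push f \<one>\<^bsub>pts T\<^esub> = \<one>\<^bsub>pts T'\<^esub>"
proof -
  interpret T: cring T using lin_topD(2)[OF complete_lin_top[OF T]] .
  have "f (\<epsilon> r \<odot>\<^bsub>T\<^esub> \<one>\<^bsub>T\<^esub>) = \<epsilon> r \<odot>\<^bsub>T'\<^esub> \<one>\<^bsub>T'\<^esub>" if "r \<in> carrier R" for r
    using cont_alg_homsD(3)[OF f, of "\<epsilon> r" "\<one>\<^bsub>T\<^esub>"] cont_alg_homsD(5)[OF eps_hom that] ring_hom_one[OF cont_alg_homsD(1)[OF f]]
    by simp
  then show ?thesis by (auto simp: push_def)
qed

text \<open>Yoneda: the axioms are given for universal points, and any points \<open>a\<close>,
  \<open>b\<close>, \<open>d\<close> with values in \<open>T\<close> are the images of the universal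
  ones under the morphisms \<open>(a, b)\<close> and \<open>((a, b), d)\<close>. Since
  \<open>push\<close> respects addition and zero, the axioms are carried to
  \<open>T\<close>.\<close>

lemma points_comm_group:
  assumes T: "complete_algebra k T"
  shows "comm_group (pts T)"
proof (rule comm_groupI)
  note lt = complete_lin_top[OF T]
  let ?p1 = "\<lambda>r\<in>carrier R. in1 k R2 R (in1 k R R r)"
  let ?p2 = "\<lambda>r\<in>carrier R. in1 k R2 R (in2 k R R r)"
  let ?p3 = "in2 k R2 R"
  note c = coprojections[OF R_lin_top R_lin_top] and c3 = coprojections[OF R2_lin_top R_lin_top]
  have p: "?p1 \<in> cont_alg_homs k R R3" "?p2 \<in> cont_alg_homs k R R3"
    using push_closed[OF R2_lin_top complete_lin_top[OF R3] c3(1) c(1)]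
      push_closed[OF R2_lin_top complete_lin_top[OF R3] c3(1) c(2)] by (simp_all add: push_def)
  {
    fix a b assume "a \<in> carrier (pts T)" "b \<in> carrier (pts T)"
    then have ab: "a \<in> cont_alg_homs k R T" "b \<in> cont_alg_homs k R T" by simp_all
    show "a \<otimes>\<^bsub>pts T\<^esub> b \<in> carrier (pts T)" using mult_closed[OF T ab] by simp
    note h = copair_props[OF R_lin_top R_lin_top T ab]
    have pu: "push (copair k R R T a b) (in1 k R R) = a" "push (copair k R R T a b) (in2 k R R) = b"
      using h(2,3) cont_alg_homsD(2)[OF ab(1)] cont_alg_homsD(2)[OF ab(2)]
      by (auto simp: push_def extensional_def fun_eq_iff)
    have "in1 k R R \<otimes>\<^bsub>pts R2\<^esub> in2 k R R = in2 k R R \<otimes>\<^bsub>pts R2\<^esub> in1 k R R"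
      using grp unfolding comm_group_structure_def Let_def by blast
    from arg_cong[OF this, of "push (copair k R R T a b)"]
    show "a \<otimes>\<^bsub>pts T\<^esub> b = b \<otimes>\<^bsub>pts T\<^esub> a"
      unfolding push_mult[OF R2 T h(1) c(1,2)] push_mult[OF R2 T h(1) c(2,1)] pu .
    fix d assume "d \<in> carrier (pts T)"
    then have d: "d \<in> cont_alg_homs k R T" by simp
    note h3 = copair_props[OF R2_lin_top R_lin_top T h(1) d]
    \<comment> \<open>\<open>?h\<close> is the point \<open>((a, b), d)\<close>; it sends the three
      projections to \<open>a\<close>, \<open>b\<close> and \<open>d\<close>.\<close>
    let ?h = "copair k R2 R T (copair k R R T a b) d"
    have pu3: "push ?h ?p1 = a" "push ?h ?p2 = b" "push ?h ?p3 = d"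
      using h(2,3) h3(2,3) cont_alg_homsD(5)[OF c(1)] cont_alg_homsD(5)[OF c(2)]
        cont_alg_homsD(2)[OF ab(1)] cont_alg_homsD(2)[OF ab(2)] cont_alg_homsD(2)[OF d]
      by (auto simp: push_def extensional_def fun_eq_iff)
    have "(?p1 \<otimes>\<^bsub>pts R3\<^esub> ?p2) \<otimes>\<^bsub>pts R3\<^esub> ?p3 = ?p1 \<otimes>\<^bsub>pts R3\<^esub> (?p2 \<otimes>\<^bsub>pts R3\<^esub> ?p3)"
      using grp unfolding comm_group_structure_def Let_def by blast
    from arg_cong[OF this, of "push ?h"]
    show "a \<otimes>\<^bsub>pts T\<^esub> b \<otimes>\<^bsub>pts T\<^esub> d = a \<otimes>\<^bsub>pts T\<^esub> (b \<otimes>\<^bsub>pts T\<^esub> d)"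
      unfolding push_mult[OF R3 T h3(1) mult_closed[OF R3 p] c3(2)] push_mult[OF R3 T h3(1) p(1) mult_closed[OF R3 p(2) c3(2)]]
        push_mult[OF R3 T h3(1) p] push_mult[OF R3 T h3(1) p(2) c3(2)] pu3 .
  }
  show "\<one>\<^bsub>pts T\<^esub> \<in> carrier (pts T)" using one_closed'[OF T] by simp
  fix a assume "a \<in> carrier (pts T)"
  then have a: "a \<in> cont_alg_homs k R T" by simp
  have i: "idR \<in> cont_alg_homs k R R" using id_hom[OF R_lin_top] .
  have "\<one>\<^bsub>pts R\<^esub> \<otimes>\<^bsub>pts R\<^esub> idR = idR"
    using grp unfolding comm_group_structure_def Let_def by blast
  from arg_cong[OF this, of "push a"] show "\<one>\<^bsub>pts T\<^esub> \<otimes>\<^bsub>pts T\<^esub> a = a"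
    unfolding push_mult[OF R T a one_closed'[OF R] i] push_one[OF R T a] push_id[OF a] .
  obtain \<nu> where n: "\<nu> \<in> cont_alg_homs k R R" "\<nu> \<otimes>\<^bsub>pts R\<^esub> idR = \<one>\<^bsub>pts R\<^esub>"
    using grp unfolding comm_group_structure_def Let_def pts_sel(1) by blast
  from arg_cong[OF n(2), of "push a"] have "push a \<nu> \<otimes>\<^bsub>pts T\<^esub> a = \<one>\<^bsub>pts T\<^esub>"
    unfolding push_mult[OF R T a n(1) i] push_one[OF R T a] push_id[OF a] .
  moreover have "push a \<nu> \<in> carrier (pts T)" using push_closed[OF R_lin_top lt a n(1)] by simp
  ultimately show "\<exists>b\<in>carrier (pts T). b \<otimes>\<^bsub>pts T\<^esub> a = \<one>\<^bsub>pts T\<^esub>" by blast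
qed

lemma push_pow:
  assumes T: "complete_algebra k T" and T': "complete_algebra k T'" and f: "f \<in> cont_alg_homs k T T'"
    and a: "a \<in> cont_alg_homs k R T"
  shows "push f (a [^]\<^bsub>pts T\<^esub> (n::nat)) = push f a [^]\<^bsub>pts T'\<^esub> n"
proof -
  interpret G: comm_group "pts T" using points_comm_group[OF T] .
  have pc: "a [^]\<^bsub>pts T\<^esub> (n::nat) \<in> cont_alg_homs k R T" for n using G.nat_pow_closed[of a n] a by simp
  show ?thesis
    by (induction n) (simp_all only: nat_pow_0 nat_pow_Suc push_one[OF T T' f] push_mult[OF T T' f pc a])
qed

end

section \<open>Congruences between values of functions\<close>

context formal_group
begin

abbreviation "\<iota> \<equiv> to_lim (tensor_algebra k R R) (open_ideals (tensor_algebra k R R))"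

text \<open>Evaluation of algebraic tensors at a pair of points is a homomorphism; its behaviour at
  zero and at differences supplies the corresponding cases of \<open>tensor_induct\<close> in the
  congruences below.\<close>

lemma tensor_dense_induct:
  assumes T: "complete_algebra k T" and a: "a \<in> cont_alg_homs k R T" and b: "b \<in> cont_alg_homs k R T"
  shows "copair k R R T a b (\<iota> \<zero>\<^bsub>tensor_ring k R R\<^esub>) = \<zero>\<^bsub>T\<^esub>"
    "\<And>y z. y \<in> carrier (tensor_ring k R R) \<Longrightarrow> z \<in> carrier (tensor_ring k R R) \<Longrightarrow>
      copair k R R T a b (\<iota> (y \<ominus>\<^bsub>tensor_ring k R R\<^esub> z)) =
      copair k R R T a b (\<iota> y) \<ominus>\<^bsub>T\<^esub> copair k R R T a b (\<iota> z)"
    "\<And>z. z \<in> carrier (tensor_ring k R R) \<Longrightarrow> copair k R R T a b (\<iota> z) \<in> carrier T"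
proof -
  note lt = complete_lin_top[OF T]
  interpret T: cring T using lin_topD(2)[OF lt] .
  interpret TR: cring "tensor_ring k R R" using tensor_ring_cring[OF R_lin_top R_lin_top] .
  note sel = TA_sel[OF R_lin_top R_lin_top]
  have "\<iota> \<in> ring_hom (tensor_ring k R R) R2"
    using to_ctensor_hom[OF R_lin_top R_lin_top] by (simp add: ring_hom_def sel)
  from ring_hom_trans[OF this cont_alg_homsD(1)[OF copair_props(1)[OF R_lin_top R_lin_top T a b]]]
  have "(\<lambda>z. copair k R R T a b (\<iota> z)) \<in> ring_hom (tensor_ring k R R) T" by (simp add: comp_def)
  then interpret h: ring_hom_cring "tensor_ring k R R" T "\<lambda>z. copair k R R T a b (\<iota> z)"
    using T.is_cring TR.is_cring by (simp add: ring_hom_cring_def ring_hom_cring_axioms_def)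
  show "copair k R R T a b (\<iota> \<zero>\<^bsub>tensor_ring k R R\<^esub>) = \<zero>\<^bsub>T\<^esub>" by (rule h.hom_zero)
  fix z assume z: "z \<in> carrier (tensor_ring k R R)"
  show "copair k R R T a b (\<iota> z) \<in> carrier T" by (rule h.hom_closed[OF z])
  fix y assume y: "y \<in> carrier (tensor_ring k R R)"
  show "copair k R R T a b (\<iota> (y \<ominus>\<^bsub>tensor_ring k R R\<^esub> z)) =
      copair k R R T a b (\<iota> y) \<ominus>\<^bsub>T\<^esub> copair k R R T a b (\<iota> z)"
    unfolding a_minus_def using h.hom_add[OF y TR.a_inv_closed[OF z]] h.hom_a_inv[OF z] by simp
qed

text \<open>The value of \<open>r\<close> at a sum of points is the pairing of the points applied to
  \<open>\<mu> r\<close>. One algebraic tensor close to \<open>\<mu> r\<close> serves all pairs in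
  \<open>S\<close>, so relations between several sums can be tested on it.\<close>

lemma mult_approx:
  assumes T: "complete_algebra k T" and S: "finite S" "\<And>a b. (a, b) \<in> S \<Longrightarrow> a \<in> cont_alg_homs k R T \<and> b \<in> cont_alg_homs k R T"
    and J: "J \<in> open_ideals T" and r: "r \<in> carrier R"
  shows "\<exists>z\<in>carrier (tensor_ring k R R). \<forall>(a, b)\<in>S.
    (a \<otimes>\<^bsub>pts T\<^esub> b) r \<ominus>\<^bsub>T\<^esub> copair k R R T a b (\<iota> z) \<in> J"
proof -
  let ?H = "(\<lambda>(a, b). copair k R R T a b) ` S"
  have "?H \<subseteq> cont_alg_homs k R2 T"
    using copair_props(1)[OF R_lin_top R_lin_top T] S(2) by auto
  then obtain z where "z \<in> carrier (tensor_algebra k R R)" "\<forall>h\<in>?H. h (\<mu> r) \<ominus>\<^bsub>T\<^esub> h (\<iota> z) \<in> J"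
    using completion_approx[OF TA_lin_top[OF R_lin_top R_lin_top] complete_lin_top[OF T] finite_imageI[OF S(1)] _ J]
      cont_alg_homsD(5)[OF mu_hom r] unfolding ctensor_def by blast
  then show ?thesis using r TA_sel(1)[OF R_lin_top R_lin_top] by (intro bexI[of _ z]) auto
qed

text \<open>On a pure tensor the difference is \<open>a p\<close> times \<open>b q - e q\<close>,
  which lies in \<open>J\<close>; differences of tensors preserve this, and approximation extends it
  to \<open>\<mu> r\<close>. With \<open>e\<close> the zero point and \<open>J\<close> generated by
  x(b), it yields the divisibility of f(a + b) - f(a) by x(b).\<close>

lemma mult_cong_right:
  assumes T: "complete_algebra k T" and a: "a \<in> cont_alg_homs k R T" and b: "b \<in> cont_alg_homs k R T"
    and e: "e \<in> cont_alg_homs k R T" and J: "J \<in> open_ideals T"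
    and be: "\<And>q. q \<in> carrier R \<Longrightarrow> b q \<ominus>\<^bsub>T\<^esub> e q \<in> J" and r: "r \<in> carrier R"
  shows "(a \<otimes>\<^bsub>pts T\<^esub> b) r \<ominus>\<^bsub>T\<^esub> (a \<otimes>\<^bsub>pts T\<^esub> e) r \<in> J"
proof -
  note lt = complete_lin_top[OF T]
  interpret T: cring T using lin_topD(2)[OF lt] .
  interpret J: ideal J T using lin_topD(6)[OF lt J] .
  note ab = tensor_dense_induct[OF T a b] and ae = tensor_dense_induct[OF T a e]
  have in_J: "copair k R R T a b (\<iota> z) \<ominus>\<^bsub>T\<^esub> copair k R R T a e (\<iota> z) \<in> J"
    if "z \<in> carrier (tensor_ring k R R)" for z
    using that
  proof (induction z rule: tensor_induct[OF R_lin_top R_lin_top, consumes 1, case_names zero pure diff])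
    case zero
    show ?case unfolding ab(1) ae(1) by (simp add: a_minus_def)
  next
    case (pure p q)
    have "a p \<otimes>\<^bsub>T\<^esub> b q \<ominus>\<^bsub>T\<^esub> a p \<otimes>\<^bsub>T\<^esub> e q = a p \<otimes>\<^bsub>T\<^esub> (b q \<ominus>\<^bsub>T\<^esub> e q)"
      using cont_alg_homsD(5)[OF a pure(1)] cont_alg_homsD(5)[OF b pure(2)] cont_alg_homsD(5)[OF e pure(2)] by algebra
    then show ?case
      using copair_props(4)[OF R_lin_top R_lin_top T a b pure] copair_props(4)[OF R_lin_top R_lin_top T a e pure]
        J.I_l_closed[OF be[OF pure(2)] cont_alg_homsD(5)[OF a pure(1)]] by simp
  next
    case (diff y z)
    let ?f = "\<lambda>z. copair k R R T a b (\<iota> z)" and ?g = "\<lambda>z. copair k R R T a e (\<iota> z)"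
    have "(?f y \<ominus>\<^bsub>T\<^esub> ?f z) \<ominus>\<^bsub>T\<^esub> (?g y \<ominus>\<^bsub>T\<^esub> ?g z) = (?f y \<ominus>\<^bsub>T\<^esub> ?g y) \<ominus>\<^bsub>T\<^esub> (?f z \<ominus>\<^bsub>T\<^esub> ?g z)"
      using ab(3)[OF diff(1)] ab(3)[OF diff(2)] ae(3)[OF diff(1)] ae(3)[OF diff(2)] by algebra
    moreover have "\<dots> \<in> J" using diff J.a_closed J.a_inv_closed unfolding a_minus_def by blast
    ultimately show ?case unfolding ab(2)[OF diff(1,2)] ae(2)[OF diff(1,2)] by simp
  qed
  obtain z where z: "z \<in> carrier (tensor_ring k R R)"
    "(a \<otimes>\<^bsub>pts T\<^esub> b) r \<ominus>\<^bsub>T\<^esub> copair k R R T a b (\<iota> z) \<in> J"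
    "(a \<otimes>\<^bsub>pts T\<^esub> e) r \<ominus>\<^bsub>T\<^esub> copair k R R T a e (\<iota> z) \<in> J"
    using mult_approx[OF T, of "{(a, b), (a, e)}" J r] a b e J r by auto
  define m m' w w' where "m = (a \<otimes>\<^bsub>pts T\<^esub> b) r" and "m' = (a \<otimes>\<^bsub>pts T\<^esub> e) r"
    and "w = copair k R R T a b (\<iota> z)" and "w' = copair k R R T a e (\<iota> z)"
  have c: "m \<in> carrier T" "m' \<in> carrier T" "w \<in> carrier T" "w' \<in> carrier T"
    using cont_alg_homsD(5)[OF mult_closed[OF T a b] r] cont_alg_homsD(5)[OF mult_closed[OF T a e] r]
      ab(3)[OF z(1)] ae(3)[OF z(1)] by (simp_all only: m_def m'_def w_def w'_def)
  have "m \<ominus>\<^bsub>T\<^esub> m' = (m \<ominus>\<^bsub>T\<^esub> w) \<oplus>\<^bsub>T\<^esub> (w \<ominus>\<^bsub>T\<^esub> w') \<oplus>\<^bsub>T\<^esub> \<ominus>\<^bsub>T\<^esub> (m' \<ominus>\<^bsub>T\<^esub> w')" using c by algebra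
  also have "\<dots> \<in> J"
    using z(2,3) in_J[OF z(1)] J.a_closed J.a_inv_closed
    unfolding m_def[symmetric] m'_def[symmetric] w_def[symmetric] w'_def[symmetric] by blast
  finally show ?thesis unfolding m_def m'_def .
qed

text \<open>On a pure tensor the combination equals the product of \<open>a p - e p\<close> and
  \<open>b q - e q\<close>. With \<open>e\<close> the zero point it says that functions are additive
  on sums up to products of the two increments; for the coordinate this becomes x(a + b) = x(a) +
  x(b) modulo x(a) x(b).\<close>

lemma mult_second_order:
  assumes T: "complete_algebra k T" and a: "a \<in> cont_alg_homs k R T" and b: "b \<in> cont_alg_homs k R T"
    and e: "e \<in> cont_alg_homs k R T" and J: "J \<in> open_ideals T"
    and abe: "\<And>p q. p \<in> carrier R \<Longrightarrow> q \<in> carrier R \<Longrightarrow> (a p \<ominus>\<^bsub>T\<^esub> e p) \<otimes>\<^bsub>T\<^esub> (b q \<ominus>\<^bsub>T\<^esub> e q) \<in> J" and r: "r \<in> carrier R"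
  shows "(a \<otimes>\<^bsub>pts T\<^esub> b) r \<oplus>\<^bsub>T\<^esub> (e \<otimes>\<^bsub>pts T\<^esub> e) r \<ominus>\<^bsub>T\<^esub> ((a \<otimes>\<^bsub>pts T\<^esub> e) r \<oplus>\<^bsub>T\<^esub> (e \<otimes>\<^bsub>pts T\<^esub> b) r) \<in> J"
proof -
  note lt = complete_lin_top[OF T]
  interpret T: cring T using lin_topD(2)[OF lt] .
  interpret J: ideal J T using lin_topD(6)[OF lt J] .
  note ab = tensor_dense_induct[OF T a b] and ae = tensor_dense_induct[OF T a e]
    and eb = tensor_dense_induct[OF T e b] and ee = tensor_dense_induct[OF T e e]
  \<comment> \<open>\<open>F\<close> is additive in its four arguments jointly, so it is compatible
    with the differences of the induction and with the errors of approximation.\<close>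
  define F where "F = (\<lambda>s t u v. s \<oplus>\<^bsub>T\<^esub> t \<ominus>\<^bsub>T\<^esub> (u \<oplus>\<^bsub>T\<^esub> v))"
  have F_minus: "F (s \<ominus>\<^bsub>T\<^esub> s') (t \<ominus>\<^bsub>T\<^esub> t') (u \<ominus>\<^bsub>T\<^esub> u') (v \<ominus>\<^bsub>T\<^esub> v') = F s t u v \<ominus>\<^bsub>T\<^esub> F s' t' u' v'"
    if "s \<in> carrier T" "t \<in> carrier T" "u \<in> carrier T" "v \<in> carrier T"
      "s' \<in> carrier T" "t' \<in> carrier T" "u' \<in> carrier T" "v' \<in> carrier T" for s t u v s' t' u' v'
    unfolding F_def using that by algebra
  let ?G = "\<lambda>z. F (copair k R R T a b (\<iota> z)) (copair k R R T e e (\<iota> z)) (copair k R R T a e (\<iota> z)) (copair k R R T e b (\<iota> z))"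
  have in_J: "?G z \<in> J" if "z \<in> carrier (tensor_ring k R R)" for z
    using that
  proof (induction z rule: tensor_induct[OF R_lin_top R_lin_top, consumes 1, case_names zero pure diff])
    case zero
    show ?case unfolding ab(1) ae(1) eb(1) ee(1) F_def by (simp add: a_minus_def)
  next
    case (pure p q)
    have "F (a p \<otimes>\<^bsub>T\<^esub> b q) (e p \<otimes>\<^bsub>T\<^esub> e q) (a p \<otimes>\<^bsub>T\<^esub> e q) (e p \<otimes>\<^bsub>T\<^esub> b q) = (a p \<ominus>\<^bsub>T\<^esub> e p) \<otimes>\<^bsub>T\<^esub> (b q \<ominus>\<^bsub>T\<^esub> e q)"
      unfolding F_def using cont_alg_homsD(5)[OF a pure(1)] cont_alg_homsD(5)[OF e pure(1)]
        cont_alg_homsD(5)[OF b pure(2)] cont_alg_homsD(5)[OF e pure(2)] by algebra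
    then show ?case
      using copair_props(4)[OF R_lin_top R_lin_top T a b pure] copair_props(4)[OF R_lin_top R_lin_top T a e pure]
        copair_props(4)[OF R_lin_top R_lin_top T e b pure] copair_props(4)[OF R_lin_top R_lin_top T e e pure]
        abe[OF pure] by simp
  next
    case (diff y z)
    have "?G y \<ominus>\<^bsub>T\<^esub> ?G z \<in> J" using diff J.a_closed J.a_inv_closed unfolding a_minus_def by blast
    then show ?case
      unfolding ab(2)[OF diff(1,2)] ae(2)[OF diff(1,2)] eb(2)[OF diff(1,2)] ee(2)[OF diff(1,2)]
      by (subst F_minus) (use ab(3) ae(3) eb(3) ee(3) diff in simp_all)
  qed
  obtain z where z: "z \<in> carrier (tensor_ring k R R)"
    "(a \<otimes>\<^bsub>pts T\<^esub> b) r \<ominus>\<^bsub>T\<^esub> copair k R R T a b (\<iota> z) \<in> J"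
    "(e \<otimes>\<^bsub>pts T\<^esub> e) r \<ominus>\<^bsub>T\<^esub> copair k R R T e e (\<iota> z) \<in> J"
    "(a \<otimes>\<^bsub>pts T\<^esub> e) r \<ominus>\<^bsub>T\<^esub> copair k R R T a e (\<iota> z) \<in> J"
    "(e \<otimes>\<^bsub>pts T\<^esub> b) r \<ominus>\<^bsub>T\<^esub> copair k R R T e b (\<iota> z) \<in> J"
    using mult_approx[OF T, of "{(a, b), (a, e), (e, b), (e, e)}" J r] a b e J r by auto
  have c: "(a \<otimes>\<^bsub>pts T\<^esub> b) r \<in> carrier T" "(e \<otimes>\<^bsub>pts T\<^esub> e) r \<in> carrier T"
      "(a \<otimes>\<^bsub>pts T\<^esub> e) r \<in> carrier T" "(e \<otimes>\<^bsub>pts T\<^esub> b) r \<in> carrier T"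
    by (rule cont_alg_homsD(5)[OF mult_closed[OF T] r]; rule a b e)+
  let ?M = "F ((a \<otimes>\<^bsub>pts T\<^esub> b) r) ((e \<otimes>\<^bsub>pts T\<^esub> e) r) ((a \<otimes>\<^bsub>pts T\<^esub> e) r) ((e \<otimes>\<^bsub>pts T\<^esub> b) r)"
  have FJ: "F s t u v \<in> J" if "s \<in> J" "t \<in> J" "u \<in> J" "v \<in> J" for s t u v
    unfolding F_def using that J.a_closed J.a_inv_closed unfolding a_minus_def by blast
  have Fc: "F s t u v \<in> carrier T" if "s \<in> carrier T" "t \<in> carrier T" "u \<in> carrier T" "v \<in> carrier T" for s t u v
    unfolding F_def using that by simp
  have "?M \<ominus>\<^bsub>T\<^esub> ?G z \<in> J"
    using FJ[OF z(2,3,4,5)] F_minus[OF c ab(3)[OF z(1)] ee(3)[OF z(1)] ae(3)[OF z(1)] eb(3)[OF z(1)]] by (simp only:)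
  then have "(?M \<ominus>\<^bsub>T\<^esub> ?G z) \<oplus>\<^bsub>T\<^esub> ?G z \<in> J" using in_J[OF z(1)] J.a_closed by blast
  moreover have "(?M \<ominus>\<^bsub>T\<^esub> ?G z) \<oplus>\<^bsub>T\<^esub> ?G z = ?M"
    using Fc[OF c] Fc[OF ab(3)[OF z(1)] ee(3)[OF z(1)] ae(3)[OF z(1)] eb(3)[OF z(1)]]
    by (simp only: a_minus_def T.a_assoc T.a_inv_closed T.l_neg T.r_zero)
  ultimately show ?thesis by (simp only: F_def)
qed

end

section \<open>The functions \<open>v\<^sub>n\<close>\<close>

text \<open>A neighbourhood of zero in the limit topology restricts finitely many components, and a
  high power of \<open>y\<close> vanishes in all of them. That power then lies in the image of
  \<open>J\<close>, and injectivity of the map to the limit puts it into \<open>J\<close>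
  itself.\<close>

lemma principal_power_open:
  assumes R: "formal_algebra k R" and lim: "is_lim_of_quotients R {PIdl\<^bsub>R\<^esub> (y [^]\<^bsub>R\<^esub> m) | m::nat. True}"
    and y: "y \<in> carrier R" and J: "J \<in> open_ideals R"
  shows "\<exists>m::nat. y [^]\<^bsub>R\<^esub> m \<in> J"
proof -
  let ?Y = "{PIdl\<^bsub>R\<^esub> (y [^]\<^bsub>R\<^esub> m) | m::nat. True}"
  have lt: "lin_top_algebra k R" using R unfolding formal_algebra_def by blast
  interpret cring R using lin_topD(2)[OF lt] .
  let ?f = "to_lim R ?Y"
  have hm: "homeomorphic_map (opens R) (opens (lim_algebra R ?Y)) ?f" using lim unfolding is_lim_of_quotients_def .
  have inj: "inj_on ?f (carrier R)" using homeomorphic_imp_injective_map[OF hm] lin_topD(3)[OF lt] by simp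
  have J0: "openin (opens R) J" "ideal J R" using J unfolding open_ideals_def by auto
  have Jc: "J \<subseteq> carrier R" "\<zero>\<^bsub>R\<^esub> \<in> J"
    using ideal_subset_carrier[OF J0(2)] additive_subgroup.zero_closed[OF ideal.axioms(1)[OF J0(2)]] .
  define X where "X = product_topology (\<lambda>J. opens (quot_algebra R J)) ?Y"
  have "openin (opens (lim_algebra R ?Y)) (?f ` J)"
    using homeomorphic_imp_open_map[OF hm] J0(1) unfolding open_map_def by blast
  then obtain W where W: "openin X W" "?f ` J = W \<inter> lim_families R ?Y"
    by (auto simp: lim_algebra_def X_def openin_subtopology)
  have "?f \<zero>\<^bsub>R\<^esub> \<in> W" using W(2) Jc(2) by blast
  from bspec[OF iffD1[OF openin_product_topology_alt W(1)[unfolded X_def]] this]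
  obtain V where V: "finite {i \<in> ?Y. V i \<noteq> topspace (opens (quot_algebra R i))}" "?f \<zero>\<^bsub>R\<^esub> \<in> PiE ?Y V" "PiE ?Y V \<subseteq> W"
    by (elim exE conjE)
  let ?F = "{i \<in> ?Y. V i \<noteq> topspace (opens (quot_algebra R i))}"
  have "\<forall>i\<in>?F. \<exists>m::nat. i = PIdl\<^bsub>R\<^esub> (y [^]\<^bsub>R\<^esub> m)" by blast
  then obtain mf where mf: "\<forall>i\<in>?F. i = PIdl\<^bsub>R\<^esub> (y [^]\<^bsub>R\<^esub> (mf i :: nat))" by (rule bchoice[THEN exE])
  \<comment> \<open>\<open>M\<close> bounds the exponents that belong to the finitely many
    restricted components.\<close>
  obtain M where M: "\<forall>i\<in>?F. mf i \<le> M" using V(1) finite_nat_set_iff_bounded_le[of "mf ` ?F"] by auto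
  have pid: "ideal (PIdl\<^bsub>R\<^esub> (y [^]\<^bsub>R\<^esub> m)) R" for m :: nat using cgenideal_ideal y by simp
  have yM: "y [^]\<^bsub>R\<^esub> M \<in> carrier R" using y by simp
  have "?f (y [^]\<^bsub>R\<^esub> M) i \<in> V i" if i: "i \<in> ?Y" for i
  proof (cases "i \<in> ?F")
    case True
    have "y [^]\<^bsub>R\<^esub> M = y [^]\<^bsub>R\<^esub> (M - mf i) \<otimes>\<^bsub>R\<^esub> y [^]\<^bsub>R\<^esub> mf i" using M True y by (simp add: nat_pow_mult)
    then have "y [^]\<^bsub>R\<^esub> M \<in> PIdl\<^bsub>R\<^esub> (y [^]\<^bsub>R\<^esub> mf i)" unfolding cgenideal_def using y by auto
    then have yi: "y [^]\<^bsub>R\<^esub> M \<in> i" using bspec[OF mf True] by simp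
    have ii: "ideal i R" using i pid by blast
    have "i +>\<^bsub>R\<^esub> (y [^]\<^bsub>R\<^esub> M) = i +>\<^bsub>R\<^esub> \<zero>\<^bsub>R\<^esub>"
      using coset_eq_iff[OF ii yM zero_closed] yi yM by (simp add: a_minus_def)
    then have "?f (y [^]\<^bsub>R\<^esub> M) i = ?f \<zero>\<^bsub>R\<^esub> i" using i by (simp add: to_lim_def)
    then show ?thesis using PiE_mem[OF V(2) i] by simp
  next
    case False
    then have "V i = carrier (R Quot i)" using i by auto
    then show ?thesis using i yM unfolding carrier_quot by (simp add: to_lim_def)
  qed
  then have "?f (y [^]\<^bsub>R\<^esub> M) \<in> PiE ?Y V" by (auto simp: PiE_iff to_lim_def)
  moreover have "?f (y [^]\<^bsub>R\<^esub> M) \<in> lim_families R ?Y"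
    using homeomorphic_imp_surjective_map[OF hm] yM lin_topD(3)[OF lt] topspace_lim by blast
  ultimately have "?f (y [^]\<^bsub>R\<^esub> M) \<in> ?f ` J" using W(2) V(3) by blast
  then obtain j where "j \<in> J" "?f (y [^]\<^bsub>R\<^esub> M) = ?f j" by blast
  then have "y [^]\<^bsub>R\<^esub> M = j" using inj_onD[OF inj] yM Jc by blast
  then show ?thesis using \<open>j \<in> J\<close> by blast
qed

text \<open>Openness of the ideal generated by the square of \<open>x\<close> lets congruences
  modulo that square pass through the completed tensor product.\<close>

locale coordinate_group = formal_group +
  fixes x :: 'c
  assumes x: "coordinate k R \<epsilon> x" and x2_open: "PIdl\<^bsub>R\<^esub> (x \<otimes>\<^bsub>R\<^esub> x) \<in> open_ideals R"
begin

lemma x_closed [simp]: "x \<in> carrier R"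
  using x unfolding coordinate_def regular_element_def by blast

lemma x_cancel:
  assumes "r \<in> carrier R" "s \<in> carrier R" "x \<otimes>\<^bsub>R\<^esub> r = x \<otimes>\<^bsub>R\<^esub> s" shows "r = s"
proof -
  have "x \<otimes>\<^bsub>R\<^esub> (r \<ominus>\<^bsub>R\<^esub> s) = x \<otimes>\<^bsub>R\<^esub> r \<ominus>\<^bsub>R\<^esub> x \<otimes>\<^bsub>R\<^esub> s" using assms(1,2) x_closed by algebra
  then have "x \<otimes>\<^bsub>R\<^esub> (r \<ominus>\<^bsub>R\<^esub> s) = \<zero>\<^bsub>R\<^esub>" using assms R.r_neg by (simp add: a_minus_def)
  then have "r \<ominus>\<^bsub>R\<^esub> s = \<zero>\<^bsub>R\<^esub>"
    using x R.minus_closed[OF assms(1,2)] unfolding coordinate_def regular_element_def by blast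
  then show ?thesis using R.r_right_minus_eq assms by simp
qed

lemma eps_zero_iff: "r \<in> carrier R \<Longrightarrow> \<epsilon> r = \<zero>\<^bsub>k\<^esub> \<longleftrightarrow> (\<exists>s\<in>carrier R. r = x \<otimes>\<^bsub>R\<^esub> s)"
proof -
  assume r: "r \<in> carrier R"
  have "PIdl\<^bsub>R\<^esub> x = a_kernel R kk \<epsilon>" using x unfolding coordinate_def by blast
  then have "r \<in> PIdl\<^bsub>R\<^esub> x \<longleftrightarrow> \<epsilon> r = \<zero>\<^bsub>k\<^esub>" using r by (simp add: a_kernel_def')
  then show ?thesis using R.m_comm unfolding cgenideal_def by auto
qed

lemma eps_x: "\<epsilon> x = \<zero>\<^bsub>k\<^esub>"
  using eps_zero_iff[OF x_closed] by (auto intro!: bexI[of _ "\<one>\<^bsub>R\<^esub>"])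

text \<open>Since \<open>x\<close> generates the kernel of \<open>\<epsilon>\<close>, a point is determined modulo its \<open>x\<close>-coordinate.\<close>

lemma point_cong_one:
  assumes T: "complete_algebra k T" and a: "a \<in> cont_alg_homs k R T" and q: "q \<in> carrier R"
  shows "\<exists>s\<in>carrier T. a q \<ominus>\<^bsub>T\<^esub> \<one>\<^bsub>pts T\<^esub> q = a x \<otimes>\<^bsub>T\<^esub> s"
proof -
  interpret T: cring T using lin_topD(2)[OF complete_lin_top[OF T]] .
  interpret TA: Module.algebra k T using lin_topD(1)[OF complete_lin_top[OF T]] .
  note A = cont_alg_homsD[OF a]
  interpret a: ring_hom_cring R T a
    using A(1) R.is_cring T.is_cring by (simp add: ring_hom_cring_def ring_hom_cring_axioms_def)
  interpret e: ring_hom_cring R kk \<epsilon>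
    using cont_alg_homsD(1)[OF eps_hom] R.is_cring kk.is_cring by (simp add: ring_hom_cring_def ring_hom_cring_axioms_def)
  have e: "\<epsilon> q \<in> carrier k" using cont_alg_homsD(5)[OF eps_hom q] by simp
  have ec: "\<epsilon> q \<odot>\<^bsub>R\<^esub> \<one>\<^bsub>R\<^esub> \<in> carrier R" using e by simp
  have "\<epsilon> (\<epsilon> q \<odot>\<^bsub>R\<^esub> \<one>\<^bsub>R\<^esub>) = \<epsilon> q"
    using cont_alg_homsD(3)[OF eps_hom e R.one_closed] e.hom_one kk.r_one e by simp
  then have "\<epsilon> (q \<ominus>\<^bsub>R\<^esub> \<epsilon> q \<odot>\<^bsub>R\<^esub> \<one>\<^bsub>R\<^esub>) = \<zero>\<^bsub>k\<^esub>"
    using e.hom_add[OF q R.a_inv_closed[OF ec]] e.hom_a_inv[OF ec] kk.r_neg[of "\<epsilon> q"] e by (simp add: a_minus_def)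
  then obtain s where s: "s \<in> carrier R" "q \<ominus>\<^bsub>R\<^esub> \<epsilon> q \<odot>\<^bsub>R\<^esub> \<one>\<^bsub>R\<^esub> = x \<otimes>\<^bsub>R\<^esub> s"
    using eps_zero_iff[OF R.minus_closed[OF q ec]] by blast
  have "a q \<ominus>\<^bsub>T\<^esub> a (\<epsilon> q \<odot>\<^bsub>R\<^esub> \<one>\<^bsub>R\<^esub>) = a (q \<ominus>\<^bsub>R\<^esub> \<epsilon> q \<odot>\<^bsub>R\<^esub> \<one>\<^bsub>R\<^esub>)" using q ec by (simp add: a_minus_def)
  also have "\<dots> = a x \<otimes>\<^bsub>T\<^esub> a s" using s by simp
  finally have "a q \<ominus>\<^bsub>T\<^esub> \<one>\<^bsub>pts T\<^esub> q = a x \<otimes>\<^bsub>T\<^esub> a s" using A(3)[OF e R.one_closed] q by simp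
  then show ?thesis using s a.hom_closed by blast
qed

abbreviation "v \<equiv> v_fun k R \<mu> \<epsilon> x"
abbreviation "mul n \<equiv> idR [^]\<^bsub>pts R\<^esub> (n::nat)"

sublocale ptsR: comm_group "pts R" using points_comm_group[OF R] .
sublocale ptsk: comm_group "pts kk" using points_comm_group[OF kk] .

lemma id_closed: "idR \<in> cont_alg_homs k R R" using id_hom[OF R_lin_top] .

lemma mul_closed: "mul n \<in> cont_alg_homs k R R"
  using ptsR.nat_pow_closed[of idR n] id_closed by (simp only: pts_sel(1))

lemma one_eps: "\<one>\<^bsub>pts kk\<^esub> = \<epsilon>"
proof (rule extensionalityI[of _ "carrier R"])
  show "\<epsilon> \<in> extensional (carrier R)" using cont_alg_homsD(2)[OF eps_hom] .
  fix r assume "r \<in> carrier R"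
  then show "\<one>\<^bsub>pts kk\<^esub> r = \<epsilon> r" using kk.r_one cont_alg_homsD(5)[OF eps_hom] by simp
qed simp

text \<open>Since x(n 0) = x(0) = 0, multiplication by n sends \<open>x\<close> into the kernel of
  \<open>\<epsilon>\<close>, which \<open>x\<close> generates; regularity of \<open>x\<close> makes
  the quotient unique.\<close>

lemma v_props: "v n \<in> carrier R" "mul n x = x \<otimes>\<^bsub>R\<^esub> v n"
proof -
  have "push \<epsilon> (mul n) = \<epsilon> [^]\<^bsub>pts kk\<^esub> n" using push_pow[OF R kk eps_hom id_closed] push_id[OF eps_hom] by simp
  also have "\<dots> = \<epsilon>" using ptsk.nat_pow_one[of n] by (simp only: one_eps)
  finally have "\<epsilon> (mul n x) = \<zero>\<^bsub>k\<^esub>" using eps_x by (metis push_def restrict_apply' x_closed)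
  then obtain w where w: "w \<in> carrier R" "mul n x = x \<otimes>\<^bsub>R\<^esub> w"
    using eps_zero_iff[OF cont_alg_homsD(5)[OF mul_closed x_closed]] by blast
  have "v n = w" unfolding v_fun_def
    by (rule the_equality) (use w x_cancel in auto)
  then show "v n \<in> carrier R" "mul n x = x \<otimes>\<^bsub>R\<^esub> v n" using w by auto
qed

text \<open>The endomorphism for n, applied to the m-th multiple of the universal point, gives the
  m-th multiple of the n-th.\<close>

lemma mul_mul: "push (mul n) (mul m) = mul (m * n)"
  using push_pow[OF R R mul_closed id_closed, of n m] push_id[OF mul_closed, of n]
    ptsR.nat_pow_pow[of idR n m] id_closed by (simp add: mult.commute)

text \<open>Cancel x(a) in x(mn a) = x(na) v_m(na) = x(a) v_n(a) v_m(na).\<close>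

lemma v_mult_univ: "v (m * n) = mul n (v m) \<otimes>\<^bsub>R\<^esub> v n"
proof (rule x_cancel)
  note M = cont_alg_homsD[OF mul_closed[of n]]
  show c: "v (m * n) \<in> carrier R" "mul n (v m) \<otimes>\<^bsub>R\<^esub> v n \<in> carrier R" using v_props M(5) by simp_all
  have "x \<otimes>\<^bsub>R\<^esub> v (m * n) = mul n (mul m x)"
    unfolding v_props(2)[symmetric] mul_mul[symmetric] by (simp add: push_def)
  also have "\<dots> = mul n x \<otimes>\<^bsub>R\<^esub> mul n (v m)"
    using ring_hom_mult[OF M(1) x_closed v_props(1)] v_props(2)[of m] by simp
  also have "\<dots> = x \<otimes>\<^bsub>R\<^esub> (mul n (v m) \<otimes>\<^bsub>R\<^esub> v n)"
    using v_props M(5)[OF v_props(1)[of m]] by (simp add: R.m_ac)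
  finally show "x \<otimes>\<^bsub>R\<^esub> v (m * n) = x \<otimes>\<^bsub>R\<^esub> (mul n (v m) \<otimes>\<^bsub>R\<^esub> v n)" .
qed

text \<open>By induction x(na) = n x(a) modulo x(a)^2. Dividing by the regular element
  \<open>x\<close> gives v_n = n modulo \<open>x\<close>, and \<open>\<epsilon>\<close> kills
  \<open>x\<close>.\<close>

lemma eps_v: "\<epsilon> (v n) = [n] \<cdot>\<^bsub>kk\<^esub> \<one>\<^bsub>kk\<^esub>"
proof -
  let ?J = "PIdl\<^bsub>R\<^esub> (x \<otimes>\<^bsub>R\<^esub> x)"
  have Ji: "ideal ?J R" using R.cgenideal_ideal by simp
  interpret J: ideal ?J R by fact
  have J: "z \<in> ?J \<longleftrightarrow> (\<exists>s\<in>carrier R. z = x \<otimes>\<^bsub>R\<^esub> (x \<otimes>\<^bsub>R\<^esub> s))" for z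
    unfolding cgenideal_def using R.m_ac by auto
  let ?e = "\<one>\<^bsub>pts R\<^esub>"
  have ec: "?e \<in> cont_alg_homs k R R" using one_closed'[OF R] .
  have ex: "?e x = \<zero>\<^bsub>R\<^esub>" using eps_x by simp
  have "mul n x \<ominus>\<^bsub>R\<^esub> [n] \<cdot>\<^bsub>R\<^esub> x \<in> ?J"
  proof (induction n)
    case 0
    then show ?case using ex by (simp add: a_minus_def)
  next
    case (Suc n)
    \<comment> \<open>The increments of the points na and a from the zero point are both multiples
      of \<open>x\<close>, so their products lie in the ideal generated by the square.\<close>
    have "(mul n \<otimes>\<^bsub>pts R\<^esub> idR) x \<oplus>\<^bsub>R\<^esub> (?e \<otimes>\<^bsub>pts R\<^esub> ?e) x \<ominus>\<^bsub>R\<^esub>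
        ((mul n \<otimes>\<^bsub>pts R\<^esub> ?e) x \<oplus>\<^bsub>R\<^esub> (?e \<otimes>\<^bsub>pts R\<^esub> idR) x) \<in> ?J"
    proof (rule mult_second_order[OF R mul_closed id_closed ec x2_open _ x_closed])
      fix p q assume p: "p \<in> carrier R" and q: "q \<in> carrier R"
      obtain s where s: "s \<in> carrier R" "mul n p \<ominus>\<^bsub>R\<^esub> ?e p = mul n x \<otimes>\<^bsub>R\<^esub> s"
        using point_cong_one[OF R mul_closed p] by blast
      obtain t where t: "t \<in> carrier R" "idR q \<ominus>\<^bsub>R\<^esub> ?e q = idR x \<otimes>\<^bsub>R\<^esub> t"
        using point_cong_one[OF R id_closed q] by blast
      have "(x \<otimes>\<^bsub>R\<^esub> v n \<otimes>\<^bsub>R\<^esub> s) \<otimes>\<^bsub>R\<^esub> (x \<otimes>\<^bsub>R\<^esub> t) = x \<otimes>\<^bsub>R\<^esub> (x \<otimes>\<^bsub>R\<^esub> (v n \<otimes>\<^bsub>R\<^esub> s \<otimes>\<^bsub>R\<^esub> t))"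
        using s t v_props(1)[of n] by (simp add: R.m_ac)
      moreover have "v n \<otimes>\<^bsub>R\<^esub> s \<otimes>\<^bsub>R\<^esub> t \<in> carrier R" using s t v_props(1)[of n] by simp
      ultimately show "(mul n p \<ominus>\<^bsub>R\<^esub> ?e p) \<otimes>\<^bsub>R\<^esub> (idR q \<ominus>\<^bsub>R\<^esub> ?e q) \<in> ?J"
        unfolding J s(2) t(2) v_props(2) by auto
    qed
    moreover have "mul n \<otimes>\<^bsub>pts R\<^esub> ?e = mul n" "?e \<otimes>\<^bsub>pts R\<^esub> idR = idR" "?e \<otimes>\<^bsub>pts R\<^esub> ?e = ?e"
      using ptsR.r_one[of "mul n"] ptsR.l_one[of idR] ptsR.l_one[of ?e] mul_closed id_closed ec
      by (simp_all only: pts_sel(1))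
    ultimately have "mul (Suc n) x \<oplus>\<^bsub>R\<^esub> \<zero>\<^bsub>R\<^esub> \<ominus>\<^bsub>R\<^esub> (mul n x \<oplus>\<^bsub>R\<^esub> x) \<in> ?J" using ex by (simp only: nat_pow_Suc) simp
    then have "(mul (Suc n) x \<oplus>\<^bsub>R\<^esub> \<zero>\<^bsub>R\<^esub> \<ominus>\<^bsub>R\<^esub> (mul n x \<oplus>\<^bsub>R\<^esub> x)) \<oplus>\<^bsub>R\<^esub> (mul n x \<ominus>\<^bsub>R\<^esub> [n] \<cdot>\<^bsub>R\<^esub> x) \<in> ?J"
      using Suc J.a_closed by blast
    moreover have "(mul (Suc n) x \<oplus>\<^bsub>R\<^esub> \<zero>\<^bsub>R\<^esub> \<ominus>\<^bsub>R\<^esub> (mul n x \<oplus>\<^bsub>R\<^esub> x)) \<oplus>\<^bsub>R\<^esub> (mul n x \<ominus>\<^bsub>R\<^esub> [n] \<cdot>\<^bsub>R\<^esub> x)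
        = mul (Suc n) x \<ominus>\<^bsub>R\<^esub> ([n] \<cdot>\<^bsub>R\<^esub> x \<oplus>\<^bsub>R\<^esub> x)"
    proof -
      have "(s \<oplus>\<^bsub>R\<^esub> \<zero>\<^bsub>R\<^esub> \<ominus>\<^bsub>R\<^esub> (t \<oplus>\<^bsub>R\<^esub> x)) \<oplus>\<^bsub>R\<^esub> (t \<ominus>\<^bsub>R\<^esub> w) = s \<ominus>\<^bsub>R\<^esub> (w \<oplus>\<^bsub>R\<^esub> x)"
        if "s \<in> carrier R" "t \<in> carrier R" "w \<in> carrier R" for s t w
        using that x_closed by algebra
      then show ?thesis
        using cont_alg_homsD(5)[OF mul_closed[of n] x_closed] cont_alg_homsD(5)[OF mul_closed[of "Suc n"] x_closed]
          R.add.nat_pow_closed[OF x_closed] by blast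
    qed
    ultimately show ?case by (simp only: R.add.nat_pow_Suc)
  qed
  then obtain s where s: "s \<in> carrier R" "mul n x \<ominus>\<^bsub>R\<^esub> [n] \<cdot>\<^bsub>R\<^esub> x = x \<otimes>\<^bsub>R\<^esub> (x \<otimes>\<^bsub>R\<^esub> s)" unfolding J by blast
  have n1: "[n] \<cdot>\<^bsub>R\<^esub> \<one>\<^bsub>R\<^esub> \<in> carrier R" by simp
  have "x \<otimes>\<^bsub>R\<^esub> v n \<ominus>\<^bsub>R\<^esub> x \<otimes>\<^bsub>R\<^esub> ([n] \<cdot>\<^bsub>R\<^esub> \<one>\<^bsub>R\<^esub>) = x \<otimes>\<^bsub>R\<^esub> (x \<otimes>\<^bsub>R\<^esub> s)"
    using s(2) v_props(2)[of n] by (simp add: R.add_pow_rdistr)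
  then have "x \<otimes>\<^bsub>R\<^esub> (v n \<ominus>\<^bsub>R\<^esub> [n] \<cdot>\<^bsub>R\<^esub> \<one>\<^bsub>R\<^esub>) = x \<otimes>\<^bsub>R\<^esub> (x \<otimes>\<^bsub>R\<^esub> s)"
    using v_props(1)[of n] n1 by (simp add: a_minus_def R.r_distr R.r_minus)
  then have e: "v n \<ominus>\<^bsub>R\<^esub> [n] \<cdot>\<^bsub>R\<^esub> \<one>\<^bsub>R\<^esub> = x \<otimes>\<^bsub>R\<^esub> s" by (rule x_cancel[rotated 2]) (use v_props(1)[of n] s(1) n1 in simp_all)
  interpret e: ring_hom_cring R kk \<epsilon>
    using cont_alg_homsD(1)[OF eps_hom] R.is_cring kk.is_cring by (simp add: ring_hom_cring_def ring_hom_cring_axioms_def)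
  have en: "\<epsilon> ([n] \<cdot>\<^bsub>R\<^esub> \<one>\<^bsub>R\<^esub>) = [n] \<cdot>\<^bsub>kk\<^esub> \<one>\<^bsub>kk\<^esub>" by (induction n) (simp_all del: base_algebra_sel)
  have "\<epsilon> (v n) \<ominus>\<^bsub>kk\<^esub> [n] \<cdot>\<^bsub>kk\<^esub> \<one>\<^bsub>kk\<^esub> = \<epsilon> (x \<otimes>\<^bsub>R\<^esub> s)"
    unfolding e[symmetric] en[symmetric] using v_props(1)[of n] n1 by (simp add: a_minus_def del: base_algebra_sel)
  also have "\<dots> = \<zero>\<^bsub>kk\<^esub>" using eps_x s e.hom_mult[OF x_closed s(1)] kk.l_null[of "\<epsilon> s"] e.hom_closed[OF s(1)] by simp
  finally show ?thesis using kk.r_right_minus_eq e.hom_closed[OF v_props(1)[of n]] kk.add.nat_pow_closed[OF kk.one_closed] by simp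
qed

section \<open>The identities evaluated at sections\<close>

lemma point_pow_x:
  assumes u: "u \<in> cont_alg_homs k R kk"
  shows "(u [^]\<^bsub>pts kk\<^esub> n) x = u x \<otimes>\<^bsub>kk\<^esub> u (v n)"
    "u (v (m * n)) = (u [^]\<^bsub>pts kk\<^esub> n) (v m) \<otimes>\<^bsub>kk\<^esub> u (v n)"
proof -
  have p: "push u (mul n) = u [^]\<^bsub>pts kk\<^esub> n" using push_pow[OF R kk u id_closed] push_id[OF u] by simp
  have pn: "u (mul n r) = (u [^]\<^bsub>pts kk\<^esub> n) r" if "r \<in> carrier R" for r
    unfolding p[symmetric] using that by (simp add: push_def)
  note U = cont_alg_homsD[OF u]
  show "(u [^]\<^bsub>pts kk\<^esub> n) x = u x \<otimes>\<^bsub>kk\<^esub> u (v n)"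
    using pn[OF x_closed] ring_hom_mult[OF U(1) x_closed v_props(1)] v_props(2) by simp
  show "u (v (m * n)) = (u [^]\<^bsub>pts kk\<^esub> n) (v m) \<otimes>\<^bsub>kk\<^esub> u (v n)"
    unfolding v_mult_univ using ring_hom_mult[OF U(1) cont_alg_homsD(5)[OF mul_closed v_props(1)] v_props(1)]
      pn[OF v_props(1)] by simp
qed

text \<open>Modulo \<open>w x\<close> the point \<open>w\<close> is the zero point. In the discrete
  ring \<open>k\<close> the ideal generated by \<open>w x\<close> is open, so the congruence for
  sums of points applies to it.\<close>

lemma point_shift:
  assumes u: "u \<in> cont_alg_homs k R kk" and w: "w \<in> cont_alg_homs k R kk" and f: "f \<in> carrier R"
  shows "\<exists>c\<in>carrier kk. (u \<otimes>\<^bsub>pts kk\<^esub> w) f = u f \<oplus>\<^bsub>kk\<^esub> c \<otimes>\<^bsub>kk\<^esub> w x"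
proof -
  have wx: "w x \<in> carrier kk" using cont_alg_homsD(5)[OF w x_closed] .
  have J: "PIdl\<^bsub>kk\<^esub> (w x) \<in> open_ideals kk"
    using base_algebra_complete(2)[OF k] kk.cgenideal_ideal[OF wx] by simp
  have "w q \<ominus>\<^bsub>kk\<^esub> \<one>\<^bsub>pts kk\<^esub> q \<in> PIdl\<^bsub>kk\<^esub> (w x)" if q: "q \<in> carrier R" for q
  proof -
    obtain s where s: "s \<in> carrier kk" "w q \<ominus>\<^bsub>kk\<^esub> \<one>\<^bsub>pts kk\<^esub> q = w x \<otimes>\<^bsub>kk\<^esub> s"
      using point_cong_one[OF kk w q] by blast
    then show ?thesis unfolding cgenideal_def using kk.m_comm[OF wx s(1)] by auto
  qed
  from mult_cong_right[OF kk u w one_closed'[OF kk] J this f]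
  have "(u \<otimes>\<^bsub>pts kk\<^esub> w) f \<ominus>\<^bsub>kk\<^esub> (u \<otimes>\<^bsub>pts kk\<^esub> \<one>\<^bsub>pts kk\<^esub>) f \<in> PIdl\<^bsub>kk\<^esub> (w x)" .
  moreover have "u \<otimes>\<^bsub>pts kk\<^esub> \<one>\<^bsub>pts kk\<^esub> = u" using ptsk.r_one[of u] u by (simp only: pts_sel(1))
  ultimately have "(u \<otimes>\<^bsub>pts kk\<^esub> w) f \<ominus>\<^bsub>kk\<^esub> u f \<in> PIdl\<^bsub>kk\<^esub> (w x)" by (simp only:)
  then obtain c where c: "c \<in> carrier kk" "(u \<otimes>\<^bsub>pts kk\<^esub> w) f \<ominus>\<^bsub>kk\<^esub> u f = c \<otimes>\<^bsub>kk\<^esub> w x"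
    unfolding cgenideal_def by blast
  define m where "m = (u \<otimes>\<^bsub>pts kk\<^esub> w) f"
  have mc: "m \<in> carrier kk" "u f \<in> carrier kk"
    unfolding m_def by (rule cont_alg_homsD(5)[OF mult_closed[OF kk u w] f], rule cont_alg_homsD(5)[OF u f])
  have "m = u f \<oplus>\<^bsub>kk\<^esub> (m \<ominus>\<^bsub>kk\<^esub> u f)" using mc by algebra
  then show ?thesis using c unfolding m_def[symmetric] by metis
qed

end

section \<open>Chains of subgroups with cyclic quotients\<close>

context comm_group
begin

text \<open>In a finite group this is the subgroup generated by \<open>W\<close> and
  \<open>\<alpha>\<close>, with inverses supplied by natural powers.\<close>

definition adjoin :: "'a set \<Rightarrow> 'a \<Rightarrow> 'a set" where
  "adjoin W \<alpha> = {w \<otimes> \<alpha> [^] j | w (j::nat). w \<in> W}"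

text \<open>\<open>n\<close> is the order of \<open>\<alpha>\<close> modulo \<open>W\<close>. The
  condition \<open>n > 1\<close> excludes trivial steps, so every step of a chain is proper.\<close>

definition order_mod :: "'a set \<Rightarrow> 'a \<Rightarrow> nat \<Rightarrow> bool" where
  "order_mod W \<alpha> n \<longleftrightarrow> n > 1 \<and> (\<forall>j. \<alpha> [^] (j::nat) \<in> W \<longleftrightarrow> n dvd j)"

text \<open>The head of the list is the last step, so that recursion peels a chain from the
  top.\<close>

inductive chain :: "'a set \<Rightarrow> 'a set \<Rightarrow> ('a \<times> nat) list \<Rightarrow> bool" for V where
  Nil: "chain V V []"
| Cons: "chain V W L \<Longrightarrow> \<alpha> \<in> carrier G \<Longrightarrow> order_mod W \<alpha> n \<Longrightarrow> chain V (adjoin W \<alpha>) ((\<alpha>, n) # L)"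

definition prime_chain :: "'a set \<Rightarrow> 'a set \<Rightarrow> ('a \<times> nat) list \<Rightarrow> bool" where
  "prime_chain V W L \<longleftrightarrow> chain V W L \<and> (\<forall>(\<alpha>, n)\<in>set L. Factorial_Ring.prime n)"

lemma subgroup_mult_iff:
  assumes "subgroup W G" "w \<in> W" "a \<in> carrier G"
  shows "w \<otimes> a \<in> W \<longleftrightarrow> a \<in> W" "a \<otimes> w \<in> W \<longleftrightarrow> a \<in> W"
proof -
  interpret W: subgroup W G by fact
  have w: "w \<in> carrier G" using assms by simp
  have "inv w \<otimes> (w \<otimes> a) = a" using w assms by (simp add: m_assoc [symmetric])
  then show "w \<otimes> a \<in> W \<longleftrightarrow> a \<in> W" by (metis W.m_closed W.m_inv_closed assms(2))
  then show "a \<otimes> w \<in> W \<longleftrightarrow> a \<in> W" using m_comm w assms by simp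
qed

lemma subgroup_pow_closed: "subgroup W G \<Longrightarrow> w \<in> W \<Longrightarrow> w [^] (j::nat) \<in> W"
  using subgroup_int_pow_closed[of W w "int j"] by (simp add: int_pow_int)

lemma pow_mod_subgroup_iff:
  assumes "subgroup W G" "w \<in> W" "a \<in> carrier G"
  shows "(w \<otimes> a) [^] (j::nat) \<in> W \<longleftrightarrow> a [^] j \<in> W"
  using assms subgroup_mult_iff subgroup_pow_closed[OF assms(1,2), of j]
  by (simp add: nat_pow_distrib subgroup.mem_carrier)

lemma subset_adjoin: assumes "subgroup W G" shows "W \<subseteq> adjoin W \<alpha>"
proof
  fix w assume w: "w \<in> W"
  then have "w = w \<otimes> \<alpha> [^] (0::nat)" using assms by (simp add: subgroup.mem_carrier)
  with w show "w \<in> adjoin W \<alpha>" unfolding adjoin_def by blast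
qed

lemma mem_adjoin: assumes "subgroup W G" "\<alpha> \<in> carrier G" shows "\<alpha> \<in> adjoin W \<alpha>"
proof -
  have "\<alpha> = \<one> \<otimes> \<alpha> [^] (1::nat)" "\<one> \<in> W" using assms by (simp_all add: subgroup.one_closed)
  then show ?thesis unfolding adjoin_def by blast
qed

lemma adjoin_subset:
  assumes "subgroup U G" "W \<subseteq> U" "\<alpha> \<in> U"
  shows "adjoin W \<alpha> \<subseteq> U"
  using assms unfolding adjoin_def by (auto intro!: subgroup.m_closed subgroup_pow_closed)

lemma order_mod_nontrivial:
  assumes "order_mod W \<alpha> n" "\<alpha> \<in> carrier G" shows "\<alpha> \<notin> W"
proof
  assume "\<alpha> \<in> W"
  then have "\<alpha> [^] (1::nat) \<in> W" using assms by simp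
  then show False using assms(1) unfolding order_mod_def by (metis nat_dvd_1_iff_1 less_irrefl)
qed

lemma order_mod_exists:
  assumes W: "subgroup W G" and fin: "finite (carrier G)" and a: "\<alpha> \<in> carrier G" "\<alpha> \<notin> W"
  shows "\<exists>n. order_mod W \<alpha> n"
proof -
  interpret W: subgroup W G by fact
  define P where "P = (\<lambda>j::nat. j > 0 \<and> \<alpha> [^] j \<in> W)"
  have "P (order G)" unfolding P_def using a fin
    by (metis W.one_closed order_gt_0_iff_finite pow_order_eq_1)
  define n where "n = (LEAST j. P j)"
  have Pn: "P n" unfolding n_def by (rule LeastI) fact
  have least: "\<not> P j" if "j < n" for j using not_less_Least that unfolding n_def by blast
  have "n \<noteq> 1" using Pn a unfolding P_def by auto
  then have n1: "n > 1" using Pn unfolding P_def by auto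
  have "\<alpha> [^] j \<in> W \<longleftrightarrow> n dvd j" for j :: nat
  proof -
    have "\<alpha> [^] j = (\<alpha> [^] n) [^] (j div n) \<otimes> \<alpha> [^] (j mod n)"
      using a by (simp add: nat_pow_pow nat_pow_mult)
    then have "\<alpha> [^] j \<in> W \<longleftrightarrow> \<alpha> [^] (j mod n) \<in> W"
      using subgroup_mult_iff(1)[OF W subgroup_pow_closed[OF W, of "\<alpha> [^] n"]] Pn a
      unfolding P_def by simp
    also have "\<dots> \<longleftrightarrow> j mod n = 0"
    proof
      assume "\<alpha> [^] (j mod n) \<in> W"
      then show "j mod n = 0" using least[of "j mod n"] n1 unfolding P_def by auto
    qed simp
    finally show ?thesis by auto
  qed
  with n1 show ?thesis unfolding order_mod_def by blast
qed

text \<open>Division of the exponent by \<open>n\<close> moves the multiples of \<open>n\<close>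
  into \<open>W\<close>.\<close>

lemma adjoin_eq:
  assumes W: "subgroup W G" and a: "\<alpha> \<in> carrier G" and n: "\<alpha> [^] n \<in> W" "n > (0::nat)"
  shows "adjoin W \<alpha> = (\<lambda>(w, j). w \<otimes> \<alpha> [^] j) ` (W \<times> {..<n})"
proof
  interpret W: subgroup W G by fact
  show "adjoin W \<alpha> \<subseteq> (\<lambda>(w, j). w \<otimes> \<alpha> [^] j) ` (W \<times> {..<n})"
  proof
    fix z assume "z \<in> adjoin W \<alpha>"
    then obtain w and j :: nat where z: "z = w \<otimes> \<alpha> [^] j" "w \<in> W" unfolding adjoin_def by auto
    have "\<alpha> [^] j = (\<alpha> [^] n) [^] (j div n) \<otimes> \<alpha> [^] (j mod n)"
      using a by (simp add: nat_pow_pow nat_pow_mult)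
    then have "z = (w \<otimes> (\<alpha> [^] n) [^] (j div n)) \<otimes> \<alpha> [^] (j mod n)"
      using z a by (simp add: m_assoc)
    moreover have "w \<otimes> (\<alpha> [^] n) [^] (j div n) \<in> W" using z n subgroup_pow_closed[OF W] by auto
    ultimately show "z \<in> (\<lambda>(w, j). w \<otimes> \<alpha> [^] j) ` (W \<times> {..<n})"
      using n by (auto intro!: image_eqI[of _ _ "(w \<otimes> (\<alpha> [^] n) [^] (j div n), j mod n)"])
  qed
qed (auto simp: adjoin_def)

lemma subgroup_adjoin:
  assumes W: "subgroup W G" and fin: "finite (carrier G)" and a: "\<alpha> \<in> carrier G"
  shows "subgroup (adjoin W \<alpha>) G"
proof -
  interpret W: subgroup W G by fact
  have sub: "adjoin W \<alpha> \<subseteq> carrier G" using a unfolding adjoin_def by auto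
  have one: "\<one> \<in> adjoin W \<alpha>" using subset_adjoin[OF W] W.one_closed by blast
  have mult: "y \<otimes> z \<in> adjoin W \<alpha>" if yz: "y \<in> adjoin W \<alpha>" "z \<in> adjoin W \<alpha>" for y z
  proof -
    obtain w i w' j where "y = w \<otimes> \<alpha> [^] (i::nat)" "z = w' \<otimes> \<alpha> [^] (j::nat)" "w \<in> W" "w' \<in> W"
      using yz unfolding adjoin_def by auto
    then have "y \<otimes> z = (w \<otimes> w') \<otimes> \<alpha> [^] (i + j)" "w \<otimes> w' \<in> W"
      using a by (simp_all add: nat_pow_mult [symmetric] m_ac)
    then show ?thesis unfolding adjoin_def by blast
  qed
  have "inv y \<in> adjoin W \<alpha>" if y: "y \<in> adjoin W \<alpha>" for y
  proof -
    have yc: "y \<in> carrier G" using y sub by auto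
    have pow: "y [^] (j::nat) \<in> adjoin W \<alpha>" for j by (induction j) (auto simp: one mult y)
    have "order G > 0" using fin order_gt_0_iff_finite by simp
    then have "y \<otimes> y [^] (order G - 1) = y [^] (order G)"
      using yc by (metis Suc_diff_1 m_comm nat_pow_Suc nat_pow_closed)
    then have "inv y = y [^] (order G - 1)"
      using yc pow_order_eq_1[OF yc] by (metis inv_unique' m_comm nat_pow_closed)
    then show ?thesis using pow by simp
  qed
  then show ?thesis by (intro subgroupI sub) (use one mult in auto)
qed

text \<open>Equal products with exponents below \<open>n\<close> give a power of
  \<open>\<alpha>\<close> in \<open>W\<close> whose exponent, their difference, is less than
  \<open>n\<close>; so it is zero.\<close>

lemma inj_on_adjoin:
  assumes W: "subgroup W G" and a: "\<alpha> \<in> carrier G" and n: "order_mod W \<alpha> n"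
  shows "inj_on (\<lambda>(w, j). w \<otimes> \<alpha> [^] j) (W \<times> {..<n})"
proof -
  interpret W: subgroup W G by fact
  have aux: "w = w' \<and> i = j"
    if eq: "w \<otimes> \<alpha> [^] i = w' \<otimes> \<alpha> [^] j" and w: "w \<in> W" "w' \<in> W" and ij: "i \<le> j" "j < n"
    for w w' and i j :: nat
  proof -
    have "\<alpha> [^] j = \<alpha> [^] (j - i) \<otimes> \<alpha> [^] i" using a ij by (simp add: nat_pow_mult)
    then have "w \<otimes> \<alpha> [^] i = (w' \<otimes> \<alpha> [^] (j - i)) \<otimes> \<alpha> [^] i" using eq w a by (simp add: m_assoc)
    then have e: "w = w' \<otimes> \<alpha> [^] (j - i)" using w a by simp
    then have "\<alpha> [^] (j - i) \<in> W" using subgroup_mult_iff(1)[OF W w(2), of "\<alpha> [^] (j - i)"] w a by simp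
    then have "n dvd j - i" using n unfolding order_mod_def by blast
    then have "j - i = 0" using ij by (metis dvd_imp_le less_imp_diff_less not_le neq0_conv)
    then show ?thesis using e ij w by simp
  qed
  show ?thesis
  proof (rule inj_onI, clarsimp)
    fix w w' and i j :: nat
    assume "w \<otimes> \<alpha> [^] i = w' \<otimes> \<alpha> [^] j" "w \<in> W" "w' \<in> W" "i < n" "j < n"
    then show "w = w' \<and> i = j"
      using aux[of w i w' j] aux[of w' j w i] by (cases "i \<le> j") auto
  qed
qed

lemma card_adjoin:
  assumes W: "subgroup W G" and a: "\<alpha> \<in> carrier G" and n: "order_mod W \<alpha> n"
  shows "card (adjoin W \<alpha>) = card W * n"
proof -
  have "\<alpha> [^] n \<in> W" "n > 0" using n unfolding order_mod_def by auto
  from adjoin_eq[OF W a this] show ?thesis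
    using card_image[OF inj_on_adjoin[OF assms]] by (simp add: card_cartesian_product)
qed

lemma chain_subgroup:
  assumes "chain V W L" "subgroup V G" "finite (carrier G)"
  shows "subgroup W G"
  using assms by induction (auto intro: subgroup_adjoin)

lemma chain_subset:
  assumes "chain V W L" "subgroup V G" "finite (carrier G)"
  shows "V \<subseteq> W"
  using assms by induction (use subset_adjoin chain_subgroup in blast)+

lemma chain_card:
  assumes "chain V W L" "subgroup V G" "finite (carrier G)"
  shows "card W = card V * prod_list (map snd L)"
  using assms
proof induction
  case (Cons W L \<alpha> n)
  then show ?case using card_adjoin[OF chain_subgroup] by (simp add: mult_ac)
qed simp

lemma chain_carrier:
  assumes "chain V W L" "(\<alpha>, n) \<in> set L"
  shows "\<alpha> \<in> carrier G"
  using assms by induction auto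

lemma chain_append:
  assumes "chain U W L'" "chain V U L" 
  shows "chain V W (L' @ L)"
  using assms by induction (auto intro: chain.intros)

text \<open>Any element of \<open>W\<close> outside the group reached so far can be adjoined; it has
  a finite order modulo that group, and the distance to \<open>W\<close> decreases.\<close>

lemma chain_exists:
  assumes V: "subgroup V G" and W: "subgroup W G" and "V \<subseteq> W" and fin: "finite (carrier G)"
  shows "\<exists>L. chain V W L"
proof -
  have finW: "finite W" using W fin by (meson finite_subset subgroup.subset)
  have "chain V V' L \<Longrightarrow> V' \<subseteq> W \<Longrightarrow> \<exists>L. chain V W L" for V' L
  proof (induction "card W - card V'" arbitrary: V' L rule: less_induct)
    case less
    show ?case
    proof (cases "V' = W")
      case False
      then obtain \<alpha> where a: "\<alpha> \<in> W" "\<alpha> \<notin> V'" using less.prems by blast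
      have ac: "\<alpha> \<in> carrier G" using a W by (simp add: subgroup.mem_carrier)
      have V': "subgroup V' G" using chain_subgroup less.prems V fin by blast
      obtain n where "order_mod V' \<alpha> n" using order_mod_exists[OF V' fin ac a(2)] by blast
      then have c: "chain V (adjoin V' \<alpha>) ((\<alpha>, n) # L)"
        using less.prems ac by (auto intro: chain.intros)
      have s: "adjoin V' \<alpha> \<subseteq> W" using adjoin_subset[OF W less.prems(2) a(1)] .
      have "V' \<subset> adjoin V' \<alpha>" using subset_adjoin[OF V'] mem_adjoin[OF V' ac] a by blast
      then have "card V' < card (adjoin V' \<alpha>)" using finW s by (meson finite_subset psubset_card_mono)
      moreover have "card (adjoin V' \<alpha>) \<le> card W" using s finW by (rule card_mono[rotated])
      ultimately show ?thesis using less.hyps[OF _ c s] by simp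
    qed (use less.prems in blast)
  qed
  from this[OF chain.Nil \<open>V \<subseteq> W\<close>] show ?thesis .
qed

text \<open>\<open>adjoin W \<alpha>\<close> has prime index over \<open>W\<close>, so nothing lies
  strictly between them; concretely, the exponent of \<open>\<alpha>\<close> in
  \<open>\<beta>\<close> is prime to \<open>p\<close>.\<close>

lemma prime_index_generator:
  assumes W: "subgroup W G" and a: "\<alpha> \<in> carrier G" and p: "order_mod W \<alpha> p" "Factorial_Ring.prime p"
    and fin: "finite (carrier G)"
    and b: "\<beta> \<in> adjoin W \<alpha>" "\<beta> \<notin> W"
  obtains w s where "w \<in> W" "\<beta> = w \<otimes> \<alpha> [^] (s::nat)" "coprime s p"
    "order_mod W \<beta> p" "adjoin W \<beta> = adjoin W \<alpha>"
proof -
  interpret W: subgroup W G by fact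
  obtain w s where ws: "w \<in> W" "\<beta> = w \<otimes> \<alpha> [^] (s::nat)" using b unfolding adjoin_def by auto
  have iff: "\<alpha> [^] (j::nat) \<in> W \<longleftrightarrow> p dvd j" for j using p unfolding order_mod_def by blast
  have "\<not> p dvd s" using b ws iff subgroup_mult_iff(1)[OF W ws(1)] a by simp
  then have cop: "coprime s p" using p prime_imp_coprime coprime_commute by blast
  have bc: "\<beta> \<in> carrier G" using ws a by simp
  have "\<beta> [^] j \<in> W \<longleftrightarrow> p dvd j" for j :: nat
  proof -
    have "\<beta> [^] j \<in> W \<longleftrightarrow> (\<alpha> [^] s) [^] j \<in> W" using pow_mod_subgroup_iff[OF W ws(1)] ws a by simp
    also have "\<dots> \<longleftrightarrow> p dvd s * j" using iff a by (simp add: nat_pow_pow)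
    also have "\<dots> \<longleftrightarrow> p dvd j" using cop by (simp add: coprime_commute coprime_dvd_mult_right_iff)
    finally show ?thesis .
  qed
  then have ob: "order_mod W \<beta> p" using p unfolding order_mod_def by simp
  have sub: "adjoin W \<beta> \<subseteq> adjoin W \<alpha>"
    by (rule adjoin_subset[OF subgroup_adjoin[OF W fin a] subset_adjoin[OF W] b(1)])
  have "finite (adjoin W \<alpha>)"
    using subgroup_adjoin[OF W fin a] fin by (meson finite_subset subgroup.subset)
  then have "adjoin W \<beta> = adjoin W \<alpha>"
    by (rule card_subset_eq[OF _ sub]) (simp add: card_adjoin[OF W bc ob] card_adjoin[OF W a p(1)])
  with ws cop ob show ?thesis using that by blast
qed

text \<open>An element of composite order \<open>p m\<close> modulo \<open>W\<close> splits into two steps, of orders \<open>m\<close> and \<open>p\<close>.\<close>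

lemma order_mod_split:
  assumes W: "subgroup W G" and a: "\<alpha> \<in> carrier G" and n: "order_mod W \<alpha> (p * m)" and pm: "p > 1" "m > 1"
    and fin: "finite (carrier G)"
  shows "order_mod W (\<alpha> [^] p) m" "order_mod (adjoin W (\<alpha> [^] p)) \<alpha> p"
    "adjoin (adjoin W (\<alpha> [^] p)) \<alpha> = adjoin W \<alpha>"
proof -
  interpret W: subgroup W G by fact
  have iff: "\<alpha> [^] (j::nat) \<in> W \<longleftrightarrow> p * m dvd j" for j using n unfolding order_mod_def by blast
  show 1: "order_mod W (\<alpha> [^] p) m"
    using pm a iff unfolding order_mod_def by (simp add: nat_pow_pow)
  have "\<alpha> [^] j \<in> adjoin W (\<alpha> [^] p) \<longleftrightarrow> p dvd j" for j :: nat
  proof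
    assume "\<alpha> [^] j \<in> adjoin W (\<alpha> [^] p)"
    moreover have "(\<alpha> [^] p) [^] m \<in> W" using 1 unfolding order_mod_def by auto
    ultimately obtain w i where wi: "w \<in> W" "\<alpha> [^] j = w \<otimes> (\<alpha> [^] p) [^] (i::nat)" "i < m"
      using adjoin_eq[OF W, of "\<alpha> [^] p" m] a pm by auto
    \<comment> \<open>The exponent \<open>p (m - i)\<close> completes \<open>p i\<close> to
      \<open>p m\<close>, whose power lies in \<open>W\<close>. Divisibility of the total exponent
      by \<open>p m\<close> then gives \<open>p dvd j\<close>.\<close>
    have "\<alpha> [^] (j + p * (m - i)) = \<alpha> [^] j \<otimes> (\<alpha> [^] p) [^] (m - i)"
      using a by (simp add: nat_pow_mult [symmetric] nat_pow_pow)
    also have "\<dots> = w \<otimes> ((\<alpha> [^] p) [^] i \<otimes> (\<alpha> [^] p) [^] (m - i))" using wi a by (simp add: m_assoc)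
    finally have "\<alpha> [^] (j + p * (m - i)) = w \<otimes> (\<alpha> [^] p) [^] (i + (m - i))"
      using a by (simp add: nat_pow_mult del: nat_pow_pow)
    then have "\<alpha> [^] (j + p * (m - i)) = w \<otimes> \<alpha> [^] (p * m)"
      using wi a by (simp add: nat_pow_pow)
    then have "\<alpha> [^] (j + p * (m - i)) \<in> W" using wi iff[of "p * m"] by simp
    then have "p * m dvd j + p * (m - i)" using iff by blast
    then show "p dvd j" by (metis dvd_add_left_iff dvd_mult_left dvd_triv_left)
  next
    assume "p dvd j"
    then obtain i where "j = p * i" by auto
    then have "\<alpha> [^] j = \<one> \<otimes> (\<alpha> [^] p) [^] i" using a by (simp add: nat_pow_pow)
    then show "\<alpha> [^] j \<in> adjoin W (\<alpha> [^] p)" unfolding adjoin_def using W.one_closed by blast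
  qed
  then show "order_mod (adjoin W (\<alpha> [^] p)) \<alpha> p" using pm unfolding order_mod_def by simp
  have sW: "subgroup (adjoin W \<alpha>) G" and sWp: "subgroup (adjoin W (\<alpha> [^] p)) G"
    using subgroup_adjoin W fin a by auto
  show "adjoin (adjoin W (\<alpha> [^] p)) \<alpha> = adjoin W \<alpha>"
  proof
    have "\<alpha> [^] p \<in> adjoin W \<alpha>" using subgroup_pow_closed[OF sW mem_adjoin[OF W a]] .
    then have "adjoin W (\<alpha> [^] p) \<subseteq> adjoin W \<alpha>" by (rule adjoin_subset[OF sW subset_adjoin[OF W]])
    then show "adjoin (adjoin W (\<alpha> [^] p)) \<alpha> \<subseteq> adjoin W \<alpha>"
      using adjoin_subset[OF sW] mem_adjoin[OF W a] by blast
    have "subgroup (adjoin (adjoin W (\<alpha> [^] p)) \<alpha>) G" using subgroup_adjoin[OF sWp fin a] .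
    moreover have "W \<subseteq> adjoin (adjoin W (\<alpha> [^] p)) \<alpha>"
      using subset_adjoin[OF W] subset_adjoin[OF sWp] by blast
    ultimately show "adjoin W \<alpha> \<subseteq> adjoin (adjoin W (\<alpha> [^] p)) \<alpha>"
      using adjoin_subset mem_adjoin[OF sWp a] by blast
  qed
qed

text \<open>The modular law: \<open>\<beta>\<close> lies in \<open>W1\<close>, so when an element of
  \<open>W1\<close> is written with a factor from \<open>W2\<close> and a power of
  \<open>\<beta>\<close>, the factor from \<open>W2\<close> lies in \<open>W1\<close> as
  well.\<close>

lemma adjoin_Int:
  assumes W1: "subgroup W1 G" and W2: "subgroup W2 G"
    and b: "\<beta> \<in> W1" "order_mod W2 \<beta> q" and sub: "W1 \<subseteq> adjoin W2 \<beta>"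
  shows "order_mod (W1 \<inter> W2) \<beta> q" "adjoin (W1 \<inter> W2) \<beta> = W1"
proof -
  show "order_mod (W1 \<inter> W2) \<beta> q"
    using b subgroup_pow_closed[OF W1 b(1)] unfolding order_mod_def by simp
  show "adjoin (W1 \<inter> W2) \<beta> = W1"
  proof
    show "adjoin (W1 \<inter> W2) \<beta> \<subseteq> W1" using adjoin_subset[OF W1 _ b(1)] by blast
    show "W1 \<subseteq> adjoin (W1 \<inter> W2) \<beta>"
    proof
      fix z assume z: "z \<in> W1"
      then obtain w j where w: "w \<in> W2" "z = w \<otimes> \<beta> [^] (j::nat)" using sub unfolding adjoin_def by blast
      have "w \<in> carrier G" using w W2 by (simp add: subgroup.mem_carrier)
      then have "w \<in> W1"
        using subgroup_mult_iff(2)[OF W1 subgroup_pow_closed[OF W1 b(1)]] w z by blast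
      with w show "z \<in> adjoin (W1 \<inter> W2) \<beta>" unfolding adjoin_def by blast
    qed
  qed
qed

end

section \<open>Independence of the transfer element of the chain\<close>

text \<open>What the comparison of chains uses of the formal group: \<open>X a\<close> stands for
  x(\<phi>(a)) and \<open>v n a\<close> for v_n(\<phi>(a)), both in a ring \<open>T\<close> that
  will be one of the k_B. The shift axioms are the divisibility of f(a + b) - f(a) by x(b), for f
  the coordinate and for f = v_n.\<close>

locale transfer_data = D?: comm_group D + T?: cring T for D (structure) and T (structure) +
  fixes X :: "'a \<Rightarrow> 'c" and v :: "nat \<Rightarrow> 'a \<Rightarrow> 'c"
  assumes fin: "finite (carrier D)"
    and X_closed [simp]: "a \<in> carrier D \<Longrightarrow> X a \<in> carrier T"
    and v_closed [simp]: "a \<in> carrier D \<Longrightarrow> v n a \<in> carrier T"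
    and X_one: "X \<one>\<^bsub>D\<^esub> = \<zero>\<^bsub>T\<^esub>"
    and X_pow: "a \<in> carrier D \<Longrightarrow> X (a [^]\<^bsub>D\<^esub> n) = X a \<otimes>\<^bsub>T\<^esub> v n a"
    and v_mult: "a \<in> carrier D \<Longrightarrow> v (m * n) a = v m (a [^]\<^bsub>D\<^esub> n) \<otimes>\<^bsub>T\<^esub> v n a"
    and X_shift: "a \<in> carrier D \<Longrightarrow> b \<in> carrier D \<Longrightarrow>
      \<exists>c\<in>carrier T. X (a \<otimes>\<^bsub>D\<^esub> b) = X a \<oplus>\<^bsub>T\<^esub> c \<otimes>\<^bsub>T\<^esub> X b"
    and v_shift: "a \<in> carrier D \<Longrightarrow> b \<in> carrier D \<Longrightarrow>
      \<exists>c\<in>carrier T. v n (a \<otimes>\<^bsub>D\<^esub> b) = v n a \<oplus>\<^bsub>T\<^esub> c \<otimes>\<^bsub>T\<^esub> X b"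
    and v_one: "v n \<one>\<^bsub>D\<^esub> = [n] \<cdot>\<^bsub>T\<^esub> \<one>\<^bsub>T\<^esub>"
begin

definition val :: "('a \<times> nat) list \<Rightarrow> 'c" where
  "val L = foldr (\<lambda>(\<alpha>, n) t. v n \<alpha> \<otimes>\<^bsub>T\<^esub> t) L \<one>\<^bsub>T\<^esub>"

lemma val_simps [simp]: "val [] = \<one>\<^bsub>T\<^esub>" "val ((\<alpha>, n) # L) = v n \<alpha> \<otimes>\<^bsub>T\<^esub> val L"
  by (simp_all add: val_def)

lemma val_closed: "(\<And>\<alpha> n. (\<alpha>, n) \<in> set L \<Longrightarrow> \<alpha> \<in> carrier D) \<Longrightarrow> val L \<in> carrier T"
proof (induction L)
  case (Cons y L)
  obtain \<alpha> n where y: "y = (\<alpha>, n)" by force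
  have "val L \<in> carrier T" using Cons.IH Cons.prems by (meson list.set_intros(2))
  then show ?case using Cons.prems[of \<alpha> n] y by simp
qed simp

lemma chain_val_closed: "chain V W L \<Longrightarrow> val L \<in> carrier T"
  using val_closed chain_carrier by blast

text \<open>\<open>c\<close> kills the ideal generated by the values of \<open>X\<close> on
  \<open>W\<close>, so congruences modulo that ideal become equalities after multiplication by
  \<open>c\<close>.\<close>

definition annihilates :: "'c \<Rightarrow> 'a set \<Rightarrow> bool" where
  "annihilates c W \<longleftrightarrow> c \<in> carrier T \<and> (\<forall>w\<in>W. c \<otimes>\<^bsub>T\<^esub> X w = \<zero>\<^bsub>T\<^esub>)"

lemma annihilates_closed: "annihilates c W \<Longrightarrow> c \<in> carrier T"
  by (simp add: annihilates_def)

lemma annihilates_shift: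
  assumes c: "annihilates c W" and W: "W \<subseteq> carrier D" "w \<in> W" and a: "a \<in> carrier D"
  shows "c \<otimes>\<^bsub>T\<^esub> v n (a \<otimes>\<^bsub>D\<^esub> w) = c \<otimes>\<^bsub>T\<^esub> v n a" "c \<otimes>\<^bsub>T\<^esub> X (a \<otimes>\<^bsub>D\<^esub> w) = c \<otimes>\<^bsub>T\<^esub> X a"
proof -
  note cc = annihilates_closed[OF c]
  have w: "w \<in> carrier D" using W by blast
  have cX: "c \<otimes>\<^bsub>T\<^esub> X w = \<zero>\<^bsub>T\<^esub>" using c W unfolding annihilates_def by blast
  have 0: "c \<otimes>\<^bsub>T\<^esub> (d \<otimes>\<^bsub>T\<^esub> X w) = \<zero>\<^bsub>T\<^esub>" if "d \<in> carrier T" for d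
    using T.m_lcomm[OF cc that X_closed[OF w]] cX that by simp
  from v_shift[OF a w, of n] 0 cc a w show "c \<otimes>\<^bsub>T\<^esub> v n (a \<otimes>\<^bsub>D\<^esub> w) = c \<otimes>\<^bsub>T\<^esub> v n a"
    by (auto simp: T.r_distr)
  from X_shift[OF a w] 0 cc a w show "c \<otimes>\<^bsub>T\<^esub> X (a \<otimes>\<^bsub>D\<^esub> w) = c \<otimes>\<^bsub>T\<^esub> X a"
    by (auto simp: T.r_distr)
qed

text \<open>X(\<alpha>^j) is a multiple of X(\<alpha>), and X(\<alpha>) v_n(\<alpha>) =
  X(\<alpha>^n) is a value of \<open>X\<close> on \<open>W\<close>, which \<open>c\<close>
  kills.\<close>

lemma annihilates_adjoin:
  assumes c: "annihilates c W" and W: "subgroup W D" and a: "\<alpha> \<in> carrier D" "\<alpha> [^]\<^bsub>D\<^esub> n \<in> W"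
  shows "annihilates (v n \<alpha> \<otimes>\<^bsub>T\<^esub> c) (adjoin W \<alpha>)"
  unfolding annihilates_def
proof (intro conjI ballI)
  note cc = annihilates_closed[OF c]
  show "v n \<alpha> \<otimes>\<^bsub>T\<^esub> c \<in> carrier T" using cc a by simp
  fix z assume "z \<in> adjoin W \<alpha>"
  then obtain w j where z: "w \<in> W" "z = w \<otimes>\<^bsub>D\<^esub> \<alpha> [^]\<^bsub>D\<^esub> (j::nat)" unfolding adjoin_def by auto
  have w: "w \<in> carrier D" using z W by (simp add: subgroup.mem_carrier)
  have "(v n \<alpha> \<otimes>\<^bsub>T\<^esub> c) \<otimes>\<^bsub>T\<^esub> X z = v n \<alpha> \<otimes>\<^bsub>T\<^esub> (c \<otimes>\<^bsub>T\<^esub> X (\<alpha> [^]\<^bsub>D\<^esub> j \<otimes>\<^bsub>D\<^esub> w))"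
    using z w a cc by (simp add: T.m_assoc D.m_comm)
  also have "\<dots> = v n \<alpha> \<otimes>\<^bsub>T\<^esub> (c \<otimes>\<^bsub>T\<^esub> (X \<alpha> \<otimes>\<^bsub>T\<^esub> v j \<alpha>))"
    using annihilates_shift(2)[OF c subgroup.subset[OF W] z(1)] a X_pow by simp
  also have "\<dots> = v j \<alpha> \<otimes>\<^bsub>T\<^esub> (c \<otimes>\<^bsub>T\<^esub> (X \<alpha> \<otimes>\<^bsub>T\<^esub> v n \<alpha>))"
    using a cc by (simp add: T.m_ac)
  also have "\<dots> = \<zero>\<^bsub>T\<^esub>"
    using c a X_pow[of \<alpha> n, symmetric] unfolding annihilates_def by simp
  finally show "(v n \<alpha> \<otimes>\<^bsub>T\<^esub> c) \<otimes>\<^bsub>T\<^esub> X z = \<zero>\<^bsub>T\<^esub>" .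
qed

lemma chain_annihilates:
  assumes "chain V W L" "subgroup V D" "\<And>w. w \<in> V \<Longrightarrow> X w = \<zero>\<^bsub>T\<^esub>"
  shows "annihilates (val L) W"
  using assms
proof induction
  case Nil
  then show ?case by (simp add: annihilates_def)
next
  case (Cons W L \<alpha> n)
  have "subgroup W D" using chain_subgroup Cons.hyps Cons.prems fin by blast
  moreover have "\<alpha> [^]\<^bsub>D\<^esub> n \<in> W" using Cons.hyps unfolding order_mod_def by auto
  ultimately show ?case using annihilates_adjoin Cons by simp
qed

text \<open>Both \<open>s'\<close> and \<open>n\<close> kill \<open>c (v\<^sub>n(\<alpha>\<^sup>s) - v\<^sub>n(\<alpha>))\<close>, where \<open>s'\<close> inverts \<open>s\<close> modulo \<open>n\<close>: for \<open>n\<close>, compare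
  \<open>s'\<close> with \<open>s' + n\<close>.\<close>

lemma generator_change_aux:
  assumes c: "annihilates c W" and W: "subgroup W D" and a: "\<alpha> \<in> carrier D" "\<alpha> [^]\<^bsub>D\<^esub> n \<in> W"
    and s: "s * s' = 1 + n * m"
  shows "[s'] \<cdot>\<^bsub>T\<^esub> (c \<otimes>\<^bsub>T\<^esub> v n (\<alpha> [^]\<^bsub>D\<^esub> s)) = [s'] \<cdot>\<^bsub>T\<^esub> (c \<otimes>\<^bsub>T\<^esub> v n \<alpha>)"
proof -
  note cc = annihilates_closed[OF c] and Wc = subgroup.subset[OF W]
  have in_W: "\<alpha> [^]\<^bsub>D\<^esub> (n * j) \<in> W" for j
    using subgroup_pow_closed[OF W a(2), of j] D.nat_pow_pow[OF a(1)] by simp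
  \<comment> \<open>\<alpha>^(ns) lies in \<open>W\<close>, so under multiplication by
    \<open>c\<close> the function v_s' takes there its value s' at the identity.\<close>
  have "c \<otimes>\<^bsub>T\<^esub> v s' (\<alpha> [^]\<^bsub>D\<^esub> (n * s)) = c \<otimes>\<^bsub>T\<^esub> v s' (\<one>\<^bsub>D\<^esub> \<otimes>\<^bsub>D\<^esub> \<alpha> [^]\<^bsub>D\<^esub> (n * s))" using a by simp
  also have "\<dots> = c \<otimes>\<^bsub>T\<^esub> v s' \<one>\<^bsub>D\<^esub>" by (rule annihilates_shift(1)[OF c Wc in_W]) simp
  also have "\<dots> = [s'] \<cdot>\<^bsub>T\<^esub> c" using v_one cc by (simp add: T.add_pow_rdistr)
  finally have 1: "c \<otimes>\<^bsub>T\<^esub> v s' (\<alpha> [^]\<^bsub>D\<^esub> (n * s)) = [s'] \<cdot>\<^bsub>T\<^esub> c" .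
  have "c \<otimes>\<^bsub>T\<^esub> v n (\<alpha> [^]\<^bsub>D\<^esub> (s * s')) = c \<otimes>\<^bsub>T\<^esub> v n (\<alpha> \<otimes>\<^bsub>D\<^esub> \<alpha> [^]\<^bsub>D\<^esub> (n * m))"
    unfolding s using a by (simp add: nat_pow_mult [symmetric] D.m_comm)
  also have "\<dots> = c \<otimes>\<^bsub>T\<^esub> v n \<alpha>" by (rule annihilates_shift(1)[OF c Wc in_W a(1)])
  finally have 2: "c \<otimes>\<^bsub>T\<^esub> v n (\<alpha> [^]\<^bsub>D\<^esub> (s * s')) = c \<otimes>\<^bsub>T\<^esub> v n \<alpha>" .
  \<comment> \<open>\<open>c\<close> times v_n(\<alpha>) kills X(\<alpha>), hence also
    X(\<alpha>^s); so multiplied by it, v_s' at \<alpha>^s becomes s'.\<close>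
  have 3: "(c \<otimes>\<^bsub>T\<^esub> v n \<alpha>) \<otimes>\<^bsub>T\<^esub> v s' (\<alpha> [^]\<^bsub>D\<^esub> s) = [s'] \<cdot>\<^bsub>T\<^esub> (c \<otimes>\<^bsub>T\<^esub> v n \<alpha>)"
  proof -
    obtain d where d: "d \<in> carrier T" "v s' (\<one>\<^bsub>D\<^esub> \<otimes>\<^bsub>D\<^esub> \<alpha> [^]\<^bsub>D\<^esub> s) = v s' \<one>\<^bsub>D\<^esub> \<oplus>\<^bsub>T\<^esub> d \<otimes>\<^bsub>T\<^esub> X (\<alpha> [^]\<^bsub>D\<^esub> s)"
      using v_shift[of "\<one>\<^bsub>D\<^esub>" "\<alpha> [^]\<^bsub>D\<^esub> s" s'] a by auto
    have "c \<otimes>\<^bsub>T\<^esub> (X \<alpha> \<otimes>\<^bsub>T\<^esub> v n \<alpha>) = \<zero>\<^bsub>T\<^esub>" using c a X_pow[of \<alpha> n, symmetric] unfolding annihilates_def by simp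
    moreover have "(c \<otimes>\<^bsub>T\<^esub> v n \<alpha>) \<otimes>\<^bsub>T\<^esub> (d \<otimes>\<^bsub>T\<^esub> X (\<alpha> [^]\<^bsub>D\<^esub> s)) =
        d \<otimes>\<^bsub>T\<^esub> (v s \<alpha> \<otimes>\<^bsub>T\<^esub> (c \<otimes>\<^bsub>T\<^esub> (X \<alpha> \<otimes>\<^bsub>T\<^esub> v n \<alpha>)))"
      using a cc d X_pow[of \<alpha> s] by (simp add: T.m_ac)
    ultimately have "(c \<otimes>\<^bsub>T\<^esub> v n \<alpha>) \<otimes>\<^bsub>T\<^esub> (d \<otimes>\<^bsub>T\<^esub> X (\<alpha> [^]\<^bsub>D\<^esub> s)) = \<zero>\<^bsub>T\<^esub>" using a d by simp
    then show ?thesis using d a cc v_one by (simp add: T.r_distr T.add_pow_rdistr)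
  qed
  \<comment> \<open>Both sides are v_(ns') at \<alpha>^s, with ns' factored in the two
    orders.\<close>
  have e: "v s' (\<alpha> [^]\<^bsub>D\<^esub> (n * s)) \<otimes>\<^bsub>T\<^esub> v n (\<alpha> [^]\<^bsub>D\<^esub> s) = v n (\<alpha> [^]\<^bsub>D\<^esub> (s * s')) \<otimes>\<^bsub>T\<^esub> v s' (\<alpha> [^]\<^bsub>D\<^esub> s)"
    using v_mult[of "\<alpha> [^]\<^bsub>D\<^esub> s" s' n] v_mult[of "\<alpha> [^]\<^bsub>D\<^esub> s" n s']
      D.nat_pow_pow[OF a(1), of s n] D.nat_pow_pow[OF a(1), of s s'] a
    by (simp add: mult.commute)
  have "[s'] \<cdot>\<^bsub>T\<^esub> (c \<otimes>\<^bsub>T\<^esub> v n (\<alpha> [^]\<^bsub>D\<^esub> s)) = ([s'] \<cdot>\<^bsub>T\<^esub> c) \<otimes>\<^bsub>T\<^esub> v n (\<alpha> [^]\<^bsub>D\<^esub> s)"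
    using cc a by (simp add: T.add_pow_ldistr)
  also have "\<dots> = (c \<otimes>\<^bsub>T\<^esub> v s' (\<alpha> [^]\<^bsub>D\<^esub> (n * s))) \<otimes>\<^bsub>T\<^esub> v n (\<alpha> [^]\<^bsub>D\<^esub> s)" using 1 by simp
  also have "\<dots> = c \<otimes>\<^bsub>T\<^esub> (v n (\<alpha> [^]\<^bsub>D\<^esub> (s * s')) \<otimes>\<^bsub>T\<^esub> v s' (\<alpha> [^]\<^bsub>D\<^esub> s))" using e cc a by (simp add: T.m_assoc)
  also have "\<dots> = (c \<otimes>\<^bsub>T\<^esub> v n (\<alpha> [^]\<^bsub>D\<^esub> (s * s'))) \<otimes>\<^bsub>T\<^esub> v s' (\<alpha> [^]\<^bsub>D\<^esub> s)" using cc a by (simp add: T.m_assoc)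
  also have "\<dots> = [s'] \<cdot>\<^bsub>T\<^esub> (c \<otimes>\<^bsub>T\<^esub> v n \<alpha>)" using 2 3 by simp
  finally show ?thesis .
qed

lemma generator_change:
  assumes c: "annihilates c W" and W: "subgroup W D" and a: "\<alpha> \<in> carrier D" "\<alpha> [^]\<^bsub>D\<^esub> n \<in> W"
    and n: "n > 1" and cop: "coprime s n"
  shows "c \<otimes>\<^bsub>T\<^esub> v n (\<alpha> [^]\<^bsub>D\<^esub> s) = c \<otimes>\<^bsub>T\<^esub> v n \<alpha>"
proof -
  note cc = annihilates_closed[OF c]
  have "s \<noteq> 0" using cop n by (metis coprime_0_left_iff less_irrefl nat_dvd_1_iff_1)
  obtain s' m where "s * s' = n * m + 1" using coprime_bezout_strong[OF cop] n by auto
  then have s: "s * s' = 1 + n * m" by simp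
  have s2: "s * (s' + n) = 1 + n * (m + s)" using s by (simp add: algebra_simps)
  define y z where "y = c \<otimes>\<^bsub>T\<^esub> v n (\<alpha> [^]\<^bsub>D\<^esub> s)" and "z = c \<otimes>\<^bsub>T\<^esub> v n \<alpha>"
  have yz: "y \<in> carrier T" "z \<in> carrier T" using cc a by (auto simp: y_def z_def)
  have 1: "[s'] \<cdot>\<^bsub>T\<^esub> y = [s'] \<cdot>\<^bsub>T\<^esub> z" and "[(s' + n)] \<cdot>\<^bsub>T\<^esub> y = [(s' + n)] \<cdot>\<^bsub>T\<^esub> z"
    using generator_change_aux[OF c W a s] generator_change_aux[OF c W a s2] by (auto simp: y_def z_def)
  then have 2: "[n] \<cdot>\<^bsub>T\<^esub> y = [n] \<cdot>\<^bsub>T\<^esub> z"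
    using yz by (simp add: T.add.nat_pow_mult [symmetric])
  \<comment> \<open>Since s s' - n m = 1, agreement after multiplication by s s' and by n m gives
    agreement.\<close>
  have "[(s * s')] \<cdot>\<^bsub>T\<^esub> y = [(s * s')] \<cdot>\<^bsub>T\<^esub> z" "[(n * m)] \<cdot>\<^bsub>T\<^esub> y = [(n * m)] \<cdot>\<^bsub>T\<^esub> z"
    using 1 2 yz by (metis T.add.nat_pow_pow mult.commute)+
  then show ?thesis unfolding s using yz
    by (simp add: T.add.nat_pow_mult [symmetric] y_def [symmetric] z_def [symmetric])
qed

text \<open>An element of \<open>adjoin W \<alpha>\<close> outside \<open>W\<close> is w \<alpha>^s
  with s prime to \<open>p\<close>; the factor w is absorbed by \<open>c\<close>, the exponent by
  \<open>generator_change\<close>.\<close>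

lemma generator_change':
  assumes c: "annihilates c W" and W: "subgroup W D" and a: "\<alpha> \<in> carrier D"
    and p: "order_mod W \<alpha> p" "Factorial_Ring.prime p" and b: "\<beta> \<in> adjoin W \<alpha>" "\<beta> \<notin> W"
  shows "v p \<beta> \<otimes>\<^bsub>T\<^esub> c = v p \<alpha> \<otimes>\<^bsub>T\<^esub> c"
proof -
  obtain w s where ws: "w \<in> W" "\<beta> = w \<otimes>\<^bsub>D\<^esub> \<alpha> [^]\<^bsub>D\<^esub> (s::nat)" "coprime s p"
    using prime_index_generator[OF W a p fin b] by blast
  note cc = annihilates_closed[OF c] and Wc = subgroup.subset[OF W]
  have w: "w \<in> carrier D" using ws Wc by blast
  have pp: "p > 1" "\<alpha> [^]\<^bsub>D\<^esub> p \<in> W" using p unfolding order_mod_def by auto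
  have "c \<otimes>\<^bsub>T\<^esub> v p \<beta> = c \<otimes>\<^bsub>T\<^esub> v p (\<alpha> [^]\<^bsub>D\<^esub> s \<otimes>\<^bsub>D\<^esub> w)" using ws w a by (simp add: D.m_comm)
  also have "\<dots> = c \<otimes>\<^bsub>T\<^esub> v p (\<alpha> [^]\<^bsub>D\<^esub> s)" using annihilates_shift(1)[OF c Wc ws(1)] a by simp
  also have "\<dots> = c \<otimes>\<^bsub>T\<^esub> v p \<alpha>" by (rule generator_change[OF c W a pp(2) pp(1) ws(3)])
  finally show ?thesis using cc a ws w by (simp add: T.m_comm)
qed

text \<open>Splitting a step of order pm into \<alpha>^p of order m followed by \<alpha> of order p
  leaves the value unchanged, because v_(mp)(\<alpha>) = v_m(\<alpha>^p) v_p(\<alpha>).\<close>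

lemma step_prime_refinement:
  assumes "prime_chain V W L" "subgroup V D" "\<alpha> \<in> carrier D" "order_mod W \<alpha> n"
  shows "\<exists>L'. prime_chain V (adjoin W \<alpha>) L' \<and> val L' = v n \<alpha> \<otimes>\<^bsub>T\<^esub> val L"
  using assms
proof (induction n arbitrary: \<alpha> rule: less_induct)
  case (less n)
  have W: "subgroup W D" using less.prems chain_subgroup fin unfolding prime_chain_def by blast
  have n1: "n > 1" using less.prems unfolding order_mod_def by simp
  then obtain p where p: "Factorial_Ring.prime p" "p dvd n" using prime_factor_nat by (metis less_irrefl)
  then obtain m where m: "n = p * m" by auto
  have p1: "p > 1" using p prime_gt_1_nat by blast
  show ?case
  proof (cases "m = 1")
    case True
    then have "prime_chain V (adjoin W \<alpha>) ((\<alpha>, n) # L)"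
      using less.prems p m unfolding prime_chain_def by (auto intro: chain.intros)
    then show ?thesis by (metis val_simps(2))
  next
    case False
    then have m1: "m > 1" using n1 m by (cases m) auto
    note split = order_mod_split[OF W less.prems(3) less.prems(4)[unfolded m] p1 m1 fin]
    have "m < n" using m p1 m1 by simp
    then obtain L' where L': "prime_chain V (adjoin W (\<alpha> [^]\<^bsub>D\<^esub> p)) L'"
        "val L' = v m (\<alpha> [^]\<^bsub>D\<^esub> p) \<otimes>\<^bsub>T\<^esub> val L"
      using less.IH[OF _ less.prems(1,2) _ split(1)] less.prems by auto
    have "prime_chain V (adjoin W \<alpha>) ((\<alpha>, p) # L')"
      using L' split less.prems p chain.Cons[of V "adjoin W (\<alpha> [^]\<^bsub>D\<^esub> p)" L' \<alpha> p]
      unfolding prime_chain_def by auto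
    moreover have "val L \<in> carrier T"
      using less.prems chain_val_closed unfolding prime_chain_def by blast
    then have "val ((\<alpha>, p) # L') = v n \<alpha> \<otimes>\<^bsub>T\<^esub> val L"
      using L' less.prems v_mult[of \<alpha> m p] m by (simp add: T.m_ac mult.commute)
    ultimately show ?thesis by blast
  qed
qed

lemma prime_refinement:
  assumes "chain V W L" "subgroup V D"
  shows "\<exists>L'. prime_chain V W L' \<and> val L' = val L"
  using assms
proof induction
  case Nil
  have "prime_chain V V []" by (simp add: prime_chain_def chain.intros)
  then show ?case by blast
next
  case (Cons W L \<alpha> n)
  then obtain L' where "prime_chain V W L'" "val L' = val L" by blast
  then show ?case using step_prime_refinement[of V W L' \<alpha> n] Cons by auto
qed

text \<open>Every step of a chain is proper, so a chain cannot return to its start.\<close>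

lemma chain_NilE:
  assumes "chain V V L" "subgroup V D"
  shows "L = []"
  using assms(1)
proof cases
  case (Cons W L' \<alpha> n)
  have W: "subgroup W D" "V \<subseteq> W"
    using chain_subgroup[OF Cons(3) assms(2) fin] chain_subset[OF Cons(3) assms(2) fin] .
  have "\<alpha> \<in> V" using mem_adjoin[OF W(1) Cons(4)] Cons(1) by metis
  moreover have "\<alpha> \<notin> W" using order_mod_nontrivial[OF Cons(5,4)] .
  ultimately show ?thesis using W by blast
qed simp

text \<open>Induction on the order of \<open>W\<close>. If both chains end with a step from the same
  subgroup, only the last generator differs. Otherwise the two subgroups have prime index in
  \<open>W\<close> and neither contains the other; chains through their intersection, with
  generators taken from the opposite subgroup, have values that differ only in the order of two
  factors.\<close>

lemma prime_chain_val_unique: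
  assumes V: "subgroup V D" "\<And>w. w \<in> V \<Longrightarrow> X w = \<zero>\<^bsub>T\<^esub>"
    and "prime_chain V W L" "prime_chain V W L'"
  shows "val L = val L'"
  using assms(3,4)
proof (induction "card W" arbitrary: W L L' rule: less_induct)
  case less
  \<comment> \<open>\<open>step\<close> unpacks the top step of a nonempty chain together with what
    is needed of the chain below it, including that the value of that chain kills \<open>X\<close>
    on the smaller subgroup.\<close>
  have step: "\<exists>W\<^sub>1 L\<^sub>1 \<alpha> p. L = (\<alpha>, p) # L\<^sub>1 \<and> W = adjoin W\<^sub>1 \<alpha> \<and> prime_chain V W\<^sub>1 L\<^sub>1 \<and> subgroup W\<^sub>1 D \<and>
     V \<subseteq> W\<^sub>1 \<and> \<alpha> \<in> carrier D \<and> order_mod W\<^sub>1 \<alpha> p \<and> Factorial_Ring.prime p \<and> card W\<^sub>1 < card W \<and>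
     annihilates (val L\<^sub>1) W\<^sub>1"
    if L: "prime_chain V W L" "L \<noteq> []" for L
  proof -
    from L(1) have "chain V W L" unfolding prime_chain_def by blast
    then show ?thesis
    proof cases
      case (Cons W1 L1 \<alpha> p)
      have W1: "subgroup W1 D" using chain_subgroup[OF Cons(3) V(1) fin] .
      have "card W1 > 0" using W1 fin
        by (metis card_gt_0_iff empty_iff finite_subset subgroup.one_closed subgroup.subset)
      moreover have "p > 1" using Cons(5) unfolding order_mod_def by simp
      ultimately have "card W1 < card W"
        using card_adjoin[OF W1 Cons(4,5)] Cons(1) by simp
      then show ?thesis
        using Cons L W1 chain_subset[OF Cons(3) V(1) fin] chain_annihilates[OF Cons(3) V]
        unfolding prime_chain_def by auto
    qed (use L in simp)
  qed
  show ?case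
  proof (cases "W = V")
    case True
    then show ?thesis using less.prems chain_NilE[OF _ V(1)] unfolding prime_chain_def by metis
  next
    case False
    then have ne: "L \<noteq> []" "L' \<noteq> []" using less.prems chain.cases[of V W "[]"]
      unfolding prime_chain_def by blast+
    obtain W1 L1 \<alpha> p where 1: "L = (\<alpha>, p) # L1" "W = adjoin W1 \<alpha>" "prime_chain V W1 L1" "subgroup W1 D"
     "V \<subseteq> W1" "\<alpha> \<in> carrier D" "order_mod W1 \<alpha> p" "Factorial_Ring.prime p" "card W1 < card W"
     "annihilates (val L1) W1" using step[OF less.prems(1) ne(1)] by blast
    obtain W2 L2 \<beta> q where 2: "L' = (\<beta>, q) # L2" "W = adjoin W2 \<beta>" "prime_chain V W2 L2" "subgroup W2 D"
     "V \<subseteq> W2" "\<beta> \<in> carrier D" "order_mod W2 \<beta> q" "Factorial_Ring.prime q" "card W2 < card W"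
     "annihilates (val L2) W2" using step[OF less.prems(2) ne(2)] by blast
    have W: "subgroup W D" using 1 subgroup_adjoin fin by simp
    have sub: "W1 \<subseteq> W" "W2 \<subseteq> W" using 1 2 subset_adjoin by blast+
    show ?thesis
    proof (cases "W1 = W2")
      case True
      have bW: "\<beta> \<in> adjoin W1 \<alpha>" "\<beta> \<notin> W1"
        using mem_adjoin 1 2 True order_mod_nontrivial by auto
      have "card W1 * p = card W1 * q" using 1 2 True card_adjoin by metis
      moreover have "card W1 > 0" using 1(4) fin
        by (metis card_gt_0_iff empty_iff finite_subset subgroup.one_closed subgroup.subset)
      ultimately have "p = q" by simp
      moreover have "val L1 = val L2" using less.hyps[OF 1(9,3)] 2(3) True by simp
      ultimately show ?thesis
        using generator_change'[OF 1(10,4,6,7,8) bW] 1 2 by simp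
    next
      case False
      \<comment> \<open>By primality of the index, an element of \<open>W2\<close> outside
        \<open>W1\<close> generates \<open>W\<close> over \<open>W1\<close>; so \<open>W1\<close>
        inside \<open>W2\<close> would force \<open>W2 = W\<close>.\<close>
      have "\<not> W1 \<subseteq> W2"
      proof
        assume s: "W1 \<subseteq> W2"
        then obtain z where z: "z \<in> W2" "z \<notin> W1" using False by blast
        have "adjoin W1 z = W" using prime_index_generator[OF 1(4,6,7,8) fin] z sub 1(2) by blast
        then have "W \<subseteq> W2" using adjoin_subset[OF 2(4) s z(1)] by simp
        then show False using sub 2(9) by (metis less_irrefl subset_antisym)
      qed
      then obtain \<beta>' where b': "\<beta>' \<in> W1" "\<beta>' \<notin> W2" by blast
      have "\<not> W2 \<subseteq> W1"
      proof
        assume s: "W2 \<subseteq> W1"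
        have "adjoin W2 \<beta>' = W" using prime_index_generator[OF 2(4,6,7,8) fin] b' sub 2(2) by blast
        then have "W \<subseteq> W1" using adjoin_subset[OF 1(4) s b'(1)] by simp
        then show False using sub 1(9) by (metis less_irrefl subset_antisym)
      qed
      then obtain \<alpha>' where a': "\<alpha>' \<in> W2" "\<alpha>' \<notin> W1" by blast
      have c': "\<alpha>' \<in> carrier D" "\<beta>' \<in> carrier D" using a' b' 1 2 by (auto simp: subgroup.mem_carrier)
      have A: "order_mod W1 \<alpha>' p" "adjoin W1 \<alpha>' = W"
        using prime_index_generator[OF 1(4,6,7,8) fin] a' sub 1(2) by blast+
      have B: "order_mod W2 \<beta>' q" "adjoin W2 \<beta>' = W"
        using prime_index_generator[OF 2(4,6,7,8) fin] b' sub 2(2) by blast+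
      \<comment> \<open>Over the intersection \<open>\<beta>'\<close> generates \<open>W1\<close>
        with order \<open>q\<close>, and \<open>\<alpha>'\<close> generates \<open>W2\<close> with
        order \<open>p\<close>. Both sides of this diamond can be completed by one chain
        \<open>K\<close> below it.\<close>
      let ?U = "W1 \<inter> W2"
      have U1: "order_mod ?U \<beta>' q" "adjoin ?U \<beta>' = W1"
        using adjoin_Int[OF 1(4) 2(4) b'(1) B(1)] B sub by simp_all
      have U2: "order_mod ?U \<alpha>' p" "adjoin ?U \<alpha>' = W2"
        using adjoin_Int[OF 2(4) 1(4) a'(1) A(1)] A sub by (simp_all add: Int_commute)
      have "subgroup ?U D" using subgroups_Inter_pair 1(4) 2(4) by blast
      then obtain K0 where "chain V ?U K0" using chain_exists[OF V(1) _ _ fin] 1(5) 2(5) by blast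
      then obtain K where K: "prime_chain V ?U K" using prime_refinement V(1) by blast
      then have K1: "prime_chain V W1 ((\<beta>', q) # K)" and K2: "prime_chain V W2 ((\<alpha>', p) # K)"
        using chain.Cons[of V ?U K \<beta>' q] chain.Cons[of V ?U K \<alpha>' p] U1 U2 c' 1(8) 2(8)
        unfolding prime_chain_def by auto
      have Kc: "val K \<in> carrier T" using K chain_val_closed unfolding prime_chain_def by blast
      have "val L = v p \<alpha>' \<otimes>\<^bsub>T\<^esub> val L1"
        using generator_change'[OF 1(10,4,6,7,8), of \<alpha>'] a' sub 1(1,2) by auto
      also have "val L1 = v q \<beta>' \<otimes>\<^bsub>T\<^esub> val K" using less.hyps[OF 1(9,3) K1] by simp
      finally have vL: "val L = v p \<alpha>' \<otimes>\<^bsub>T\<^esub> (v q \<beta>' \<otimes>\<^bsub>T\<^esub> val K)" .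
      have "val L' = v q \<beta>' \<otimes>\<^bsub>T\<^esub> val L2"
        using generator_change'[OF 2(10,4,6,7,8), of \<beta>'] b' sub 2(1,2) by auto
      also have "val L2 = v p \<alpha>' \<otimes>\<^bsub>T\<^esub> val K" using less.hyps[OF 2(9,3) K2] by simp
      finally show ?thesis using vL Kc c' by (simp add: T.m_ac)
    qed
  qed
qed

theorem chain_val_unique:
  assumes "subgroup V D" "\<And>w. w \<in> V \<Longrightarrow> X w = \<zero>\<^bsub>T\<^esub>" "chain V W L" "chain V W L'"
  shows "val L = val L'"
  using prime_refinement[OF assms(3,1)] prime_refinement[OF assms(4,1)]
    prime_chain_val_unique[OF assms(1,2)] by metis

text \<open>Where \<open>X\<close> vanishes, the shift law gives v_n(\<alpha>) its value n at the
  identity.\<close>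

lemma chain_val_trivial:
  assumes "chain V W L" "subgroup V D" "\<And>w. w \<in> W \<Longrightarrow> X w = \<zero>\<^bsub>T\<^esub>"
  shows "val L = [prod_list (map snd L)] \<cdot>\<^bsub>T\<^esub> \<one>\<^bsub>T\<^esub>"
  using assms
proof induction
  case (Cons W L \<alpha> n)
  have W: "subgroup W D" using chain_subgroup[OF Cons.hyps(1) Cons.prems(1) fin] .
  have IH: "val L = [prod_list (map snd L)] \<cdot>\<^bsub>T\<^esub> \<one>\<^bsub>T\<^esub>" using Cons subset_adjoin[OF W] by blast
  have Xa: "X \<alpha> = \<zero>\<^bsub>T\<^esub>" using Cons.prems(2) mem_adjoin[OF W Cons.hyps(2)] by blast
  obtain c where "c \<in> carrier T" "v n (\<one>\<^bsub>D\<^esub> \<otimes>\<^bsub>D\<^esub> \<alpha>) = v n \<one>\<^bsub>D\<^esub> \<oplus>\<^bsub>T\<^esub> c \<otimes>\<^bsub>T\<^esub> X \<alpha>"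
    using v_shift[of "\<one>\<^bsub>D\<^esub>" \<alpha> n] Cons.hyps by auto
  then have "v n \<alpha> = [n] \<cdot>\<^bsub>T\<^esub> \<one>\<^bsub>T\<^esub>" using Cons.hyps v_one Xa by simp
  then show ?case using IH
    by (simp add: T.add_pow_ldistr T.add_pow_rdistr T.add.nat_pow_pow mult.commute)
qed simp

end

section \<open>Characters of finite abelian groups\<close>

lemma set_mult_subgroup_carrier [simp]: "set_mult (G\<lparr>carrier := H\<rparr>) = set_mult G"
  by (simp add: set_mult_def fun_eq_iff)

lemma r_coset_update_carrier [simp]: "r_coset (G\<lparr>carrier := H\<rparr>) = r_coset G"
  by (simp add: r_coset_def fun_eq_iff)

section \<open>The group Q/Z and its roots\<close>

definition rat_class :: "rat \<Rightarrow> rat set" where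
  "rat_class q = {q + z | z. z \<in> \<int>}"

lemma rat_group: "comm_group \<lparr>carrier = UNIV, monoid.mult = (+), monoid.one = (0::rat)\<rparr>"
  by (rule comm_groupI) (auto intro: exI[of _ "- x" for x])

lemma rat_class_eq_coset:
  "rat_class q = \<int> #>\<^bsub>\<lparr>carrier = UNIV, monoid.mult = (+), monoid.one = (0::rat)\<rparr>\<^esub> q"
  by (auto simp: rat_class_def r_coset_def add.commute)

lemma Ints_normal: "\<int> \<lhd> \<lparr>carrier = UNIV, monoid.mult = (+), monoid.one = (0::rat)\<rparr>"
proof -
  interpret comm_group "\<lparr>carrier = UNIV, monoid.mult = (+), monoid.one = (0::rat)\<rparr>" by (rule rat_group)
  have inv: "inv\<^bsub>\<lparr>carrier = UNIV, monoid.mult = (+), monoid.one = (0::rat)\<rparr>\<^esub> q = - q" for q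
    by (rule inv_equality) auto
  show ?thesis
    by (rule subgroup_imp_normal, rule subgroupI) (auto simp: inv)
qed

lemma carrier_rat_mod_int: "carrier rat_mod_int = range rat_class"
  by (auto simp: rat_mod_int_def FactGroup_def RCOSETS_def rat_class_eq_coset)

lemma rat_class_mult: "rat_class p \<otimes>\<^bsub>rat_mod_int\<^esub> rat_class q = rat_class (p + q)"
  using normal.rcos_sum[OF Ints_normal, of p q] by (simp add: rat_mod_int_def rat_class_eq_coset)

lemma rat_class_zero: "\<one>\<^bsub>rat_mod_int\<^esub> = rat_class 0"
  by (simp add: rat_mod_int_def rat_class_def)

lemma rat_class_eq_iff: "rat_class p = rat_class q \<longleftrightarrow> p - q \<in> \<int>"
proof
  assume "rat_class p = rat_class q"
  moreover have "p \<in> rat_class p" unfolding rat_class_def by (auto intro!: exI[of _ 0])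
  ultimately have "p \<in> rat_class q" by simp
  then show "p - q \<in> \<int>" by (auto simp: rat_class_def)
next
  assume d: "p - q \<in> \<int>"
  have "\<exists>z'. p + z = q + z' \<and> z' \<in> \<int>" if "z \<in> \<int>" for z
    by (rule exI[of _ "(p - q) + z"]) (simp add: d that)
  moreover have "\<exists>z'. q + z = p + z' \<and> z' \<in> \<int>" if "z \<in> \<int>" for z
    by (rule exI[of _ "z - (p - q)"]) (simp add: d that)
  ultimately show "rat_class p = rat_class q" unfolding rat_class_def by fast
qed

lemma comm_group_rat_mod_int: "comm_group rat_mod_int"
  unfolding rat_mod_int_def
  by (rule comm_group.abelian_FactGroup[OF rat_group normal_imp_subgroup[OF Ints_normal]])

interpretation QZ: comm_group rat_mod_int by (rule comm_group_rat_mod_int)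

lemma rat_class_pow: "rat_class q [^]\<^bsub>rat_mod_int\<^esub> (n::nat) = rat_class (of_nat n * q)"
  by (induction n) (simp_all add: rat_class_zero rat_class_mult algebra_simps)

lemma rat_class_in_carrier [simp]: "rat_class q \<in> carrier rat_mod_int"
  by (simp add: carrier_rat_mod_int)

text \<open>A solution p satisfies n p = q + j with an integer j, and reducing j modulo n changes p
  by an integer. For q = 0 the list describes the elements killed by n, as needed for splitting off
  cyclic summands.\<close>

lemma rat_mod_int_roots_eq:
  assumes n: "n > (0::nat)"
  shows "{y \<in> carrier rat_mod_int. y [^]\<^bsub>rat_mod_int\<^esub> n = rat_class q} =
    (\<lambda>i::nat. rat_class ((q + of_nat i) / of_nat n)) ` {..<n}"
proof -
  define f where "f = (\<lambda>i::nat. rat_class ((q + of_nat i) / of_nat n))"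
  have "f i [^]\<^bsub>rat_mod_int\<^esub> n = rat_class q" "f i \<in> carrier rat_mod_int" for i
    using n unfolding f_def rat_class_pow rat_class_eq_iff by simp_all
  moreover have "y \<in> f ` {..<n}"
    if yc: "y \<in> carrier rat_mod_int" and yn: "y [^]\<^bsub>rat_mod_int\<^esub> n = rat_class q" for y
  proof -
    obtain p where y: "y = rat_class p" using yc by (auto simp: carrier_rat_mod_int)
    then have "of_nat n * p - q \<in> \<int>" using yn by (simp add: rat_class_pow rat_class_eq_iff)
    then obtain j :: int where j: "of_nat n * p - q = of_int j" by (auto elim: Ints_cases)
    define i where "i = nat (j mod int n)"
    have i: "i < n" "int i = j mod int n" using n unfolding i_def by (simp_all add: nat_less_iff)
    have "j = int i + int n * (j div int n)" using i by simp
    then have "(of_int j :: rat) = of_nat i + of_nat n * of_int (j div int n)"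
      by (metis of_int_add of_int_mult of_int_of_nat_eq)
    then have "p - (q + of_nat i) / of_nat n = of_int (j div int n)"
      using j n by (simp add: field_simps)
    then have "y = f i" unfolding y f_def rat_class_eq_iff by simp
    then show "y \<in> f ` {..<n}" using i by blast
  qed
  ultimately show ?thesis unfolding f_def by blast
qed

lemma rat_mod_int_roots:
  assumes z: "z \<in> carrier rat_mod_int" and n: "n > (0::nat)"
  shows "finite {y \<in> carrier rat_mod_int. y [^]\<^bsub>rat_mod_int\<^esub> n = z}"
    "card {y \<in> carrier rat_mod_int. y [^]\<^bsub>rat_mod_int\<^esub> n = z} = n"
proof -
  obtain q where q: "z = rat_class q" using z carrier_rat_mod_int by auto
  define f where "f = (\<lambda>i::nat. rat_class ((q + of_nat i) / of_nat n))"
  have "{y \<in> carrier rat_mod_int. y [^]\<^bsub>rat_mod_int\<^esub> n = z} = f ` {..<n}"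
    unfolding q f_def by (rule rat_mod_int_roots_eq[OF n])
  moreover have "inj_on f {..<n}"
  proof (rule inj_onI)
    fix i j assume ij: "i \<in> {..<n}" "j \<in> {..<n}" "f i = f j"
    then have "(q + of_nat i) / of_nat n - (q + of_nat j) / of_nat n \<in> (\<int> :: rat set)"
      by (simp add: f_def rat_class_eq_iff)
    then obtain m :: int where "(q + of_nat i) / of_nat n - (q + of_nat j) / of_nat n = (of_int m :: rat)"
      by (auto elim: Ints_cases)
    then have "(of_nat i - of_nat j) / of_nat n = (of_int m :: rat)"
      by (simp add: diff_divide_distrib add_divide_distrib)
    then have "(of_nat i - of_nat j :: rat) = of_int m * of_nat n" using n by (simp add: divide_eq_eq)
    then have e: "int i - int j = m * int n"
      by (metis (mono_tags) of_int_diff of_int_eq_iff of_int_mult of_int_of_nat_eq)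
    have "m = 0"
    proof (rule ccontr)
      assume "m \<noteq> 0"
      then have "1 * int n \<le> \<bar>m\<bar> * int n" by (intro mult_right_mono) auto
      then have "\<bar>m * int n\<bar> \<ge> int n" by (simp add: abs_mult)
      then show False using e ij by auto
    qed
    then show "i = j" using e by simp
  qed
  ultimately show "finite {y \<in> carrier rat_mod_int. y [^]\<^bsub>rat_mod_int\<^esub> n = z}"
    "card {y \<in> carrier rat_mod_int. y [^]\<^bsub>rat_mod_int\<^esub> n = z} = n"
    by (simp_all add: card_image)
qed

section \<open>Extending and counting characters\<close>

context comm_group
begin

text \<open>The characters of W/V, written as characters of \<open>W\<close> that are trivial on
  \<open>V\<close>, so that extension problems avoid quotient groups. Annihilators are the case
  where \<open>W\<close> is the whole group.\<close>

definition chars :: "'a set \<Rightarrow> 'a set \<Rightarrow> ('a \<Rightarrow> rat set) set" where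
  "chars V W = {\<xi> \<in> hom (G\<lparr>carrier := W\<rparr>) rat_mod_int \<inter> extensional W.
     \<forall>v\<in>V. \<xi> v = \<one>\<^bsub>rat_mod_int\<^esub>}"

lemma charsD:
  assumes "\<xi> \<in> chars V W"
  shows "\<And>w. w \<in> W \<Longrightarrow> \<xi> w \<in> carrier rat_mod_int"
    "\<And>a b. a \<in> W \<Longrightarrow> b \<in> W \<Longrightarrow> \<xi> (a \<otimes> b) = \<xi> a \<otimes>\<^bsub>rat_mod_int\<^esub> \<xi> b"
    "\<And>v. v \<in> V \<Longrightarrow> \<xi> v = \<one>\<^bsub>rat_mod_int\<^esub>" "\<xi> \<in> extensional W"
  using assms by (auto simp: chars_def hom_def)

lemma chars_pow:
  assumes c: "\<xi> \<in> chars V W" and W: "subgroup W G" and a: "a \<in> W"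
  shows "\<xi> (a [^] (n::nat)) = \<xi> a [^]\<^bsub>rat_mod_int\<^esub> n"
proof -
  have one: "\<xi> \<one> = \<one>\<^bsub>rat_mod_int\<^esub>"
  proof -
    have "\<one> \<in> W" using W by (rule subgroup.one_closed)
    then have "\<xi> \<one> \<otimes>\<^bsub>rat_mod_int\<^esub> \<xi> \<one> = \<xi> \<one>" "\<xi> \<one> \<in> carrier rat_mod_int"
      using charsD[OF c] by (metis l_one one_closed, simp)
    then show ?thesis by simp
  qed
  show ?thesis
    by (induction n) (use one a charsD[OF c] subgroup_pow_closed[OF W a] in simp_all)
qed

text \<open>Send w \<alpha>^j to \<xi>(w) y^j. If w \<alpha>^i = w' \<alpha>^j then \<open>n\<close>
  divides \<open>j - i\<close>, and the condition on the n-th power of \<open>y\<close> makes the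
  value unambiguous.\<close>

lemma chars_extend:
  assumes c: "\<xi> \<in> chars V W" and W: "subgroup W G" and VW: "V \<subseteq> W" and a: "\<alpha> \<in> carrier G"
    and n: "order_mod W \<alpha> n"
    and y: "y \<in> carrier rat_mod_int" "y [^]\<^bsub>rat_mod_int\<^esub> n = \<xi> (\<alpha> [^] n)" and fin: "finite (carrier G)"
  shows "\<exists>\<xi>'\<in>chars V (adjoin W \<alpha>). restrict \<xi>' W = \<xi> \<and> \<xi>' \<alpha> = y"
proof -
  interpret W: subgroup W G by fact
  have iff: "\<alpha> [^] (j::nat) \<in> W \<longleftrightarrow> n dvd j" for j using n unfolding order_mod_def by blast
  note D = charsD[OF c]
  have wd0: "\<xi> w \<otimes>\<^bsub>rat_mod_int\<^esub> y [^]\<^bsub>rat_mod_int\<^esub> i = \<xi> w' \<otimes>\<^bsub>rat_mod_int\<^esub> y [^]\<^bsub>rat_mod_int\<^esub> j"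
    if eq: "w \<otimes> \<alpha> [^] i = w' \<otimes> \<alpha> [^] j" and w: "w \<in> W" "w' \<in> W" and ij: "i \<le> j" for w w' and i j :: nat
  proof -
    have "\<alpha> [^] j = \<alpha> [^] (j - i) \<otimes> \<alpha> [^] i" using a ij by (simp add: nat_pow_mult)
    then have "w \<otimes> \<alpha> [^] i = (w' \<otimes> \<alpha> [^] (j - i)) \<otimes> \<alpha> [^] i" using eq w a by (simp add: m_assoc)
    then have e: "w = w' \<otimes> \<alpha> [^] (j - i)" using w a by simp
    then have "\<alpha> [^] (j - i) \<in> W" using subgroup_mult_iff(1)[OF W w(2), of "\<alpha> [^] (j - i)"] w a by simp
    then obtain m where m: "j - i = n * m" using iff by auto
    have an: "\<alpha> [^] n \<in> W" using iff by simp
    have "\<xi> (\<alpha> [^] (j - i)) = \<xi> ((\<alpha> [^] n) [^] m)" using m a by (simp add: nat_pow_pow)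
    also have "\<dots> = y [^]\<^bsub>rat_mod_int\<^esub> (j - i)"
      using chars_pow[OF c W an, of m] y m QZ.nat_pow_pow[OF y(1), of n m] by simp
    finally have "\<xi> w = \<xi> w' \<otimes>\<^bsub>rat_mod_int\<^esub> y [^]\<^bsub>rat_mod_int\<^esub> (j - i)"
      using e D(2) w \<open>\<alpha> [^] (j - i) \<in> W\<close> by simp
    moreover have "y [^]\<^bsub>rat_mod_int\<^esub> j = y [^]\<^bsub>rat_mod_int\<^esub> (j - i) \<otimes>\<^bsub>rat_mod_int\<^esub> y [^]\<^bsub>rat_mod_int\<^esub> i"
      using y ij by (simp add: QZ.nat_pow_mult)
    ultimately show ?thesis using D(1) w y by (simp add: QZ.m_assoc)
  qed
  have wd: "\<xi> w \<otimes>\<^bsub>rat_mod_int\<^esub> y [^]\<^bsub>rat_mod_int\<^esub> i = \<xi> w' \<otimes>\<^bsub>rat_mod_int\<^esub> y [^]\<^bsub>rat_mod_int\<^esub> j"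
    if eq: "w \<otimes> \<alpha> [^] i = w' \<otimes> \<alpha> [^] j" and w: "w \<in> W" "w' \<in> W" for w w' and i j :: nat
    using wd0[OF eq w] wd0[OF eq[symmetric] w(2,1)] by (cases "i \<le> j") auto
  define \<xi>' where "\<xi>' = (\<lambda>z\<in>adjoin W \<alpha>. THE t. \<exists>w\<in>W. \<exists>j::nat. z = w \<otimes> \<alpha> [^] j \<and>
    t = \<xi> w \<otimes>\<^bsub>rat_mod_int\<^esub> y [^]\<^bsub>rat_mod_int\<^esub> j)"
  have val: "\<xi>' (w \<otimes> \<alpha> [^] j) = \<xi> w \<otimes>\<^bsub>rat_mod_int\<^esub> y [^]\<^bsub>rat_mod_int\<^esub> j" if w: "w \<in> W" for w and j :: nat
  proof -
    have "w \<otimes> \<alpha> [^] j \<in> adjoin W \<alpha>" using w unfolding adjoin_def by blast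
    moreover have "(THE t. \<exists>w'\<in>W. \<exists>j'::nat. w \<otimes> \<alpha> [^] j = w' \<otimes> \<alpha> [^] j' \<and>
        t = \<xi> w' \<otimes>\<^bsub>rat_mod_int\<^esub> y [^]\<^bsub>rat_mod_int\<^esub> j') = \<xi> w \<otimes>\<^bsub>rat_mod_int\<^esub> y [^]\<^bsub>rat_mod_int\<^esub> j"
      by (rule the_equality) (use w wd in blast)+
    ultimately show ?thesis unfolding \<xi>'_def by simp
  qed
  have on_W: "\<xi>' w = \<xi> w" if "w \<in> W" for w
    using val[OF that, of 0] that D(1) by simp
  have 1: "\<xi> \<one> = \<one>\<^bsub>rat_mod_int\<^esub>" using chars_pow[OF c W W.one_closed, of 0] by simp
  have "\<xi>' \<in> hom (G\<lparr>carrier := adjoin W \<alpha>\<rparr>) rat_mod_int"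
  proof (rule homI; clarsimp)
    fix z assume "z \<in> adjoin W \<alpha>"
    then obtain w and j :: nat where z: "w \<in> W" "z = w \<otimes> \<alpha> [^] j" unfolding adjoin_def by blast
    then show "\<xi>' z \<in> carrier rat_mod_int" using val D(1) y by simp
    fix z' assume "z' \<in> adjoin W \<alpha>"
    then obtain w' and i :: nat where z': "w' \<in> W" "z' = w' \<otimes> \<alpha> [^] i" unfolding adjoin_def by blast
    have "z \<otimes> z' = (w \<otimes> w') \<otimes> \<alpha> [^] (j + i)" using z z' a by (simp add: nat_pow_mult [symmetric] m_ac)
    then have "\<xi>' (z \<otimes> z') = \<xi> (w \<otimes> w') \<otimes>\<^bsub>rat_mod_int\<^esub> y [^]\<^bsub>rat_mod_int\<^esub> (j + i)"
      using val[of "w \<otimes> w'" "j + i"] z z' by simp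
    also have "\<dots> = \<xi>' z \<otimes>\<^bsub>rat_mod_int\<^esub> \<xi>' z'"
      using z z' val D y by (simp add: QZ.nat_pow_mult [symmetric] QZ.m_ac)
    finally show "\<xi>' (z \<otimes> z') = \<xi>' z \<otimes>\<^bsub>rat_mod_int\<^esub> \<xi>' z'" .
  qed
  moreover have "\<xi>' v = \<one>\<^bsub>rat_mod_int\<^esub>" if "v \<in> V" for v using on_W VW D(3) that by auto
  moreover have "\<xi>' \<in> extensional (adjoin W \<alpha>)" by (simp add: \<xi>'_def)
  ultimately have "\<xi>' \<in> chars V (adjoin W \<alpha>)" unfolding chars_def by blast
  moreover have "restrict \<xi>' W = \<xi>" using on_W D(4) by (auto simp: fun_eq_iff extensional_def)
  moreover have "\<xi>' \<alpha> = y" using val[OF W.one_closed, of 1] a y 1 by simp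
  ultimately show ?thesis by blast
qed

lemma chars_restrict:
  assumes "\<xi> \<in> chars V W'" "W \<subseteq> W'" "subgroup W G" "V \<subseteq> W"
  shows "restrict \<xi> W \<in> chars V W"
  using assms unfolding chars_def hom_def
  by (auto simp: subgroup.m_closed subset_iff Pi_iff)

text \<open>A character of \<open>adjoin W \<alpha>\<close> is fixed by its restriction to
  \<open>W\<close> and its value at \<open>\<alpha>\<close>, and the only constraint on that value
  is its n-th power. As n-th roots in Q/Z number n, each step of a chain multiplies the number of
  characters by its order.\<close>

lemma bij_betw_chars:
  assumes W: "subgroup W G" and VW: "V \<subseteq> W" and a: "\<alpha> \<in> carrier G"
    and n: "order_mod W \<alpha> n" and fin: "finite (carrier G)"
  shows "bij_betw (\<lambda>\<xi>. (restrict \<xi> W, \<xi> \<alpha>)) (chars V (adjoin W \<alpha>))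
    (SIGMA \<xi>:chars V W. {y \<in> carrier rat_mod_int. y [^]\<^bsub>rat_mod_int\<^esub> n = \<xi> (\<alpha> [^] n)})"
  unfolding bij_betw_def
proof
  let ?W' = "adjoin W \<alpha>"
  have W': "subgroup ?W' G" and sub: "W \<subseteq> ?W'" and aW': "\<alpha> \<in> ?W'"
    using subgroup_adjoin[OF W fin a] subset_adjoin[OF W] mem_adjoin[OF W a] .
  have an: "\<alpha> [^] n \<in> W" using n unfolding order_mod_def by simp
  show "inj_on (\<lambda>\<xi>. (restrict \<xi> W, \<xi> \<alpha>)) (chars V ?W')"
  proof (rule inj_onI, clarsimp)
    fix \<xi> \<xi>' assume c: "\<xi> \<in> chars V ?W'" "\<xi>' \<in> chars V ?W'"
      and eq: "restrict \<xi> W = restrict \<xi>' W" "\<xi> \<alpha> = \<xi>' \<alpha>"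
    show "\<xi> = \<xi>'"
    proof (rule extensionalityI[OF charsD(4)[OF c(1)] charsD(4)[OF c(2)]])
      fix z assume "z \<in> ?W'"
      then obtain w and j :: nat where z: "w \<in> W" "z = w \<otimes> \<alpha> [^] j" unfolding adjoin_def by blast
      have w: "w \<in> ?W'" "\<alpha> [^] j \<in> ?W'" using z sub subgroup_pow_closed[OF W' aW'] by auto
      have "\<xi> w = \<xi>' w" using eq z by (metis restrict_apply')
      then show "\<xi> z = \<xi>' z"
        using z w eq charsD(2)[OF c(1)] charsD(2)[OF c(2)] chars_pow[OF c(1) W' aW'] chars_pow[OF c(2) W' aW']
        by simp
    qed
  qed
  show "(\<lambda>\<xi>. (restrict \<xi> W, \<xi> \<alpha>)) ` chars V ?W' =
    (SIGMA \<xi>:chars V W. {y \<in> carrier rat_mod_int. y [^]\<^bsub>rat_mod_int\<^esub> n = \<xi> (\<alpha> [^] n)})"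
  proof (intro equalityI subsetI)
    fix z assume "z \<in> (\<lambda>\<xi>. (restrict \<xi> W, \<xi> \<alpha>)) ` chars V ?W'"
    then obtain \<xi> where c: "\<xi> \<in> chars V ?W'" "z = (restrict \<xi> W, \<xi> \<alpha>)" by blast
    then show "z \<in> (SIGMA \<xi>:chars V W. {y \<in> carrier rat_mod_int. y [^]\<^bsub>rat_mod_int\<^esub> n = \<xi> (\<alpha> [^] n)})"
      using chars_restrict[OF c(1) sub W VW] chars_pow[OF c(1) W' aW', of n] charsD(1)[OF c(1) aW'] an by simp
  next
    fix z assume "z \<in> (SIGMA \<xi>:chars V W. {y \<in> carrier rat_mod_int. y [^]\<^bsub>rat_mod_int\<^esub> n = \<xi> (\<alpha> [^] n)})"
    then obtain \<xi> y where "z = (\<xi>, y)" "\<xi> \<in> chars V W" "y \<in> carrier rat_mod_int"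
       "y [^]\<^bsub>rat_mod_int\<^esub> n = \<xi> (\<alpha> [^] n)" by auto
    then show "z \<in> (\<lambda>\<xi>. (restrict \<xi> W, \<xi> \<alpha>)) ` chars V ?W'"
      using chars_extend[OF _ W VW a n _ _ fin, of \<xi> y] by (force simp: image_iff)
  qed
qed

lemma chain_card_chars:
  assumes "chain V W L" "subgroup V G" "finite (carrier G)"
  shows "finite (chars V W) \<and> card (chars V W) = prod_list (map snd L)"
  using assms
proof induction
  case Nil
  have "chars V V = {\<lambda>v\<in>V. \<one>\<^bsub>rat_mod_int\<^esub>}"
  proof
    show "chars V V \<subseteq> {\<lambda>v\<in>V. \<one>\<^bsub>rat_mod_int\<^esub>}"
      by (auto simp: chars_def extensional_def fun_eq_iff)
    show "{\<lambda>v\<in>V. \<one>\<^bsub>rat_mod_int\<^esub>} \<subseteq> chars V V"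
      using Nil by (auto simp: chars_def hom_def subgroup.m_closed)
  qed
  then show ?case by simp
next
  case (Cons W L \<alpha> n)
  have W: "subgroup W G" "V \<subseteq> W" using chain_subgroup chain_subset Cons by blast+
  have n: "n > 0" "\<alpha> [^] n \<in> W" using Cons.hyps unfolding order_mod_def by auto
  note bij = bij_betw_chars[OF W Cons.hyps(2,3) Cons.prems(2)]
  have IH: "finite (chars V W)" "card (chars V W) = prod_list (map snd L)" using Cons by auto
  note roots = rat_mod_int_roots[OF _ n(1)]
  have "finite (SIGMA \<xi>:chars V W. {y \<in> carrier rat_mod_int. y [^]\<^bsub>rat_mod_int\<^esub> n = \<xi> (\<alpha> [^] n)})"
    using IH roots charsD(1) n by (intro finite_SigmaI) auto
  moreover have "card (SIGMA \<xi>:chars V W. {y \<in> carrier rat_mod_int. y [^]\<^bsub>rat_mod_int\<^esub> n = \<xi> (\<alpha> [^] n)})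
      = card (chars V W) * n"
    using IH roots charsD(1) n by (subst card_SigmaI) (auto simp: mult.commute)
  ultimately show ?case
    using bij_betw_finite[OF bij] bij_betw_same_card[OF bij] IH by (simp add: mult.commute)
qed

lemma card_chars:
  assumes "subgroup V G" "subgroup W G" "V \<subseteq> W" "finite (carrier G)"
  shows "finite (chars V W)" "card (chars V W) * card V = card W"
proof -
  obtain L where "chain V W L" using chain_exists assms by blast
  then show "finite (chars V W)" "card (chars V W) * card V = card W"
    using chain_card_chars chain_card assms by (auto simp: mult.commute)
qed

text \<open>Roots exist in Q/Z, so a character passes through every step of a chain: injectivity of
  Q/Z in the finite case.\<close>

lemma chars_extend_chain:
  assumes "chain V W L" "subgroup V G" "\<xi> \<in> chars U V" "U \<subseteq> V" "finite (carrier G)"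
  shows "\<exists>\<xi>'\<in>chars U W. restrict \<xi>' V = \<xi>"
  using assms
proof induction
  case Nil
  then show ?case using charsD(4) by (metis extensional_restrict)
next
  case (Cons W L \<alpha> n)
  then obtain \<xi>1 where c1: "\<xi>1 \<in> chars U W" "restrict \<xi>1 V = \<xi>" by blast
  have W: "subgroup W G" "V \<subseteq> W" using chain_subgroup chain_subset Cons by blast+
  have n: "n > 0" "\<alpha> [^] n \<in> W" using Cons.hyps unfolding order_mod_def by auto
  have "card {y \<in> carrier rat_mod_int. y [^]\<^bsub>rat_mod_int\<^esub> n = \<xi>1 (\<alpha> [^] n)} > 0"
    using rat_mod_int_roots(2)[OF charsD(1)[OF c1(1) n(2)] n(1)] n by simp
  then obtain y where y: "y \<in> carrier rat_mod_int" "y [^]\<^bsub>rat_mod_int\<^esub> n = \<xi>1 (\<alpha> [^] n)"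
    by (auto simp: card_gt_0_iff)
  have UW: "U \<subseteq> W" using Cons.prems W by blast
  obtain \<xi>' where "\<xi>' \<in> chars U (adjoin W \<alpha>)" "restrict \<xi>' W = \<xi>1"
    using chars_extend[OF c1(1) W(1) UW Cons.hyps(2,3) y Cons.prems(4)] by blast
  moreover from this have "restrict \<xi>' V = restrict \<xi>1 V" using W(2) by (metis restrict_restrict Int_absorb1)
  ultimately show ?case using c1 by auto
qed

section \<open>The dual group and annihilators\<close>

lemma hom_carrier_chars: "hom G rat_mod_int \<inter> extensional (carrier G) = chars {} (carrier G)"
  by (auto simp: chars_def)

lemma ann_eq_chars: "ann G B = chars B (carrier G)"
  by (auto simp: ann_def dual_group_def chars_def)

lemma comm_group_dual: "comm_group (dual_group G)"
proof -
  let ?C = "hom G rat_mod_int \<inter> extensional (carrier G)"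
  let ?mult = "\<lambda>\<alpha> \<beta>. \<lambda>a\<in>carrier G. \<alpha> a \<otimes>\<^bsub>rat_mod_int\<^esub> \<beta> a"
  let ?one = "\<lambda>a\<in>carrier G. \<one>\<^bsub>rat_mod_int\<^esub>"
  have "\<exists>y\<in>?C. ?mult y x = ?one" if x: "x \<in> ?C" for x
  proof
    show "(\<lambda>a\<in>carrier G. inv\<^bsub>rat_mod_int\<^esub> x a) \<in> ?C"
      using x by (auto simp: hom_def QZ.inv_mult Pi_iff)
    show "?mult (\<lambda>a\<in>carrier G. inv\<^bsub>rat_mod_int\<^esub> x a) x = ?one"
      using x by (intro extensionalityI[of _ "carrier G"]) (auto simp: hom_def Pi_iff)
  qed
  moreover have "?mult ?one x = x" if x: "x \<in> ?C" for x
    using x by (intro extensionalityI[of _ "carrier G"]) (auto simp: hom_def Pi_iff)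
  moreover have "?mult x y \<in> ?C" if "x \<in> ?C" "y \<in> ?C" for x y
    using that by (auto simp: hom_def QZ.m_ac Pi_iff)
  moreover have "?mult x y = ?mult y x" if "x \<in> ?C" "y \<in> ?C" for x y
    using that by (intro extensionalityI[of _ "carrier G"]) (auto simp: hom_def QZ.m_comm Pi_iff)
  moreover have "?mult (?mult x y) z = ?mult x (?mult y z)" if "x \<in> ?C" "y \<in> ?C" "z \<in> ?C" for x y z
    using that by (intro extensionalityI[of _ "carrier G"]) (auto simp: hom_def QZ.m_assoc Pi_iff)
  moreover have "?one \<in> ?C" by (auto simp: hom_def)
  ultimately show ?thesis
    unfolding dual_group_def by (intro comm_groupI) (simp_all only: partial_object.simps monoid.simps)
qed

lemma finite_dual: "finite (carrier G) \<Longrightarrow> finite (carrier (dual_group G))"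
proof -
  assume fin: "finite (carrier G)"
  \<comment> \<open>A homomorphism is trivial at the identity, which brings the dual into the form
    to which the count of characters applies.\<close>
  have "chars {} (carrier G) = chars {\<one>} (carrier G)"
    using chars_pow[OF _ subgroup_self, of _ "{}" \<one> 0] by (auto simp: chars_def)
  then show ?thesis
    using card_chars(1)[OF triv_subgroup subgroup_self _ fin] by (simp add: dual_group_def hom_carrier_chars)
qed

lemma ann_antimono: "B' \<subseteq> B \<Longrightarrow> ann G B \<subseteq> ann G B'"
  by (auto simp: ann_def)

lemma subgroup_ann:
  assumes "B \<subseteq> carrier G"
  shows "subgroup (ann G B) (dual_group G)"
proof -
  interpret dual: comm_group "dual_group G" by (rule comm_group_dual)
  have inv: "inv\<^bsub>dual_group G\<^esub> \<alpha> = (\<lambda>a\<in>carrier G. inv\<^bsub>rat_mod_int\<^esub> \<alpha> a)"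
    if "\<alpha> \<in> carrier (dual_group G)" for \<alpha>
    by (rule dual.inv_equality)
      (use that in \<open>auto simp: dual_group_def hom_def QZ.inv_mult Pi_iff fun_eq_iff\<close>)
  show ?thesis
  proof (rule dual.subgroupI)
    show "ann G B \<noteq> {}"
      using dual.one_closed assms by (auto simp: ann_def dual_group_def subset_iff)
    show "inv\<^bsub>dual_group G\<^esub> \<alpha> \<in> ann G B" if "\<alpha> \<in> ann G B" for \<alpha>
      using that assms inv dual.inv_closed[of \<alpha>] by (auto simp: ann_def subset_iff)
    show "\<alpha> \<otimes>\<^bsub>dual_group G\<^esub> \<beta> \<in> ann G B" if "\<alpha> \<in> ann G B" "\<beta> \<in> ann G B" for \<alpha> \<beta>
      using that assms dual.m_closed[of \<alpha> \<beta>] by (auto simp: ann_def dual_group_def subset_iff)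
  qed (auto simp: ann_def)
qed

lemma card_ann:
  assumes "subgroup B G" "finite (carrier G)"
  shows "card (ann G B) * card B = card (carrier G)"
  using card_chars(2)[OF assms(1) subgroup_self subgroup.subset[OF assms(1)] assms(2)]
  by (simp add: ann_eq_chars)

end

section \<open>Cyclic decompositions\<close>

context comm_group
begin

text \<open>The cyclic group generated by \<open>\<alpha>\<close> meets \<open>W\<close> trivially,
  so passing to the quotient does not lower the order.\<close>

lemma order_mod_ord:
  assumes W: "subgroup W G" and fin: "finite (carrier G)" and a: "\<alpha> \<in> carrier G" "\<alpha> \<noteq> \<one>"
    and int: "\<And>j. \<alpha> [^] (j::nat) \<in> W \<Longrightarrow> \<alpha> [^] j = \<one>"
  shows "order_mod W \<alpha> (ord \<alpha>)"
proof -
  have "ord \<alpha> \<noteq> 1" using ord_eq_1 a by blast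
  moreover have "ord \<alpha> > 0" using ord_ge_1[OF fin a(1)] by simp
  moreover have "\<alpha> [^] j \<in> W \<longleftrightarrow> ord \<alpha> dvd j" for j :: nat
    using pow_eq_id[OF a(1), of j] int[of j] subgroup.one_closed[OF W] by metis
  ultimately show ?thesis unfolding order_mod_def by simp
qed

text \<open>Raising a relation (ab)^j = 1 to the power \<open>ord b\<close> removes b, so
  \<open>ord a\<close> divides \<open>j ord b\<close> and hence \<open>j\<close>; symmetrically for
  \<open>ord b\<close>.\<close>

lemma ord_mult_coprime:
  assumes a: "a \<in> carrier G" "b \<in> carrier G" and cop: "coprime (ord a) (ord b)"
  shows "ord (a \<otimes> b) = ord a * ord b"
proof -
  have aux: "ord a dvd j"
    if a: "a \<in> carrier G" "b \<in> carrier G" and cop: "coprime (ord a) (ord b)" and j: "(a \<otimes> b) [^] (j::nat) = \<one>"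
    for a b j
  proof -
    have "b [^] (j * ord b) = (b [^] ord b) [^] j" using a by (simp only: nat_pow_pow mult.commute)
    then have "b [^] (j * ord b) = \<one>" using a by simp
    moreover have "(a \<otimes> b) [^] (j * ord b) = \<one>"
      using nat_pow_pow[of "a \<otimes> b" j "ord b"] a j by simp
    ultimately have "a [^] (j * ord b) = \<one>" using a by (simp add: nat_pow_distrib)
    then show ?thesis using pow_eq_id a cop coprime_dvd_mult_left_iff by blast
  qed
  have "(a \<otimes> b) [^] j = \<one> \<longleftrightarrow> ord a * ord b dvd j" for j :: nat
  proof
    assume j: "(a \<otimes> b) [^] j = \<one>"
    then have "(b \<otimes> a) [^] j = \<one>" using a by (simp add: m_comm)
    with aux[OF a cop j] aux[OF a(2,1) _ this] show "ord a * ord b dvd j"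
      using cop by (simp add: coprime_commute divides_mult)
  next
    assume "ord a * ord b dvd j"
    then have "ord a dvd j" "ord b dvd j" by (auto elim: dvd_mult_left dvd_mult_right)
    then have "a [^] j = \<one>" "b [^] j = \<one>" using a pow_eq_id by blast+
    then show "(a \<otimes> b) [^] j = \<one>" using a by (simp add: nat_pow_distrib)
  qed
  then show ?thesis using ord_unique a by simp
qed

text \<open>If a prime divided \<open>ord b\<close> to a higher power than \<open>ord a\<close>,
  that primary part of \<open>a\<close> could be exchanged for the larger one of \<open>b\<close>,
  giving an element of order above the maximum.\<close>

lemma ord_dvd_maximal_ord:
  assumes H: "subgroup H G" and fin: "finite (carrier G)" and a: "a \<in> H"
    and max: "\<And>b. b \<in> H \<Longrightarrow> ord b \<le> ord a" and b: "b \<in> H"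
  shows "ord b dvd ord a"
proof (rule ccontr)
  interpret H: subgroup H G by fact
  have ge: "ord c > 0" if "c \<in> carrier G" for c using ord_ge_1[OF fin that] by simp
  have ac: "a \<in> carrier G" "b \<in> carrier G" using a b by auto
  have nz: "ord a \<noteq> 0" "ord b \<noteq> 0" using ge[OF ac(1)] ge[OF ac(2)] by auto
  assume "\<not> ord b dvd ord a"
  then obtain p where p: "Factorial_Ring.prime p" "multiplicity p (ord b) > multiplicity p (ord a)"
    using multiplicity_le_imp_dvd[OF nz(2)] nz by (metis not_le)
  define i j where "i = multiplicity p (ord a)" and "j = multiplicity p (ord b)"
  have np: "\<not> is_unit p" using p by auto
  obtain n' where n': "ord a = p ^ i * n'" "\<not> p dvd n'"
    unfolding i_def by (rule multiplicity_decompose'[OF nz(1) np])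
  obtain m' where m': "ord b = p ^ j * m'" "\<not> p dvd m'"
    unfolding j_def by (rule multiplicity_decompose'[OF nz(2) np])
  have pos: "p > 0" "n' > 0" "m' > 0" using p nz n' m' by (auto simp: prime_gt_0_nat intro!: Nat.gr0I)
  have oa: "ord (a [^] (p ^ i)) = n'" using ord_pow[of a "p ^ i"] ac n' pos by simp
  have ob: "ord (b [^] m') = p ^ j" using ord_pow[of b m'] ac m' pos by simp
  have "coprime n' (p ^ j)" using n'(2) p(1) prime_imp_coprime coprime_commute coprime_power_right_iff by blast
  then have "ord (a [^] (p ^ i) \<otimes> b [^] m') = n' * p ^ j"
    using ord_mult_coprime[of "a [^] (p ^ i)" "b [^] m'"] ac oa ob by simp
  moreover have "a [^] (p ^ i) \<otimes> b [^] m' \<in> H" using a b subgroup_pow_closed[OF H] by simp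
  ultimately have "n' * p ^ j \<le> p ^ i * n'" using max n' by metis
  then have "p ^ j \<le> p ^ i" using pos by (simp add: mult.commute)
  moreover have "p ^ i < p ^ j" using p prime_gt_1_nat[of p]
    by (intro power_strict_increasing) (auto simp: i_def j_def)
  ultimately show False by simp
qed

text \<open>A cyclic subgroup of maximal order \<open>n\<close> is a direct summand: the character that sends a generator
  to \<open>1/n\<close> extends to the group, and takes values in the group of order \<open>n\<close> since \<open>n\<close> is the exponent.\<close>

lemma cyclic_summand:
  assumes H: "subgroup H G" and fin: "finite (carrier G)" and ne: "H \<noteq> {\<one>}"
  obtains K \<alpha> where "subgroup K G" "\<alpha> \<in> carrier G" "\<alpha> \<noteq> \<one>" "order_mod K \<alpha> (ord \<alpha>)" "H = adjoin K \<alpha>"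
proof -
  interpret H: subgroup H G by fact
  have finH: "finite H" using fin H.subset finite_subset by blast
  have "finite (ord ` H)" "ord ` H \<noteq> {}" using finH H.one_closed by (simp, blast)
  then obtain \<alpha> where a: "\<alpha> \<in> H" "\<And>b. b \<in> H \<Longrightarrow> ord b \<le> ord \<alpha>"
    by (metis (no_types, lifting) Max_ge Max_in imageE image_eqI)
  have ac: "\<alpha> \<in> carrier G" using a by auto
  have div: "ord b dvd ord \<alpha>" if "b \<in> H" for b using ord_dvd_maximal_ord[OF H fin a that] .
  have a1: "\<alpha> \<noteq> \<one>"
  proof
    assume "\<alpha> = \<one>"
    then have "b = \<one>" if "b \<in> H" for b using div[OF that] ord_eq_1[of b] that by simp
    with ne H.one_closed show False by blast
  qed
  define n where "n = ord \<alpha>"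
  have n: "n > 0" unfolding n_def using ord_ge_1[OF fin ac] by simp
  have om: "order_mod {\<one>} \<alpha> n" unfolding n_def by (rule order_mod_ord[OF triv_subgroup fin ac a1]) simp
  define y where "y = rat_class (1 / of_nat n)"
  have y: "y [^]\<^bsub>rat_mod_int\<^esub> (j::nat) = rat_class (of_nat j / of_nat n)" for j
    by (simp add: y_def rat_class_pow)
  have triv: "(\<lambda>a\<in>{\<one>}. \<one>\<^bsub>rat_mod_int\<^esub>) \<in> chars {\<one>} {\<one>}" by (auto simp: chars_def hom_def)
  have yn: "y [^]\<^bsub>rat_mod_int\<^esub> n = (\<lambda>a\<in>{\<one>}. \<one>\<^bsub>rat_mod_int\<^esub>) (\<alpha> [^] n)"
    using y[of n] n ac by (simp add: n_def rat_class_zero rat_class_eq_iff)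
  obtain \<xi>0 where x0: "\<xi>0 \<in> chars {\<one>} (adjoin {\<one>} \<alpha>)" "\<xi>0 \<alpha> = y"
    using chars_extend[OF triv triv_subgroup order_refl ac om _ yn fin] by (auto simp: y_def)
  have C: "subgroup (adjoin {\<one>} \<alpha>) G" "\<one> \<in> adjoin {\<one>} \<alpha>" "\<alpha> \<in> adjoin {\<one>} \<alpha>"
    using subgroup_adjoin[OF triv_subgroup fin ac] subset_adjoin[OF triv_subgroup] mem_adjoin[OF triv_subgroup ac]
    by auto
  have "adjoin {\<one>} \<alpha> \<subseteq> H" using adjoin_subset[OF H _ a(1)] by simp
  then obtain L where "chain (adjoin {\<one>} \<alpha>) H L" using chain_exists[OF C(1) H _ fin] by blast
  then obtain \<xi> where x: "\<xi> \<in> chars {\<one>} H" "restrict \<xi> (adjoin {\<one>} \<alpha>) = \<xi>0"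
    using chars_extend_chain[OF _ C(1) x0(1) _ fin] C by blast
  have xa: "\<xi> \<alpha> = y" using x(2) x0(2) C(3) by (metis restrict_apply')
  note D = charsD[OF x(1)] and P = chars_pow[OF x(1) H]
  \<comment> \<open>The complement is the kernel of the character: it meets the powers of
    \<open>\<alpha>\<close> trivially, and every value of \<open>\<xi>\<close> on \<open>H\<close>
    is also its value at some power of \<open>\<alpha>\<close>.\<close>
  define K where "K = {h \<in> H. \<xi> h = \<one>\<^bsub>rat_mod_int\<^esub>}"
  have x1: "\<xi> \<one> = \<one>\<^bsub>rat_mod_int\<^esub>" using D(3) by simp
  have inv: "\<xi> (inv h) = inv\<^bsub>rat_mod_int\<^esub> \<xi> h" if "h \<in> H" for h
    using D(2)[of "inv h" h] D(1) that x1 by (intro QZ.inv_equality[symmetric]) auto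
  have K: "subgroup K G" by (rule subgroupI) (use D x1 inv H.one_closed in \<open>auto simp: K_def intro!: exI[of _ \<one>]\<close>)
  have pow_K: "\<alpha> [^] j = \<one>" if "\<alpha> [^] (j::nat) \<in> K" for j
  proof -
    have "rat_class (of_nat j / of_nat n) = rat_class 0"
      using that P[OF a(1), of j] xa y by (simp add: K_def rat_class_zero)
    then obtain m :: int where "(of_nat j / of_nat n :: rat) = of_int m"
      unfolding rat_class_eq_iff by (auto elim: Ints_cases)
    then have "(of_nat j :: rat) = of_int m * of_nat n" using n by (simp add: divide_simps)
    then have "int j = m * int n" by (metis (mono_tags) of_int_eq_iff of_int_mult of_int_of_nat_eq)
    then have "n dvd j" by (metis dvd_triv_right int_dvd_int_iff)
    then show ?thesis using pow_eq_id[OF ac] by (simp add: n_def)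
  qed
  have "H \<subseteq> adjoin K \<alpha>"
  proof
    fix h assume h: "h \<in> H"
    have "h [^] n = \<one>" using div[OF h] h by (simp add: n_def pow_eq_id)
    then have "\<xi> h [^]\<^bsub>rat_mod_int\<^esub> n = rat_class 0" using P[OF h, of n] x1 by (simp add: rat_class_zero)
    then have "\<xi> h \<in> (\<lambda>i::nat. rat_class ((0 + of_nat i) / of_nat n)) ` {..<n}"
      using rat_mod_int_roots_eq[OF n, of 0] D(1)[OF h] by blast
    then obtain i :: nat where "\<xi> h = rat_class (of_nat i / of_nat n)" by auto
    then have i: "\<xi> h = \<xi> (\<alpha> [^] i)" using P[OF a(1), of i] xa y by simp
    have ai: "\<alpha> [^] i \<in> H" using subgroup_pow_closed[OF H a(1)] .
    have "h \<otimes> inv (\<alpha> [^] i) \<in> K"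
      using h ai D(1,2) inv i by (simp add: K_def)
    moreover have "h = (h \<otimes> inv (\<alpha> [^] i)) \<otimes> \<alpha> [^] i" using h ac by (simp add: m_assoc)
    ultimately show "h \<in> adjoin K \<alpha>" unfolding adjoin_def by blast
  qed
  moreover have "adjoin K \<alpha> \<subseteq> H" using adjoin_subset[OF H _ a(1)] by (auto simp: K_def)
  ultimately have "H = adjoin K \<alpha>" by blast
  then show ?thesis using that[OF K ac a1 order_mod_ord[OF K fin ac a1 pow_K]] by blast
qed

section \<open>Cyclic decompositions as lists with exponents\<close>

definition list_prod :: "'a list \<Rightarrow> (nat \<Rightarrow> int) \<Rightarrow> 'a" where
  "list_prod \<alpha>s e = finprod G (\<lambda>i. (\<alpha>s ! i) [^] e i) {..<length \<alpha>s}"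

text \<open>The carrier of the sum group in \<open>cyclic_decomposition\<close>: residues are
  represented by integers from 0 to below the order.\<close>

definition exponents :: "'a list \<Rightarrow> (nat \<Rightarrow> int) set" where
  "exponents \<alpha>s = (\<Pi>\<^sub>E i\<in>{..<length \<alpha>s}. {0..<int (ord (\<alpha>s ! i))})"

text \<open>The map from exponents is a homomorphism for any list of group elements, since exponents
  count modulo the orders; so being an isomorphism reduces to bijectivity.\<close>

lemma cyclic_decomposition_iff:
  assumes fin: "finite (carrier G)"
  shows "cyclic_decomposition G \<alpha>s \<longleftrightarrow>
    set \<alpha>s \<subseteq> carrier G - {\<one>} \<and> bij_betw (list_prod \<alpha>s) (exponents \<alpha>s) (carrier G)"
proof (cases "set \<alpha>s \<subseteq> carrier G - {\<one>}")
  case True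
  then have \<alpha>: "\<alpha>s ! i \<in> carrier G" if "i < length \<alpha>s" for i using that nth_mem by blast
  let ?S = "sum_group {..<length \<alpha>s} (\<lambda>i. integer_mod_group (ord (\<alpha>s ! i)))"
  have S: "carrier ?S = exponents \<alpha>s"
  proof -
    have "carrier (integer_mod_group (ord (\<alpha>s ! i))) = {0..<int (ord (\<alpha>s ! i))}" if "i \<in> {..<length \<alpha>s}" for i
      using ord_ge_1[OF fin \<alpha>[of i]] that by (simp add: carrier_integer_mod_group)
    then show ?thesis unfolding exponents_def
      by (subst carrier_sum_group) (auto intro!: PiE_cong)
  qed
  have "list_prod \<alpha>s \<in> hom ?S G"
  proof (rule homI)
    fix e assume "e \<in> carrier ?S"
    show "list_prod \<alpha>s e \<in> carrier G" unfolding list_prod_def using \<alpha> by (auto intro: finprod_closed)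
    fix e' assume "e' \<in> carrier ?S"
    have m: "(\<alpha>s ! i) [^] ((e i + e' i) mod int (ord (\<alpha>s ! i))) = (\<alpha>s ! i) [^] e i \<otimes> (\<alpha>s ! i) [^] e' i"
      if i: "i < length \<alpha>s" for i
    proof -
      have "(\<alpha>s ! i) [^] ((e i + e' i) mod int (ord (\<alpha>s ! i))) = (\<alpha>s ! i) [^] (e i + e' i)"
        using \<alpha>[OF i] by (subst int_pow_eq) (auto simp: minus_mod_eq_mult_div)
      then show ?thesis using \<alpha>[OF i] by (simp add: int_pow_mult)
    qed
    have "list_prod \<alpha>s (e \<otimes>\<^bsub>?S\<^esub> e') = finprod G (\<lambda>i. (\<alpha>s ! i) [^] e i \<otimes> (\<alpha>s ! i) [^] e' i) {..<length \<alpha>s}"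
      unfolding list_prod_def using m \<alpha> by (intro finprod_cong) auto
    also have "\<dots> = list_prod \<alpha>s e \<otimes> list_prod \<alpha>s e'"
      unfolding list_prod_def using \<alpha> by (subst finprod_multf) auto
    finally show "list_prod \<alpha>s (e \<otimes>\<^bsub>?S\<^esub> e') = list_prod \<alpha>s e \<otimes> list_prod \<alpha>s e'" .
  qed
  then show ?thesis using True unfolding cyclic_decomposition_def iso_def S list_prod_def[abs_def] by auto
qed (auto simp: cyclic_decomposition_def)

lemma list_prod_append:
  assumes "set \<alpha>s \<subseteq> carrier G" "\<alpha> \<in> carrier G"
  shows "list_prod (\<alpha>s @ [\<alpha>]) e = list_prod \<alpha>s e \<otimes> \<alpha> [^] e (length \<alpha>s)"
proof -
  have c: "\<alpha>s ! i \<in> carrier G" if "i < length \<alpha>s" for i using assms that nth_mem by blast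
  have "list_prod (\<alpha>s @ [\<alpha>]) e = finprod G (\<lambda>i. ((\<alpha>s @ [\<alpha>]) ! i) [^] e i) (insert (length \<alpha>s) {..<length \<alpha>s})"
    by (simp add: list_prod_def lessThan_Suc)
  also have "\<dots> = \<alpha> [^] e (length \<alpha>s) \<otimes> finprod G (\<lambda>i. ((\<alpha>s @ [\<alpha>]) ! i) [^] e i) {..<length \<alpha>s}"
    using c assms by (subst finprod_insert) (auto simp: nth_append)
  also have "finprod G (\<lambda>i. ((\<alpha>s @ [\<alpha>]) ! i) [^] e i) {..<length \<alpha>s} = list_prod \<alpha>s e"
    unfolding list_prod_def using c by (intro finprod_cong) (auto simp: nth_append)
  finally show ?thesis using c assms by (simp add: m_comm list_prod_def)
qed

lemma list_prod_cong:
  assumes "set \<alpha>s \<subseteq> carrier G" "\<And>i. i < length \<alpha>s \<Longrightarrow> e i = e' i"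
  shows "list_prod \<alpha>s e = list_prod \<alpha>s e'"
  unfolding list_prod_def using assms nth_mem by (intro finprod_cong) (auto simp: subset_iff)

text \<open>Reversed, because chains record their last step first.\<close>

definition ord_list :: "'a list \<Rightarrow> ('a \<times> nat) list" where
  "ord_list \<alpha>s = rev (map (\<lambda>\<alpha>. (\<alpha>, ord \<alpha>)) \<alpha>s)"

lemma card_exponents: "card (exponents \<alpha>s) = prod_list (map snd (ord_list \<alpha>s))"
proof -
  have "card (exponents \<alpha>s) = (\<Prod>i<length \<alpha>s. ord (\<alpha>s ! i))"
    unfolding exponents_def by (simp add: card_PiE)
  also have "\<dots> = prod_list (map ord \<alpha>s)"
    by (simp add: prod.list_conv_set_nth atLeast0LessThan)
  finally show ?thesis by (simp add: ord_list_def rev_map [symmetric] comp_def)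
qed

text \<open>In each step the exponent can be reduced below the order of the new element, which
  supplies one more coordinate of the exponent vector.\<close>

lemma chain_imp_list_prod_surj:
  assumes "chain {\<one>} H (ord_list \<alpha>s)" and fin: "finite (carrier G)"
  shows "H \<subseteq> list_prod \<alpha>s ` exponents \<alpha>s"
  using assms(1)
proof (induction \<alpha>s arbitrary: H rule: rev_induct)
  case Nil
  then show ?case by (auto simp: ord_list_def list_prod_def exponents_def elim: chain.cases)
next
  case (snoc \<alpha> \<alpha>s)
  have "chain {\<one>} H ((\<alpha>, ord \<alpha>) # ord_list \<alpha>s)" using snoc.prems by (simp add: ord_list_def)
  then obtain W where W: "chain {\<one>} W (ord_list \<alpha>s)" "\<alpha> \<in> carrier G" "order_mod W \<alpha> (ord \<alpha>)"
      "H = adjoin W \<alpha>"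
    by (auto elim: chain.cases)
  have c: "set \<alpha>s \<subseteq> carrier G" using chain_carrier[OF W(1)] by (auto simp: ord_list_def)
  have sW: "subgroup W G" using chain_subgroup[OF W(1) triv_subgroup fin] .
  show ?case
  proof
    fix h assume "h \<in> H"
    then obtain w j where w: "w \<in> W" "h = w \<otimes> \<alpha> [^] (j::nat)" "j < ord \<alpha>"
      using adjoin_eq[OF sW W(2), of "ord \<alpha>"] W(3,4) unfolding order_mod_def by auto
    then obtain e where e: "e \<in> exponents \<alpha>s" "w = list_prod \<alpha>s e" using snoc.IH[OF W(1)] by blast
    let ?e = "e(length \<alpha>s := int j)"
    have "?e \<in> exponents (\<alpha>s @ [\<alpha>])"
      using e(1) w(3) unfolding exponents_def
      by (auto simp: PiE_iff nth_append extensional_def less_Suc_eq)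
    moreover have "list_prod (\<alpha>s @ [\<alpha>]) ?e = h"
      using list_prod_append[OF c W(2)] list_prod_cong[OF c, of ?e e] w e by (simp add: int_pow_int)
    ultimately show "h \<in> list_prod (\<alpha>s @ [\<alpha>]) ` exponents (\<alpha>s @ [\<alpha>])" by blast
  qed
qed

text \<open>Splitting off cyclic summands of maximal order gives a chain in which the order of every
  generator modulo the group below it is its true order. The exponent vectors cover the group and
  are as many as its elements, so the covering is a bijection.\<close>

lemma cyclic_decomposition_exists:
  assumes fin: "finite (carrier G)"
  shows "\<exists>\<alpha>s. cyclic_decomposition G \<alpha>s"
proof -
  have "\<exists>\<alpha>s. set \<alpha>s \<subseteq> carrier G - {\<one>} \<and> chain {\<one>} H (ord_list \<alpha>s)" if "subgroup H G" for H
    using that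
  proof (induction "card H" arbitrary: H rule: less_induct)
    case less
    show ?case
    proof (cases "H = {\<one>}")
      case True
      then show ?thesis by (intro exI[of _ "[]"]) (simp add: ord_list_def chain.intros)
    next
      case False
      obtain K \<alpha> where K: "subgroup K G" "\<alpha> \<in> carrier G" "\<alpha> \<noteq> \<one>" "order_mod K \<alpha> (ord \<alpha>)" "H = adjoin K \<alpha>"
        by (rule cyclic_summand[OF less.prems fin False])
      have "card K > 0" using K(1) fin
        by (metis card_gt_0_iff empty_iff finite_subset subgroup.one_closed subgroup.subset)
      moreover have "ord \<alpha> > 1" using K(4) unfolding order_mod_def by simp
      ultimately have "card K < card H" using card_adjoin[OF K(1,2,4)] K(5) by simp
      then obtain \<alpha>s where "set \<alpha>s \<subseteq> carrier G - {\<one>}" "chain {\<one>} K (ord_list \<alpha>s)"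
        using less.hyps K(1) by blast
      then show ?thesis using K chain.Cons[of "{\<one>}" K "ord_list \<alpha>s" \<alpha> "ord \<alpha>"]
        by (intro exI[of _ "\<alpha>s @ [\<alpha>]"]) (simp add: ord_list_def)
    qed
  qed
  then obtain \<alpha>s where \<alpha>: "set \<alpha>s \<subseteq> carrier G - {\<one>}" "chain {\<one>} (carrier G) (ord_list \<alpha>s)"
    using subgroup_self by blast
  have "finite (exponents \<alpha>s)" unfolding exponents_def by (intro finite_PiE) auto
  moreover have "list_prod \<alpha>s ` exponents \<alpha>s = carrier G"
    using chain_imp_list_prod_surj[OF \<alpha>(2) fin] \<alpha>(1) nth_mem
    unfolding list_prod_def by (auto intro!: finprod_closed simp: subset_iff)
  moreover from this have "card (list_prod \<alpha>s ` exponents \<alpha>s) = card (exponents \<alpha>s)"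
    using chain_card[OF \<alpha>(2) triv_subgroup fin] card_exponents by simp
  ultimately have "bij_betw (list_prod \<alpha>s) (exponents \<alpha>s) (carrier G)"
    unfolding bij_betw_def using eq_card_imp_inj_on by blast
  then show ?thesis using cyclic_decomposition_iff[OF fin] \<alpha>(1) by blast
qed

lemma list_prod_take:
  assumes c: "set \<alpha>s \<subseteq> carrier G" and j: "j \<le> length \<alpha>s" and z: "\<And>i. j \<le> i \<Longrightarrow> i < length \<alpha>s \<Longrightarrow> e i = 0"
  shows "list_prod \<alpha>s e = list_prod (take j \<alpha>s) e"
proof -
  have c: "\<alpha>s ! i \<in> carrier G" if "i < length \<alpha>s" for i using c that nth_mem by blast
  have "list_prod (take j \<alpha>s) e = finprod G (\<lambda>i. (\<alpha>s ! i) [^] e i) {..<j}"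
    unfolding list_prod_def using j c by (intro finprod_cong) auto
  also have "\<dots> = list_prod \<alpha>s e"
    unfolding list_prod_def using j c z by (intro finprod_mono_neutral_cong_left) auto
  finally show ?thesis by simp
qed

text \<open>The groups generated by the first j elements form the chain. If a power of the next
  element falls into the group already reached, it is written by two exponent vectors, and
  injectivity makes it trivial.\<close>

lemma cyclic_decomposition_chain:
  assumes fin: "finite (carrier G)" and dec: "cyclic_decomposition G \<alpha>s"
  shows "chain {\<one>} (carrier G) (ord_list \<alpha>s)"
proof -
  have c1: "set \<alpha>s \<subseteq> carrier G - {\<one>}" and bij: "bij_betw (list_prod \<alpha>s) (exponents \<alpha>s) (carrier G)"
    using dec cyclic_decomposition_iff[OF fin] by auto
  have c: "set \<alpha>s \<subseteq> carrier G" using c1 by blast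
  have pos: "ord (\<alpha>s ! i) > 0" if "i < length \<alpha>s" for i
    using ord_ge_1[OF fin] c that nth_mem by (metis One_nat_def Suc_le_eq subsetD)
  have "\<exists>H. chain {\<one>} H (ord_list (take j \<alpha>s))" if "j \<le> length \<alpha>s" for j
    using that
  proof (induction j)
    case 0
    then show ?case by (auto simp: ord_list_def intro: chain.intros)
  next
    case (Suc j)
    then obtain H where H: "chain {\<one>} H (ord_list (take j \<alpha>s))" by auto
    have j: "j < length \<alpha>s" using Suc by simp
    have sH: "subgroup H G" using chain_subgroup[OF H triv_subgroup fin] .
    let ?\<alpha> = "\<alpha>s ! j"
    have a: "?\<alpha> \<in> carrier G" "?\<alpha> \<noteq> \<one>" using c1 j nth_mem by blast+
    have "?\<alpha> [^] t = \<one>" if t: "?\<alpha> [^] (t::nat) \<in> H" for t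
    proof -
      obtain e where e: "e \<in> exponents (take j \<alpha>s)" "?\<alpha> [^] t = list_prod (take j \<alpha>s) e"
        using chain_imp_list_prod_surj[OF H fin] t by blast
      \<comment> \<open>\<open>e1\<close> and \<open>e2\<close> are two exponent vectors for the
        same element, one supported below \<open>j\<close> and the other at \<open>j\<close> only;
        comparing their coordinates at \<open>j\<close> gives the claim.\<close>
      define e1 where "e1 = (\<lambda>i\<in>{..<length \<alpha>s}. if i < j then e i else 0)"
      define e2 where "e2 = (\<lambda>i\<in>{..<length \<alpha>s}. if i = j then int t mod int (ord ?\<alpha>) else 0)"
      have e1: "e1 \<in> exponents \<alpha>s"
        using e(1) pos j unfolding exponents_def e1_def by (auto simp: PiE_iff)
      have e2: "e2 \<in> exponents \<alpha>s"
        using pos j unfolding exponents_def e2_def by (auto simp: PiE_iff)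
      have ct: "set (take j \<alpha>s) \<subseteq> carrier G" using c by (meson order_trans set_take_subset)
      have "list_prod \<alpha>s e1 = list_prod (take j \<alpha>s) e1"
        by (rule list_prod_take[OF c]) (use j in \<open>auto simp: e1_def\<close>)
      also have "\<dots> = list_prod (take j \<alpha>s) e"
        by (rule list_prod_cong[OF ct]) (use j in \<open>auto simp: e1_def\<close>)
      finally have 1: "list_prod \<alpha>s e1 = ?\<alpha> [^] t" using e by simp
      have "list_prod \<alpha>s e2 = list_prod (take (Suc j) \<alpha>s) e2"
        by (rule list_prod_take[OF c]) (use j in \<open>auto simp: e2_def\<close>)
      also have "\<dots> = list_prod (take j \<alpha>s) e2 \<otimes> ?\<alpha> [^] e2 j"
        using list_prod_append[OF ct a(1), of e2] j by (simp add: take_Suc_conv_app_nth min_def)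
      also have "list_prod (take j \<alpha>s) e2 = list_prod (take j \<alpha>s) (\<lambda>i. 0)"
        by (rule list_prod_cong[OF ct]) (use j in \<open>auto simp: e2_def\<close>)
      also have "\<dots> = \<one>" by (simp add: list_prod_def)
      also have "?\<alpha> [^] e2 j = ?\<alpha> [^] (int t mod int (ord ?\<alpha>))" using j by (simp add: e2_def)
      also have "\<dots> = ?\<alpha> [^] int t"
        using a by (subst int_pow_eq) (auto simp: minus_mod_eq_mult_div)
      finally have 2: "list_prod \<alpha>s e2 = ?\<alpha> [^] t" using a by (simp add: int_pow_int)
      have "e1 = e2" using bij e1 e2 1 2 by (metis bij_betw_imp_inj_on inj_onD)
      then have "e1 j = e2 j" by simp
      then have "int t mod int (ord ?\<alpha>) = 0" using j by (simp add: e1_def e2_def)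
      then have "ord ?\<alpha> dvd t" by (metis int_dvd_int_iff mod_0_imp_dvd)
      then show ?thesis using pow_eq_id a by blast
    qed
    then have "order_mod H ?\<alpha> (ord ?\<alpha>)" using order_mod_ord[OF sH fin a] by blast
    then have "chain {\<one>} (adjoin H ?\<alpha>) (ord_list (take (Suc j) \<alpha>s))"
      using chain.Cons[OF H a(1)] j by (simp add: ord_list_def take_Suc_conv_app_nth)
    then show ?case by blast
  qed
  from this[of "length \<alpha>s"] obtain H where H: "chain {\<one>} H (ord_list \<alpha>s)" by auto
  have "card H = card (carrier G)"
    using chain_card[OF H triv_subgroup fin] card_exponents bij_betw_same_card[OF bij] by simp
  moreover have "H \<subseteq> carrier G" using chain_subgroup[OF H triv_subgroup fin] subgroup.subset by blast
  ultimately have "H = carrier G" using card_subset_eq[OF fin] by blast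
  then show ?thesis using H by simp
qed

end

section \<open>Transport of chains along sums and quotients\<close>

context comm_group
begin

lemma set_mult_memI: "a \<in> H \<Longrightarrow> b \<in> K \<Longrightarrow> a \<otimes> b \<in> H <#> K"
  by (auto simp: set_mult_def)

lemma subset_set_mult:
  assumes "subgroup H G" "subgroup K G"
  shows "H \<subseteq> H <#> K" "K \<subseteq> H <#> K"
proof -
  show "H \<subseteq> H <#> K"
    using set_mult_memI[of _ H \<one> K] subgroup.one_closed[OF assms(2)] subgroup.mem_carrier[OF assms(1)] by force
  show "K \<subseteq> H <#> K"
    using set_mult_memI[of \<one> H _ K] subgroup.one_closed[OF assms(1)] subgroup.mem_carrier[OF assms(2)] by force
qed

text \<open>The second isomorphism theorem, step by step. \<open>Q \<inter> U\<close> lies in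
  \<open>W\<close>, so a power of the new generator, being in \<open>U\<close>, lies in the sum of
  \<open>Q\<close> and \<open>W\<close> only if it lies in \<open>W\<close>; adding \<open>Q\<close>
  leaves the orders unchanged.\<close>

lemma chain_push:
  assumes "chain (Q \<inter> U) W L" "W \<subseteq> U" and Q: "subgroup Q G" and U: "subgroup U G"
    and fin: "finite (carrier G)"
  shows "chain Q (Q <#> W) L"
  using assms(1,2)
proof induction
  case Nil
  interpret Q: subgroup Q G by fact
  have "Q <#> (Q \<inter> U) = Q"
  proof
    show "Q <#> (Q \<inter> U) \<subseteq> Q" by (auto simp: set_mult_def)
    show "Q \<subseteq> Q <#> (Q \<inter> U)"
      using subset_set_mult(1)[OF Q subgroups_Inter_pair[OF Q U]] .
  qed
  then show ?case by (metis chain.Nil)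
next
  case (Cons W L \<alpha> n)
  interpret Q: subgroup Q G by fact
  interpret U: subgroup U G by fact
  have sQU: "subgroup (Q \<inter> U) G" using subgroups_Inter_pair[OF Q U] .
  have sW: "subgroup W G" using chain_subgroup[OF Cons.hyps(1) sQU fin] .
  interpret W: subgroup W G by fact
  have QUW: "Q \<inter> U \<subseteq> W" using chain_subset[OF Cons.hyps(1) sQU fin] .
  have WU: "W \<subseteq> U" and aU: "\<alpha> \<in> U" using Cons.prems subset_adjoin[OF sW] mem_adjoin[OF sW Cons.hyps(2)] by blast+
  have "\<alpha> [^] j \<in> Q <#> W \<longleftrightarrow> \<alpha> [^] j \<in> W" for j :: nat
  proof
    assume "\<alpha> [^] j \<in> Q <#> W"
    then obtain q w where qw: "q \<in> Q" "w \<in> W" "\<alpha> [^] j = q \<otimes> w" by (auto simp: set_mult_def)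
    have "q \<otimes> w \<in> U" using qw(3) subgroup_pow_closed[OF U aU, of j] by simp
    then have "q \<in> U" using subgroup_mult_iff(2)[OF U, of w q] qw WU by auto
    then show "\<alpha> [^] j \<in> W" using qw QUW by auto
  next
    assume "\<alpha> [^] j \<in> W"
    then show "\<alpha> [^] j \<in> Q <#> W" using subset_set_mult(2)[OF Q sW] by blast
  qed
  then have "order_mod (Q <#> W) \<alpha> n" using Cons.hyps(3) unfolding order_mod_def by simp
  then have "chain Q (adjoin (Q <#> W) \<alpha>) ((\<alpha>, n) # L)"
    using Cons.IH[OF WU] Cons.hyps(2) chain.Cons by blast
  moreover have "adjoin (Q <#> W) \<alpha> = Q <#> adjoin W \<alpha>"
  proof (intro equalityI subsetI)
    fix z assume "z \<in> adjoin (Q <#> W) \<alpha>"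
    then obtain q w and j :: nat where "z = (q \<otimes> w) \<otimes> \<alpha> [^] j" "q \<in> Q" "w \<in> W"
      unfolding adjoin_def set_mult_def by blast
    then have "z = q \<otimes> (w \<otimes> \<alpha> [^] j)" "w \<otimes> \<alpha> [^] j \<in> adjoin W \<alpha>" "q \<in> Q"
      using Cons.hyps(2) by (auto simp: m_assoc adjoin_def)
    then show "z \<in> Q <#> adjoin W \<alpha>" using set_mult_memI by simp
  next
    fix z assume "z \<in> Q <#> adjoin W \<alpha>"
    then obtain q w and j :: nat where z: "z = q \<otimes> (w \<otimes> \<alpha> [^] j)" "q \<in> Q" "w \<in> W"
      unfolding adjoin_def set_mult_def by blast
    then have "z = (q \<otimes> w) \<otimes> \<alpha> [^] j" using Cons.hyps(2) by (simp add: m_assoc)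
    then show "z \<in> adjoin (Q <#> W) \<alpha>" unfolding adjoin_def using set_mult_memI[OF z(2,3)] by blast
  qed
  ultimately show ?case by simp
qed

lemma subgroup_is_comm_group:
  assumes "subgroup N G" shows "comm_group (G\<lparr>carrier := N\<rparr>)"
proof (rule group.group_comm_groupI)
  show "group (G\<lparr>carrier := N\<rparr>)" using assms is_group by (rule subgroup.subgroup_is_group)
qed (use assms in \<open>auto intro!: m_comm simp: subgroup.mem_carrier\<close>)

text \<open>Subgroups of N/V correspond to their unions, and a power of \<open>\<alpha>\<close> lies
  in the union exactly if the power of its coset lies in the subgroup. Hence representatives of the
  generators form a chain with the same orders; the list relation keeps each representative tied to
  its coset.\<close>

lemma chain_lift:
  fixes N V defines "K \<equiv> (G\<lparr>carrier := N\<rparr>) Mod V"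
  assumes N: "subgroup N G" and V: "subgroup V G" and VN: "V \<subseteq> N" and fin: "finite (carrier G)"
    and "comm_group.chain K {V} H Ls"
  shows "\<exists>L. chain V (\<Union>H) L \<and> list_all2 (\<lambda>(X, n) (\<alpha>, m). n = m \<and> \<alpha> \<in> X \<and> \<alpha> \<in> N) Ls L"
proof -
  interpret N: subgroup N G by fact
  interpret V: subgroup V G by fact
  interpret GN: comm_group "G\<lparr>carrier := N\<rparr>" by (rule subgroup_is_comm_group[OF N])
  have VGN: "subgroup V (G\<lparr>carrier := N\<rparr>)" using subgroup_incl[OF V N VN] .
  interpret K: comm_group K unfolding K_def by (rule GN.abelian_FactGroup[OF VGN])
  interpret VN: normal V "G\<lparr>carrier := N\<rparr>" by (rule GN.subgroup_imp_normal[OF VGN])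
  have carrK: "carrier K = (\<lambda>\<alpha>. V #> \<alpha>) ` N" by (auto simp: K_def FactGroup_def RCOSETS_def)
  have oneK: "\<one>\<^bsub>K\<^esub> = V" by (simp add: K_def FactGroup_def)
  have multK: "(V #> a) \<otimes>\<^bsub>K\<^esub> (V #> b) = V #> (a \<otimes> b)" if "a \<in> N" "b \<in> N" for a b
    using VN.rcos_sum[of a b] that by (simp add: K_def FactGroup_def)
  have powK: "(V #> a) [^]\<^bsub>K\<^esub> j = V #> (a [^] j)" if "a \<in> N" for a and j :: nat
    using that by (induction j) (simp_all add: oneK multK subgroup_pow_closed[OF N] coset_mult_one[OF V.subset])
  have self: "a \<in> V #> a" if "a \<in> N" for a using that rcos_self[OF _ V] by auto
  have eq: "V #> b = V #> a" if "a \<in> V #> b" "b \<in> N" for a b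
    using repr_independence[OF that(1) _ V] that(2) by auto
  have finK: "finite (carrier K)" using fin N.subset finite_subset unfolding carrK by blast
  have mem: "a \<in> \<Union>H \<longleftrightarrow> V #> a \<in> H" if H: "H \<subseteq> carrier K" and a: "a \<in> N" for H a
  proof
    assume "a \<in> \<Union>H"
    then obtain b where "V #> b \<in> H" "a \<in> V #> b" "b \<in> N" using H unfolding carrK by blast
    then show "V #> a \<in> H" using eq by metis
  qed (use self[OF a] in blast)
  show ?thesis using assms(6)
  proof induction
    case Nil
    show ?case by (intro exI[of _ "[]"]) (simp add: chain.intros)
  next
    case (Cons H Ls X n)
    then obtain L where L: "chain V (\<Union>H) L" "list_all2 (\<lambda>(X, n) (\<alpha>, m). n = m \<and> \<alpha> \<in> X \<and> \<alpha> \<in> N) Ls L"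
      by blast
    obtain \<alpha> where a: "\<alpha> \<in> N" "X = V #> \<alpha>" using Cons.hyps(2) unfolding carrK by blast
    have sH: "subgroup H K"
      using K.chain_subgroup[OF Cons.hyps(1) _ finK] K.triv_subgroup by (simp add: oneK)
    then have HK: "H \<subseteq> carrier K" by (rule subgroup.subset)
    have "order_mod (\<Union>H) \<alpha> n"
      using Cons.hyps(3) mem[OF HK subgroup_pow_closed[OF N a(1)]] powK[OF a(1)] a(2)
      unfolding order_mod_def K.order_mod_def by simp
    then have "chain V (adjoin (\<Union>H) \<alpha>) ((\<alpha>, n) # L)"
      using L(1) a(1) by (intro chain.Cons) auto
    moreover have "adjoin (\<Union>H) \<alpha> = \<Union>(K.adjoin H X)"
    proof (intro equalityI subsetI)
      fix z assume "z \<in> adjoin (\<Union>H) \<alpha>"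
      then obtain w Y and j :: nat where z: "z = w \<otimes> \<alpha> [^] j" "w \<in> Y" "Y \<in> H" unfolding adjoin_def by blast
      obtain b where b: "b \<in> N" "Y = V #> b" using z HK unfolding carrK by blast
      obtain v where v: "v \<in> V" "w = v \<otimes> b" using z b unfolding r_coset_def by blast
      have aj: "\<alpha> [^] j \<in> N" using subgroup_pow_closed[OF N a(1)] .
      have "z = v \<otimes> (b \<otimes> \<alpha> [^] j)" using z v b a by (simp add: m_assoc)
      then have "z \<in> V #> (b \<otimes> \<alpha> [^] j)" using v by (auto simp: r_coset_def)
      then have "z \<in> Y \<otimes>\<^bsub>K\<^esub> X [^]\<^bsub>K\<^esub> j" using b a powK multK aj by simp
      then show "z \<in> \<Union>(K.adjoin H X)" unfolding K.adjoin_def using z by blast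
    next
      fix z assume "z \<in> \<Union>(K.adjoin H X)"
      then obtain Y and j :: nat where z: "z \<in> Y \<otimes>\<^bsub>K\<^esub> X [^]\<^bsub>K\<^esub> j" "Y \<in> H" unfolding K.adjoin_def by blast
      obtain b where b: "b \<in> N" "Y = V #> b" using z HK unfolding carrK by blast
      have aj: "\<alpha> [^] j \<in> N" using subgroup_pow_closed[OF N a(1)] .
      have "z \<in> V #> (b \<otimes> \<alpha> [^] j)" using z b a powK multK aj by simp
      then obtain v where v: "v \<in> V" "z = v \<otimes> (b \<otimes> \<alpha> [^] j)" by (auto simp: r_coset_def)
      then have "z = (v \<otimes> b) \<otimes> \<alpha> [^] j" "v \<otimes> b \<in> Y" using b a by (auto simp: m_assoc r_coset_def)
      then show "z \<in> adjoin (\<Union>H) \<alpha>" unfolding adjoin_def using z by blast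
    qed
    ultimately show ?case using L(2) a self by (intro exI[of _ "(\<alpha>, n) # L"]) simp
  qed
qed

lemma ann_generate:
  assumes "subgroup B' G" "subgroup B'' G"
  shows "ann G (generate G (B' \<union> B'')) = ann G B' \<inter> ann G B''"
proof
  have "B' \<union> B'' \<subseteq> generate G (B' \<union> B'')" by (rule subsetI, rule generate.incl)
  then show "ann G (generate G (B' \<union> B'')) \<subseteq> ann G B' \<inter> ann G B''"
    using ann_antimono by blast
  show "ann G B' \<inter> ann G B'' \<subseteq> ann G (generate G (B' \<union> B''))"
  proof
    fix \<xi> assume x: "\<xi> \<in> ann G B' \<inter> ann G B''"
    have x1: "\<xi> h = \<one>\<^bsub>rat_mod_int\<^esub>" if "h \<in> B' \<union> B''" for h using x that unfolding ann_def by blast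
    have sub: "B' \<union> B'' \<subseteq> carrier G" using assms subgroup.subset by blast
    from x have hom: "\<xi> \<in> hom G rat_mod_int" by (auto simp: ann_def dual_group_def)
    interpret \<xi>: group_hom G rat_mod_int \<xi>
      using hom by unfold_locales
    have "\<xi> h = \<one>\<^bsub>rat_mod_int\<^esub> \<and> h \<in> carrier G" if "h \<in> generate G (B' \<union> B'')" for h
      using that
    proof induction
      case (incl h)
      then show ?case using x1 sub by blast
    next
      case (inv h)
      then have "\<xi> h = \<one>\<^bsub>rat_mod_int\<^esub>" "h \<in> carrier G" using x1 sub by blast+
      then show ?case by simp
    qed simp_all
    then show "\<xi> \<in> ann G (generate G (B' \<union> B''))" using x unfolding ann_def by blast
  qed
qed

text \<open>A chain from the intersection to \<open>U\<close> becomes, after adding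
  \<open>Q\<close>, a chain from \<open>Q\<close> to the sum with the same orders.\<close>

lemma card_set_mult:
  assumes Q: "subgroup Q G" and U: "subgroup U G" and fin: "finite (carrier G)"
  shows "card (Q <#> U) * card (Q \<inter> U) = card Q * card U"
proof -
  have sQU: "subgroup (Q \<inter> U) G" using subgroups_Inter_pair[OF Q U] .
  obtain L where L: "chain (Q \<inter> U) U L" using chain_exists[OF sQU U _ fin] by blast
  have "chain Q (Q <#> U) L" using chain_push[OF L order_refl Q U fin] .
  from chain_card[OF this Q fin] chain_card[OF L sQU fin] show ?thesis by simp
qed

text \<open>The sum of the annihilators clearly lies in the annihilator of the intersection.
  Equality follows by counting, from |ann(B)| |B| = |A| and the order formula for sums of subgroups
  in \<open>G\<close> and in its dual.\<close>

lemma ann_Int: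
  assumes B': "subgroup B' G" and B'': "subgroup B'' G" and fin: "finite (carrier G)"
  shows "ann G (B' \<inter> B'') = ann G B' <#>\<^bsub>dual_group G\<^esub> ann G B''"
proof -
  interpret dual: comm_group "dual_group G" by (rule comm_group_dual)
  have sub: "subgroup (ann G B) (dual_group G)" if "subgroup B G" for B
    using subgroup_ann[OF subgroup.subset[OF that]] .
  have sg: "subgroup (generate G (B' \<union> B'')) G"
    using generate_is_subgroup B' B'' by (meson Un_least subgroup.subset)
  have "generate G (B' \<union> B'') = B' <#> B''"
  proof (rule subset_antisym)
    have smult: "subgroup (B' <#> B'') G" using B' B'' by (rule mult_subgroups)
    have "B' \<union> B'' \<subseteq> B' <#> B''"
      using subset_set_mult[OF B' B''] by blast
    then show "generate G (B' \<union> B'') \<subseteq> B' <#> B''" using smult generate_subgroup_incl by blast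
    show "B' <#> B'' \<subseteq> generate G (B' \<union> B'')"
      by (auto simp: set_mult_def intro: generate.eng generate.incl)
  qed
  then have g: "card (generate G (B' \<union> B'')) * card (B' \<inter> B'') = card B' * card B''"
    using card_set_mult[OF B' B'' fin] by simp
  let ?Q = "ann G B'" and ?U = "ann G B''"
  have 1: "card (?Q <#>\<^bsub>dual_group G\<^esub> ?U) * card (ann G (generate G (B' \<union> B''))) = card ?Q * card ?U"
    using dual.card_set_mult[OF sub[OF B'] sub[OF B''] finite_dual[OF fin]] ann_generate[OF B' B''] by simp
  have pos: "card B > 0" if "subgroup B G" for B
    using that fin by (metis card_gt_0_iff empty_iff finite_subset subgroup.one_closed subgroup.subset)
  have sI: "subgroup (B' \<inter> B'') G" using subgroups_Inter_pair[OF B' B''] .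
  define a where "a = card (carrier G)"
  have a: "card ?Q * card B' = a" "card ?U * card B'' = a"
    "card (ann G (generate G (B' \<union> B''))) * card (generate G (B' \<union> B'')) = a"
    "card (ann G (B' \<inter> B'')) * card (B' \<inter> B'') = a"
    unfolding a_def using card_ann B' B'' sg sI fin by blast+
  have a0: "a > 0" unfolding a_def using fin card_gt_0_iff one_closed by blast
  have "card (?Q <#>\<^bsub>dual_group G\<^esub> ?U) * card (B' \<inter> B'') * a =
      card (?Q <#>\<^bsub>dual_group G\<^esub> ?U) * card (ann G (generate G (B' \<union> B''))) *
      (card (generate G (B' \<union> B'')) * card (B' \<inter> B''))"
    unfolding a(3)[symmetric] by simp
  also have "\<dots> = (card ?Q * card B') * (card ?U * card B'')" unfolding 1 g by simp
  also have "\<dots> = a * a" unfolding a(1,2) by simp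
  finally have "card (?Q <#>\<^bsub>dual_group G\<^esub> ?U) * card (B' \<inter> B'') = a" using a0 by simp
  then have "card (?Q <#>\<^bsub>dual_group G\<^esub> ?U) = card (ann G (B' \<inter> B''))"
    using a(4) pos[OF sI] by (metis mult_cancel2 less_irrefl)
  moreover have "?Q <#>\<^bsub>dual_group G\<^esub> ?U \<subseteq> ann G (B' \<inter> B'')"
    using subgroup.m_closed[OF sub[OF sI]] ann_antimono[of "B' \<inter> B''" B'] ann_antimono[of "B' \<inter> B''" B'']
    by (auto simp: set_mult_def subset_iff)
  moreover have "finite (ann G (B' \<inter> B''))"
    using finite_subset[OF subgroup.subset[OF sub[OF sI]] finite_dual[OF fin]] .
  ultimately show ?thesis using card_subset_eq by metis
qed

end

section \<open>The Mackey structure\<close>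

text \<open>Matches the product over indices in the transfer element with the fold over a reversed
  list in the value of a chain.\<close>

lemma (in comm_monoid) finprod_nth:
  assumes "f \<in> set xs \<rightarrow> carrier G"
  shows "finprod G (\<lambda>i. f (xs ! i)) {..<length xs} = foldr (\<lambda>y t. f y \<otimes> t) (rev xs) \<one>"
  using assms
proof (induction xs rule: rev_induct)
  case (snoc y xs)
  have c: "f (xs ! i) \<in> carrier G" if "i < length xs" for i using snoc.prems that by (auto simp: nth_append)
  have "finprod G (\<lambda>i. f ((xs @ [y]) ! i)) {..<length (xs @ [y])} =
      finprod G (\<lambda>i. f ((xs @ [y]) ! i)) (insert (length xs) {..<length xs})"
    by (simp add: lessThan_Suc)
  also have "\<dots> = f y \<otimes> finprod G (\<lambda>i. f ((xs @ [y]) ! i)) {..<length xs}"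
    using c snoc.prems by (subst finprod_insert) (auto simp: nth_append)
  also have "finprod G (\<lambda>i. f ((xs @ [y]) ! i)) {..<length xs} = finprod G (\<lambda>i. f (xs ! i)) {..<length xs}"
    using c by (intro finprod_cong) (auto simp: nth_append)
  finally show ?case using snoc by simp
qed simp

locale mackey_data = coordinate_group k R \<mu> \<epsilon> x + A: comm_group A
  for k :: "('k, 'y) ring_scheme" and R :: "('k, 'r) top_algebra" and \<mu> \<epsilon> x and A :: "('g, 'm) monoid_scheme" +
  fixes \<phi> :: "('g \<Rightarrow> rat set) \<Rightarrow> 'r \<Rightarrow> 'k"
  assumes finA: "finite (carrier A)"
    and \<phi>: "\<phi> \<in> hom (dual_group A) (points k R \<mu> \<epsilon> (base_algebra k))"
begin

abbreviation "I \<equiv> kB_ideal k x A \<phi>"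
abbreviation "K \<equiv> kB k x A \<phi>"
abbreviation "res \<equiv> resB k x A \<phi>"
abbreviation "tr \<equiv> trB k R \<mu> \<epsilon> x A \<phi>"

sublocale D: comm_group "dual_group A" by (rule A.comm_group_dual)

lemma finD: "finite (carrier (dual_group A))" by (rule A.finite_dual[OF finA])

lemma phi_closed: "\<alpha> \<in> carrier (dual_group A) \<Longrightarrow> \<phi> \<alpha> \<in> cont_alg_homs k R kk"
  using \<phi> unfolding hom_def by auto

lemma phi_val: "\<alpha> \<in> carrier (dual_group A) \<Longrightarrow> r \<in> carrier R \<Longrightarrow> \<phi> \<alpha> r \<in> carrier k"
  using cont_alg_homsD(5)[OF phi_closed] by simp

lemma ann_subgroup: "subgroup B A \<Longrightarrow> subgroup (ann A B) (dual_group A)"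
  by (rule A.subgroup_ann[OF subgroup.subset])

lemma ann_carrier: "\<alpha> \<in> ann A B \<Longrightarrow> \<alpha> \<in> carrier (dual_group A)"
  by (simp add: ann_def)

lemma I_generators: "(\<lambda>u. \<phi> u x) ` ann A B \<subseteq> carrier kk"
  using phi_val[OF ann_carrier x_closed] by auto

lemma I_ideal: "ideal (I B) kk"
  unfolding kB_ideal_def coord_ideal_def by (rule kk.genideal_ideal[OF I_generators])

lemma I_mem: "\<alpha> \<in> ann A B \<Longrightarrow> \<phi> \<alpha> x \<in> I B"
  unfolding kB_ideal_def coord_ideal_def using kk.genideal_self[OF I_generators] by blast

lemma I_minimal: "ideal J kk \<Longrightarrow> (\<And>\<alpha>. \<alpha> \<in> ann A B \<Longrightarrow> \<phi> \<alpha> x \<in> J) \<Longrightarrow> I B \<subseteq> J"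
  unfolding kB_ideal_def coord_ideal_def by (rule kk.genideal_minimal) auto

lemma I_mono: "B' \<subseteq> B \<Longrightarrow> I B \<subseteq> I B'"
  using I_minimal[OF I_ideal] I_mem A.ann_antimono by (meson subsetD)

lemma K_cring: "cring (K B)"
  unfolding kB_def by (rule quot_algebra_cring[OF kk.is_cring I_ideal])

definition proj :: "'g set \<Rightarrow> 'k \<Rightarrow> 'k set" where
  "proj B c = I B +>\<^bsub>kk\<^esub> c"

lemma proj_hom: "ring_hom_cring kk (K B) (proj B)"
proof -
  have "proj B \<in> ring_hom kk (K B)"
    using ideal.rcos_ring_hom[OF I_ideal] unfolding ring_hom_def proj_def[abs_def] kB_def by simp
  then show ?thesis using kk.is_cring K_cring by (simp add: ring_hom_cring_def ring_hom_cring_axioms_def)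
qed

lemma K_carrier: "carrier (K B) = proj B ` carrier k"
  by (simp add: kB_def carrier_quot proj_def[abs_def])

lemma proj_eq_iff: "c \<in> carrier k \<Longrightarrow> d \<in> carrier k \<Longrightarrow> proj B c = proj B d \<longleftrightarrow> c \<ominus>\<^bsub>kk\<^esub> d \<in> I B"
  unfolding proj_def using kk.coset_eq_iff[OF I_ideal] by simp

lemma proj_zero_iff: "c \<in> carrier k \<Longrightarrow> proj B c = \<zero>\<^bsub>K B\<^esub> \<longleftrightarrow> c \<in> I B"
proof -
  assume c: "c \<in> carrier k"
  interpret h: ring_hom_cring kk "K B" "proj B" by (rule proj_hom)
  have "c \<ominus>\<^bsub>kk\<^esub> \<zero>\<^bsub>kk\<^esub> = c" using c kk.r_zero[of c] by (simp add: a_minus_def del: base_algebra_sel(4,5))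
  then show ?thesis using proj_eq_iff[OF c, of "\<zero>\<^bsub>kk\<^esub>" B] h.hom_zero kk.zero_closed by simp
qed

text \<open>The identities hold in \<open>k\<close> for the values at sections and are carried to
  each \<open>K B\<close> by the projection; both shift laws are instances of
  \<open>point_shift\<close>.\<close>

sublocale TD: transfer_data "dual_group A" "K B" "\<lambda>\<alpha>. proj B (\<phi> \<alpha> x)" "\<lambda>n \<alpha>. proj B (\<phi> \<alpha> (v n))" for B
proof -
  interpret h: ring_hom_cring kk "K B" "proj B" by (rule proj_hom)
  interpret K: cring "K B" by (rule K_cring)
  have p1: "\<phi> \<one>\<^bsub>dual_group A\<^esub> = \<epsilon>"
    using hom_one[OF \<phi> D.is_group ptsk.is_group] unfolding one_eps .
  have ppow: "\<phi> (\<alpha> [^]\<^bsub>dual_group A\<^esub> n) = \<phi> \<alpha> [^]\<^bsub>pts kk\<^esub> n" if "\<alpha> \<in> carrier (dual_group A)" for \<alpha> and n :: nat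
  proof -
    interpret f: group_hom "dual_group A" "pts kk" \<phi>
      using \<phi> D.is_group ptsk.is_group by (simp add: group_hom_def group_hom_axioms_def)
    show ?thesis using f.hom_nat_pow[OF that] .
  qed
  have pmult: "\<phi> (\<alpha> \<otimes>\<^bsub>dual_group A\<^esub> \<beta>) = \<phi> \<alpha> \<otimes>\<^bsub>pts kk\<^esub> \<phi> \<beta>"
    if "\<alpha> \<in> carrier (dual_group A)" "\<beta> \<in> carrier (dual_group A)" for \<alpha> \<beta>
    by (rule hom_mult[OF \<phi> that])
  have shift: "\<exists>c\<in>carrier (K B). proj B (\<phi> (\<alpha> \<otimes>\<^bsub>dual_group A\<^esub> \<beta>) f) =
      proj B (\<phi> \<alpha> f) \<oplus>\<^bsub>K B\<^esub> c \<otimes>\<^bsub>K B\<^esub> proj B (\<phi> \<beta> x)"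
    if ab: "\<alpha> \<in> carrier (dual_group A)" "\<beta> \<in> carrier (dual_group A)" and f: "f \<in> carrier R" for \<alpha> \<beta> f
  proof -
    note c1 = cont_alg_homsD(5)[OF phi_closed[OF ab(1)] f] and c2 = cont_alg_homsD(5)[OF phi_closed[OF ab(2)] x_closed]
    obtain c where c: "c \<in> carrier kk" "\<phi> (\<alpha> \<otimes>\<^bsub>dual_group A\<^esub> \<beta>) f = \<phi> \<alpha> f \<oplus>\<^bsub>kk\<^esub> c \<otimes>\<^bsub>kk\<^esub> \<phi> \<beta> x"
      using point_shift[OF phi_closed[OF ab(1)] phi_closed[OF ab(2)] f] unfolding pmult[OF ab] by blast
    show ?thesis unfolding c(2)
      by (rule bexI[OF _ h.hom_closed[OF c(1)]])
        (simp only: h.hom_add[OF c1 kk.m_closed[OF c(1) c2]] h.hom_mult[OF c(1) c2])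
  qed
  have nat: "proj B ([n] \<cdot>\<^bsub>kk\<^esub> \<one>\<^bsub>kk\<^esub>) = [n] \<cdot>\<^bsub>K B\<^esub> \<one>\<^bsub>K B\<^esub>" for n :: nat
    by (induction n) (simp_all del: base_algebra_sel)
  show "transfer_data (dual_group A) (K B) (\<lambda>\<alpha>. proj B (\<phi> \<alpha> x)) (\<lambda>n \<alpha>. proj B (\<phi> \<alpha> (v n)))"
  proof (unfold_locales)
    show "finite (carrier (dual_group A))" by (rule finD)
    show "proj B (\<phi> \<one>\<^bsub>dual_group A\<^esub> x) = \<zero>\<^bsub>K B\<^esub>" unfolding p1 eps_x using h.hom_zero by simp
    show "proj B (\<phi> \<one>\<^bsub>dual_group A\<^esub> (v n)) = [n] \<cdot>\<^bsub>K B\<^esub> \<one>\<^bsub>K B\<^esub>" for n unfolding p1 eps_v by (rule nat)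
    fix \<alpha> assume a: "\<alpha> \<in> carrier (dual_group A)"
    note c = cont_alg_homsD(5)[OF phi_closed[OF a]]
    show "proj B (\<phi> \<alpha> x) \<in> carrier (K B)" by (rule h.hom_closed[OF c[OF x_closed]])
    show "proj B (\<phi> \<alpha> (v n)) \<in> carrier (K B)" for n by (rule h.hom_closed[OF c[OF v_props(1)]])
    show "proj B (\<phi> (\<alpha> [^]\<^bsub>dual_group A\<^esub> n) x) = proj B (\<phi> \<alpha> x) \<otimes>\<^bsub>K B\<^esub> proj B (\<phi> \<alpha> (v n))" for n :: nat
      unfolding ppow[OF a] point_pow_x(1)[OF phi_closed[OF a]] by (rule h.hom_mult[OF c[OF x_closed] c[OF v_props(1)]])
    show "proj B (\<phi> \<alpha> (v (m * n))) = proj B (\<phi> (\<alpha> [^]\<^bsub>dual_group A\<^esub> n) (v m)) \<otimes>\<^bsub>K B\<^esub> proj B (\<phi> \<alpha> (v n))" for m n :: nat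
    proof -
      have "\<phi> (\<alpha> [^]\<^bsub>dual_group A\<^esub> n) (v m) \<in> carrier kk"
        by (rule cont_alg_homsD(5)[OF phi_closed[OF D.nat_pow_closed[OF a]] v_props(1)])
      from h.hom_mult[OF this c[OF v_props(1)[of n]]] show ?thesis
        unfolding point_pow_x(2)[OF phi_closed[OF a], of m n] ppow[OF a] by simp
    qed
    fix \<beta> assume b: "\<beta> \<in> carrier (dual_group A)"
    show "\<exists>c\<in>carrier (K B). proj B (\<phi> (\<alpha> \<otimes>\<^bsub>dual_group A\<^esub> \<beta>) x) =
      proj B (\<phi> \<alpha> x) \<oplus>\<^bsub>K B\<^esub> c \<otimes>\<^bsub>K B\<^esub> proj B (\<phi> \<beta> x)" by (rule shift[OF a b x_closed])
    show "\<exists>c\<in>carrier (K B). proj B (\<phi> (\<alpha> \<otimes>\<^bsub>dual_group A\<^esub> \<beta>) (v n)) =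
      proj B (\<phi> \<alpha> (v n)) \<oplus>\<^bsub>K B\<^esub> c \<otimes>\<^bsub>K B\<^esub> proj B (\<phi> \<beta> x)" for n by (rule shift[OF a b v_props(1)])
  qed
qed

text \<open>The product formed in \<open>k\<close>, before any projection. Its images in the various
  \<open>K B\<close> are the values of the same list there, which is how transfers into different
  rings are compared under restriction.\<close>

definition vprod :: "(('g \<Rightarrow> rat set) \<times> nat) list \<Rightarrow> 'k" where
  "vprod L = foldr (\<lambda>(\<alpha>, n) t. \<phi> \<alpha> (v n) \<otimes>\<^bsub>k\<^esub> t) L \<one>\<^bsub>k\<^esub>"

lemma vprod_proj:
  assumes "\<And>\<alpha> n. (\<alpha>, n) \<in> set L \<Longrightarrow> \<alpha> \<in> carrier (dual_group A)"
  shows "vprod L \<in> carrier k \<and> proj B (vprod L) = TD.val B L"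
  using assms
proof (induction L)
  case Nil
  interpret h: ring_hom_cring kk "K B" "proj B" by (rule proj_hom)
  show ?case using h.hom_one kk.one_closed by (simp add: vprod_def)
next
  case (Cons y L)
  interpret h: ring_hom_cring kk "K B" "proj B" by (rule proj_hom)
  obtain \<alpha> n where y: "y = (\<alpha>, n)" by force
  have a: "\<phi> \<alpha> (v n) \<in> carrier k" using phi_val[OF Cons.prems[of \<alpha> n] v_props(1)] y by simp
  have IH: "vprod L \<in> carrier k" "proj B (vprod L) = TD.val B L" using Cons by auto
  have s: "vprod (y # L) = \<phi> \<alpha> (v n) \<otimes>\<^bsub>k\<^esub> vprod L" by (simp add: y vprod_def)
  show ?case unfolding s using kk.m_closed[of "\<phi> \<alpha> (v n)" "vprod L"] h.hom_mult[of "\<phi> \<alpha> (v n)" "vprod L"] a IH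
    by (simp add: y)
qed

lemma chain_vprod:
  assumes "D.chain V W L"
  shows "vprod L \<in> carrier k" "proj B (vprod L) = TD.val B L"
  using vprod_proj[of L] D.chain_carrier[OF assms] by blast+

lemma X_ann: "\<alpha> \<in> ann A B \<Longrightarrow> proj B (\<phi> \<alpha> x) = \<zero>\<^bsub>K B\<^esub>"
  using proj_zero_iff[OF phi_val[OF ann_carrier x_closed]] I_mem by blast

text \<open>Two members of the coset differ by some \<open>\<gamma>\<close> in
  \<open>ann A B\<close>, which changes the value of a function by a multiple of
  \<open>\<phi> \<gamma> x\<close>, an element of the ideal defining \<open>K B\<close>. So the set
  in the definition of \<open>phiB\<close> has one element.\<close>

lemma phiB_coset:
  assumes B: "subgroup B A" and a: "\<alpha> \<in> carrier (dual_group A)" and X: "X = ann A B #>\<^bsub>dual_group A\<^esub> \<alpha>" and r: "r \<in> carrier R"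
  shows "phiB k R x A \<phi> B X r = proj B (\<phi> \<alpha> r)"
proof -
  interpret h: ring_hom_cring kk "K B" "proj B" by (rule proj_hom)
  have eq: "proj B (\<phi> \<beta> r) = proj B (\<phi> \<alpha> r)" if b: "\<beta> \<in> X" and r: "r \<in> carrier R" for \<beta> r
  proof -
    obtain \<gamma> where g: "\<gamma> \<in> ann A B" "\<beta> = \<gamma> \<otimes>\<^bsub>dual_group A\<^esub> \<alpha>" using b X by (auto simp: r_coset_def)
    have gc: "\<gamma> \<in> carrier (dual_group A)" using ann_carrier g by blast
    have "\<phi> \<beta> = \<phi> \<alpha> \<otimes>\<^bsub>pts kk\<^esub> \<phi> \<gamma>" unfolding g(2) D.m_comm[OF gc a] by (rule hom_mult[OF \<phi> a gc])
    then obtain c where c: "c \<in> carrier kk" "\<phi> \<beta> r = \<phi> \<alpha> r \<oplus>\<^bsub>kk\<^esub> c \<otimes>\<^bsub>kk\<^esub> \<phi> \<gamma> x"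
      using point_shift[OF phi_closed[OF a] phi_closed[OF gc] r] by metis
    note c1 = cont_alg_homsD(5)[OF phi_closed[OF a] r] and c2 = cont_alg_homsD(5)[OF phi_closed[OF gc] x_closed]
    show ?thesis unfolding c(2) h.hom_add[OF c1 kk.m_closed[OF c(1) c2]] h.hom_mult[OF c(1) c2] X_ann[OF g(1)]
      using h.hom_closed[OF c(1)] h.hom_closed[OF c1] by simp
  qed
  have "\<alpha> \<in> X" unfolding X by (rule D.rcos_self[OF a ann_subgroup[OF B]])
  have "(\<lambda>\<beta>. \<lambda>r\<in>carrier R. I B +>\<^bsub>kk\<^esub> \<phi> \<beta> r) ` X = (\<lambda>\<beta>. \<lambda>r\<in>carrier R. proj B (\<phi> \<alpha> r)) ` X"
    by (rule image_cong[OF refl restrict_ext]) (use eq in \<open>simp add: proj_def\<close>)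
  also have "\<dots> = {\<lambda>r\<in>carrier R. proj B (\<phi> \<alpha> r)}" by (rule image_constant[OF \<open>\<alpha> \<in> X\<close>])
  finally show ?thesis unfolding phiB_def using r by simp
qed

text \<open>The decomposition chosen in the definition gives a chain in ann(B')/ann(B), this lifts
  to a chain from ann(B) to ann(B') with the same factors, and all such chains have the same value.
  From here on any convenient chain computes the transfer.\<close>

lemma transfer_element_eq:
  assumes B: "subgroup B A" and B': "subgroup B' A" and sub: "B' \<subseteq> B" and L: "D.chain (ann A B) (ann A B') L"
  shows "transfer_element k R \<mu> \<epsilon> x (K B) (ann_quot A B B') (phiB k R x A \<phi> B) = TD.val B L"
proof -
  let ?V = "ann A B" and ?N = "ann A B'"
  let ?U = "ann_quot A B B'"
  have V: "subgroup ?V (dual_group A)" and N: "subgroup ?N (dual_group A)" using ann_subgroup B B' by auto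
  have VN: "?V \<subseteq> ?N" using A.ann_antimono[OF sub] .
  interpret U: comm_group ?U
    unfolding ann_quot_def
    by (rule comm_group.abelian_FactGroup[OF D.subgroup_is_comm_group[OF N] D.subgroup_incl[OF V N VN]])
  have carrU: "carrier ?U = (\<lambda>\<alpha>. ?V #>\<^bsub>dual_group A\<^esub> \<alpha>) ` ?N"
    by (auto simp: ann_quot_def FactGroup_def RCOSETS_def)
  have oneU: "\<one>\<^bsub>?U\<^esub> = ?V" by (simp add: ann_quot_def FactGroup_def)
  have finN: "finite ?N" using finD N by (meson finite_subset subgroup.subset)
  have finU: "finite (carrier ?U)" unfolding carrU using finN by blast
  define \<alpha>s where "\<alpha>s = (SOME \<alpha>s. cyclic_decomposition ?U \<alpha>s)"
  have dec: "cyclic_decomposition ?U \<alpha>s"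
    unfolding \<alpha>s_def by (rule someI_ex[OF U.cyclic_decomposition_exists[OF finU]])
  have "U.chain {?V} (carrier ?U) (U.ord_list \<alpha>s)"
    using U.cyclic_decomposition_chain[OF finU dec] by (simp add: oneU)
  from D.chain_lift[OF N V VN finD this[unfolded ann_quot_def], folded ann_quot_def]
  obtain L' where L': "D.chain ?V (\<Union>(carrier ?U)) L'"
    "list_all2 (\<lambda>(X, n) (\<alpha>, m). n = m \<and> \<alpha> \<in> X \<and> \<alpha> \<in> ?N) (U.ord_list \<alpha>s) L'" by blast
  have self: "\<alpha> \<in> ?V #>\<^bsub>dual_group A\<^esub> \<alpha>" if "\<alpha> \<in> ?N" for \<alpha>
    by (rule D.rcos_self[OF ann_carrier[OF that] V])
  have cos: "X = ?V #>\<^bsub>dual_group A\<^esub> \<alpha>" if X: "X \<in> carrier ?U" and a: "\<alpha> \<in> X" for X \<alpha>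
  proof -
    obtain \<beta> where b: "\<beta> \<in> ?N" "X = ?V #>\<^bsub>dual_group A\<^esub> \<beta>" using X unfolding carrU by blast
    show ?thesis using D.repr_independence[OF a[unfolded b(2)] ann_carrier[OF b(1)] V] b(2) by simp
  qed
  have "\<Union>(carrier ?U) = ?N"
  proof
    show "\<Union>(carrier ?U) \<subseteq> ?N"
    proof
      fix z assume "z \<in> \<Union>(carrier ?U)"
      then obtain \<alpha> \<beta> where "\<alpha> \<in> ?N" "\<beta> \<in> ?V" "z = \<beta> \<otimes>\<^bsub>dual_group A\<^esub> \<alpha>" unfolding carrU by (auto simp: r_coset_def)
      then show "z \<in> ?N" using subgroup.m_closed[OF N] VN by blast
    qed
    show "?N \<subseteq> \<Union>(carrier ?U)" using self unfolding carrU by blast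
  qed
  then have L'c: "D.chain ?V ?N L'" using L'(1) by simp
  define f where "f = (\<lambda>X. phiB k R x A \<phi> B X (v (U.ord X)))"
  have setc: "set \<alpha>s \<subseteq> carrier ?U" using dec unfolding cyclic_decomposition_def by blast
  have fc: "f X = proj B (\<phi> \<alpha> (v (U.ord X)))" if "X \<in> carrier ?U" "\<alpha> \<in> X" "\<alpha> \<in> ?N" for X \<alpha>
    unfolding f_def by (rule phiB_coset[OF B ann_carrier[OF that(3)] cos[OF that(1,2)] v_props(1)])
  have fcar: "f \<in> set \<alpha>s \<rightarrow> carrier (K B)"
  proof
    fix X assume "X \<in> set \<alpha>s"
    then have X: "X \<in> carrier ?U" using setc by blast
    then obtain \<alpha> where a: "\<alpha> \<in> ?N" "\<alpha> \<in> X" using self unfolding carrU by blast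
    show "f X \<in> carrier (K B)" unfolding fc[OF X a(2,1)] K_carrier using phi_val[OF ann_carrier[OF a(1)] v_props(1)] by blast
  qed
  have "transfer_element k R \<mu> \<epsilon> x (K B) ?U (phiB k R x A \<phi> B) = finprod (K B) (\<lambda>i. f (\<alpha>s ! i)) {..<length \<alpha>s}"
    unfolding transfer_element_def \<alpha>s_def[symmetric] Let_def f_def by simp
  also have "\<dots> = foldr (\<lambda>y t. f y \<otimes>\<^bsub>K B\<^esub> t) (rev \<alpha>s) \<one>\<^bsub>K B\<^esub>" by (rule TD.T.finprod_nth[OF fcar])
  also have "\<dots> = foldr (\<lambda>(X, n) t. f X \<otimes>\<^bsub>K B\<^esub> t) (U.ord_list \<alpha>s) \<one>\<^bsub>K B\<^esub>"
    by (simp add: U.ord_list_def rev_map foldr_map comp_def)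
  also have "\<dots> = TD.val B L'"
  proof -
    have "snd z = U.ord (fst z) \<and> fst z \<in> carrier ?U" if "z \<in> set (U.ord_list \<alpha>s)" for z
      using that setc by (auto simp: U.ord_list_def)
    with L'(2) show ?thesis
    proof (induction rule: list_all2_induct)
      case (Cons y ys z zs)
      obtain X n \<alpha> m where e: "y = (X, n)" "z = (\<alpha>, m)" by force
      have "X \<in> carrier ?U" "n = U.ord X" using Cons.prems[of "(X, n)"] e by simp_all
      moreover have "n = m" "\<alpha> \<in> X" "\<alpha> \<in> ?N" using Cons.hyps(1) e by auto
      ultimately show ?case using Cons e fc by simp
    qed simp
  qed
  also have "\<dots> = TD.val B L" by (rule TD.chain_val_unique[OF V X_ann L'c L])
  finally show ?thesis .
qed

section \<open>Restriction and transfer on representatives in \<open>k\<close>\<close>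

lemma chain_ann_exists:
  assumes "subgroup B A" "subgroup B' A" "B' \<subseteq> B"
  shows "\<exists>L. D.chain (ann A B) (ann A B') L"
  by (rule D.chain_exists[OF ann_subgroup[OF assms(1)] ann_subgroup[OF assms(2)] A.ann_antimono[OF assms(3)] finD])

lemma res_proj:
  assumes "B' \<subseteq> B" "c \<in> carrier k"
  shows "res B B' (proj B c) = proj B' c"
proof -
  interpret h: ring_hom_cring kk "K B" "proj B" by (rule proj_hom)
  have "I B' +>\<^bsub>kk\<^esub> r = proj B' c" if r: "r \<in> proj B c" for r
  proof -
    have "r \<in> carrier k" "r \<ominus>\<^bsub>kk\<^esub> c \<in> I B'"
      using kk.mem_coset_iff[OF I_ideal, of c r B] r assms I_mono[OF assms(1)] by (auto simp: proj_def)
    then show ?thesis using proj_eq_iff[of r c B'] assms by (simp add: proj_def)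
  qed
  moreover have "c \<in> proj B c"
  proof -
    interpret IB: ideal "I B" kk by (rule I_ideal)
    show ?thesis unfolding proj_def using IB.a_rcos_self assms by simp
  qed
  ultimately have "(\<Union>r\<in>proj B c. I B' +>\<^bsub>kk\<^esub> r) = proj B' c" by blast
  then show ?thesis unfolding resB_def using assms K_carrier by simp
qed

text \<open>The elements of \<open>k\<close> killed by the value of the chain form an ideal that
  contains the generators of \<open>I B'\<close>. Hence different lifts of a class to
  \<open>K B\<close> have the same product with it, and the set in \<open>trB\<close> is a
  singleton.\<close>

lemma tr_proj:
  assumes B: "subgroup B A" and B': "subgroup B' A" and sub: "B' \<subseteq> B" and L: "D.chain (ann A B) (ann A B') L"
    and c: "c \<in> carrier k"
  shows "tr B B' (proj B' c) = proj B (vprod L \<otimes>\<^bsub>k\<^esub> c)"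
proof -
  interpret h: ring_hom_cring kk "K B" "proj B" by (rule proj_hom)
  let ?t = "TD.val B L"
  note t = chain_vprod[OF L]
  have tc: "?t \<in> carrier (K B)" by (rule TD.chain_val_closed[OF L])
  have ann: "TD.annihilates B ?t (ann A B')" by (rule TD.chain_annihilates[OF L ann_subgroup[OF B] X_ann])
  have kill: "?t \<otimes>\<^bsub>K B\<^esub> proj B d = \<zero>\<^bsub>K B\<^esub>" if d: "d \<in> I B'" for d
  proof -
    have "ideal {d \<in> carrier kk. ?t \<otimes>\<^bsub>K B\<^esub> proj B d = \<zero>\<^bsub>K B\<^esub>} kk"
      unfolding kk.ideal_iff
    proof (intro conjI ballI)
      show "\<zero>\<^bsub>kk\<^esub> \<in> {d \<in> carrier kk. ?t \<otimes>\<^bsub>K B\<^esub> proj B d = \<zero>\<^bsub>K B\<^esub>}"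
        using h.hom_zero tc kk.zero_closed by simp
      fix a assume a: "a \<in> {d \<in> carrier kk. ?t \<otimes>\<^bsub>K B\<^esub> proj B d = \<zero>\<^bsub>K B\<^esub>}"
      then have ac: "a \<in> carrier kk" "?t \<otimes>\<^bsub>K B\<^esub> proj B a = \<zero>\<^bsub>K B\<^esub>" by auto
      {
        fix b assume b: "b \<in> {d \<in> carrier kk. ?t \<otimes>\<^bsub>K B\<^esub> proj B d = \<zero>\<^bsub>K B\<^esub>}"
        then have bc: "b \<in> carrier kk" "?t \<otimes>\<^bsub>K B\<^esub> proj B b = \<zero>\<^bsub>K B\<^esub>" by auto
        have "?t \<otimes>\<^bsub>K B\<^esub> proj B (a \<oplus>\<^bsub>kk\<^esub> b) = \<zero>\<^bsub>K B\<^esub>"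
          unfolding h.hom_add[OF ac(1) bc(1)]
          using TD.T.r_distr[OF h.hom_closed[OF ac(1)] h.hom_closed[OF bc(1)] tc] ac bc by simp
        then show "a \<oplus>\<^bsub>kk\<^esub> b \<in> {d \<in> carrier kk. ?t \<otimes>\<^bsub>K B\<^esub> proj B d = \<zero>\<^bsub>K B\<^esub>}"
          using kk.a_closed[OF ac(1) bc(1)] by blast
      }
      fix r assume r: "r \<in> carrier kk"
      have "?t \<otimes>\<^bsub>K B\<^esub> proj B (r \<otimes>\<^bsub>kk\<^esub> a) = \<zero>\<^bsub>K B\<^esub>"
        unfolding h.hom_mult[OF r ac(1)]
        using TD.T.m_lcomm[OF tc h.hom_closed[OF r] h.hom_closed[OF ac(1)]] ac(2) h.hom_closed[OF r] by simp
      then show "r \<otimes>\<^bsub>kk\<^esub> a \<in> {d \<in> carrier kk. ?t \<otimes>\<^bsub>K B\<^esub> proj B d = \<zero>\<^bsub>K B\<^esub>}"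
        using kk.m_closed[OF r ac(1)] by blast
    qed auto
    moreover have "\<phi> \<alpha> x \<in> {d \<in> carrier kk. ?t \<otimes>\<^bsub>K B\<^esub> proj B d = \<zero>\<^bsub>K B\<^esub>}" if "\<alpha> \<in> ann A B'" for \<alpha>
      using ann that phi_val[OF ann_carrier[OF that] x_closed] unfolding TD.annihilates_def by simp
    ultimately show ?thesis using I_minimal d by blast
  qed
  have "?t \<otimes>\<^bsub>K B\<^esub> X = ?t \<otimes>\<^bsub>K B\<^esub> proj B c" if X: "X \<in> carrier (K B)" "res B B' X = proj B' c" for X
  proof -
    obtain d where d: "d \<in> carrier k" "X = proj B d" using X unfolding K_carrier by blast
    have "proj B' d = proj B' c" using X(2) res_proj[OF sub d(1)] d(2) by simp
    then have dc: "d \<ominus>\<^bsub>kk\<^esub> c \<in> I B'" using proj_eq_iff[OF d(1) c] by blast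
    have dk: "d \<in> carrier kk" "c \<in> carrier kk" using d c by auto
    have "proj B d = proj B (d \<ominus>\<^bsub>kk\<^esub> c) \<oplus>\<^bsub>K B\<^esub> proj B c"
    proof -
      have "d = (d \<ominus>\<^bsub>kk\<^esub> c) \<oplus>\<^bsub>kk\<^esub> c"
        by (simp only: a_minus_def kk.a_assoc[OF dk(1) kk.a_inv_closed[OF dk(2)] dk(2)] kk.l_neg[OF dk(2)] kk.r_zero[OF dk(1)])
      then show ?thesis using h.hom_add[OF kk.minus_closed[OF dk] dk(2)] by metis
    qed
    then have "?t \<otimes>\<^bsub>K B\<^esub> proj B d = ?t \<otimes>\<^bsub>K B\<^esub> proj B (d \<ominus>\<^bsub>kk\<^esub> c) \<oplus>\<^bsub>K B\<^esub> ?t \<otimes>\<^bsub>K B\<^esub> proj B c"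
      using TD.T.r_distr[OF h.hom_closed[OF kk.minus_closed[OF dk]] h.hom_closed[OF dk(2)] tc] by simp
    then show ?thesis using kill[OF dc] TD.T.l_zero[OF TD.T.m_closed[OF tc h.hom_closed[OF dk(2)]]] d(2) by simp
  qed
  moreover have "proj B c \<in> carrier (K B)" "res B B' (proj B c) = proj B' c"
    using K_carrier c res_proj[OF sub c] by auto
  ultimately have "{?t \<otimes>\<^bsub>K B\<^esub> X | X. X \<in> carrier (K B) \<and> res B B' X = proj B' c} = {?t \<otimes>\<^bsub>K B\<^esub> proj B c}"
    by blast
  then have "tr B B' (proj B' c) = ?t \<otimes>\<^bsub>K B\<^esub> proj B c"
    unfolding trB_def transfer_element_eq[OF B B' sub L] Let_def using K_carrier c by simp
  then show ?thesis using h.hom_mult[of "vprod L" c] t(1) c t(2)[of B] by simp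
qed

lemma res_hom:
  assumes "B' \<subseteq> B" shows "res B B' \<in> ring_hom (K B) (K B')"
proof (rule ring_hom_memI)
  interpret h: ring_hom_cring kk "K B" "proj B" by (rule proj_hom)
  interpret h': ring_hom_cring kk "K B'" "proj B'" by (rule proj_hom)
  show "res B B' X \<in> carrier (K B')" if "X \<in> carrier (K B)" for X
    using that res_proj[OF assms] unfolding K_carrier by auto
  show "res B B' \<one>\<^bsub>K B\<^esub> = \<one>\<^bsub>K B'\<^esub>"
    using res_proj[OF assms, of "\<one>\<^bsub>kk\<^esub>"] h.hom_one h'.hom_one kk.one_closed by simp
  fix X Y assume "X \<in> carrier (K B)" "Y \<in> carrier (K B)"
  then obtain c d where c: "c \<in> carrier kk" "X = proj B c" and d: "d \<in> carrier kk" "Y = proj B d"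
    unfolding K_carrier by auto
  note r = res_proj[OF assms, folded base_algebra_sel(1)[of k]]
  show "res B B' (X \<otimes>\<^bsub>K B\<^esub> Y) = res B B' X \<otimes>\<^bsub>K B'\<^esub> res B B' Y"
    unfolding c(2) d(2) h.hom_mult[OF c(1) d(1), symmetric] r[OF c(1)] r[OF d(1)] r[OF kk.m_closed[OF c(1) d(1)]]
    by (rule h'.hom_mult[OF c(1) d(1)])
  show "res B B' (X \<oplus>\<^bsub>K B\<^esub> Y) = res B B' X \<oplus>\<^bsub>K B'\<^esub> res B B' Y"
    unfolding c(2) d(2) h.hom_add[OF c(1) d(1), symmetric] r[OF c(1)] r[OF d(1)] r[OF kk.a_closed[OF c(1) d(1)]]
    by (rule h'.hom_add[OF c(1) d(1)])
qed

lemma tr_hom: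
  assumes B: "subgroup B A" and B': "subgroup B' A" and sub: "B' \<subseteq> B"
  shows "tr B B' \<in> hom (add_monoid (K B')) (add_monoid (K B))"
proof -
  interpret h: ring_hom_cring kk "K B" "proj B" by (rule proj_hom)
  interpret h': ring_hom_cring kk "K B'" "proj B'" by (rule proj_hom)
  obtain L where L: "D.chain (ann A B) (ann A B') L" using chain_ann_exists[OF assms] by blast
  note t = tr_proj[OF assms L, folded base_algebra_sel(1)[of k] base_algebra_sel(2)[of k]]
  have vc: "vprod L \<in> carrier kk" using chain_vprod(1)[OF L] by simp
  show ?thesis
  proof (rule homI; simp)
    show "tr B B' X \<in> carrier (K B)" if "X \<in> carrier (K B')" for X
      using that t h.hom_closed[OF kk.m_closed[OF vc]] unfolding K_carrier[of B'] by auto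
    fix X Y assume "X \<in> carrier (K B')" "Y \<in> carrier (K B')"
    then obtain c d where c: "c \<in> carrier kk" "X = proj B' c" and d: "d \<in> carrier kk" "Y = proj B' d"
      unfolding K_carrier by auto
    show "tr B B' (X \<oplus>\<^bsub>K B'\<^esub> Y) = tr B B' X \<oplus>\<^bsub>K B\<^esub> tr B B' Y"
      unfolding c(2) d(2) h'.hom_add[OF c(1) d(1), symmetric] t[OF c(1)] t[OF d(1)] t[OF kk.a_closed[OF c(1) d(1)]]
        kk.r_distr[OF c(1) d(1) vc]
      by (rule h.hom_add[OF kk.m_closed[OF vc c(1)] kk.m_closed[OF vc d(1)]])
  qed
qed

lemma vprod_append:
  assumes "D.chain V W L'" "D.chain U V L"
  shows "vprod (L' @ L) = vprod L' \<otimes>\<^bsub>k\<^esub> vprod L"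
proof -
  have "vprod (L' @ L) = vprod L' \<otimes>\<^bsub>k\<^esub> vprod L"
    if "\<And>\<alpha> n. (\<alpha>, n) \<in> set L' \<Longrightarrow> \<alpha> \<in> carrier (dual_group A)" for L'
    using that
  proof (induction L')
    case Nil
    then show ?case using kk.l_one chain_vprod(1)[OF assms(2)] by (simp add: vprod_def)
  next
    case (Cons y L')
    obtain \<alpha> n where y: "y = (\<alpha>, n)" by force
    have a: "\<phi> \<alpha> (v n) \<in> carrier k" using phi_val[OF Cons.prems[of \<alpha> n] v_props(1)] y by simp
    have s: "vprod (y # L) = \<phi> \<alpha> (v n) \<otimes>\<^bsub>k\<^esub> vprod L" for L by (simp add: y vprod_def)
    have "vprod L' \<in> carrier k"
      by (rule conjunct1[OF vprod_proj]) (rule Cons.prems, rule list.set_intros(2))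
    moreover have "vprod (L' @ L) = vprod L' \<otimes>\<^bsub>k\<^esub> vprod L"
      by (rule Cons.IH) (rule Cons.prems, rule list.set_intros(2))
    ultimately show ?case using kk.m_assoc[of "\<phi> \<alpha> (v n)" "vprod L'" "vprod L"] a chain_vprod(1)[OF assms(2)]
      by (simp add: s)
  qed
  then show ?thesis using D.chain_carrier[OF assms(1)] by blast
qed

lemma tr_tr:
  assumes B: "subgroup B A" and B': "subgroup B' A" and B'': "subgroup B'' A" and sub: "B'' \<subseteq> B'" "B' \<subseteq> B"
    and X: "X \<in> carrier (K B'')"
  shows "tr B B'' X = tr B B' (tr B' B'' X)"
proof -
  obtain L1 where L1: "D.chain (ann A B) (ann A B') L1" using chain_ann_exists[OF B B' sub(2)] by blast
  obtain L2 where L2: "D.chain (ann A B') (ann A B'') L2" using chain_ann_exists[OF B' B'' sub(1)] by blast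
  have L: "D.chain (ann A B) (ann A B'') (L2 @ L1)" by (rule D.chain_append[OF L2 L1])
  obtain c where c: "c \<in> carrier k" "X = proj B'' c" using X unfolding K_carrier by blast
  have v: "vprod L1 \<in> carrier k" "vprod L2 \<in> carrier k" using chain_vprod(1) L1 L2 by blast+
  have m: "vprod L2 \<otimes>\<^bsub>k\<^esub> c \<in> carrier k" using kk.m_closed v c by simp
  have "B'' \<subseteq> B" using sub by blast
  have "vprod (L2 @ L1) \<otimes>\<^bsub>k\<^esub> c = vprod L1 \<otimes>\<^bsub>k\<^esub> (vprod L2 \<otimes>\<^bsub>k\<^esub> c)"
    unfolding vprod_append[OF L2 L1] using kk.m_ac v c by simp
  then show ?thesis
    unfolding c(2) tr_proj[OF B B'' \<open>B'' \<subseteq> B\<close> L c(1)] tr_proj[OF B' B'' sub(1) L2 c(1)] tr_proj[OF B B' sub(2) L1 m]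
    by simp
qed

lemma mackey_formula:
  assumes B: "subgroup B A" and B': "subgroup B' A" and B'': "subgroup B'' A" and sub: "B' \<subseteq> B" "B'' \<subseteq> B"
    and X: "X \<in> carrier (K B'')"
  shows "res B B' (tr B B'' X) = [order (A\<lparr>carrier := B\<rparr> Mod generate A (B' \<union> B''))] \<cdot>\<^bsub>K B'\<^esub>
    tr B' (B' \<inter> B'') (res B'' (B' \<inter> B'') X)"
proof -
  let ?P = "ann A B" and ?Q = "ann A B'" and ?U = "ann A B''" and ?G = "generate A (B' \<union> B'')"
  interpret h': ring_hom_cring kk "K B'" "proj B'" by (rule proj_hom)
  have P: "subgroup ?P (dual_group A)" and Q: "subgroup ?Q (dual_group A)" and U: "subgroup ?U (dual_group A)"
    using ann_subgroup B B' B'' by auto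
  have QU: "subgroup (?Q \<inter> ?U) (dual_group A)" by (rule D.subgroups_Inter_pair[OF Q U])
  have PQU: "?P \<subseteq> ?Q \<inter> ?U" using A.ann_antimono sub by blast
  obtain L1 where L1: "D.chain ?P (?Q \<inter> ?U) L1" using D.chain_exists[OF P QU PQU finD] by blast
  obtain L2 where L2: "D.chain (?Q \<inter> ?U) ?U L2" using D.chain_exists[OF QU U _ finD] by blast
  have L: "D.chain ?P ?U (L2 @ L1)" by (rule D.chain_append[OF L2 L1])
  \<comment> \<open>The annihilator of the intersection is the sum of the annihilators, so the
    pushed chain ends exactly where the transfer from \<open>B' \<inter> B''\<close> to
    \<open>B'\<close> needs it.\<close>
  have L2': "D.chain ?Q (ann A (B' \<inter> B'')) L2"
    unfolding A.ann_Int[OF B' B'' finA] by (rule D.chain_push[OF L2 order_refl Q U finD])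
  obtain c where c: "c \<in> carrier k" "X = proj B'' c" using X unfolding K_carrier by blast
  have v: "vprod L1 \<in> carrier k" "vprod L2 \<in> carrier k" using chain_vprod(1) L1 L2 by blast+
  have m: "vprod L2 \<otimes>\<^bsub>k\<^esub> c \<in> carrier k" "vprod (L2 @ L1) \<otimes>\<^bsub>k\<^esub> c \<in> carrier k"
    using kk.m_closed v c chain_vprod(1)[OF L] by simp_all
  define n where "n = prod_list (map snd L1)"
  have "proj B' (vprod L1) = [n] \<cdot>\<^bsub>K B'\<^esub> \<one>\<^bsub>K B'\<^esub>"
    unfolding chain_vprod(2)[OF L1] n_def by (rule TD.chain_val_trivial[OF L1 P X_ann]) blast
  moreover have "vprod (L2 @ L1) \<otimes>\<^bsub>k\<^esub> c = vprod L1 \<otimes>\<^bsub>k\<^esub> (vprod L2 \<otimes>\<^bsub>k\<^esub> c)"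
    unfolding vprod_append[OF L2 L1] using kk.m_ac v c by simp
  ultimately have "proj B' (vprod (L2 @ L1) \<otimes>\<^bsub>k\<^esub> c) = [n] \<cdot>\<^bsub>K B'\<^esub> proj B' (vprod L2 \<otimes>\<^bsub>k\<^esub> c)"
    using h'.hom_mult[of "vprod L1" "vprod L2 \<otimes>\<^bsub>k\<^esub> c"] h'.hom_closed[of "vprod L2 \<otimes>\<^bsub>k\<^esub> c"] v m
    by (simp add: TD.T.add_pow_ldistr)
  \<comment> \<open>\<open>n\<close> is the index of ann(B) in ann(B' + B''). As |ann(H)| |H| = |A|
    for both groups, it equals the index of the generated subgroup in \<open>B\<close>.\<close>
  moreover have "n = order (A\<lparr>carrier := B\<rparr> Mod ?G)"
  proof -
    have GB: "?G \<subseteq> B" using A.generate_subgroup_incl[OF _ B] sub by simp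
    have G: "subgroup ?G A" by (rule A.generate_is_subgroup) (use sub subgroup.subset[OF B] in blast)
    interpret AB: group "A\<lparr>carrier := B\<rparr>" by (rule subgroup.subgroup_is_group[OF B A.is_group])
    have "card (rcosets\<^bsub>A\<lparr>carrier := B\<rparr>\<^esub> ?G) * card ?G = card B"
      using AB.lagrange[OF A.subgroup_incl[OF G B GB]] by (simp add: order_def)
    then have 1: "order (A\<lparr>carrier := B\<rparr> Mod ?G) * card ?G = card B" by (simp add: order_def FactGroup_def)
    have 2: "card (?Q \<inter> ?U) = card ?P * n" unfolding n_def by (rule D.chain_card[OF L1 P finD])
    have 3: "card (?Q \<inter> ?U) * card ?G = card ?P * card B"
      using A.card_ann[OF G finA] A.card_ann[OF B finA] A.ann_generate[OF B' B''] by simp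
    have pos: "card ?P > 0" "card ?G > 0"
      using finD finA P G by (metis card_gt_0_iff empty_iff finite_subset subgroup.one_closed subgroup.subset)+
    have "card ?P * (n * card ?G) = card ?P * (order (A\<lparr>carrier := B\<rparr> Mod ?G) * card ?G)"
      using 2 3 unfolding 1 by (simp add: mult.assoc)
    then show ?thesis using pos by simp
  qed
  moreover have "tr B' (B' \<inter> B'') (res B'' (B' \<inter> B'') X) = proj B' (vprod L2 \<otimes>\<^bsub>k\<^esub> c)"
    unfolding c(2) res_proj[OF Int_lower2 c(1)]
    by (rule tr_proj[OF B' A.subgroups_Inter_pair[OF B' B''] Int_lower1 L2' c(1)])
  ultimately show ?thesis unfolding c(2) tr_proj[OF B B'' sub(2) L c(1)] res_proj[OF sub(1) m(2)] by simp
qed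

end

text \<open>The kernel of \<open>\<epsilon>\<close> is open because zero is open in
  \<open>k\<close>, and \<open>x\<close> generates it, so some power y^m is a multiple of
  \<open>x\<close>. Then y^(2m) is a multiple of the square of \<open>x\<close>, and the ideal of
  y^(2m) is open.\<close>

lemma coordinate_square_open:
  assumes k: "cring k" and grp: "formal_multicurve_group k R \<mu> \<epsilon>" and x: "coordinate k R \<epsilon> x"
  shows "PIdl\<^bsub>R\<^esub> (x \<otimes>\<^bsub>R\<^esub> x) \<in> open_ideals R"
proof -
  have fm: "formal_algebra k R" and cg: "comm_group_structure k R \<mu> \<epsilon>"
    using grp unfolding formal_multicurve_group_def formal_multicurve_def by blast+
  obtain y where y: "regular_element R y" "\<forall>m::nat. openin (opens R) (PIdl\<^bsub>R\<^esub> (y [^]\<^bsub>R\<^esub> m))"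
    "is_lim_of_quotients R {PIdl\<^bsub>R\<^esub> (y [^]\<^bsub>R\<^esub> m) | m::nat. True}"
    using grp unfolding formal_multicurve_group_def formal_multicurve_def by blast
  interpret formal_group k R \<mu> \<epsilon> by (rule formal_group.intro[OF k formal_imp_complete[OF fm] cg])
  have xc: "x \<in> carrier R" and yc: "y \<in> carrier R" using x y(1) unfolding coordinate_def regular_element_def by blast+
  have "PIdl\<^bsub>R\<^esub> x = {r \<in> carrier R. \<epsilon> r \<in> {\<zero>\<^bsub>kk\<^esub>}}"
    using x unfolding coordinate_def a_kernel_def' by simp
  also have "\<dots> \<in> open_ideals R"
    by (rule cont_alg_homs_vimage[OF R_lin_top kk_lin_top eps_hom])
      (use base_algebra_complete(2)[OF k] kk.zeroideal in simp)
  finally obtain m :: nat where "y [^]\<^bsub>R\<^esub> m \<in> PIdl\<^bsub>R\<^esub> x" using principal_power_open[OF fm y(3) yc] by blast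
  then obtain z where z: "z \<in> carrier R" "y [^]\<^bsub>R\<^esub> m = z \<otimes>\<^bsub>R\<^esub> x" unfolding cgenideal_def by blast
  have "y [^]\<^bsub>R\<^esub> (m + m) = (z \<otimes>\<^bsub>R\<^esub> z) \<otimes>\<^bsub>R\<^esub> (x \<otimes>\<^bsub>R\<^esub> x)"
    unfolding R.nat_pow_mult[OF yc, symmetric] z(2) using z(1) xc by (simp add: R.m_ac)
  then have "y [^]\<^bsub>R\<^esub> (m + m) \<in> PIdl\<^bsub>R\<^esub> (x \<otimes>\<^bsub>R\<^esub> x)" unfolding cgenideal_def using z(1) by blast
  then have sub: "PIdl\<^bsub>R\<^esub> (y [^]\<^bsub>R\<^esub> (m + m)) \<subseteq> PIdl\<^bsub>R\<^esub> (x \<otimes>\<^bsub>R\<^esub> x)"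
    using R.cgenideal_minimal[OF R.cgenideal_ideal[OF R.m_closed[OF xc xc]]] by blast
  have "PIdl\<^bsub>R\<^esub> (y [^]\<^bsub>R\<^esub> (m + m)) \<in> open_ideals R"
    unfolding open_ideals_def using y(2) R.cgenideal_ideal[OF R.nat_pow_closed[OF yc]] by blast
  then show ?thesis using lin_topD(7)[OF R_lin_top _ R.cgenideal_ideal[OF R.m_closed[OF xc xc]] sub] by blast
qed

theorem proposition23p33:
  fixes k :: "'k ring" and R :: "('k, 'r) top_algebra"
    and \<mu> :: "'r \<Rightarrow> ('r, 'r) ctensor" and \<epsilon> :: "'r \<Rightarrow> 'k" and x :: 'r
    and A :: "('g, 'm) monoid_scheme" and \<phi> :: "('g \<Rightarrow> rat set) \<Rightarrow> 'r \<Rightarrow> 'k"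
  assumes "cring k"
    and "comm_group A" and "finite (carrier A)"
    and "equivariant_formal_group k R \<mu> \<epsilon> A \<phi>"
    and "coordinate k R \<epsilon> x"
  defines "K \<equiv> kB k x A \<phi>"
    and "res \<equiv> resB k x A \<phi>"
    and "tr \<equiv> trB k R \<mu> \<epsilon> x A \<phi>"
  shows
    \<comment> \<open>rings, ring homomorphisms and additive maps\<close>
    "(\<forall>B. subgroup B A \<longrightarrow> cring (K B)) \<and>
     (\<forall>B B'. subgroup B A \<and> subgroup B' A \<and> B' \<subseteq> B \<longrightarrow>
        res B B' \<in> ring_hom (K B) (K B') \<and>
        tr B B' \<in> hom (add_monoid (K B')) (add_monoid (K B))) \<and>
     \<comment> \<open>(a)\<close>
     (\<forall>B. subgroup B A \<longrightarrow> (\<forall>r\<in>carrier (K B). res B B r = r)) \<and>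
     (\<forall>B B' B''. subgroup B A \<and> subgroup B' A \<and> subgroup B'' A \<and> B'' \<subseteq> B' \<and> B' \<subseteq> B \<longrightarrow>
        (\<forall>r\<in>carrier (K B). res B B'' r = res B' B'' (res B B' r))) \<and>
     \<comment> \<open>(b)\<close>
     (\<forall>B. subgroup B A \<longrightarrow> (\<forall>r\<in>carrier (K B). tr B B r = r)) \<and>
     (\<forall>B B' B''. subgroup B A \<and> subgroup B' A \<and> subgroup B'' A \<and> B'' \<subseteq> B' \<and> B' \<subseteq> B \<longrightarrow>
        (\<forall>r\<in>carrier (K B''). tr B B'' r = tr B B' (tr B' B'' r))) \<and>
     \<comment> \<open>(c)\<close>
     (\<forall>B B' B''. subgroup B A \<and> subgroup B' A \<and> subgroup B'' A \<and> B' \<subseteq> B \<and> B'' \<subseteq> B \<longrightarrow>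
        (\<forall>r\<in>carrier (K B''). res B B' (tr B B'' r) =
           [order (A\<lparr>carrier := B\<rparr> Mod generate A (B' \<union> B''))] \<cdot>\<^bsub>K B'\<^esub>
             tr B' (B' \<inter> B'') (res B'' (B' \<inter> B'') r)))"
proof -
  have grp: "formal_multicurve_group k R \<mu> \<epsilon>"
    and \<phi>: "\<phi> \<in> hom (dual_group A) (points k R \<mu> \<epsilon> (base_algebra k))"
    using assms(4) unfolding equivariant_formal_group_def by blast+
  have fm: "formal_algebra k R" and cg: "comm_group_structure k R \<mu> \<epsilon>"
    using grp unfolding formal_multicurve_group_def formal_multicurve_def by blast+
  interpret G: formal_group k R \<mu> \<epsilon> by (rule formal_group.intro[OF assms(1) formal_imp_complete[OF fm] cg])
  interpret A: comm_group A by fact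
  interpret M: mackey_data k R \<mu> \<epsilon> x A \<phi>
    by (intro mackey_data.intro coordinate_group.intro coordinate_group_axioms.intro mackey_data_axioms.intro
        G.formal_group_axioms A.comm_group_axioms assms(3,5) coordinate_square_open[OF assms(1) grp assms(5)] \<phi>)
  \<comment> \<open>The empty chain computes the transfer from a group to itself, and its product is
    1.\<close>
  have tr_id: "tr B B r = r" if B: "subgroup B A" and r: "r \<in> carrier (K B)" for B r
  proof -
    obtain c where c: "c \<in> carrier k" "r = M.proj B c" using r unfolding K_def M.K_carrier by blast
    have "M.vprod [] \<otimes>\<^bsub>k\<^esub> c = c" using G.kk.l_one c by (simp add: M.vprod_def)
    then show ?thesis unfolding c(2) tr_def M.tr_proj[OF B B order_refl M.D.chain.Nil c(1)] by simp
  qed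
  have res_id: "res B B r = r" if r: "r \<in> carrier (K B)" for B r
    using r M.res_proj[OF order_refl] unfolding K_def res_def M.K_carrier by auto
  have res_res: "res B B'' r = res B' B'' (res B B' r)"
    if s: "B'' \<subseteq> B'" "B' \<subseteq> B" and r: "r \<in> carrier (K B)" for B B' B'' r
    using r M.res_proj[OF s(1)] M.res_proj[OF s(2)] M.res_proj[OF order_trans[OF s]]
    unfolding K_def res_def M.K_carrier by auto
  show ?thesis
  proof (intro conjI allI impI ballI; (elim conjE)?)
    show "cring (K B)" for B unfolding K_def by (rule M.K_cring)
    show "res B B' \<in> ring_hom (K B) (K B')" if "B' \<subseteq> B" for B B'
      unfolding K_def res_def by (rule M.res_hom[OF that])
    show "tr B B' \<in> hom (add_monoid (K B')) (add_monoid (K B))"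
      if "subgroup B A" "subgroup B' A" "B' \<subseteq> B" for B B'
      unfolding K_def tr_def by (rule M.tr_hom[OF that])
    show "res B B r = r" if "r \<in> carrier (K B)" for B r by (rule res_id[OF that])
    show "res B B'' r = res B' B'' (res B B' r)"
      if "B'' \<subseteq> B'" "B' \<subseteq> B" "r \<in> carrier (K B)" for B B' B'' r by (rule res_res[OF that])
    show "tr B B r = r" if "subgroup B A" "r \<in> carrier (K B)" for B r by (rule tr_id[OF that])
    show "tr B B'' r = tr B B' (tr B' B'' r)"
      if "subgroup B A" "subgroup B' A" "subgroup B'' A" "B'' \<subseteq> B'" "B' \<subseteq> B" "r \<in> carrier (K B'')" for B B' B'' r
      using that unfolding K_def tr_def by (rule M.tr_tr)
    show "res B B' (tr B B'' r) = [order (A\<lparr>carrier := B\<rparr> Mod generate A (B' \<union> B''))] \<cdot>\<^bsub>K B'\<^esub>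
        tr B' (B' \<inter> B'') (res B'' (B' \<inter> B'') r)"
      if "subgroup B A" "subgroup B' A" "subgroup B'' A" "B' \<subseteq> B" "B'' \<subseteq> B" "r \<in> carrier (K B'')" for B B' B'' r
      using that unfolding K_def res_def tr_def by (rule M.mackey_formula)
  qed
qed

end
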